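(* Let $k$ be a perfect field of characteristic $p>0$, $S=k[x_1,\dots,x_N]$, $\mathfrak m=(x_1,\dots,x_N)$ and $R=S_{\mathfrak m}$. Let $f\in\mathfrak m$ be nonzero, and let $\theta\colon F_*S\to S$ be the $S$-module homomorphism $F_*a\mapsto u(F_*(\Delta_1(f^{p-1})a))$. Define an increasing sequence of ideals of $S$ by $I_1:=(f^{p-1})$ and $I_{n+1}:=\theta(F_*I_n\cap\ker(u))+I_1$, and let $I_\infty$ be the maximum element of $\{I_n\mid n\ge1\}$ (which exists by Noetherianity). Then: (1) $R/f$ is quasi-$F$-split if and only if $I_\infty$ is not contained in $\mathfrak m^{[p]}$. (2) $I_\infty$ is the minimum element of the set of ideals $J$ of $S$ satisfying $J\supseteq\theta(F_*J\cap\ker(u))+(f^{p-1})$.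
   Context: Quasi-$F$-splitting: for an $\mathbb F_p$-scheme $X$ and $n\ge1$, let $W_n\mathcal O_X$ be the sheaf of ($p$-typical) Witt vectors of length $n$, $F\colon W_n\mathcal O_X\to F_*W_n\mathcal O_X$ the Frobenius and $R^{n-1}\colon W_n\mathcal O_X\to\mathcal O_X$ the restriction. $X$ is $n$-quasi-$F$-split if there is a $W_n\mathcal O_X$-module homomorphism $\phi\colon F_*W_n\mathcal O_X\to\mathcal O_X$ with $\phi\circ F=R^{n-1}$; $X$ is quasi-$F$-split if it is $n$-quasi-$F$-split for some $n$. A ring $B$ is called quasi-$F$-split if $\operatorname{Spec}B$ is. Notation: for an $S$-module $M$, $F_*M$ is $M$ with $S$-action $a\cdot F_*m=F_*(a^pm)$. $F_*S$ is free over $S$ with basis $\{F_*(x_1^{i_1}\cdots x_N^{i_N})\mid 0\le i_j\le p-1\}$, and $u\in\operatorname{Hom}_S(F_*S,S)$ is the dual basis element of $F_*((x_1\cdots x_N)^{p-1})$. For an ideal $I$, $I^{[p]}$ is the ideal generated by $\{a^p\mid a\in I\}$. The map $\Delta_1\colon S\to S$: for $a\in S$ with monomial decomposition $a=\sum_{i=1}^m M_i$ (each $M_i$ a scalar times a monic monomial, the monic monomials distinct), $\Delta_1(a)$ is defined by $(0,\Delta_1(a))=(a,0)-\sum_i(M_i,0)$ in $W_2(S)$; explicitly $$\Delta_1(a)=\sum_{\substack{0\le\alpha_1,\dots,\alpha_m\le p-1\\ \alpha_1+\cdots+\alpha_m=p}}\frac1p\binom{p}{\alpha_1,\dots,\alpha_m}M_1^{\alpha_1}\cdots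 M_m^{\alpha_m}.$$ *)

theory Defs
  imports
    "HOL-Algebra.QuotRing"
    "HOL-Algebra.Module"
    "HOL-Computational_Algebra.Primes"
    "HOL-Library.Poly_Mapping"
    "HOL-Library.FuncSet"
begin

section \<open>Module homomorphisms and restriction of scalars\<close>

definition mod_hom ::
  "('a, 'x) ring_scheme \<Rightarrow> ('a, 'b, 'y) module_scheme \<Rightarrow> ('a, 'c, 'z) module_scheme \<Rightarrow> ('b \<Rightarrow> 'c) set"
  where "mod_hom A M N =
    {h \<in> carrier M \<rightarrow> carrier N.
       (\<forall>x\<in>carrier M. \<forall>y\<in>carrier M. h (x \<oplus>\<^bsub>M\<^esub> y) = h x \<oplus>\<^bsub>N\<^esub> h y) \<and>
       (\<forall>a\<in>carrier A. \<forall>x\<in>carrier M. h (a \<odot>\<^bsub>M\<^esub> x) = a \<odot>\<^bsub>N\<^esub> h x)}"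

text \<open>The ring \<open>B\<close> regarded as a module over the source of a ring homomorphism \<open>g\<close> into \<open>B\<close>.
  For \<open>g\<close> the Frobenius of \<open>B\<close> this is the module usually written \<open>F\<^sub>*B\<close>.\<close>

definition restr_scalars :: "('a \<Rightarrow> 'b) \<Rightarrow> ('b, 'x) ring_scheme \<Rightarrow> ('a, 'b) module"
  where "restr_scalars g B =
    \<lparr>carrier = carrier B, monoid.mult = monoid.mult B, one = one B, zero = zero B, add = add B,
     smult = (\<lambda>a x. g a \<otimes>\<^bsub>B\<^esub> x)\<rparr>"

section \<open>Polynomials\<close>

text \<open>For a finite type \<open>'v\<close> of variables this is the polynomial ring in \<open>CARD('v)\<close> variables:
  finitely supported functions from exponent vectors to coefficients.\<close>

type_synonym ('v, 'k) mpoly = "('v \<Rightarrow>\<^sub>0 nat) \<Rightarrow>\<^sub>0 'k"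

definition mvar :: "'v \<Rightarrow> ('v, 'k::comm_ring_1) mpoly"
  where "mvar v = Poly_Mapping.single (Poly_Mapping.single v 1) 1"

definition int_poly_eval :: "('a, 'x) ring_scheme \<Rightarrow> ('v \<Rightarrow> 'a) \<Rightarrow> ('v, int) mpoly \<Rightarrow> 'a"
  where "int_poly_eval A z P =
    (\<Oplus>\<^bsub>A\<^esub>m\<in>Poly_Mapping.keys P.
       [Poly_Mapping.lookup P m] \<cdot>\<^bsub>A\<^esub>
         (\<Otimes>\<^bsub>A\<^esub>v\<in>Poly_Mapping.keys m. z v [^]\<^bsub>A\<^esub> Poly_Mapping.lookup m v))"

section \<open>Witt vectors of finite length\<close>

definition witt_poly :: "nat \<Rightarrow> nat \<Rightarrow> (nat \<Rightarrow> 'r::comm_ring_1) \<Rightarrow> 'r"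
  where "witt_poly p n z = (\<Sum>i\<le>n. of_nat p ^ i * z i ^ (p ^ (n - i)))"

text \<open>The universal addition and multiplication polynomials, in the variables
  \<open>X\<^sub>i = mvar (Inl i)\<close> and \<open>Y\<^sub>i = mvar (Inr i)\<close>. That such sequences of integral polynomials exist
  and are unique for \<open>p\<close> prime is Witt's theorem.\<close>

definition witt_add_poly :: "nat \<Rightarrow> nat \<Rightarrow> (nat + nat, int) mpoly"
  where "witt_add_poly p =
    (THE P. \<forall>n. witt_poly p n P =
       witt_poly p n (\<lambda>i. mvar (Inl i)) + witt_poly p n (\<lambda>i. mvar (Inr i)))"

definition witt_mult_poly :: "nat \<Rightarrow> nat \<Rightarrow> (nat + nat, int) mpoly"
  where "witt_mult_poly p =
    (THE P. \<forall>n. witt_poly p n P =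
       witt_poly p n (\<lambda>i. mvar (Inl i)) * witt_poly p n (\<lambda>i. mvar (Inr i)))"

definition witt_ring :: "nat \<Rightarrow> nat \<Rightarrow> ('a, 'x) ring_scheme \<Rightarrow> (nat \<Rightarrow> 'a) ring"
  where "witt_ring p n A =
    \<lparr>carrier = {..<n} \<rightarrow>\<^sub>E carrier A,
     monoid.mult = (\<lambda>x y. \<lambda>i\<in>{..<n}. int_poly_eval A (case_sum x y) (witt_mult_poly p i)),
     one = (\<lambda>i\<in>{..<n}. if i = 0 then \<one>\<^bsub>A\<^esub> else \<zero>\<^bsub>A\<^esub>),
     zero = (\<lambda>i\<in>{..<n}. \<zero>\<^bsub>A\<^esub>),
     add = (\<lambda>x y. \<lambda>i\<in>{..<n}. int_poly_eval A (case_sum x y) (witt_add_poly p i))\<rparr>"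

definition witt_map :: "nat \<Rightarrow> ('a \<Rightarrow> 'b) \<Rightarrow> (nat \<Rightarrow> 'a) \<Rightarrow> (nat \<Rightarrow> 'b)"
  where "witt_map n h w = (\<lambda>i\<in>{..<n}. h (w i))"

text \<open>Over a ring of characteristic \<open>p\<close> the Witt vector Frobenius is induced by functoriality
  from \<open>a \<mapsto> a\<^sup>p\<close>; only this case is used.\<close>

definition witt_frob :: "nat \<Rightarrow> nat \<Rightarrow> ('a, 'x) ring_scheme \<Rightarrow> (nat \<Rightarrow> 'a) \<Rightarrow> (nat \<Rightarrow> 'a)"
  where "witt_frob p n A = witt_map n (\<lambda>a. a [^]\<^bsub>A\<^esub> p)"

text \<open>The iterated restriction \<open>R\<^sup>n\<^sup>-\<^sup>1\<close> from length \<open>n\<close> to length 1.\<close>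

definition witt_restr :: "(nat \<Rightarrow> 'a) \<Rightarrow> 'a"
  where "witt_restr w = w 0"

section \<open>Localization\<close>

text \<open>The fraction \<open>a/s\<close> as an equivalence class of pairs; \<open>M\<close> is a multiplicative subset of \<open>B\<close>.\<close>

definition loc_frac :: "('a, 'x) ring_scheme \<Rightarrow> 'a set \<Rightarrow> 'a \<Rightarrow> 'a \<Rightarrow> ('a \<times> 'a) set"
  where "loc_frac B M a s =
    {(b, t). b \<in> carrier B \<and> t \<in> M \<and>
       (\<exists>v\<in>M. v \<otimes>\<^bsub>B\<^esub> (a \<otimes>\<^bsub>B\<^esub> t) = v \<otimes>\<^bsub>B\<^esub> (b \<otimes>\<^bsub>B\<^esub> s))}"

definition localization :: "('a, 'x) ring_scheme \<Rightarrow> 'a set \<Rightarrow> ('a \<times> 'a) set ring"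
  where "localization B M =
    \<lparr>carrier = {loc_frac B M a s | a s. a \<in> carrier B \<and> s \<in> M},
     monoid.mult = (\<lambda>x y. \<Union>(a, s)\<in>x. \<Union>(b, t)\<in>y. loc_frac B M (a \<otimes>\<^bsub>B\<^esub> b) (s \<otimes>\<^bsub>B\<^esub> t)),
     one = loc_frac B M \<one>\<^bsub>B\<^esub> \<one>\<^bsub>B\<^esub>,
     zero = loc_frac B M \<zero>\<^bsub>B\<^esub> \<one>\<^bsub>B\<^esub>,
     add = (\<lambda>x y. \<Union>(a, s)\<in>x. \<Union>(b, t)\<in>y.
              loc_frac B M (a \<otimes>\<^bsub>B\<^esub> t \<oplus>\<^bsub>B\<^esub> b \<otimes>\<^bsub>B\<^esub> s) (s \<otimes>\<^bsub>B\<^esub> t))\<rparr>"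

section \<open>The spectrum of a ring with its structure sheaf\<close>

record ('x, 's) ringed_space =
  opens :: "'x set set"
  sect :: "'x set \<Rightarrow> 's ring"
  res :: "'x set \<Rightarrow> 'x set \<Rightarrow> 's \<Rightarrow> 's"

definition prime_spectrum :: "('a, 'x) ring_scheme \<Rightarrow> 'a set set"
  where "prime_spectrum B = {P. primeideal P B}"

definition zariski_opens :: "('a, 'x) ring_scheme \<Rightarrow> 'a set set set"
  where "zariski_opens B = {{P \<in> prime_spectrum B. \<not> E \<subseteq> P} | E. E \<subseteq> carrier B}"

text \<open>Sections over \<open>U\<close>: functions assigning to each prime \<open>P\<close> in \<open>U\<close> an element of the localization
  at \<open>P\<close> and locally given by a single fraction.\<close>

definition spec_sections ::
  "('a, 'x) ring_scheme \<Rightarrow> 'a set set \<Rightarrow> ('a set \<Rightarrow> ('a \<times> 'a) set) ring"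
  where "spec_sections B U =
    \<lparr>carrier =
       {s \<in> (\<Pi>\<^sub>E P\<in>U. carrier (localization B (carrier B - P))).
          \<forall>P\<in>U. \<exists>V\<in>zariski_opens B. P \<in> V \<and> V \<subseteq> U \<and>
            (\<exists>a\<in>carrier B. \<exists>b\<in>carrier B. \<forall>Q\<in>V. b \<notin> Q \<and> s Q = loc_frac B (carrier B - Q) a b)},
     monoid.mult = (\<lambda>s t. \<lambda>P\<in>U. s P \<otimes>\<^bsub>localization B (carrier B - P)\<^esub> t P),
     one = (\<lambda>P\<in>U. \<one>\<^bsub>localization B (carrier B - P)\<^esub>),
     zero = (\<lambda>P\<in>U. \<zero>\<^bsub>localization B (carrier B - P)\<^esub>),
     add = (\<lambda>s t. \<lambda>P\<in>U. s P \<oplus>\<^bsub>localization B (carrier B - P)\<^esub> t P)\<rparr>"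

definition Spec ::
  "('a, 'x) ring_scheme \<Rightarrow> ('a set, 'a set \<Rightarrow> ('a \<times> 'a) set) ringed_space"
  where "Spec B =
    \<lparr>opens = zariski_opens B, sect = spec_sections B, res = (\<lambda>U V s. restrict s V)\<rparr>"

section \<open>Quasi-F-splitting\<close>

text \<open>The sheaf \<open>W\<^sub>n\<O>\<^sub>X\<close> has sections \<open>W\<^sub>n(\<O>\<^sub>X(U))\<close> over \<open>U\<close>. The Frobenius is the identity on the
  underlying space, so \<open>F\<^sub>*W\<^sub>n\<O>\<^sub>X\<close> has the same sections, with scalars acting through Frobenius.
  The sheaf \<open>\<O>\<^sub>X\<close> is a \<open>W\<^sub>n\<O>\<^sub>X\<close>-module through \<open>R\<^sup>n\<^sup>-\<^sup>1\<close>. A homomorphism of sheaves is a family of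
  module homomorphisms indexed by the open sets and compatible with restriction.\<close>

definition n_quasi_F_split :: "nat \<Rightarrow> nat \<Rightarrow> ('x, 's) ringed_space \<Rightarrow> bool"
  where "n_quasi_F_split p n X \<longleftrightarrow>
    (\<exists>\<phi> :: 'x set \<Rightarrow> (nat \<Rightarrow> 's) \<Rightarrow> 's.
       (\<forall>U\<in>opens X.
          \<phi> U \<in> mod_hom (witt_ring p n (sect X U))
                  (restr_scalars (witt_frob p n (sect X U)) (witt_ring p n (sect X U)))
                  (restr_scalars witt_restr (sect X U))) \<and>
       (\<forall>U\<in>opens X. \<forall>V\<in>opens X. V \<subseteq> U \<longrightarrow>
          (\<forall>w\<in>carrier (witt_ring p n (sect X U)).
             res X U V (\<phi> U w) = \<phi> V (witt_map n (res X U V) w))) \<and>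
       (\<forall>U\<in>opens X. \<forall>w\<in>carrier (witt_ring p n (sect X U)).
          \<phi> U (witt_frob p n (sect X U) w) = witt_restr w))"

definition quasi_F_split :: "nat \<Rightarrow> ('x, 's) ringed_space \<Rightarrow> bool"
  where "quasi_F_split p X \<longleftrightarrow> (\<exists>n\<ge>1. n_quasi_F_split p n X)"

definition ring_quasi_F_split :: "nat \<Rightarrow> ('a, 'x) ring_scheme \<Rightarrow> bool"
  where "ring_quasi_F_split p B \<longleftrightarrow> quasi_F_split p (Spec B)"

section \<open>The polynomial ring over a field of characteristic \<open>p\<close>\<close>

definition poly_ring :: "('v, 'k::comm_ring_1) mpoly ring"
  where "poly_ring = \<lparr>carrier = UNIV, monoid.mult = (*), one = 1, zero = 0, add = (+)\<rparr>"

definition irrelevant_ideal :: "('v, 'k::comm_ring_1) mpoly set"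
  where "irrelevant_ideal = Idl\<^bsub>poly_ring\<^esub> (range mvar)"

definition frob_power :: "nat \<Rightarrow> ('v, 'k::comm_ring_1) mpoly set \<Rightarrow> ('v, 'k) mpoly set"
  where "frob_power p I = Idl\<^bsub>poly_ring\<^esub> ((\<lambda>a. a ^ p) ` I)"

text \<open>The local ring of the polynomial ring at the origin, and its quotient by the image of \<open>f\<close>.\<close>

definition local_poly_ring :: "(('v, 'k::comm_ring_1) mpoly \<times> ('v, 'k) mpoly) set ring"
  where "local_poly_ring = localization poly_ring (UNIV - irrelevant_ideal)"

definition hypersurface_ring ::
  "('v, 'k::comm_ring_1) mpoly \<Rightarrow> (('v, 'k) mpoly \<times> ('v, 'k) mpoly) set set ring"
  where "hypersurface_ring f =
    local_poly_ring Quot (PIdl\<^bsub>local_poly_ring\<^esub> (loc_frac poly_ring (UNIV - irrelevant_ideal) f 1))"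

text \<open>The dual basis element of \<open>(x\<^sub>1 \<cdots> x\<^sub>N)\<^sup>p\<^sup>-\<^sup>1\<close> for the monomial basis of \<open>F\<^sub>*S\<close> over \<open>S\<close>; it is
  well defined when the coefficient field is perfect.\<close>

definition dual_u :: "nat \<Rightarrow> ('v::finite, 'k::comm_ring_1) mpoly \<Rightarrow> ('v, 'k) mpoly"
  where "dual_u p =
    (THE u. u \<in> mod_hom poly_ring (restr_scalars (\<lambda>a. a ^ p) poly_ring)
                  (restr_scalars (\<lambda>a. a) poly_ring) \<and>
       (\<forall>i. (\<forall>j. Poly_Mapping.lookup i j \<le> p - 1) \<longrightarrow>
          u (Poly_Mapping.single i 1) =
            (if \<forall>j. Poly_Mapping.lookup i j = p - 1 then 1 else 0)))"

text \<open>The monomials of \<open>a\<close> are indexed by the exponent vectors in its support; the division of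
  the multinomial coefficient by \<open>p\<close> is exact for \<open>p\<close> prime.\<close>

definition Delta1 :: "nat \<Rightarrow> ('v, 'k::comm_ring_1) mpoly \<Rightarrow> ('v, 'k) mpoly"
  where "Delta1 p a =
    (\<Sum>\<alpha> | \<alpha> \<in> Poly_Mapping.keys a \<rightarrow>\<^sub>E {0..p - 1} \<and> (\<Sum>t\<in>Poly_Mapping.keys a. \<alpha> t) = p.
       of_nat ((fact p div (\<Prod>t\<in>Poly_Mapping.keys a. fact (\<alpha> t))) div p) *
       (\<Prod>t\<in>Poly_Mapping.keys a. Poly_Mapping.single t (Poly_Mapping.lookup a t) ^ \<alpha> t))"

definition theta :: "nat \<Rightarrow> ('v::finite, 'k::comm_ring_1) mpoly \<Rightarrow> ('v, 'k) mpoly \<Rightarrow> ('v, 'k) mpoly"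
  where "theta p f a = dual_u p (Delta1 p (f ^ (p - 1)) * a)"

definition theta_step ::
  "nat \<Rightarrow> ('v::finite, 'k::comm_ring_1) mpoly \<Rightarrow> ('v, 'k) mpoly set \<Rightarrow> ('v, 'k) mpoly set"
  where "theta_step p f J =
    (theta p f ` (J \<inter> {a. dual_u p a = 0})) <+>\<^bsub>poly_ring\<^esub> (PIdl\<^bsub>poly_ring\<^esub> (f ^ (p - 1)))"

text \<open>Only indices \<open>n \<ge> 1\<close> are meaningful; the value at 0 is a placeholder.\<close>

fun I_seq :: "nat \<Rightarrow> ('v::finite, 'k::comm_ring_1) mpoly \<Rightarrow> nat \<Rightarrow> ('v, 'k) mpoly set"
  where
    "I_seq p f 0 = {0}"
  | "I_seq p f (Suc 0) = PIdl\<^bsub>poly_ring\<^esub> (f ^ (p - 1))"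
  | "I_seq p f (Suc (Suc n)) = theta_step p f (I_seq p f (Suc n))"

definition I_infty :: "nat \<Rightarrow> ('v::finite, 'k::comm_ring_1) mpoly \<Rightarrow> ('v, 'k) mpoly set"
  where "I_infty p f = (GREATEST J. J \<in> {I_seq p f n | n. n \<ge> 1})"

end

theory Submission
  imports Defs Complex_Main
begin

text \<open>Let \<open>S\<close> be the polynomial ring. The Teichmueller lifts of the variables define a map \<open>sec\<close> from \<open>S\<close>
  to \<open>W(S)\<close> that is a ring homomorphism modulo \<open>p\<close>, so that every Witt vector is the sum of
  \<open>V\<^sup>i (sec a\<^sub>i)\<close> modulo \<open>p\<close> for suitable \<open>a\<^sub>i\<close>, and every homomorphism \<open>F\<^sub>* W\<^sub>n S / p \<rightarrow> S\<close> is
  determined by coordinates \<open>g\<^sub>1, \<dots>, g\<^sub>n\<close> in \<open>S\<close>, with \<open>u (g\<^sub>i) = 0\<close> for \<open>i \<ge> 2\<close>. It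
  descends to \<open>S / f\<close> iff it is divisible by \<open>f\<close> on the Witt vectors with components in \<open>(f)\<close>.
  Expanding the Teichmueller lift of \<open>f\<close>, whose second component is governed by \<open>\<Delta>\<^sub>1\<close>, turns this
  into the divisibility of \<open>f g\<^sub>i + u (\<Delta>\<^sub>1(f) g\<^sub>i\<^sub>+\<^sub>1)\<close> by the \<open>p\<^sup>i\<close>-th power of \<open>f\<close>. Dividing \<open>g\<^sub>i\<close> by
  \<open>f ^ (p\<^sup>i - p)\<close> yields \<open>g\<^sub>i \<in> \<theta>(- g\<^sub>i\<^sub>+\<^sub>1) + (f ^ (p - 1))\<close>, that is \<open>g\<^sub>1 \<in> I\<^sub>n\<close>. The
  homomorphism sends 1 to \<open>u (g\<^sub>1)\<close>, which is a unit in the local ring for some \<open>g\<^sub>1\<close> in the ideal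
  \<open>I\<^sub>n\<close> iff that ideal is not contained in the Frobenius power of the maximal ideal.\<close>

section \<open>Exponent vectors and monomials\<close>

text \<open>A scalar acts on the source through Frobenius and on the target through its zeroth
  component. Since \<open>p = F (V 1)\<close> and \<open>V 1\<close> has zeroth component 0, every
  homomorphism kills \<open>p\<close>; behind at least one \<open>V\<close> it also kills Frobenius
  images, as \<open>V F = p\<close>. This is why only the first-order term \<open>Delta1\<close> of
  the expansion of a Teichmueller element survives. The calculus lives in untruncated Witt vectors
  of the domain \<open>S\<close>, where \<open>F\<close>, \<open>V\<close> and \<open>p\<close> are
  injective and congruences can be divided by \<open>p\<close>, whereas a splitting lives on
  truncated Witt vectors over rings of sections. The bridge is to clear denominators by Teichmueller
  scaling, which is possible because the Witt polynomials are isobaric. One abstract notion of a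
  ring of fractions of \<open>S / f\<close> serves both the local ring and the stalks of its
  spectrum: a splitting with given coordinates is assembled stalk by stalk, and a given splitting is
  read off at the closed point. Vanishing in such a ring is divisibility by \<open>f\<close> after
  multiplication by a denominator, so coordinates have to be rescaled before they satisfy exact
  conditions in \<open>S\<close>.\<close>

lemma poly_mapping_expand:
  fixes a :: "'a \<Rightarrow>\<^sub>0 'b::comm_monoid_add"
  shows "a = (\<Sum>m\<in>Poly_Mapping.keys a. Poly_Mapping.single m (Poly_Mapping.lookup a m))"
  by (rule poly_mapping_eqI)
    (simp add: lookup_sum lookup_single when_def in_keys_iff sum.delta' if_distrib cong: if_cong)

lemma poly_mapping_sum_induct [case_names zero single add]:
  fixes a :: "'a \<Rightarrow>\<^sub>0 'b::comm_monoid_add"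
  assumes "P 0" "\<And>m c. P (Poly_Mapping.single m c)" "\<And>a b. P a \<Longrightarrow> P b \<Longrightarrow> P (a + b)"
  shows "P a"
proof -
  have "P (\<Sum>m\<in>K. Poly_Mapping.single m (Poly_Mapping.lookup a m))" if "finite K" for K
    using that by (induction K rule: finite_induct) (use assms in auto)
  then show ?thesis
    using poly_mapping_expand[of a] finite_keys by metis
qed

definition expo :: "('v::finite \<Rightarrow> nat) \<Rightarrow> ('v \<Rightarrow>\<^sub>0 nat)"
  where "expo e = Poly_Mapping.Abs_poly_mapping e"

lemma lookup_expo [simp]: "Poly_Mapping.lookup (expo e) = e"
  unfolding expo_def by (rule lookup_Abs_poly_mapping) simp

lemma expo_lookup [simp]: "expo (Poly_Mapping.lookup m) = m"
  by (rule poly_mapping_eqI) simp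

lemma expo_inject [simp]: "expo d = expo e \<longleftrightarrow> d = e"
  by (metis lookup_expo)

lemma expo_add: "expo d + expo e = expo (\<lambda>v. d v + e v)"
  by (rule poly_mapping_eqI) (simp add: lookup_add)

lemma expo_zero [simp]: "expo (\<lambda>_. 0) = 0"
  by (rule poly_mapping_eqI) simp

abbreviation xpow :: "('v::finite \<Rightarrow> nat) \<Rightarrow> ('v, 'k::comm_ring_1) mpoly"
  where "xpow e \<equiv> Poly_Mapping.single (expo e) 1"

lemma xpow_mult: "xpow d * xpow e = xpow (\<lambda>v. d v + e v)"
  by (simp add: mult_single expo_add)

lemma single_power:
  fixes m :: "'a::comm_monoid_add" and c :: "'k::comm_semiring_1"
  shows "Poly_Mapping.single m c ^ n = Poly_Mapping.single ((\<Sum>i<n. m)) (c ^ n)"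
  by (induction n) (simp_all add: mult_single ac_simps)

lemma single_expo_power:
  "Poly_Mapping.single (expo e) (c::'k::comm_semiring_1) ^ n = Poly_Mapping.single (expo (\<lambda>v. n * e v)) (c ^ n)"
proof -
  have "(\<Sum>i<n. expo e) = expo (\<lambda>v. n * e v)"
    by (rule poly_mapping_eqI) (simp add: lookup_sum)
  then show ?thesis
    by (simp add: single_power)
qed

lemma single_expo_cases:
  obtains e where "m = expo e"
  using expo_lookup by metis

section \<open>A monomial order and Noetherianity\<close>

text \<open>A monomial order borrowed from \<open>nat \<Rightarrow>\<^sub>0 nat\<close>, which is
  ordered lexicographically and compatibly with addition. \<open>SOME\<close> picks an arbitrary
  injection of the variables into \<open>nat\<close>.\<close>

definition expo_key :: "('v::finite \<Rightarrow>\<^sub>0 nat) \<Rightarrow> (nat \<Rightarrow>\<^sub>0 nat)"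
  where "expo_key m = (\<Sum>v\<in>UNIV. Poly_Mapping.single
      ((SOME e. inj (e :: 'v \<Rightarrow> nat)) v) (Poly_Mapping.lookup m v))"

lemma expo_key_add: "expo_key (m + n) = expo_key m + expo_key n"
  by (simp add: expo_key_def lookup_add single_add sum.distrib)

lemma inj_expo_key: "inj (expo_key :: ('v::finite \<Rightarrow>\<^sub>0 nat) \<Rightarrow> _)"
proof (rule injI)
  fix m n :: "'v \<Rightarrow>\<^sub>0 nat"
  assume eq: "expo_key m = expo_key n"
  define e where "e = (SOME e. inj (e :: 'v \<Rightarrow> nat))"
  have "inj e"
    unfolding e_def using finite_imp_inj_to_nat_seg[of "UNIV :: 'v set"]
    by (metis finite someI_ex)
  have *: "Poly_Mapping.lookup (expo_key k) (e v) = Poly_Mapping.lookup k v" for k v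
    unfolding expo_key_def e_def[symmetric]
    using \<open>inj e\<close> by (simp add: lookup_sum lookup_single when_def inj_eq if_distrib sum.delta cong: if_cong)
  show "m = n"
    by (rule poly_mapping_eqI) (metis * eq)
qed

text \<open>A monomial order extends divisibility: \<open>n = m + (n - m)\<close>, and nothing lies
  below 0. Together with \<open>dickson\<close> this yields well-foundedness.\<close>

lemma expo_key_mono: "(\<And>v. Poly_Mapping.lookup m v \<le> Poly_Mapping.lookup n v) \<Longrightarrow> expo_key m \<le> expo_key n"
proof -
  assume "\<And>v. Poly_Mapping.lookup m v \<le> Poly_Mapping.lookup n v"
  then have "n = m + (n - m)"
    by (intro poly_mapping_eqI) (simp add: lookup_add lookup_minus)
  then have "expo_key n = expo_key m + expo_key (n - m)"
    by (metis expo_key_add)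
  moreover have "0 \<le> (x :: nat \<Rightarrow>\<^sub>0 nat)" for x
  proof (rule ccontr)
    assume "\<not> 0 \<le> x"
    then have "x < 0" by simp
    then show False
      by (simp add: less_poly_mapping.rep_eq less_fun_def)
  qed
  ultimately show ?thesis
    using add_left_mono[of 0 "expo_key (n - m)" "expo_key m"] by simp
qed

text \<open>A sequence of naturals has a monotone subsequence. If that one is nonincreasing, it
  attains its minimum and is constant from there on, so a tail of it is nondecreasing as
  well.\<close>

lemma nondecreasing_subseq:
  fixes s :: "nat \<Rightarrow> nat"
  shows "\<exists>r :: nat \<Rightarrow> nat. strict_mono r \<and> (\<forall>i j. i \<le> j \<longrightarrow> s (r i) \<le> s (r j))"
proof -
  obtain r :: "nat \<Rightarrow> nat" where r: "strict_mono r" "monoseq (\<lambda>n. s (r n))"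
    using seq_monosub by blast
  show ?thesis
  proof (cases "\<forall>i j. i \<le> j \<longrightarrow> s (r i) \<le> s (r j)")
    case True
    then show ?thesis using r by blast
  next
    case False
    then have dec: "\<forall>i j. i \<le> j \<longrightarrow> s (r j) \<le> s (r i)"
      using r(2) unfolding monoseq_def by blast
    define M where "M = (LEAST y. \<exists>i. y = s (r i))"
    have "\<exists>i. M = s (r i)"
      unfolding M_def by (rule LeastI_ex) auto
    then obtain i0 where i0: "M = s (r i0)" by blast
    have "M \<le> s (r i)" for i
      unfolding M_def by (rule Least_le) auto
    then have const: "s (r i) = M" if "i \<ge> i0" for i
      using dec i0 that le_antisym by blast
    have "strict_mono (\<lambda>i. r (i0 + i))"
      using r(1) by (simp add: strict_mono_def)
    moreover have "\<forall>i j. i \<le> j \<longrightarrow> s (r (i0 + i)) \<le> s (r (i0 + j))"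
      by (simp add: const)
    ultimately show ?thesis by blast
  qed
qed

text \<open>The subsequence is refined once for each variable; a property of all pairs
  \<open>i \<le> j\<close> survives passage to a further subsequence.\<close>

lemma dickson_subseq:
  fixes s :: "nat \<Rightarrow> 'v \<Rightarrow> nat"
  assumes "finite A"
  shows "\<exists>r :: nat \<Rightarrow> nat. strict_mono r \<and> (\<forall>v\<in>A. \<forall>i j. i \<le> j \<longrightarrow> s (r i) v \<le> s (r j) v)"
  using assms
proof (induction A rule: finite_induct)
  case empty
  then show ?case using strict_mono_id by blast
next
  case (insert a A)
  then obtain r :: "nat \<Rightarrow> nat" where r: "strict_mono r" "\<forall>v\<in>A. \<forall>i j. i \<le> j \<longrightarrow> s (r i) v \<le> s (r j) v"
    by blast
  obtain q :: "nat \<Rightarrow> nat" where q: "strict_mono q" "\<forall>i j. i \<le> j \<longrightarrow> s (r (q i)) a \<le> s (r (q j)) a"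
    using nondecreasing_subseq[of "\<lambda>i. s (r i) a"] by blast
  have "strict_mono (\<lambda>i. r (q i))"
    using r(1) q(1) by (simp add: strict_mono_def del: strict_mono_less)
  moreover have "\<forall>v\<in>insert a A. \<forall>i j. i \<le> j \<longrightarrow> s (r (q i)) v \<le> s (r (q j)) v"
  proof (intro ballI allI impI)
    fix v and i j :: nat
    assume v: "v \<in> insert a A" and "i \<le> j"
    then have "q i \<le> q j"
      using q(1) by (metis strict_mono_less_eq)
    then show "s (r (q i)) v \<le> s (r (q j)) v"
      using v r(2) q(2) \<open>i \<le> j\<close> by (metis insert_iff)
  qed
  ultimately show ?case by blast
qed

lemma dickson:
  fixes s :: "nat \<Rightarrow> ('v::finite \<Rightarrow>\<^sub>0 nat)"
  obtains i j where "i < j" "\<And>v. Poly_Mapping.lookup (s i) v \<le> Poly_Mapping.lookup (s j) v"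
proof -
  obtain r :: "nat \<Rightarrow> nat" where r: "strict_mono r"
    "\<forall>v\<in>UNIV. \<forall>i j. i \<le> j \<longrightarrow> Poly_Mapping.lookup (s (r i)) v \<le> Poly_Mapping.lookup (s (r j)) v"
    using dickson_subseq[of "UNIV :: 'v set" "\<lambda>i. Poly_Mapping.lookup (s i)"] by auto
  then show thesis
    using that[of "r 0" "r 1"] by (simp add: strict_mono_less)
qed

text \<open>In a strictly descending chain \<open>dickson\<close> would find an exponent that
  divides a later one, which \<open>expo_key_mono\<close> forbids.\<close>

lemma wf_expo_key: "wf {(m, n). expo_key (m :: 'v::finite \<Rightarrow>\<^sub>0 nat) < expo_key n}"
proof (rule ccontr)
  assume "\<not> ?thesis"
  then obtain s :: "nat \<Rightarrow> 'v \<Rightarrow>\<^sub>0 nat" where s: "\<And>i. expo_key (s (Suc i)) < expo_key (s i)"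
    unfolding wf_iff_no_infinite_down_chain by auto
  obtain i j where ij: "i < j" "\<And>v. Poly_Mapping.lookup (s i) v \<le> Poly_Mapping.lookup (s j) v"
    using dickson[of s] by blast
  have "expo_key (s j) < expo_key (s i)"
    using ij(1) s by (induction j) (force simp: less_Suc_eq intro: less_trans)+
  then show False
    using expo_key_mono[OF ij(2)] by simp
qed

definition lead :: "('v::finite, 'k::zero) mpoly \<Rightarrow> ('v \<Rightarrow>\<^sub>0 nat)"
  where "lead a = (SOME m. m \<in> Poly_Mapping.keys a \<and> (\<forall>n\<in>Poly_Mapping.keys a. expo_key n \<le> expo_key m))"

lemma lead:
  assumes "a \<noteq> 0"
  shows lead_in_keys: "lead a \<in> Poly_Mapping.keys a"
    and le_lead: "n \<in> Poly_Mapping.keys a \<Longrightarrow> expo_key n \<le> expo_key (lead a)"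
proof -
  have "Poly_Mapping.keys a \<noteq> {}"
    using assms by (metis all_not_in_conv lookup_eq_zero_in_keys_contradict lookup_zero poly_mapping_eqI in_keys_iff)
  then have "Max (expo_key ` Poly_Mapping.keys a) \<in> expo_key ` Poly_Mapping.keys a"
    by (intro Max_in) auto
  then obtain m where "m \<in> Poly_Mapping.keys a" "expo_key m = Max (expo_key ` Poly_Mapping.keys a)"
    by (metis imageE)
  then have "m \<in> Poly_Mapping.keys a \<and> (\<forall>n\<in>Poly_Mapping.keys a. expo_key n \<le> expo_key m)"
    by (simp add: Max_ge)
  then have "lead a \<in> Poly_Mapping.keys a \<and> (\<forall>n\<in>Poly_Mapping.keys a. expo_key n \<le> expo_key (lead a))"
    unfolding lead_def by (rule someI)
  then show "lead a \<in> Poly_Mapping.keys a"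
    "n \<in> Poly_Mapping.keys a \<Longrightarrow> expo_key n \<le> expo_key (lead a)"
    by blast+
qed

lemma lookup_times_expand:
  fixes a b :: "('v, 'k::comm_ring_1) mpoly"
  shows "Poly_Mapping.lookup (a * b) k =
    (\<Sum>m\<in>Poly_Mapping.keys a. \<Sum>n\<in>Poly_Mapping.keys b.
       if m + n = k then Poly_Mapping.lookup a m * Poly_Mapping.lookup b n else 0)"
proof -
  have "a * b = (\<Sum>m\<in>Poly_Mapping.keys a. \<Sum>n\<in>Poly_Mapping.keys b.
      Poly_Mapping.single (m + n) (Poly_Mapping.lookup a m * Poly_Mapping.lookup b n))"
    by (subst poly_mapping_expand[of a], subst poly_mapping_expand[of b])
      (simp add: sum_product mult_single)
  then show ?thesis
    by (simp add: lookup_sum lookup_single when_def)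
qed

lemma lookup_single_times:
  fixes a :: "('v, 'k::comm_ring_1) mpoly"
  shows "Poly_Mapping.lookup (Poly_Mapping.single m c * a) (m + n) = c * Poly_Mapping.lookup a n"
  by (induction a rule: poly_mapping_sum_induct)
    (auto simp: mult_single lookup_single when_def distrib_left lookup_add)

text \<open>By additivity of the order, two exponents bounded by the leading ones add up to
  \<open>lead a + lead b\<close> only if both are leading, so no cancellation can occur there. Over
  a field this makes the polynomial ring a domain.\<close>

lemma lookup_lead_times:
  fixes a b :: "('v::finite, 'k::comm_ring_1) mpoly"
  assumes "a \<noteq> 0" "b \<noteq> 0"
  shows "Poly_Mapping.lookup (a * b) (lead a + lead b) =
    Poly_Mapping.lookup a (lead a) * Poly_Mapping.lookup b (lead b)"
proof -
  have *: "m + n = lead a + lead b \<longleftrightarrow> m = lead a \<and> n = lead b"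
    if "m \<in> Poly_Mapping.keys a" "n \<in> Poly_Mapping.keys b" for m n
  proof
    assume eq: "m + n = lead a + lead b"
    have "expo_key m \<le> expo_key (lead a)" "expo_key n \<le> expo_key (lead b)"
      using that assms le_lead by blast+
    moreover have "expo_key m + expo_key n = expo_key (lead a) + expo_key (lead b)"
      using eq by (metis expo_key_add)
    ultimately have "expo_key m = expo_key (lead a)" "expo_key n = expo_key (lead b)"
      by (metis add_mono_thms_linordered_field(3) add_mono_thms_linordered_field(4) linorder_neq_iff order_le_less)+
    then show "m = lead a \<and> n = lead b"
      using inj_expo_key by (metis injD)
  qed auto
  have "Poly_Mapping.lookup (a * b) (lead a + lead b) =
    (\<Sum>m\<in>Poly_Mapping.keys a. \<Sum>n\<in>Poly_Mapping.keys b.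
       if m = lead a then if n = lead b then Poly_Mapping.lookup a m * Poly_Mapping.lookup b n else 0 else 0)"
    unfolding lookup_times_expand by (intro sum.cong refl) (simp add: *)
  also have "\<dots> = (\<Sum>m\<in>Poly_Mapping.keys a. if m = lead a then
      Poly_Mapping.lookup a m * Poly_Mapping.lookup b (lead b) else 0)"
    by (intro sum.cong refl) (simp add: sum.delta' lead_in_keys[OF assms(2)])
  finally show ?thesis
    by (simp add: sum.delta' lead_in_keys[OF assms(1)])
qed

lemma mpoly_mult_eq_0:
  fixes a b :: "('v::finite, 'k::field) mpoly"
  shows "a * b = 0 \<longleftrightarrow> a = 0 \<or> b = 0"
proof
  assume ab: "a * b = 0"
  show "a = 0 \<or> b = 0"
  proof (rule ccontr)
    assume "\<not> ?thesis"
    then have "a \<noteq> 0" "b \<noteq> 0" by auto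
    then show False
      using lookup_lead_times[of a b] lead_in_keys[of a] lead_in_keys[of b] ab
      by (simp add: in_keys_iff)
  qed
qed auto

lemma mpoly_mult_left_cancel:
  fixes a b c :: "('v::finite, 'k::field) mpoly"
  assumes "c * a = c * b" "c \<noteq> 0"
  shows "a = b"
  using assms mpoly_mult_eq_0[of c "a - b"] by (simp add: algebra_simps)

lemma mpoly_power_eq_0: "(a :: ('v::finite, 'k::field) mpoly) ^ n = 0 \<Longrightarrow> a = 0"
  by (induction n) (auto simp: mpoly_mult_eq_0)

section \<open>Ideals and the ascending chain condition\<close>

definition is_ideal :: "'a::comm_ring_1 set \<Rightarrow> bool"
  where "is_ideal J \<longleftrightarrow> 0 \<in> J \<and> (\<forall>a\<in>J. \<forall>b\<in>J. a + b \<in> J) \<and> (\<forall>a\<in>J. \<forall>c. c * a \<in> J)"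

lemma is_idealD:
  assumes "is_ideal J"
  shows "0 \<in> J" "a \<in> J \<Longrightarrow> b \<in> J \<Longrightarrow> a + b \<in> J" "a \<in> J \<Longrightarrow> c * a \<in> J" "a \<in> J \<Longrightarrow> - a \<in> J"
    "a \<in> J \<Longrightarrow> b \<in> J \<Longrightarrow> a - b \<in> J" "a \<in> J \<Longrightarrow> a * c \<in> J"
proof -
  show *: "0 \<in> J" "a \<in> J \<Longrightarrow> b \<in> J \<Longrightarrow> a + b \<in> J" "a \<in> J \<Longrightarrow> c * a \<in> J"  for a b c
    using assms unfolding is_ideal_def by blast+
  show "- a \<in> J" if "a \<in> J" for a using *(3)[OF that, of "-1"] by simp
  then show "a \<in> J \<Longrightarrow> b \<in> J \<Longrightarrow> a - b \<in> J" using *(2)[of a "- b"] by simp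
  show "a \<in> J \<Longrightarrow> a * c \<in> J" using *(3)[of a c] by (simp add: mult.commute)
qed

lemma is_ideal_sum: "is_ideal J \<Longrightarrow> (\<And>i. i \<in> A \<Longrightarrow> g i \<in> J) \<Longrightarrow> (\<Sum>i\<in>A. g i) \<in> J"
  by (induction A rule: infinite_finite_induct) (auto simp: is_idealD)

definition leads :: "('v::finite, 'k::comm_ring_1) mpoly set \<Rightarrow> ('v \<Rightarrow>\<^sub>0 nat) set"
  where "leads J = {lead a | a. a \<in> J \<and> a \<noteq> 0}"

lemma lead_times_single:
  fixes a :: "('v::finite, 'k::comm_ring_1) mpoly"
  assumes "a \<noteq> 0"
  shows "Poly_Mapping.single m 1 * a \<noteq> 0" "lead (Poly_Mapping.single m 1 * a) = m + lead a"
proof -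
  let ?b = "Poly_Mapping.single m 1 * a"
  have l: "Poly_Mapping.lookup ?b (m + n) = Poly_Mapping.lookup a n" for n
    by (simp add: lookup_single_times)
  then show nz: "?b \<noteq> 0"
    using lead_in_keys[OF assms] by (metis in_keys_iff lookup_zero)
  have mem: "m + lead a \<in> Poly_Mapping.keys ?b"
    using l lead_in_keys[OF assms] by (simp add: in_keys_iff)
  have "lead ?b \<in> Poly_Mapping.keys ?b" by (rule lead_in_keys[OF nz])
  then obtain n where n: "lead ?b = m + n" "n \<in> Poly_Mapping.keys a"
    using keys_mult[of "Poly_Mapping.single m 1" a] by (auto split: if_splits)
  have "expo_key (lead ?b) \<le> expo_key (m + lead a)"
    using le_lead[OF assms n(2)] by (simp add: n expo_key_add)
  moreover have "expo_key (m + lead a) \<le> expo_key (lead ?b)"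
    by (rule le_lead[OF nz mem])
  ultimately show "lead ?b = m + lead a"
    using inj_expo_key by (metis injD order.antisym)
qed

lemma leads_upward:
  assumes "is_ideal J" "m \<in> leads J" "\<And>v. Poly_Mapping.lookup m v \<le> Poly_Mapping.lookup n v"
  shows "n \<in> leads (J :: ('v::finite, 'k::comm_ring_1) mpoly set)"
proof -
  obtain a where a: "a \<in> J" "a \<noteq> 0" "m = lead a"
    using assms(2) unfolding leads_def by blast
  have "n = (n - m) + m"
    using assms(3) by (intro poly_mapping_eqI) (simp add: lookup_add lookup_minus)
  then show ?thesis
    using lead_times_single[OF a(2), of "n - m"] a is_idealD(3)[OF assms(1) a(1)]
    unfolding leads_def by (metis (mono_tags, lifting) mem_Collect_eq)
qed

text \<open>Division with remainder: an element of \<open>J\<close> shares its leading exponent with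
  some element of \<open>I\<close>, and subtracting a scalar multiple of the latter lowers the
  leading exponent or gives 0. Well-foundedness of the monomial order ends the descent.\<close>

lemma ideal_eq_if_leads_eq:
  fixes I J :: "('v::finite, 'k::field) mpoly set"
  assumes I: "is_ideal I" and J: "is_ideal J" and "I \<subseteq> J" and leads: "leads J \<subseteq> leads I"
  shows "I = J"
proof -
  have "a \<in> I" if "lead a = m" "a \<in> J" for a m
    using wf_expo_key that
  proof (induction m arbitrary: a rule: wf_induct_rule)
    case (less m)
    show ?case
    proof (cases "a = 0")
      case True
      then show ?thesis using is_idealD(1)[OF I] by simp
    next
      case False
      then have "m \<in> leads I"
        using less.prems leads unfolding leads_def by blast
      then obtain b where b: "b \<in> I" "b \<noteq> 0" "lead b = m"
        unfolding leads_def by blast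
      define c where "c = Poly_Mapping.lookup a m / Poly_Mapping.lookup b m"
      define d where "d = a - Poly_Mapping.single 0 c * b"
      have lb: "Poly_Mapping.lookup b m \<noteq> 0"
        using lead_in_keys[OF b(2)] b(3) by (simp add: in_keys_iff)
      have ld: "Poly_Mapping.lookup d k = Poly_Mapping.lookup a k - c * Poly_Mapping.lookup b k" for k
        using lookup_single_times[of 0 c b k] by (simp add: d_def lookup_minus)
      have "d \<in> J"
        unfolding d_def using less.prems(2) b(1) \<open>I \<subseteq> J\<close>
        by (intro is_idealD(5)[OF J] is_idealD(3)[OF J]) auto
      have "d \<in> I"
      proof (cases "d = 0")
        case True
        then show ?thesis using is_idealD(1)[OF I] by simp
      next
        case False
        have k: "lead d \<in> Poly_Mapping.keys d" by (rule lead_in_keys[OF False])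
        then have "lead d \<noteq> m"
          using ld[of m] lb by (auto simp: in_keys_iff c_def)
        moreover have "lead d \<in> Poly_Mapping.keys a \<or> lead d \<in> Poly_Mapping.keys b"
          using k ld[of "lead d"] by (auto simp: in_keys_iff)
        then have "expo_key (lead d) \<le> expo_key m"
          using le_lead[OF \<open>a \<noteq> 0\<close>] le_lead[OF b(2)] less.prems(1) b(3) by auto
        ultimately have "expo_key (lead d) < expo_key m"
          using inj_expo_key by (metis injD order.not_eq_order_implies_strict)
        then show ?thesis
          using less.IH[of "lead d" d] \<open>d \<in> J\<close> by simp
      qed
      moreover have "Poly_Mapping.single 0 c * b \<in> I"
        using b(1) I is_idealD(3) by blast
      ultimately have "d + Poly_Mapping.single 0 c * b \<in> I"
        using is_idealD(2)[OF I] by blast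
      then show ?thesis by (simp add: d_def)
    qed
  qed
  then show ?thesis using \<open>I \<subseteq> J\<close> by blast
qed

text \<open>Hilbert's basis theorem through leading exponents: if the chain never became stationary,
  new leading exponents would appear infinitely often, and by Dickson's lemma one of them would
  divide a later one, which therefore was not new.\<close>

theorem mpoly_ideal_chain_stabilizes:
  fixes J :: "nat \<Rightarrow> ('v::finite, 'k::field) mpoly set"
  assumes id: "\<And>n. is_ideal (J n)" and inc: "\<And>n. J n \<subseteq> J (Suc n)"
  shows "\<exists>N. \<forall>n\<ge>N. J n = J N"
proof (rule ccontr)
  assume neg: "\<not> ?thesis"
  have mono: "J m \<subseteq> J n" if "m \<le> n" for m n
    using that inc by (rule lift_Suc_mono_le[of J, rotated]) 
  have "\<exists>n\<ge>N. \<exists>m. m \<in> leads (J n) \<and> m \<notin> leads (J N)" for N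
  proof -
    obtain n where "n \<ge> N" "J n \<noteq> J N" using neg by blast
    then show ?thesis
      using ideal_eq_if_leads_eq[OF id id mono] by blast
  qed
  then obtain nx mx where nx: "\<And>N. nx N \<ge> N" and mx: "\<And>N. mx N \<in> leads (J (nx N))" "\<And>N. mx N \<notin> leads (J N)"
    by metis
  \<comment> \<open>Jumping along \<open>nx\<close> puts the exponent that is new at stage
    \<open>t i\<close> into the leading exponents of stage \<open>t (Suc i)\<close>, so every later
    stage contains its multiples.\<close>
  define t where "t = rec_nat 0 (\<lambda>_ N. nx N)"
  have t: "t (Suc i) = nx (t i)" for i
    by (simp add: t_def)
  have tm: "t i \<le> t j" if "i \<le> j" for i j
    by (rule lift_Suc_mono_le[of t, OF _ that]) (simp add: t nx)
  obtain i j where ij: "i < j"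
    "\<And>v. Poly_Mapping.lookup (mx (t i)) v \<le> Poly_Mapping.lookup (mx (t j)) v"
    using dickson[of "\<lambda>i. mx (t i)"] by blast
  have "mx (t j) \<in> leads (J (t (Suc i)))"
    using leads_upward[OF id mx(1)[of "t i"] ij(2)] by (simp add: t)
  moreover have "leads (J (t (Suc i))) \<subseteq> leads (J (t j))"
    using mono[OF tm[of "Suc i" j]] ij(1) unfolding leads_def by fastforce
  ultimately show False using mx(2) by blast
qed

section \<open>Frobenius on the polynomial ring and its trace\<close>

definition box :: "nat \<Rightarrow> ('v::finite \<Rightarrow> nat) set"
  where "box q = {e. \<forall>v. e v < q}"

lemma finite_box [simp]: "finite (box q :: ('v::finite \<Rightarrow> nat) set)"
proof -
  have "(box q :: ('v \<Rightarrow> nat) set) \<subseteq> UNIV \<rightarrow>\<^sub>E {..<q}"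
    by (auto simp: box_def PiE_def)
  then show ?thesis
    using finite_PiE[of "UNIV :: 'v set" "\<lambda>_. {..<q}"] finite_subset by auto
qed

lemma nat_digit_iff:
  fixes q :: nat
  assumes "q > 0"
  shows "d = q * e + (q - 1) \<longleftrightarrow> d mod q = q - 1 \<and> d div q = e"
proof
  obtain r where r: "q = Suc r" using assms by (cases q) auto
  assume "d = q * e + (q - 1)"
  then show "d mod q = q - 1 \<and> d div q = e"
    by (simp add: r del: mult_Suc)
next
  assume "d mod q = q - 1 \<and> d div q = e"
  then show "d = q * e + (q - 1)"
    using mult_div_mod_eq[of q d] by simp
qed

text \<open>Over a perfect field and for \<open>q\<close> a power of \<open>p\<close> the root is
  unique, because Frobenius is injective; this makes \<open>rt\<close> additive.\<close>

definition rt :: "nat \<Rightarrow> 'k::monoid_mult \<Rightarrow> 'k"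
  where "rt q c = (SOME d. d ^ q = c)"

text \<open>For \<open>q = p ^ i\<close> this is the \<open>i\<close>-fold iterate of the dual basis element \<open>u\<close>.\<close>

definition uq :: "nat \<Rightarrow> ('v::finite, 'k::comm_ring_1) mpoly \<Rightarrow> ('v, 'k) mpoly"
  where "uq q a = Poly_Mapping.Abs_poly_mapping
    (\<lambda>m. rt q (Poly_Mapping.lookup a (expo (\<lambda>v. q * Poly_Mapping.lookup m v + (q - 1)))))"

locale perfect_char =
  fixes p :: nat and K :: "'k::field itself"
  assumes prime: "prime p" and char: "CHAR('k) = p" and perfect: "surj (\<lambda>c::'k. c ^ p)"
begin

lemma p_gt_1: "p > 1"
  using prime prime_gt_1_nat by blast

lemma p_pos [simp]: "p > 0" and p_nz [simp]: "p \<noteq> 0"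
  using p_gt_1 by simp_all

lemma q_pos: "p ^ i > 0"
  using p_pos by simp

lemma char_mpoly: "CHAR(('v, 'k) mpoly) = p"
proof (rule CHAR_eqI)
  show "of_nat p = (0 :: ('v, 'k) mpoly)"
    using of_nat_CHAR[where ?'a = 'k] by (metis char single_of_nat single_zero)
next
  fix x assume "of_nat x = (0 :: ('v, 'k) mpoly)"
  then have "of_nat x = (0 :: 'k)"
    by (metis lookup_single_eq lookup_zero single_of_nat)
  then show "p dvd x"
    using of_nat_eq_0_iff_char_dvd[where ?'a = 'k] char by metis
qed

lemma frob_add: "(a + b) ^ (p ^ i) = (a :: ('v, 'k) mpoly) ^ (p ^ i) + b ^ (p ^ i)"
  using freshmans_dream'[of "p ^ i" i a b] prime by (simp add: char_mpoly)

lemma frob_add_k: "(a + b) ^ (p ^ i) = (a :: 'k) ^ (p ^ i) + b ^ (p ^ i)"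
  using freshmans_dream'[of "p ^ i" i a b] prime by (simp add: char)

lemma frob_minus: "(- a) ^ (p ^ i) = - ((a :: ('v, 'k) mpoly) ^ (p ^ i))"
  using frob_add[of a "- a" i] q_pos[of i] by (simp add: eq_neg_iff_add_eq_0 add.commute power_0_left)

lemma frob_inj_k: "(a :: 'k) ^ (p ^ i) = b ^ (p ^ i) \<Longrightarrow> a = b"
proof -
  assume "a ^ (p ^ i) = b ^ (p ^ i)"
  then have "(a - b) ^ (p ^ i) = 0"
    using frob_add_k[of "a - b" b i] by simp
  then show "a = b" by simp
qed

lemma ex_root: "\<exists>d. d ^ (p ^ i) = (c :: 'k)"
proof (induction i arbitrary: c)
  case (Suc i)
  obtain e where "e ^ p = c" using perfect by (metis surjD)
  moreover obtain d where "d ^ (p ^ i) = e" using Suc by blast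
  ultimately show ?case by (metis power_Suc2 power_mult)
qed auto

lemma rt_power [simp]: "rt (p ^ i) (c :: 'k) ^ (p ^ i) = c"
  unfolding rt_def using ex_root by (rule someI_ex)

lemma rt_eqI: "d ^ (p ^ i) = c \<Longrightarrow> rt (p ^ i) (c :: 'k) = d"
  by (rule frob_inj_k[of _ i]) simp

lemma rt_0 [simp]: "rt (p ^ i) (0 :: 'k) = 0"
  by (rule rt_eqI) (use q_pos[of i] in \<open>simp add: power_0_left\<close>)

lemma rt_1 [simp]: "rt (p ^ i) (1 :: 'k) = 1"
  by (rule rt_eqI) simp

lemma rt_add: "rt (p ^ i) (c + d :: 'k) = rt (p ^ i) c + rt (p ^ i) d"
  by (rule rt_eqI) (simp add: frob_add_k)

text \<open>The index map from \<open>m\<close> to \<open>q m + (q - 1)\<close>, with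
  \<open>q = p ^ i\<close>, is injective. Hence only finitely many coefficients are nonzero and the
  abstraction function returns what was put in.\<close>

lemma lookup_uq:
  "Poly_Mapping.lookup (uq (p ^ i) (a :: ('v::finite, 'k) mpoly)) m =
    rt (p ^ i) (Poly_Mapping.lookup a (expo (\<lambda>v. p ^ i * Poly_Mapping.lookup m v + (p ^ i - 1))))"
proof -
  let ?g = "\<lambda>m :: 'v \<Rightarrow>\<^sub>0 nat. expo (\<lambda>v. p ^ i * Poly_Mapping.lookup m v + (p ^ i - 1))"
  have "inj ?g"
    by (intro injI poly_mapping_eqI) (simp add: fun_eq_iff)
  then have "finite (?g -` Poly_Mapping.keys a)"
    by (intro finite_vimageI) auto
  moreover have "{m. rt (p ^ i) (Poly_Mapping.lookup a (?g m)) \<noteq> 0} \<subseteq> ?g -` Poly_Mapping.keys a"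
    using rt_0[of i] by (auto simp: in_keys_iff)
  ultimately show ?thesis
    unfolding uq_def by (subst lookup_Abs_poly_mapping) (auto intro: finite_subset)
qed

lemma uq_add: "uq (p ^ i) (a + b) = uq (p ^ i) a + uq (p ^ i) (b :: ('v::finite, 'k) mpoly)"
  by (rule poly_mapping_eqI) (simp add: lookup_uq lookup_add rt_add)

lemma uq_0 [simp]: "uq (p ^ i) (0 :: ('v::finite, 'k) mpoly) = 0"
  by (rule poly_mapping_eqI) (simp add: lookup_uq)

lemma uq_minus: "uq (p ^ i) (- a) = - uq (p ^ i) (a :: ('v::finite, 'k) mpoly)"
  using uq_add[of i a "- a"] by (simp add: eq_neg_iff_add_eq_0 add.commute)

lemma uq_diff: "uq (p ^ i) (a - b) = uq (p ^ i) a - uq (p ^ i) (b :: ('v::finite, 'k) mpoly)"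
  using uq_add[of i a "- b"] by (simp add: uq_minus)

lemma uq_sum: "uq (p ^ i) (\<Sum>x\<in>A. g x) = (\<Sum>x\<in>A. uq (p ^ i) (g x :: ('v::finite, 'k) mpoly))"
  by (induction A rule: infinite_finite_induct) (auto simp: uq_add)

lemma uq_single:
  "uq (p ^ i) (Poly_Mapping.single (expo d) (c :: 'k)) =
    (if \<forall>v::'v::finite. d v mod p ^ i = p ^ i - 1
     then Poly_Mapping.single (expo (\<lambda>v. d v div p ^ i)) (rt (p ^ i) c) else 0)"
proof (rule poly_mapping_eqI)
  fix m :: "'v \<Rightarrow>\<^sub>0 nat"
  obtain e where m: "m = expo e" by (rule single_expo_cases)
  have q: "p ^ i > 0" by (rule q_pos)
  have *: "d v = p ^ i * e v + (p ^ i - 1) \<longleftrightarrow> d v mod p ^ i = p ^ i - 1 \<and> d v div p ^ i = e v" for v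
    by (rule nat_digit_iff) simp
  show "Poly_Mapping.lookup (uq (p ^ i) (Poly_Mapping.single (expo d) c)) m = Poly_Mapping.lookup
      (if \<forall>v. d v mod p ^ i = p ^ i - 1 then Poly_Mapping.single (expo (\<lambda>v. d v div p ^ i)) (rt (p ^ i) c) else 0) m"
    unfolding m lookup_uq
    by (auto simp: lookup_single when_def fun_eq_iff * simp del: One_nat_def)
qed

lemma uq_xpow:
  "uq (p ^ i) (xpow d :: ('v::finite, 'k) mpoly) =
    (if \<forall>v. d v mod p ^ i = p ^ i - 1 then xpow (\<lambda>v. d v div p ^ i) else 0)"
  by (simp add: uq_single)

text \<open>The projection formula of the trace. Both sides are additive in \<open>a\<close> and,
  Frobenius being additive, in \<open>b\<close>; so it is enough to compare exponents of monomials
  modulo \<open>p ^ i\<close>.\<close>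

lemma uq_frob_mult: "uq (p ^ i) (b ^ (p ^ i) * a) = b * uq (p ^ i) (a :: ('v::finite, 'k) mpoly)"
proof (induction a rule: poly_mapping_sum_induct)
  case (single m c)
  obtain d where m: "m = expo d" by (rule single_expo_cases)
  show ?case
  proof (induction b rule: poly_mapping_sum_induct)
    case zero
    then show ?case using q_pos[of i] by (simp add: power_0_left)
  next
    case (single n e)
    obtain f where n: "n = expo f" by (rule single_expo_cases)
    have "rt (p ^ i) (e ^ (p ^ i) * c) = e * rt (p ^ i) c"
      by (rule rt_eqI) (simp add: power_mult_distrib)
    moreover have "(p ^ i * f v + d v) mod p ^ i = d v mod p ^ i" "(p ^ i * f v + d v) div p ^ i = f v + d v div p ^ i" for v
      using q_pos[of i] by auto
    ultimately show ?case
      by (simp add: m n single_expo_power mult_single expo_add uq_single)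
  next
    case (add b b')
    then show ?case by (simp add: frob_add distrib_right uq_add)
  qed
qed (simp_all add: uq_add distrib_left)

text \<open>The trace reads the exponents whose lowest base-\<open>p\<close> digits are all
  \<open>p - 1\<close>; the composition reads off \<open>j\<close> digits and then another
  \<open>i\<close>.\<close>

lemma uq_uq: "uq (p ^ i) (uq (p ^ j) a) = uq (p ^ (i + j)) (a :: ('v::finite, 'k) mpoly)"
proof (rule poly_mapping_eqI)
  fix m :: "'v \<Rightarrow>\<^sub>0 nat"
  have rt: "rt (p ^ i) (rt (p ^ j) c) = rt (p ^ (i + j)) c" for c :: 'k
    by (rule rt_eqI[symmetric]) (metis power_add power_mult rt_power)
  have "p ^ j * (p ^ i * k + (p ^ i - 1)) + (p ^ j - 1) = p ^ (i + j) * k + (p ^ (i + j) - 1)" for k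
  proof -
    obtain r t where "p ^ i = Suc r" "p ^ j = Suc t"
      by (metis Suc_pred' q_pos)
    then show ?thesis by (simp add: power_add algebra_simps)
  qed
  then show "Poly_Mapping.lookup (uq (p ^ i) (uq (p ^ j) a)) m = Poly_Mapping.lookup (uq (p ^ (i + j)) a) m"
    by (simp add: lookup_uq rt)
qed

text \<open>With \<open>q = p ^ i\<close>, multiplication by \<open>x^(q-1-e)\<close> moves the
  basis monomial \<open>x^e\<close> to the position that the trace reads, so \<open>uq\<close> of
  the product is the coordinate of \<open>a\<close> at \<open>x^e\<close>.\<close>

lemma uq_expand:
  "(a :: ('v::finite, 'k) mpoly) =
    (\<Sum>e\<in>box (p ^ i). uq (p ^ i) (xpow (\<lambda>v. p ^ i - 1 - e v) * a) ^ (p ^ i) * xpow e)"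
proof (induction a rule: poly_mapping_sum_induct)
  case zero
  then show ?case using q_pos[of i] by (simp add: power_0_left)
next
  case (single m c)
  obtain d where m: "m = expo d" by (rule single_expo_cases)
  have q: "p ^ i > 0" by (rule q_pos)
  have *: "(\<forall>v. (p ^ i - 1 - e v + d v) mod p ^ i = p ^ i - 1) \<longleftrightarrow> e = (\<lambda>v. d v mod p ^ i)"
    (is "?L \<longleftrightarrow> _") and **: "e = (\<lambda>v. d v mod p ^ i) \<Longrightarrow> (p ^ i - 1 - e v + d v) div p ^ i = d v div p ^ i"
    if "e \<in> box (p ^ i)" for e v
  proof -
    have e: "e v < p ^ i" for v using that by (auto simp: box_def)
    have 1: "(p ^ i - 1 - e v + d v) mod p ^ i = p ^ i - 1 \<longleftrightarrow> e v = d v mod p ^ i" for v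
    proof
      assume l: "(p ^ i - 1 - e v + d v) mod p ^ i = p ^ i - 1"
      have "(p ^ i - 1 - e v + d v + Suc (e v)) mod p ^ i = (p ^ i - 1 + Suc (e v)) mod p ^ i"
        using l by (metis mod_add_left_eq)
      moreover have "p ^ i - 1 - e v + d v + Suc (e v) = p ^ i + d v"
        using e[of v] by simp
      moreover have "p ^ i - 1 + Suc (e v) = p ^ i + e v"
        using q by simp
      ultimately show "e v = d v mod p ^ i" using e[of v] by simp
    next
      assume r: "e v = d v mod p ^ i"
      then have "p ^ i - 1 - e v + d v = (p ^ i - 1) + p ^ i * (d v div p ^ i)"
        using mult_div_mod_eq[of "p ^ i" "d v"] e[of v] by linarith
      moreover have "p ^ i - 1 < p ^ i" using q by linarith
      ultimately show "(p ^ i - 1 - e v + d v) mod p ^ i = p ^ i - 1"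
        by (metis mod_less mod_mult_self2)
    qed
    then show "?L \<longleftrightarrow> e = (\<lambda>v. d v mod p ^ i)" by (auto simp: fun_eq_iff)
    assume r: "e = (\<lambda>v. d v mod p ^ i)"
    then have "p ^ i - 1 - e v + d v = (p ^ i - 1) + p ^ i * (d v div p ^ i)"
      using mult_div_mod_eq[of "p ^ i" "d v"] e[of v] fun_cong[OF r, of v] by linarith
    moreover have "(p ^ i - 1) div p ^ i = 0" using q by (intro div_less) linarith
    moreover have "((p ^ i - 1) + p ^ i * (d v div p ^ i)) div p ^ i = d v div p ^ i + (p ^ i - 1) div p ^ i"
      by (rule div_mult_self2) simp
    ultimately show "(p ^ i - 1 - e v + d v) div p ^ i = d v div p ^ i"
      by (simp only: add_0_right)
  qed
  have mem: "(\<lambda>v. d v mod p ^ i) \<in> box (p ^ i)"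
    using q by (simp add: box_def)
  have "(\<Sum>e\<in>box (p ^ i). uq (p ^ i) (xpow (\<lambda>v. p ^ i - 1 - e v) * Poly_Mapping.single m c) ^ (p ^ i) * xpow e)
    = (\<Sum>e\<in>box (p ^ i). if e = (\<lambda>v. d v mod p ^ i) then
        Poly_Mapping.single (expo (\<lambda>v. d v div p ^ i)) (rt (p ^ i) c) ^ (p ^ i) * xpow e else 0)"
  proof (intro sum.cong refl)
    fix e :: "'v \<Rightarrow> nat" assume e: "e \<in> box (p ^ i)"
    have u: "uq (p ^ i) (xpow (\<lambda>v. p ^ i - 1 - e v) * Poly_Mapping.single m c) =
        (if \<forall>v. (p ^ i - 1 - e v + d v) mod p ^ i = p ^ i - 1
         then Poly_Mapping.single (expo (\<lambda>v. (p ^ i - 1 - e v + d v) div p ^ i)) (rt (p ^ i) c) else 0)"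
      by (simp only: m mult_single expo_add mult_1 uq_single)
    show "uq (p ^ i) (xpow (\<lambda>v. p ^ i - 1 - e v) * Poly_Mapping.single m c) ^ (p ^ i) * xpow e =
      (if e = (\<lambda>v. d v mod p ^ i) then
        Poly_Mapping.single (expo (\<lambda>v. d v div p ^ i)) (rt (p ^ i) c) ^ (p ^ i) * xpow e else 0)"
    proof (cases "e = (\<lambda>v. d v mod p ^ i)")
      case True
      then show ?thesis
        unfolding u *[OF e] **[OF e True] by simp
    next
      case False
      then show ?thesis
        unfolding u *[OF e] by (simp add: power_0_left)
    qed
  qed
  also have "\<dots> = Poly_Mapping.single (expo (\<lambda>v. d v div p ^ i)) (rt (p ^ i) c) ^ (p ^ i) * xpow (\<lambda>v. d v mod p ^ i)"
    using mem by (simp add: sum.delta')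
  also have "\<dots> = Poly_Mapping.single m c"
    by (simp add: m single_expo_power mult_single expo_add)
  finally show ?case by simp
next
  case (add a b)
  show ?case
    unfolding distrib_left uq_add frob_add distrib_right sum.distrib
    by (rule arg_cong2[of a _ b _ "(+)", OF add])
qed

lemmas uq_p_add = uq_add[of 1, simplified]
lemmas uq_p_diff = uq_diff[of 1, simplified]
lemmas uq_p_0 [simp] = uq_0[of 1, simplified]
lemmas uq_p_sum = uq_sum[of 1, simplified]
lemmas uq_p_frob_mult = uq_frob_mult[of 1, simplified]
lemmas uq_p_expand = uq_expand[of _ 1, simplified]
lemmas uq_p_uq = uq_uq[of 1, simplified]
lemmas uq_uq_p = uq_uq[of _ 1, simplified]

text \<open>The description by \<open>THE\<close> prescribes the values on the basis monomials, and
  by \<open>uq_expand\<close> an additive map with the projection formula is determined by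
  them.\<close>

lemma dual_u_eq: "dual_u p = (uq p :: ('v::finite, 'k) mpoly \<Rightarrow> _)"
  unfolding dual_u_def
proof (rule the_equality)
  have box: "(\<forall>v. d v mod p = p - Suc 0) \<longleftrightarrow> (\<forall>v. d v = p - 1)" "d v div p = 0" if "\<forall>v. d v \<le> p - 1" for d v
  proof -
    have "d v < p" for v using that p_pos by (metis Suc_pred' le_imp_less_Suc One_nat_def)
    then show "(\<forall>v. d v mod p = p - Suc 0) \<longleftrightarrow> (\<forall>v. d v = p - 1)" "d v div p = 0" by simp_all
  qed
  have basis: "uq p (Poly_Mapping.single i 1) = (if \<forall>j. Poly_Mapping.lookup i j = p - 1 then 1 else (0 :: ('v, 'k) mpoly))"
    if "\<forall>j. Poly_Mapping.lookup i j \<le> p - 1" for i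
  proof -
    obtain d where i: "i = expo d" by (rule single_expo_cases)
    have d: "\<forall>j. d j \<le> p - 1" using that by (simp add: i)
    show ?thesis
      unfolding i using uq_xpow[of 1 d] box[OF d] p_gt_1 by auto
  qed
  show "(uq p :: ('v, 'k) mpoly \<Rightarrow> _) \<in> mod_hom poly_ring (restr_scalars (\<lambda>a. a ^ p) poly_ring) (restr_scalars (\<lambda>a. a) poly_ring) \<and>
    (\<forall>i. (\<forall>j. Poly_Mapping.lookup i j \<le> p - 1) \<longrightarrow> uq p (Poly_Mapping.single i 1) =
      (if \<forall>j. Poly_Mapping.lookup i j = p - 1 then 1 else (0 :: ('v, 'k) mpoly)))"
    using basis by (auto simp: uq_p_add uq_p_frob_mult mod_hom_def restr_scalars_def poly_ring_def)
  fix g :: "('v, 'k) mpoly \<Rightarrow> ('v, 'k) mpoly"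
  assume g: "g \<in> mod_hom poly_ring (restr_scalars (\<lambda>a. a ^ p) poly_ring) (restr_scalars (\<lambda>a. a) poly_ring) \<and>
    (\<forall>i. (\<forall>j. Poly_Mapping.lookup i j \<le> p - 1) \<longrightarrow> g (Poly_Mapping.single i 1) =
      (if \<forall>j. Poly_Mapping.lookup i j = p - 1 then 1 else 0))"
  have add: "g (a + b) = g a + g b" and mult: "g (a ^ p * b) = a * g b" for a b
    using g by (auto simp: mod_hom_def restr_scalars_def poly_ring_def)
  have g0: "g 0 = 0" using add[of 0 0] by simp
  have gsum: "g (\<Sum>e\<in>A. h e) = (\<Sum>e\<in>A. g (h e))" if "finite A" for A and h :: "('v \<Rightarrow> nat) \<Rightarrow> _"
    using that by (induction A rule: finite_induct) (auto simp: g0 add)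
  have gx: "g (xpow e) = uq p (xpow e)" if "e \<in> box p" for e
  proof -
    have "\<forall>j. Poly_Mapping.lookup (expo e) j \<le> p - 1"
      using that unfolding box_def by (metis (mono_tags) One_nat_def Suc_pred' less_Suc_eq_le lookup_expo mem_Collect_eq p_pos)
    then show ?thesis using g basis by auto
  qed
  show "g = uq p"
  proof
    fix a :: "('v, 'k) mpoly"
    have e: "a = (\<Sum>e\<in>box p. uq p (xpow (\<lambda>v. p - 1 - e v) * a) ^ p * xpow e)" (is "a = ?s")
      using uq_expand[of a 1] by simp
    have "g ?s = (\<Sum>e\<in>box p. uq p (xpow (\<lambda>v. p - 1 - e v) * a) * g (xpow e))"
      by (simp add: gsum mult)
    also have "\<dots> = (\<Sum>e\<in>box p. uq p (xpow (\<lambda>v. p - 1 - e v) * a) * uq p (xpow e))"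
      by (intro sum.cong refl) (simp add: gx)
    also have "\<dots> = uq p ?s"
      by (simp add: uq_p_sum uq_p_frob_mult)
    finally show "g a = uq p a" using e by simp
  qed
qed

end

section \<open>Evaluation of integral polynomials\<close>

definition is_hom :: "('a::comm_ring_1 \<Rightarrow> 'b::comm_ring_1) \<Rightarrow> bool"
  where "is_hom h \<longleftrightarrow> h 1 = 1 \<and> (\<forall>a b. h (a + b) = h a + h b) \<and> (\<forall>a b. h (a * b) = h a * h b)"

lemma is_homD:
  assumes "is_hom h"
  shows "h 1 = 1" "h (a + b) = h a + h b" "h (a * b) = h a * h b" "h 0 = 0" "h (- a) = - h a"
    "h (a - b) = h a - h b"
    "h (a ^ n) = h a ^ n" "h (of_nat n) = of_nat n" "h (of_int k) = of_int k"
    "h (\<Sum>i\<in>A. g i) = (\<Sum>i\<in>A. h (g i))" "h (\<Prod>i\<in>A. g i) = (\<Prod>i\<in>A. h (g i))"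
proof -
  show 1: "h 1 = 1" and a: "h (a + b) = h a + h b" and m: "h (a * b) = h a * h b" for a b
    using assms unfolding is_hom_def by auto
  show 0: "h 0 = 0" using a[of 0 0] by simp
  show neg: "h (- a) = - h a" for a using a[of a "- a"] 0 by (simp add: eq_neg_iff_add_eq_0 add.commute)
  show "h (a - b) = h a - h b" using a[of a "- b"] neg by simp
  show "h (a ^ n) = h a ^ n" by (induction n) (simp_all add: 1 m)
  show n: "h (of_nat n) = of_nat n" for n by (induction n) (simp_all add: 1 a 0)
  show "h (of_int k) = of_int k" by (cases k rule: int_cases2) (simp_all add: n neg)
  show "h (\<Sum>i\<in>A. g i) = (\<Sum>i\<in>A. h (g i))"
    by (induction A rule: infinite_finite_induct) (simp_all add: 0 a)
  show "h (\<Prod>i\<in>A. g i) = (\<Prod>i\<in>A. h (g i))"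
    by (induction A rule: infinite_finite_induct) (simp_all add: 1 m)
qed

definition mon :: "('v \<Rightarrow> 'a::comm_monoid_mult) \<Rightarrow> ('v \<Rightarrow>\<^sub>0 nat) \<Rightarrow> 'a"
  where "mon z m = (\<Prod>v\<in>Poly_Mapping.keys m. z v ^ Poly_Mapping.lookup m v)"

text \<open>Counterpart of \<open>int_poly_eval\<close> for rings given by a type class;
  \<open>int_poly_eval_poly_ring\<close> identifies the two.\<close>

definition ev :: "('v \<Rightarrow> 'a::comm_ring_1) \<Rightarrow> ('v, int) mpoly \<Rightarrow> 'a"
  where "ev z P = (\<Sum>m\<in>Poly_Mapping.keys P. of_int (Poly_Mapping.lookup P m) * mon z m)"

lemma mon_superset:
  assumes "finite K" "Poly_Mapping.keys m \<subseteq> K"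
  shows "mon z m = (\<Prod>v\<in>K. z v ^ Poly_Mapping.lookup m v)"
  unfolding mon_def using assms by (intro prod.mono_neutral_left) (auto simp: in_keys_iff)

lemma mon_add: "mon z (m + n) = mon z m * mon z n"
proof -
  let ?K = "Poly_Mapping.keys m \<union> Poly_Mapping.keys n"
  have "mon z (m + n) = (\<Prod>v\<in>?K. z v ^ Poly_Mapping.lookup (m + n) v)"
    using keys_add[of m n] by (intro mon_superset) auto
  then show ?thesis
    by (simp add: mon_superset[of ?K m] mon_superset[of ?K n] lookup_add power_add prod.distrib)
qed

lemma mon_0 [simp]: "mon z 0 = 1"
  by (simp add: mon_def)

lemma mon_single [simp]: "mon z (Poly_Mapping.single v n) = z v ^ n"
  by (simp add: mon_def)

lemma ev_superset:
  assumes "finite K" "Poly_Mapping.keys P \<subseteq> K"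
  shows "ev z P = (\<Sum>m\<in>K. of_int (Poly_Mapping.lookup P m) * mon z m)"
  unfolding ev_def using assms by (intro sum.mono_neutral_left) (auto simp: in_keys_iff)

lemma ev_0 [simp]: "ev z 0 = 0"
  by (simp add: ev_def)

lemma ev_single: "ev z (Poly_Mapping.single m c) = of_int c * mon z m"
  by (cases "c = 0") (simp_all add: ev_def)

lemma ev_add: "ev z (P + Q) = ev z P + ev z Q"
proof -
  let ?K = "Poly_Mapping.keys P \<union> Poly_Mapping.keys Q"
  have "ev z (P + Q) = (\<Sum>m\<in>?K. of_int (Poly_Mapping.lookup (P + Q) m) * mon z m)"
    using keys_add[of P Q] by (intro ev_superset) auto
  then show ?thesis
    by (simp add: ev_superset[of ?K P] ev_superset[of ?K Q] lookup_add distrib_right sum.distrib)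
qed

lemma ev_mult: "ev z (P * Q) = ev z P * ev z Q"
proof (induction P rule: poly_mapping_sum_induct)
  case (single m c)
  show ?case
    by (induction Q rule: poly_mapping_sum_induct)
      (simp_all add: mult_single ev_single mon_add ev_add distrib_left)
qed (simp_all add: ev_add distrib_right)

lemma is_hom_ev: "is_hom (ev z)"
  unfolding is_hom_def single_one[symmetric] by (simp only: ev_single ev_add ev_mult mon_0) simp

lemma ev_mvar [simp]: "ev z (mvar v) = z v"
  by (simp add: mvar_def ev_single)

lemma hom_ev:
  assumes "is_hom h"
  shows "h (ev z P) = ev (\<lambda>v. h (z v)) P"
  by (simp add: ev_def mon_def is_homD[OF assms])

lemma ev_mvar_id: "ev mvar P = (P :: ('v, int) mpoly)"
proof (induction P rule: poly_mapping_sum_induct)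
  case (single m c)
  have "mon mvar m = (Poly_Mapping.single m 1 :: ('v, int) mpoly)"
  proof (induction m rule: poly_mapping_sum_induct)
    case (single v n)
    have "(\<Sum>i<n. Poly_Mapping.single v 1) = Poly_Mapping.single v n"
      by (rule poly_mapping_eqI) (simp add: lookup_sum lookup_single when_def)
    then show ?case by (simp add: mvar_def single_power)
  next
    case (add a b)
    then show ?case by (simp add: mon_add mult_single)
  qed simp
  moreover have "Poly_Mapping.single 0 c = (of_int c :: ('v, int) mpoly)"
    by (metis of_int_eq_id id_apply single_of_int)
  ultimately have "ev mvar (Poly_Mapping.single m c) = Poly_Mapping.single 0 c * (Poly_Mapping.single m 1 :: ('v, int) mpoly)"
    by (simp add: ev_single)
  then show ?case by (simp add: mult_single)
qed (simp_all add: ev_add)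

section \<open>Congruences modulo powers of a prime\<close>

lemma dvd_freshman:
  fixes x y :: "'a::comm_ring_1"
  assumes "prime p"
  shows "of_nat p dvd (x + y) ^ p - (x ^ p + y ^ p)"
proof -
  have p: "p > 0" using assms prime_gt_0_nat by blast
  have "(x + y) ^ p = (\<Sum>k\<le>p. of_nat (p choose k) * x ^ k * y ^ (p - k))"
    by (rule binomial_ring)
  also have "{..p} = insert 0 (insert p {0<..<p})" using p by auto
  finally have "(x + y) ^ p - (x ^ p + y ^ p) = (\<Sum>k\<in>{0<..<p}. of_nat (p choose k) * x ^ k * y ^ (p - k))"
    using p by simp
  moreover have "of_nat p dvd \<dots>"
  proof (intro dvd_sum)
    fix k assume "k \<in> {0<..<p}"
    then have "p dvd p choose k"
      using assms by (intro dvd_choose_prime) auto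
    then obtain j where "p choose k = p * j" by (auto simp: dvd_def)
    then show "of_nat p dvd of_nat (p choose k) * x ^ k * y ^ (p - k)"
      by (simp add: mult.assoc)
  qed
  ultimately show ?thesis by simp
qed

text \<open>Each further \<open>p\<close>-th power gains a factor \<open>p\<close>: if
  \<open>p\<close> divides \<open>a - b\<close>, the cofactor of \<open>a - b\<close> in
  \<open>a^p - b^p\<close> is congruent to \<open>p b^(p-1)\<close> modulo \<open>p\<close>.\<close>

lemma dvd_power_prime:
  fixes x y :: "'a::comm_ring_1"
  assumes "of_nat p dvd x - y"
  shows "of_nat p ^ Suc k dvd x ^ (p ^ k) - y ^ (p ^ k)"
proof (induction k)
  case (Suc k)
  let ?x = "x ^ (p ^ k)" and ?y = "y ^ (p ^ k)"
  have "of_nat p dvd ?x - ?y"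
    using Suc by (metis dvd_trans dvd_triv_left power_Suc)
  have s: "of_nat p dvd (\<Sum>i<p. ?y ^ (p - Suc i) * ?x ^ i)"
  proof -
    have "of_nat p dvd ?y ^ (p - Suc i) * ?x ^ i - ?y ^ (p - 1)" if "i < p" for i
    proof -
      have "?y ^ (p - 1) = ?y ^ (p - Suc i) * ?y ^ i"
        using that by (simp flip: power_add)
      then have "?y ^ (p - Suc i) * ?x ^ i - ?y ^ (p - 1) = ?y ^ (p - Suc i) * (?x ^ i - ?y ^ i)"
        by (simp add: right_diff_distrib)
      moreover have "?x - ?y dvd ?x ^ i - ?y ^ i"
        by (simp add: power_diff_sumr2)
      ultimately show ?thesis
        using \<open>of_nat p dvd ?x - ?y\<close> by (metis dvd_mult dvd_trans)
    qed
    then have "of_nat p dvd (\<Sum>i<p. ?y ^ (p - Suc i) * ?x ^ i - ?y ^ (p - 1))"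
      by (intro dvd_sum) auto
    then have "of_nat p dvd (\<Sum>i<p. ?y ^ (p - Suc i) * ?x ^ i) - of_nat p * ?y ^ (p - 1)"
      by (simp add: sum_subtractf)
    then show ?thesis
      by (metis dvd_add_left_iff dvd_triv_left diff_add_cancel dvd_add)
  qed
  have "x ^ (p ^ Suc k) - y ^ (p ^ Suc k) = ?x ^ p - ?y ^ p"
    by (simp flip: power_mult add: mult.commute)
  also have "\<dots> = (?x - ?y) * (\<Sum>i<p. ?y ^ (p - Suc i) * ?x ^ i)"
    by (rule power_diff_sumr2)
  finally have "x ^ (p ^ Suc k) - y ^ (p ^ Suc k) = (\<Sum>i<p. ?y ^ (p - Suc i) * ?x ^ i) * (?x - ?y)"
    by (simp add: mult.commute)
  then show ?case
    using mult_dvd_mono[OF s Suc] by simp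
qed (use assms in simp)

text \<open>The polynomials with this property form a subring, the set \<open>G\<close>, that
  contains the variables. The substitution is the Frobenius lift used in the criterion
  \<open>witt_poly_solve\<close>.\<close>

lemma frobenius_lift_mpoly:
  fixes P :: "('v, int) mpoly"
  assumes "prime p"
  shows "of_nat p dvd ev (\<lambda>v. mvar v ^ p) P - P ^ p"
proof -
  let ?\<phi> = "ev (\<lambda>v. mvar v ^ p) :: ('v, int) mpoly \<Rightarrow> ('v, int) mpoly"
  have h: "is_hom ?\<phi>" by (rule is_hom_ev)
  have p: "p > 0" using assms prime_gt_0_nat by blast
  define G where "G = {P. of_nat p dvd ?\<phi> P - P ^ p}"
  have add: "A + B \<in> G" if "A \<in> G" "B \<in> G" for A B
  proof -
    have eq: "?\<phi> (A + B) - (A + B) ^ p = (?\<phi> A - A ^ p) + (?\<phi> B - B ^ p) - ((A + B) ^ p - (A ^ p + B ^ p))"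
      by (simp add: is_homD[OF h])
    show ?thesis
      using that unfolding G_def mem_Collect_eq eq
      by (intro dvd_diff[OF dvd_add dvd_freshman[OF assms]])
  qed
  have mult: "A * B \<in> G" if "A \<in> G" "B \<in> G" for A B
  proof -
    have eq: "?\<phi> (A * B) - (A * B) ^ p = (?\<phi> A - A ^ p) * ?\<phi> B + A ^ p * (?\<phi> B - B ^ p)"
      by (simp add: is_homD[OF h] algebra_simps power_mult_distrib)
    show ?thesis
      using that unfolding G_def mem_Collect_eq eq by (intro dvd_add dvd_mult dvd_mult2)
  qed
  have zero: "0 \<in> G" using p by (simp add: G_def power_0_left)
  have one: "1 \<in> G" by (simp add: G_def is_homD[OF h])
  have neg: "- A \<in> G" if "A \<in> G" for A
  proof -
    have eq: "?\<phi> (- A) - (- A) ^ p = - (?\<phi> A - A ^ p) + ((A + - A) ^ p - (A ^ p + (- A) ^ p))"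
      using p by (simp add: is_homD[OF h] power_0_left)
    show ?thesis
      using that unfolding G_def mem_Collect_eq eq
      by (intro dvd_add dvd_freshman[OF assms]) (simp only: dvd_minus_iff)
  qed
  have nat: "of_nat n \<in> G" for n
    by (induction n) (use zero one add in auto)
  have int: "of_int c \<in> G" for c
    by (cases c rule: int_cases2) (use nat neg in auto)
  have var: "mvar v \<in> G" for v by (simp add: G_def)
  have pow: "A ^ n \<in> G" if "A \<in> G" for A n
    by (induction n) (use one mult that in auto)
  have prod: "(\<Prod>i\<in>K. g i) \<in> G" if "\<And>i. g i \<in> G" for K :: "'v set" and g
    by (induction K rule: infinite_finite_induct) (use one mult that in auto)
  have mon: "mon mvar m \<in> G" for m
    unfolding mon_def by (intro prod pow var)
  have sum: "(\<Sum>i\<in>K. g i) \<in> G" if "\<And>i. g i \<in> G" for K :: "('v \<Rightarrow>\<^sub>0 nat) set" and g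
    by (induction K rule: infinite_finite_induct) (use zero add that in auto)
  have "ev mvar P \<in> G"
    unfolding ev_def by (intro sum mult int mon)
  then show ?thesis by (simp add: G_def ev_mvar_id)
qed

section \<open>Witt's theorem\<close>

definition torsion_free :: "nat \<Rightarrow> 'a::comm_ring_1 itself \<Rightarrow> bool"
  where "torsion_free p _ \<longleftrightarrow> (\<forall>x::'a. of_nat p * x = 0 \<longrightarrow> x = 0)"

lemma torsion_free_power_cancel:
  assumes "torsion_free p TYPE('a::comm_ring_1)" "of_nat p ^ n * x = of_nat p ^ n * (y::'a)"
  shows "x = y"
proof -
  have "z = 0" if "of_nat p ^ n * z = 0" for z :: 'a
    using that by (induction n) (use assms(1) in \<open>auto simp: torsion_free_def mult.assoc\<close>)
  then show ?thesis
    using assms(2) by (metis eq_iff_diff_eq_0 right_diff_distrib)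
qed

lemma torsion_free_mpoly_int:
  assumes "p > 0"
  shows "torsion_free p TYPE(('v, int) mpoly)"
  unfolding torsion_free_def
proof (intro allI impI)
  fix x :: "('v, int) mpoly"
  assume "of_nat p * x = 0"
  then have "int p * Poly_Mapping.lookup x m = 0" for m
    using lookup_single_times[of 0 "int p" x m] by (simp add: single_of_nat)
  then show "x = 0" using assms by (intro poly_mapping_eqI) simp
qed

lemma witt_poly_Suc:
  "witt_poly p (Suc n) z = (\<Sum>i\<le>n. of_nat p ^ i * z i ^ (p ^ (Suc n - i))) + of_nat p ^ Suc n * z (Suc n)"
  by (simp add: witt_poly_def)

lemma witt_poly_split:
  "witt_poly p n z = (\<Sum>i<n. of_nat p ^ i * z i ^ (p ^ (n - i))) + of_nat p ^ n * z n"
  by (simp add: witt_poly_def lessThan_Suc_atMost[symmetric])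

lemma hom_witt_poly: "is_hom h \<Longrightarrow> h (witt_poly p n z) = witt_poly p n (\<lambda>i. h (z i))"
  by (simp add: witt_poly_def is_homD)

text \<open>Earlier components that agree modulo \<open>p\<close> have \<open>p^(n-i)\<close>-th
  powers that agree modulo \<open>p^(n-i+1)\<close>, so they contribute equally to the
  \<open>n\<close>-th ghost component modulo \<open>p^(n+1)\<close>. What remains is the term
  \<open>p^n x_n\<close>, and \<open>p^n\<close> cancels.\<close>

lemma ghost_cong:
  fixes x y :: "nat \<Rightarrow> 'a::comm_ring_1"
  assumes tf: "torsion_free p TYPE('a)"
    and dvd: "\<And>n. of_nat p ^ Suc n dvd witt_poly p n x - witt_poly p n y"
  shows "of_nat p dvd x n - y n"
proof (induction n rule: less_induct)
  case (less n)
  have "of_nat p ^ Suc n dvd of_nat p ^ i * x i ^ (p ^ (n - i)) - of_nat p ^ i * y i ^ (p ^ (n - i))" if "i < n" for i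
  proof -
    have "of_nat p ^ i * of_nat p ^ Suc (n - i) dvd of_nat p ^ i * (x i ^ (p ^ (n - i)) - y i ^ (p ^ (n - i)))"
      by (intro mult_dvd_mono dvd_refl dvd_power_prime less that)
    moreover have "of_nat p ^ i * of_nat p ^ Suc (n - i) = (of_nat p ^ Suc n :: 'a)"
      using that by (subst power_add[symmetric]) simp
    ultimately show ?thesis by (simp only: right_diff_distrib)
  qed
  then have s: "of_nat p ^ Suc n dvd (\<Sum>i<n. of_nat p ^ i * x i ^ (p ^ (n - i)) - of_nat p ^ i * y i ^ (p ^ (n - i)))"
    by (intro dvd_sum) auto
  have eq: "of_nat p ^ n * (x n - y n) = (witt_poly p n x - witt_poly p n y) -
      (\<Sum>i<n. of_nat p ^ i * x i ^ (p ^ (n - i)) - of_nat p ^ i * y i ^ (p ^ (n - i)))"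
    by (simp add: witt_poly_split sum_subtractf algebra_simps)
  have "of_nat p ^ Suc n dvd of_nat p ^ n * (x n - y n)"
    unfolding eq by (rule dvd_diff[OF dvd s])
  then obtain z where "of_nat p ^ n * (x n - y n) = of_nat p ^ n * (of_nat p * z)"
    by (auto simp: dvd_def power_Suc2 mult.assoc simp del: power_Suc)
  then have "x n - y n = of_nat p * z"
    by (rule torsion_free_power_cancel[OF tf])
  then show ?case by simp
qed

lemma ghost_inject:
  fixes x y :: "nat \<Rightarrow> 'a::comm_ring_1"
  assumes tf: "torsion_free p TYPE('a)" and eq: "\<And>n. witt_poly p n x = witt_poly p n y"
  shows "x = y"
proof
  fix n show "x n = y n"
  proof (induction n rule: less_induct)
    case (less n)
    have "(\<Sum>i<n. of_nat p ^ i * x i ^ (p ^ (n - i))) = (\<Sum>i<n. of_nat p ^ i * y i ^ (p ^ (n - i)))"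
      using less by (intro sum.cong) auto
    then have "of_nat p ^ n * x n = of_nat p ^ n * y n"
      using eq[of n] by (simp add: witt_poly_split)
    then show ?case by (rule torsion_free_power_cancel[OF tf])
  qed
qed

text \<open>Solves the ghost equations one at a time; \<open>SOME\<close> stands for a division by
  \<open>p^n\<close>, which succeeds under the criterion of \<open>witt_poly_solve\<close>.\<close>

fun witt_solve :: "nat \<Rightarrow> (nat \<Rightarrow> 'a::comm_ring_1) \<Rightarrow> nat \<Rightarrow> 'a" where
  "witt_solve p G n = (SOME x. of_nat p ^ n * x = G n - (\<Sum>i<n. of_nat p ^ i * witt_solve p G i ^ (p ^ (n - i))))"

declare witt_solve.simps [simp del]

text \<open>Dwork's criterion. Applying \<open>\<phi>\<close> to the ghost equation of index
  \<open>k\<close> changes \<open>X_i^(p^(k-i))\<close> only up to congruence into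
  \<open>X_i^(p^(k+1-i))\<close>. So \<open>G (Suc k)\<close> minus its first \<open>k + 1\<close>
  terms is divisible by \<open>p^(k+1)\<close>, and the next component exists.\<close>

lemma witt_poly_solve:
  fixes G :: "nat \<Rightarrow> 'a::comm_ring_1"
  assumes h: "is_hom \<phi>" and lift: "\<And>x. of_nat p dvd \<phi> x - x ^ p"
    and G: "\<And>n. of_nat p ^ Suc n dvd G (Suc n) - \<phi> (G n)"
  shows "witt_poly p n (witt_solve p G) = G n"
proof (induction n rule: less_induct)
  case (less n)
  let ?X = "witt_solve p G"
  have "of_nat p ^ n dvd G n - (\<Sum>i<n. of_nat p ^ i * ?X i ^ (p ^ (n - i)))"
  proof (cases n)
    case (Suc k)
    have "of_nat p ^ Suc k dvd of_nat p ^ i * \<phi> (?X i) ^ (p ^ (k - i)) - of_nat p ^ i * ?X i ^ (p ^ (Suc k - i))"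
      if "i \<le> k" for i
    proof -
      have "of_nat p ^ i * of_nat p ^ Suc (k - i) dvd of_nat p ^ i * (\<phi> (?X i) ^ (p ^ (k - i)) - (?X i ^ p) ^ (p ^ (k - i)))"
        by (intro mult_dvd_mono dvd_refl dvd_power_prime lift)
      moreover have "of_nat p ^ i * of_nat p ^ Suc (k - i) = (of_nat p ^ Suc k :: 'a)"
        using that by (subst power_add[symmetric]) simp
      moreover have "(?X i ^ p) ^ (p ^ (k - i)) = ?X i ^ (p ^ (Suc k - i))"
        using that by (simp add: Suc_diff_le flip: power_mult)
      ultimately show ?thesis by (simp only: right_diff_distrib)
    qed
    then have "of_nat p ^ Suc k dvd (\<Sum>i\<le>k. of_nat p ^ i * \<phi> (?X i) ^ (p ^ (k - i)) - of_nat p ^ i * ?X i ^ (p ^ (Suc k - i)))"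
      by (intro dvd_sum) auto
    moreover have "\<phi> (G k) = (\<Sum>i\<le>k. of_nat p ^ i * \<phi> (?X i) ^ (p ^ (k - i)))"
      using less[of k] Suc hom_witt_poly[OF h, of p k ?X] by (simp add: witt_poly_def)
    ultimately have "of_nat p ^ Suc k dvd \<phi> (G k) - (\<Sum>i\<le>k. of_nat p ^ i * ?X i ^ (p ^ (Suc k - i)))"
      by (simp add: sum_subtractf)
    then have "of_nat p ^ Suc k dvd (G (Suc k) - \<phi> (G k)) + (\<phi> (G k) - (\<Sum>i\<le>k. of_nat p ^ i * ?X i ^ (p ^ (Suc k - i))))"
      using G by (intro dvd_add)
    then show ?thesis by (simp add: Suc lessThan_Suc_atMost)
  qed simp
  then have "\<exists>x. of_nat p ^ n * x = G n - (\<Sum>i<n. of_nat p ^ i * ?X i ^ (p ^ (n - i)))"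
    by (metis dvdE)
  then have "of_nat p ^ n * ?X n = G n - (\<Sum>i<n. of_nat p ^ i * ?X i ^ (p ^ (n - i)))"
    unfolding witt_solve.simps[of p G n] by (rule someI_ex)
  then show ?case by (simp add: witt_poly_split)
qed

lemma witt_poly_solve_mpoly:
  fixes G :: "nat \<Rightarrow> ('v, int) mpoly"
  assumes "prime p" and "\<And>n. of_nat p ^ Suc n dvd G (Suc n) - ev (\<lambda>v. mvar v ^ p) (G n)"
  shows "witt_poly p n (witt_solve p G) = G n"
  using is_hom_ev frobenius_lift_mpoly[OF assms(1)] assms(2) by (rule witt_poly_solve)

text \<open>Passing to the next index adds only a multiple of \<open>p^(n+1)\<close> to the
  Frobenius twist; sums, products and negatives of such ghost sequences therefore meet Dwork's
  criterion.\<close>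

lemma witt_poly_var_step:
  fixes g :: "nat \<Rightarrow> 'v" and p n :: nat
  defines "W \<equiv> \<lambda>n. witt_poly p n (\<lambda>i. mvar (g i)) :: ('v, int) mpoly"
  shows "W (Suc n) = ev (\<lambda>v. mvar v ^ p) (W n) + of_nat p ^ Suc n * mvar (g (Suc n))"
proof -
  have "ev (\<lambda>v. mvar v ^ p) (W n) =
      (\<Sum>i\<le>n. of_nat p ^ i * mvar (g i) ^ (p ^ (Suc n - i)) :: ('v, int) mpoly)"
    unfolding W_def by (subst hom_witt_poly[OF is_hom_ev])
      (simp add: witt_poly_def Suc_diff_le flip: power_mult)
  then show ?thesis by (simp add: W_def witt_poly_Suc)
qed

lemma ex1_ghost:
  assumes "prime p" "\<And>n. witt_poly p n X = (G n :: ('v, int) mpoly)"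
  shows "(THE P. \<forall>n. witt_poly p n P = G n) = X"
  using assms by (intro the_equality ghost_inject[OF torsion_free_mpoly_int[OF prime_gt_0_nat[OF assms(1)]]]) auto

lemma witt_poly_add_poly:
  assumes "prime p"
  shows "witt_poly p n (witt_add_poly p) =
    witt_poly p n (\<lambda>i. mvar (Inl i)) + witt_poly p n (\<lambda>i. mvar (Inr i))"
proof -
  let ?G = "\<lambda>n. witt_poly p n (\<lambda>i. mvar (Inl i)) + witt_poly p n (\<lambda>i. mvar (Inr i)) :: (nat + nat, int) mpoly"
  have "of_nat p ^ Suc n dvd ?G (Suc n) - ev (\<lambda>v. mvar v ^ p) (?G n)" for n
  proof -
    have "?G (Suc n) - ev (\<lambda>v. mvar v ^ p) (?G n) = of_nat p ^ Suc n * (mvar (Inl (Suc n)) + mvar (Inr (Suc n)))"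
      by (simp add: witt_poly_var_step ev_add algebra_simps)
    then show ?thesis by simp
  qed
  then have s: "witt_poly p n (witt_solve p ?G) = ?G n" for n
    by (rule witt_poly_solve_mpoly[OF assms])
  have "witt_add_poly p = witt_solve p ?G"
    unfolding witt_add_poly_def by (rule ex1_ghost[OF assms s])
  then show ?thesis using s by simp
qed

lemma witt_poly_mult_poly:
  assumes "prime p"
  shows "witt_poly p n (witt_mult_poly p) =
    witt_poly p n (\<lambda>i. mvar (Inl i)) * witt_poly p n (\<lambda>i. mvar (Inr i))"
proof -
  let ?G = "\<lambda>n. witt_poly p n (\<lambda>i. mvar (Inl i)) * witt_poly p n (\<lambda>i. mvar (Inr i)) :: (nat + nat, int) mpoly"
  have "of_nat p ^ Suc n dvd ?G (Suc n) - ev (\<lambda>v. mvar v ^ p) (?G n)" for n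
  proof -
    let ?a = "ev (\<lambda>v. mvar v ^ p) (witt_poly p n (\<lambda>i. mvar (Inl i)) :: (nat + nat, int) mpoly)"
      and ?b = "ev (\<lambda>v. mvar v ^ p) (witt_poly p n (\<lambda>i. mvar (Inr i)) :: (nat + nat, int) mpoly)"
    have "?G (Suc n) - ev (\<lambda>v. mvar v ^ p) (?G n) = of_nat p ^ Suc n *
      (?a * mvar (Inr (Suc n)) + mvar (Inl (Suc n)) * ?b + of_nat p ^ Suc n * mvar (Inl (Suc n)) * mvar (Inr (Suc n)))"
      by (simp add: witt_poly_var_step ev_mult algebra_simps)
    then show ?thesis by simp
  qed
  then have s: "witt_poly p n (witt_solve p ?G) = ?G n" for n
    by (rule witt_poly_solve_mpoly[OF assms])
  have "witt_mult_poly p = witt_solve p ?G"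
    unfolding witt_mult_poly_def by (rule ex1_ghost[OF assms s])
  then show ?thesis using s by simp
qed

text \<open>Negation has polynomials of its own, since for \<open>p = 2\<close> it is not
  componentwise.\<close>

definition witt_neg_poly :: "nat \<Rightarrow> nat \<Rightarrow> (nat, int) mpoly"
  where "witt_neg_poly p = witt_solve p (\<lambda>n. - witt_poly p n mvar)"

lemma witt_poly_neg_poly:
  assumes "prime p"
  shows "witt_poly p n (witt_neg_poly p) = - witt_poly p n mvar"
  unfolding witt_neg_poly_def
proof (rule witt_poly_solve_mpoly[OF assms])
  fix n
  have "- witt_poly p (Suc n) mvar - ev (\<lambda>v. mvar v ^ p) (- witt_poly p n mvar :: (nat, int) mpoly)
      = (of_nat p ^ Suc n * (- mvar (Suc n)) :: (nat, int) mpoly)"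
    using witt_poly_var_step[of p n id] by (simp add: is_homD[OF is_hom_ev] del: power_Suc)
  then show "of_nat p ^ Suc n dvd (- witt_poly p (Suc n) mvar -
      ev (\<lambda>v. mvar v ^ p) (- witt_poly p n mvar :: (nat, int) mpoly) :: (nat, int) mpoly)"
    by (simp del: power_Suc)
qed

section \<open>The ring of Witt vectors\<close>

definition wadd :: "nat \<Rightarrow> (nat \<Rightarrow> 'a::comm_ring_1) \<Rightarrow> (nat \<Rightarrow> 'a) \<Rightarrow> nat \<Rightarrow> 'a"
  where "wadd p x y i = ev (case_sum x y) (witt_add_poly p i)"

definition wmul :: "nat \<Rightarrow> (nat \<Rightarrow> 'a::comm_ring_1) \<Rightarrow> (nat \<Rightarrow> 'a) \<Rightarrow> nat \<Rightarrow> 'a"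
  where "wmul p x y i = ev (case_sum x y) (witt_mult_poly p i)"

definition wneg :: "nat \<Rightarrow> (nat \<Rightarrow> 'a::comm_ring_1) \<Rightarrow> nat \<Rightarrow> 'a"
  where "wneg p x i = ev x (witt_neg_poly p i)"

definition wone :: "nat \<Rightarrow> 'a::comm_ring_1"
  where "wone i = (if i = 0 then 1 else 0)"

definition wteich :: "'a::comm_ring_1 \<Rightarrow> nat \<Rightarrow> 'a"
  where "wteich a i = (if i = 0 then a else 0)"

definition wver :: "(nat \<Rightarrow> 'a::comm_ring_1) \<Rightarrow> nat \<Rightarrow> 'a"
  where "wver x i = (case i of 0 \<Rightarrow> 0 | Suc j \<Rightarrow> x j)"

lemma hom_wops:
  assumes "is_hom h"
  shows "(\<lambda>i. h (wadd p x y i)) = wadd p (\<lambda>i. h (x i)) (\<lambda>i. h (y i))"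
    "(\<lambda>i. h (wmul p x y i)) = wmul p (\<lambda>i. h (x i)) (\<lambda>i. h (y i))"
    "(\<lambda>i. h (wneg p x i)) = wneg p (\<lambda>i. h (x i))"
    "(\<lambda>i. h (wone i)) = wone"
    "(\<lambda>i. h (wteich a i)) = wteich (h a)"
    "(\<lambda>i. h (wver x i)) = wver (\<lambda>i. h (x i))"
    "(\<lambda>i. h ((\<lambda>_. 0) i)) = (\<lambda>_. 0)"
proof -
  have cs: "(\<lambda>v. h (case_sum x y v)) = case_sum (\<lambda>i. h (x i)) (\<lambda>i. h (y i))"
    by (auto simp: fun_eq_iff split: sum.split)
  show "(\<lambda>i. h (wadd p x y i)) = wadd p (\<lambda>i. h (x i)) (\<lambda>i. h (y i))"
    "(\<lambda>i. h (wmul p x y i)) = wmul p (\<lambda>i. h (x i)) (\<lambda>i. h (y i))"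
    by (simp_all add: fun_eq_iff wadd_def wmul_def hom_ev[OF assms] cs)
qed (auto simp: fun_eq_iff wneg_def hom_ev[OF assms] wone_def wteich_def wver_def is_homD[OF assms] split: nat.split)

lemma ghost_wadd:
  assumes "prime p"
  shows "witt_poly p n (wadd p x y) = witt_poly p n x + witt_poly p n y"
proof -
  have "ev (case_sum x y) (witt_poly p n (witt_add_poly p)) = witt_poly p n x + witt_poly p n y"
    by (simp add: witt_poly_add_poly[OF assms] ev_add hom_witt_poly[OF is_hom_ev])
  then show ?thesis
    by (simp add: hom_witt_poly[OF is_hom_ev] wadd_def[abs_def])
qed

lemma ghost_wmul:
  assumes "prime p"
  shows "witt_poly p n (wmul p x y) = witt_poly p n x * witt_poly p n y"
proof -
  have "ev (case_sum x y) (witt_poly p n (witt_mult_poly p)) = witt_poly p n x * witt_poly p n y"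
    by (simp add: witt_poly_mult_poly[OF assms] ev_mult hom_witt_poly[OF is_hom_ev])
  then show ?thesis
    by (simp add: hom_witt_poly[OF is_hom_ev] wmul_def[abs_def])
qed

lemma ghost_wneg:
  assumes "prime p"
  shows "witt_poly p n (wneg p x) = - witt_poly p n x"
proof -
  have "ev x (witt_poly p n (witt_neg_poly p)) = - witt_poly p n x"
    by (simp add: witt_poly_neg_poly[OF assms] is_homD[OF is_hom_ev] hom_witt_poly[OF is_hom_ev])
  then show ?thesis
    by (simp add: hom_witt_poly[OF is_hom_ev] wneg_def[abs_def])
qed

lemma ghost_wteich: "p > 0 \<Longrightarrow> witt_poly p n (wteich a) = a ^ (p ^ n)"
proof -
  assume "p > 0"
  then have "witt_poly p n (wteich a) = (\<Sum>i\<in>{..n}. if i = 0 then a ^ (p ^ n) else 0)"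
    unfolding witt_poly_def by (intro sum.cong) (auto simp: wteich_def power_0_left)
  then show ?thesis by simp
qed

lemma ghost_wone: "p > 0 \<Longrightarrow> witt_poly p n wone = 1"
  using ghost_wteich[of p n 1] by (simp add: wteich_def[abs_def] wone_def[abs_def])

lemma ghost_zero: "p > 0 \<Longrightarrow> witt_poly p n (\<lambda>_. 0) = 0"
  by (simp add: witt_poly_def power_0_left)

lemma ghost_wver_0: "p > 0 \<Longrightarrow> witt_poly p 0 (wver x) = 0"
  by (simp add: witt_poly_def wver_def)

lemma ghost_wver_Suc: "p > 0 \<Longrightarrow> witt_poly p (Suc n) (wver x) = of_nat p * witt_poly p n x"
proof -
  assume p: "p > 0"
  have "witt_poly p (Suc n) (wver x) = (\<Sum>i\<in>insert 0 (Suc ` {..n}). of_nat p ^ i * wver x i ^ (p ^ (Suc n - i)))"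
    unfolding witt_poly_def by (intro sum.cong) (auto simp: image_iff gr0_conv_Suc atMost_Suc_eq_insert_0)
  also have "\<dots> = (\<Sum>i\<le>n. of_nat p ^ Suc i * x i ^ (p ^ (n - i)))"
    using p by (subst sum.insert) (auto simp: wver_def sum.reindex power_0_left)
  finally show ?thesis
    by (simp add: witt_poly_def sum_distrib_left mult.assoc)
qed

text \<open>Identities of Witt vectors are checked on ghost components over the torsion-free ring of
  integral polynomials whose variables are the elements of the given ring.\<close>

abbreviation lift_seq :: "(nat \<Rightarrow> 'a) \<Rightarrow> nat \<Rightarrow> ('a, int) mpoly"
  where "lift_seq x \<equiv> (\<lambda>i. mvar (x i))"

abbreviation ev_id :: "('a, int) mpoly \<Rightarrow> 'a::comm_ring_1"
  where "ev_id \<equiv> ev (\<lambda>a. a)"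

lemmas hom_ev_id_wops = hom_wops[OF is_hom_ev[of "\<lambda>a. a"]]

lemma ghost_transfer:
  fixes X Y :: "nat \<Rightarrow> ('a::comm_ring_1, int) mpoly"
  assumes "prime p" "\<And>n. witt_poly p n X = witt_poly p n Y"
  shows "(\<lambda>i. ev_id (X i)) = (\<lambda>i. ev_id (Y i))"
  using ghost_inject[OF torsion_free_mpoly_int[OF prime_gt_0_nat[OF assms(1)]] assms(2)] by simp

section \<open>Ring identities checked on ghost components\<close>

context
  fixes p :: nat
  assumes p: "prime p"
begin

lemmas ghosts = ghost_wadd[OF p] ghost_wmul[OF p] ghost_wneg[OF p] ghost_wone[OF prime_gt_0_nat[OF p]]
  ghost_zero[OF prime_gt_0_nat[OF p]] ghost_wteich[OF prime_gt_0_nat[OF p]]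

lemma wadd_assoc: "wadd p (wadd p x y) z = wadd p x (wadd p y z)"
  using ghost_transfer[OF p, of "wadd p (wadd p (lift_seq x) (lift_seq y)) (lift_seq z)"
      "wadd p (lift_seq x) (wadd p (lift_seq y) (lift_seq z))"]
  by (simp add: hom_ev_id_wops ghosts)

lemma wadd_commute: "wadd p x y = wadd p y x"
  using ghost_transfer[OF p, of "wadd p (lift_seq x) (lift_seq y)" "wadd p (lift_seq y) (lift_seq x)"]
  by (simp add: hom_ev_id_wops ghosts)

lemma wadd_0: "wadd p (\<lambda>_. 0) x = x"
  using ghost_transfer[OF p, of "wadd p (\<lambda>_. 0) (lift_seq x)" "lift_seq x"]
  by (simp add: hom_ev_id_wops ghosts)

lemma wadd_neg: "wadd p (wneg p x) x = (\<lambda>_. 0)"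
  using ghost_transfer[OF p, of "wadd p (wneg p (lift_seq x)) (lift_seq x)" "\<lambda>_. 0"]
  by (simp add: hom_ev_id_wops ghosts)

lemma wmul_assoc: "wmul p (wmul p x y) z = wmul p x (wmul p y z)"
  using ghost_transfer[OF p, of "wmul p (wmul p (lift_seq x) (lift_seq y)) (lift_seq z)"
      "wmul p (lift_seq x) (wmul p (lift_seq y) (lift_seq z))"]
  by (simp add: hom_ev_id_wops ghosts mult.assoc)

lemma wmul_commute: "wmul p x y = wmul p y x"
  using ghost_transfer[OF p, of "wmul p (lift_seq x) (lift_seq y)" "wmul p (lift_seq y) (lift_seq x)"]
  by (simp add: hom_ev_id_wops ghosts)

lemma wmul_1: "wmul p wone x = x"
  using ghost_transfer[OF p, of "wmul p wone (lift_seq x)" "lift_seq x"]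
  by (simp add: hom_ev_id_wops ghosts)

lemma wmul_distrib: "wmul p (wadd p x y) z = wadd p (wmul p x z) (wmul p y z)"
  using ghost_transfer[OF p, of "wmul p (wadd p (lift_seq x) (lift_seq y)) (lift_seq z)"
      "wadd p (wmul p (lift_seq x) (lift_seq z)) (wmul p (lift_seq y) (lift_seq z))"]
  by (simp add: hom_ev_id_wops ghosts distrib_right)

lemma wver_wadd: "wver (wadd p x y) = wadd p (wver x) (wver y)"
proof -
  have "witt_poly p n (wver (wadd p (lift_seq x) (lift_seq y))) =
      witt_poly p n (wadd p (wver (lift_seq x)) (wver (lift_seq y)))" for n
    by (cases n) (simp_all add: ghosts ghost_wver_0 ghost_wver_Suc prime_gt_0_nat[OF p] distrib_left)
  from ghost_transfer[OF p this] show ?thesis by (simp add: hom_ev_id_wops)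
qed

lemma wmul_teich_teich: "wmul p (wteich a) (wteich b) = wteich (a * b)"
proof -
  have "witt_poly p n (wmul p (wteich (mvar a)) (wteich (mvar b))) =
      witt_poly p n (wteich (mvar a * mvar b) :: nat \<Rightarrow> ('a, int) mpoly)" for n
    by (simp add: ghosts power_mult_distrib)
  from ghost_transfer[OF p this] show ?thesis by (simp add: hom_ev_id_wops ev_mult)
qed

text \<open>The \<open>n\<close>-th ghost component of the right-hand side is \<open>a^(p^n)\<close>
  times that of \<open>x\<close>, because \<open>(a^(p^i))^(p^(n-i))\<close> is independent of
  \<open>i\<close>. This scaling later clears denominators.\<close>

lemma wmul_teich: "wmul p (wteich a) x = (\<lambda>i. a ^ (p ^ i) * x i)"
proof -
  have "witt_poly p n (wmul p (wteich (mvar a)) (lift_seq x)) =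
      witt_poly p n (\<lambda>i. mvar a ^ (p ^ i) * mvar (x i) :: ('a, int) mpoly)" for n
  proof -
    have "(mvar a ^ (p ^ i) * mvar (x i)) ^ (p ^ (n - i)) = mvar a ^ (p ^ n) * (mvar (x i) :: ('a, int) mpoly) ^ (p ^ (n - i))"
      if "i \<le> n" for i
      using that by (simp add: power_mult_distrib flip: power_mult power_add)
    then have "witt_poly p n (\<lambda>i. mvar a ^ (p ^ i) * mvar (x i) :: ('a, int) mpoly) =
        (\<Sum>i\<le>n. mvar a ^ (p ^ n) * (of_nat p ^ i * mvar (x i) ^ (p ^ (n - i))))"
      unfolding witt_poly_def by (intro sum.cong) (simp_all add: mult.left_commute)
    also have "\<dots> = mvar a ^ (p ^ n) * witt_poly p n (lift_seq x)"
      by (simp add: witt_poly_def sum_distrib_left)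
    finally show ?thesis by (simp add: ghosts)
  qed
  from ghost_transfer[OF p this] show ?thesis
    by (simp add: hom_ev_id_wops ev_mult is_homD[OF is_hom_ev])
qed

lemma wdecomp: "wadd p (wteich (x 0)) (wver (\<lambda>i. x (Suc i))) = x"
proof -
  have "witt_poly p n (wadd p (wteich (mvar (x 0))) (wver (lift_seq (\<lambda>i. x (Suc i))))) =
      witt_poly p n (lift_seq x)" for n
  proof (cases n)
    case 0
    then show ?thesis
      by (simp add: ghosts ghost_wver_0 prime_gt_0_nat[OF p]) (simp add: witt_poly_def)
  next
    case (Suc k)
    have "witt_poly p (Suc k) (lift_seq x) = (\<Sum>i\<in>insert 0 (Suc ` {..k}). of_nat p ^ i * mvar (x i) ^ (p ^ (Suc k - i)))"
      unfolding witt_poly_def by (intro sum.cong) (auto simp: atMost_Suc_eq_insert_0)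
    also have "\<dots> = mvar (x 0) ^ (p ^ Suc k) + (\<Sum>i\<le>k. of_nat p ^ Suc i * mvar (x (Suc i)) ^ (p ^ (k - i)))"
      by (subst sum.insert) (auto simp: sum.reindex)
    finally show ?thesis
      using Suc by (simp add: ghosts ghost_wver_Suc prime_gt_0_nat[OF p])
        (simp add: witt_poly_def sum_distrib_left mult.assoc)
  qed
  from ghost_transfer[OF p this] show ?thesis by (simp add: hom_ev_id_wops)
qed

lemma wadd_nth_0: "wadd p x y 0 = x 0 + y 0"
  using ghost_wadd[OF p, of 0 x y] by (simp add: witt_poly_def)

lemma wmul_nth_0: "wmul p x y 0 = x 0 * y 0"
  using ghost_wmul[OF p, of 0 x y] by (simp add: witt_poly_def)

definition wnmul :: "nat \<Rightarrow> (nat \<Rightarrow> 'a::comm_ring_1) \<Rightarrow> nat \<Rightarrow> 'a"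
  where "wnmul n x = (wadd p x ^^ n) (\<lambda>_. 0)"

text \<open>Multiplication by \<open>p\<close> agrees with \<open>V F\<close> up to components divisible by \<open>p\<close>.\<close>

lemma wnmul_p:
  fixes x :: "nat \<Rightarrow> 'a::comm_ring_1"
  assumes "of_nat p = (0 :: 'a)"
  shows "wnmul p x = wver (\<lambda>i. x i ^ p)"
proof -
  let ?X = "lift_seq x"
  have g: "witt_poly p n (wnmul k ?X) = of_nat k * witt_poly p n ?X" for n k
    by (induction k) (simp_all add: wnmul_def ghosts distrib_right)
  have h: "(\<lambda>i. ev_id (wnmul k ?X i)) = wnmul k x" for k
    by (induction k) (simp_all add: wnmul_def hom_ev_id_wops)
  have "of_nat p ^ Suc n dvd witt_poly p n (wnmul p ?X) - witt_poly p n (wver (\<lambda>i. ?X i ^ p))" for n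
  proof (cases n)
    case 0
    then show ?thesis
      by (simp add: g ghost_wver_0 prime_gt_0_nat[OF p])
  next
    case (Suc k)
    have "of_nat p * (\<Sum>i\<le>k. of_nat p ^ i * ?X i ^ (p ^ (Suc k - i))) = of_nat p * witt_poly p k (\<lambda>i. ?X i ^ p)"
      unfolding witt_poly_def by (intro arg_cong[where f = "(*) _"] sum.cong)
        (simp_all add: Suc_diff_le flip: power_mult)
    moreover have "witt_poly p n (wnmul p ?X) - witt_poly p n (wver (\<lambda>i. ?X i ^ p)) =
        of_nat p * witt_poly p (Suc k) ?X - of_nat p * witt_poly p k (\<lambda>i. ?X i ^ p)"
      by (simp add: Suc g ghost_wver_Suc prime_gt_0_nat[OF p])
    ultimately have "witt_poly p n (wnmul p ?X) - witt_poly p n (wver (\<lambda>i. ?X i ^ p)) = of_nat p ^ Suc n * ?X n"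
      by (simp add: Suc witt_poly_Suc algebra_simps)
    then show ?thesis by simp
  qed
  then have d: "of_nat p dvd wnmul p ?X i - wver (\<lambda>i. ?X i ^ p) i" for i
    by (rule ghost_cong[OF torsion_free_mpoly_int[OF prime_gt_0_nat[OF p]]])
  have "ev_id (wnmul p ?X i) = ev_id (wver (\<lambda>i. ?X i ^ p) i)" for i
  proof -
    obtain c where "wnmul p ?X i - wver (\<lambda>i. ?X i ^ p) i = of_nat p * c"
      using d[of i] by (auto simp: dvd_def)
    then have "ev_id (wnmul p ?X i - wver (\<lambda>i. ?X i ^ p) i) = ev_id (of_nat p * c)"
      by (rule arg_cong)
    then show ?thesis by (simp add: assms is_homD[OF is_hom_ev])
  qed
  then have "(\<lambda>i. ev_id (wnmul p ?X i)) = (\<lambda>i. ev_id (wver (\<lambda>i. ?X i ^ p) i))" by simp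
  then show ?thesis
    unfolding h hom_ev_id_wops by (simp add: is_homD[OF is_hom_ev])
qed

end

section \<open>The type of untruncated Witt vectors\<close>

text \<open>The prime is the characteristic if that is prime; otherwise it is irrelevant, and the value 2
  makes the ring axioms hold unconditionally.\<close>

definition witt_prime :: "'a::comm_ring_1 itself \<Rightarrow> nat"
  where "witt_prime _ = (if prime CHAR('a) then CHAR('a) else 2)"

lemma prime_witt_prime: "prime (witt_prime TYPE('a::comm_ring_1))"
  by (simp add: witt_prime_def two_is_prime_nat)

lemma witt_prime_nonzero [simp]: "witt_prime TYPE('a::comm_ring_1) \<noteq> 0"
  using prime_witt_prime[where ?'a = 'a] by auto

text \<open>Infinite length makes \<open>V\<close> injective and, over the polynomial ring,
  multiplication by \<open>p\<close> as well; in finite length both fail. Truncation returns through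
  \<open>E_local\<close> and through restriction to indices below \<open>n\<close>.\<close>

typedef (overloaded) 'a witt = "UNIV :: (nat \<Rightarrow> 'a::comm_ring_1) set"
  morphisms wnth Witt by simp

declare Witt_inverse[OF UNIV_I, simp] wnth_inverse [simp]

lemma witt_eqI: "wnth x = wnth y \<Longrightarrow> x = y"
  by (simp add: wnth_inject)

instantiation witt :: (comm_ring_1) comm_ring_1
begin

definition "0 = Witt (\<lambda>_. 0)"
definition "1 = Witt wone"
definition "x + y = Witt (wadd (witt_prime TYPE('a)) (wnth x) (wnth y))"
definition "x * y = Witt (wmul (witt_prime TYPE('a)) (wnth x) (wnth y))"
definition "- x = Witt (wneg (witt_prime TYPE('a)) (wnth x))"
definition "x - y = x + (- y :: 'a witt)"

instance
proof
  fix x y z :: "'a witt"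
  note d = plus_witt_def times_witt_def uminus_witt_def minus_witt_def zero_witt_def one_witt_def
  note p = prime_witt_prime[where ?'a = 'a]
  show "x + y + z = x + (y + z)" by (simp add: d wadd_assoc[OF p])
  show "x + y = y + x" by (simp add: d wadd_commute[OF p, of "wnth x"])
  show "0 + x = x" by (simp add: d wadd_0[OF p])
  show "- x + x = 0" by (simp add: d wadd_neg[OF p])
  show "x - y = x + - y" by (simp add: d)
  show "x * y * z = x * (y * z)" by (simp add: d wmul_assoc[OF p])
  show "x * y = y * x" by (simp add: d wmul_commute[OF p, of "wnth x"])
  show "1 * x = x" by (simp add: d wmul_1[OF p])
  show "(x + y) * z = x * z + y * z" by (simp add: d wmul_distrib[OF p])
  show "(0 :: 'a witt) \<noteq> 1"
    by (simp add: d Witt_inject fun_eq_iff wone_def)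
qed

end

definition teich :: "'a::comm_ring_1 \<Rightarrow> 'a witt" where "teich a = Witt (wteich a)"
definition ver :: "'a::comm_ring_1 witt \<Rightarrow> 'a witt" where "ver x = Witt (wver (wnth x))"
definition shift :: "'a::comm_ring_1 witt \<Rightarrow> 'a witt" where "shift x = Witt (\<lambda>i. wnth x (Suc i))"
definition wfrob :: "'a::comm_ring_1 witt \<Rightarrow> 'a witt"
  where "wfrob x = Witt (\<lambda>i. wnth x i ^ witt_prime TYPE('a))"

lemma wnth_simps [simp]:
  "wnth 0 i = 0" "wnth 1 0 = 1" "wnth (x + y) 0 = wnth x 0 + wnth y 0" "wnth (x * y) 0 = wnth x 0 * wnth y 0"
  "wnth (teich a) 0 = a" "wnth (teich a) (Suc i) = 0" "wnth (ver x) 0 = 0" "wnth (ver x) (Suc i) = wnth x i"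
  "wnth (shift x) i = wnth x (Suc i)" "wnth (teich a * x) i = a ^ (witt_prime TYPE('a) ^ i) * wnth x i"
  "wnth (wfrob y) i = wnth y i ^ witt_prime TYPE('a)"
  for x y :: "'a::comm_ring_1 witt"
  by (simp_all add: zero_witt_def one_witt_def plus_witt_def times_witt_def teich_def ver_def shift_def
      wone_def wteich_def wver_def wfrob_def wmul_teich wadd_nth_0 wmul_nth_0 prime_witt_prime)

lemma is_hom_wnth_0: "is_hom (\<lambda>x. wnth x 0)"
  by (simp add: is_hom_def)

lemmas wnth_0_hom = is_homD[OF is_hom_wnth_0]

lemma witt_decomp: "x = teich (wnth x 0) + ver (shift x)"
  by (rule witt_eqI) (simp add: plus_witt_def teich_def ver_def shift_def wdecomp[OF prime_witt_prime])

lemma ver_add: "ver (x + y) = ver x + ver y"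
  by (simp add: plus_witt_def ver_def wver_wadd[OF prime_witt_prime])

lemma teich_mult: "teich (a * b) = teich a * teich b"
  by (simp add: times_witt_def teich_def wmul_teich_teich[OF prime_witt_prime])

lemma teich_1 [simp]: "teich 1 = 1"
  by (simp add: teich_def one_witt_def wteich_def[abs_def] wone_def[abs_def])

lemma teich_0 [simp]: "teich 0 = 0"
  by (simp add: teich_def zero_witt_def wteich_def[abs_def])

lemma teich_power: "teich (a ^ n) = teich a ^ n"
  by (induction n) (simp_all add: teich_mult)

lemma ver_0 [simp]: "ver 0 = 0"
  using ver_add[of 0 0] by simp

lemma shift_ver [simp]: "shift (ver x) = x"
  by (rule witt_eqI) (simp add: fun_eq_iff)

lemma ver_inject [simp]: "ver x = ver y \<longleftrightarrow> x = y"
  by (metis shift_ver)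

lemma wnth_0_eq_0: "wnth x 0 = 0 \<Longrightarrow> ver (shift x) = x"
  using witt_decomp[of x] by simp

lemma wnth_of_hom:
  assumes "is_hom (h :: 'a::comm_ring_1 \<Rightarrow> 'a)"
  shows "is_hom (\<lambda>x. Witt (\<lambda>i. h (wnth x i)))"
  unfolding is_hom_def one_witt_def plus_witt_def times_witt_def
  by (simp add: hom_wops[OF assms])

lemma ver_wfrob: "ver (wfrob x) = wfrob (ver (x :: 'a::comm_ring_1 witt))"
  by (rule witt_eqI)
    (auto simp: fun_eq_iff ver_def wfrob_def wver_def prime_gt_0_nat[OF prime_witt_prime] power_0_left split: nat.split)

lemma wfrob_teich: "wfrob (teich a) = teich (a :: 'a::comm_ring_1) ^ witt_prime TYPE('a)"
  unfolding teich_power[symmetric]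
  by (rule witt_eqI) (auto simp: fun_eq_iff teich_def wfrob_def wteich_def prime_gt_0_nat[OF prime_witt_prime] power_0_left)

lemma of_nat_witt:
  fixes x :: "'a::comm_ring_1 witt"
  shows "of_nat n * x = Witt (wnmul (witt_prime TYPE('a)) n (wnth x))"
proof (induction n)
  case (Suc n)
  have "of_nat (Suc n) * x = x + of_nat n * x"
    by (simp add: distrib_right)
  then show ?case
    unfolding Suc by (simp add: plus_witt_def wnmul_def[OF prime_witt_prime])
qed (simp add: wnmul_def[OF prime_witt_prime] zero_witt_def[symmetric])

context
  assumes "prime CHAR('a::comm_ring_1)"
begin

lemma witt_prime_CHAR: "witt_prime TYPE('a) = CHAR('a)"
  using \<open>prime CHAR('a)\<close> by (simp add: witt_prime_def)

lemma is_hom_wfrob: "is_hom (wfrob :: 'a witt \<Rightarrow> 'a witt)"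
proof -
  have "is_hom (\<lambda>a :: 'a. a ^ CHAR('a))"
    using \<open>prime CHAR('a)\<close> by (simp add: is_hom_def freshmans_dream power_mult_distrib)
  from wnth_of_hom[OF this] show ?thesis
    by (simp add: wfrob_def[abs_def] witt_prime_CHAR)
qed

lemma p_eq_ver_wfrob: "of_nat CHAR('a) * x = ver (wfrob (x :: 'a witt))"
  unfolding of_nat_witt witt_prime_CHAR
  by (simp add: wnmul_p \<open>prime CHAR('a)\<close> ver_def wfrob_def witt_prime_CHAR)

end

section \<open>A section of the Witt vectors that is a ring homomorphism modulo \<open>p\<close>\<close>

definition hdz :: "'a::zero list \<Rightarrow> 'a"
  where "hdz gs = (case gs of [] \<Rightarrow> 0 | g # _ \<Rightarrow> g)"

lemma hdz_simps [simp]: "hdz [] = 0" "hdz (g # gs) = g"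
  by (simp_all add: hdz_def)

text \<open>Every term is lifted together with its coefficient. That coefficients add up modulo
  \<open>p\<close> is where perfectness enters, see \<open>teich_const_add\<close>.\<close>

definition sec :: "('v, 'k::comm_ring_1) mpoly \<Rightarrow> ('v, 'k) mpoly witt"
  where "sec a = (\<Sum>m\<in>Poly_Mapping.keys a. teich (Poly_Mapping.single m (Poly_Mapping.lookup a m)))"

text \<open>The tail of \<open>w\<close> after its zeroth component has been split off through
  \<open>sec\<close>, in contrast to \<open>shift\<close>, which belongs to the Teichmueller
  decomposition. Iteration yields the expansion into terms \<open>V^i (sec a_i)\<close>.\<close>

definition red :: "('v, 'k::comm_ring_1) mpoly witt \<Rightarrow> ('v, 'k) mpoly witt"
  where "red w = shift (w - sec (wnth w 0))"

lemma sec_superset: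
  assumes "finite K" "Poly_Mapping.keys a \<subseteq> K"
  shows "sec a = (\<Sum>m\<in>K. teich (Poly_Mapping.single m (Poly_Mapping.lookup a m)))"
  unfolding sec_def using assms by (intro sum.mono_neutral_left) (auto simp: in_keys_iff)

lemma sec_0 [simp]: "sec 0 = 0"
  by (simp add: sec_def)

lemma sec_single: "sec (Poly_Mapping.single m c) = teich (Poly_Mapping.single m c)"
  by (cases "c = 0") (simp_all add: sec_def)

lemma sec_1 [simp]: "sec 1 = 1"
  using sec_single[of 0 1] by simp

lemma wnth_sec_0 [simp]: "wnth (sec a) 0 = a"
  by (simp add: sec_def wnth_0_hom poly_mapping_expand[symmetric])

lemma sec_red: "w = sec (wnth w 0) + ver (red w)"
proof -
  have "ver (shift (w - sec (wnth w 0))) = w - sec (wnth w 0)"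
    by (rule wnth_0_eq_0) (simp add: wnth_0_hom)
  then show ?thesis by (simp add: red_def)
qed

lemma redI: "w = sec (wnth w 0) + ver x \<Longrightarrow> red w = x"
  by (metis add_diff_cancel_left' red_def shift_ver)

lemma red_sec [simp]: "red (sec a) = 0"
  by (rule redI) simp

lemma red_0 [simp]: "red 0 = 0"
  using red_sec[of 0] by simp

lemma red_ver [simp]: "red (ver x) = x"
  by (rule redI) simp

section \<open>Frobenius, Verschiebung and congruences modulo \<open>p\<close>\<close>

context perfect_char
begin

lemma prime_char_mpoly: "prime CHAR(('v, 'k) mpoly)"
  by (simp add: char_mpoly prime)

lemma witt_prime_mpoly [simp]: "witt_prime TYPE(('v, 'k) mpoly) = p"
  using witt_prime_CHAR[OF prime_char_mpoly[where ?'v = 'v]] by (simp add: char_mpoly)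

lemmas F_hom = is_homD[OF is_hom_wfrob[OF prime_char_mpoly]]

lemma p_VF: "of_nat p * x = ver (wfrob (x :: ('v, 'k) mpoly witt))"
  using p_eq_ver_wfrob[OF prime_char_mpoly, of x] by (simp add: char_mpoly)

lemma FV: "wfrob (ver x) = of_nat p * (x :: ('v, 'k) mpoly witt)"
  by (simp add: p_VF ver_wfrob)

lemma F_teich: "wfrob (teich a) = teich (a :: ('v, 'k) mpoly) ^ p"
  using wfrob_teich[of a] by simp

lemma F_eq_0: "wfrob x = 0 \<Longrightarrow> (x :: ('v::finite, 'k) mpoly witt) = 0"
proof -
  assume "wfrob x = 0"
  then have "wnth x i ^ p = 0" for i
    by (metis wnth_simps(1) wnth_simps(11) witt_prime_mpoly)
  then have "wnth x i = 0" for i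
    using mpoly_power_eq_0 by blast
  then show "x = 0" by (intro witt_eqI) auto
qed

lemma F_inject: "wfrob x = wfrob y \<Longrightarrow> x = (y :: ('v::finite, 'k) mpoly witt)"
  using F_eq_0[of "x - y"] by (simp add: F_hom)

text \<open>Multiplication by \<open>p\<close> is \<open>V F\<close>, and both factors are
  injective, \<open>F\<close> because the polynomial ring is reduced. Hence identities in
  \<open>W(S)\<close> may be divided by \<open>p\<close>.\<close>

lemma p_mult_eq_0: "of_nat p * x = 0 \<Longrightarrow> x = (0 :: ('v::finite, 'k) mpoly witt)"
  unfolding p_VF by (metis F_eq_0 ver_0 ver_inject)

lemma p_mult_cancel: "of_nat p * x = of_nat p * y \<Longrightarrow> x = (y :: ('v::finite, 'k) mpoly witt)"
  using p_mult_eq_0[of "x - y"] by (simp add: right_diff_distrib)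

text \<open>Checked after applying the injective map \<open>F\<close>, under which \<open>V\<close>
  becomes multiplication by \<open>p\<close>.\<close>

lemma ver_proj: "ver x * y = ver (x * wfrob (y :: ('v::finite, 'k) mpoly witt))"
  by (rule F_inject) (simp add: F_hom FV mult.assoc)

abbreviation cg :: "('v, 'k) mpoly witt \<Rightarrow> ('v, 'k) mpoly witt \<Rightarrow> bool"
  where "cg x y \<equiv> of_nat p dvd x - y"

lemma cg_refl: "cg x x"
  by simp

lemma cg_sym: "cg x y \<Longrightarrow> cg y x"
  by (metis dvd_minus_iff minus_diff_eq)

lemma cg_trans: "cg x y \<Longrightarrow> cg y z \<Longrightarrow> cg x z"
  using dvd_add[of "of_nat p" "x - y" "y - z"] by simp

lemma cg_add: "cg x y \<Longrightarrow> cg x' y' \<Longrightarrow> cg (x + x') (y + y')"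
  using dvd_add[of "of_nat p" "x - y" "x' - y'"] by (simp add: algebra_simps)

lemma cg_mult: "cg x y \<Longrightarrow> cg x' y' \<Longrightarrow> cg (x * x') (y * y')"
proof -
  assume a: "cg x y" "cg x' y'"
  have "x * x' - y * y' = (x - y) * x' + y * (x' - y')"
    by (simp add: algebra_simps)
  then show ?thesis using a by (simp only:) (intro dvd_add dvd_mult dvd_mult2)
qed

lemma cg_sum: "(\<And>i. i \<in> A \<Longrightarrow> cg (g i) (h i)) \<Longrightarrow> cg (\<Sum>i\<in>A. g i) (\<Sum>i\<in>A. h i)"
  by (simp add: sum_subtractf[symmetric] dvd_sum)

text \<open>The difference comes from a Witt vector over \<open>k\<close>. Its zeroth component is 0
  and, \<open>k\<close> being perfect, its other components are \<open>p\<close>-th powers, so it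
  has the form \<open>V (F z) = p z\<close>. In other words, \<open>W(k) / p = k\<close>.\<close>

lemma teich_const_add:
  "cg (teich (Poly_Mapping.single 0 (c + d))) (teich (Poly_Mapping.single 0 c) + teich (Poly_Mapping.single 0 d) :: ('v, 'k) mpoly witt)"
proof -
  let ?\<kappa> = "Poly_Mapping.single 0 :: 'k \<Rightarrow> ('v, 'k) mpoly"
  have h: "is_hom ?\<kappa>"
    by (simp add: is_hom_def single_add mult_single)
  note hw = hom_wops[OF h, symmetric]
  define t where "t = wadd p (wteich (c + d)) (wneg p (wadd p (wteich c) (wteich d)))"
  have T: "teich (?\<kappa> (c + d)) - (teich (?\<kappa> c) + teich (?\<kappa> d)) = Witt (\<lambda>i. ?\<kappa> (t i))" (is "?T = _")
    by (simp add: teich_def plus_witt_def minus_witt_def uminus_witt_def hw t_def)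
  have "\<forall>i. \<exists>r. t i = r ^ p"
    using perfect unfolding surj_def by blast
  then obtain r where r: "\<And>i. t i = r i ^ p"
    by (auto dest: choice)
  have "wnth ?T 0 = 0"
    by (simp add: wnth_0_hom single_add)
  then have "?T = ver (shift ?T)" by (simp add: wnth_0_eq_0)
  moreover have "shift ?T = wfrob (Witt (\<lambda>i. ?\<kappa> (r (Suc i))))"
    unfolding T by (rule witt_eqI) (simp add: fun_eq_iff shift_def wfrob_def r is_homD[OF h])
  ultimately show ?thesis
    by (metis dvd_triv_left p_VF)
qed

lemma sec_add: "cg (sec (a + b)) (sec a + sec b)"
proof -
  let ?K = "Poly_Mapping.keys a \<union> Poly_Mapping.keys b"
  have "cg (teich (Poly_Mapping.single m (c + d))) (teich (Poly_Mapping.single m c) + teich (Poly_Mapping.single m d))"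
    for m c d
    using cg_mult[OF cg_refl teich_const_add, of "teich (Poly_Mapping.single m 1)" c d]
    by (simp add: distrib_left teich_mult[symmetric] mult_single)
  then have "cg (\<Sum>m\<in>?K. teich (Poly_Mapping.single m (Poly_Mapping.lookup (a + b) m)))
      (\<Sum>m\<in>?K. teich (Poly_Mapping.single m (Poly_Mapping.lookup a m)) + teich (Poly_Mapping.single m (Poly_Mapping.lookup b m)))"
    by (intro cg_sum) (simp add: lookup_add)
  then show ?thesis
    using keys_add[of a b] by (simp add: sec_superset[of ?K] sum.distrib)
qed

lemma sec_sum: "cg (sec (\<Sum>i\<in>A. g i)) (\<Sum>i\<in>A. sec (g i))"
proof (induction A rule: infinite_finite_induct)
  case (insert i A)
  then show ?case
    using cg_trans[OF sec_add cg_add[OF cg_refl insert.IH]] by simp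
qed simp_all

lemma sec_mult: "cg (sec (a * b)) (sec a * sec b)"
proof (induction a rule: poly_mapping_sum_induct)
  case (single m c)
  show ?case
  proof (induction b rule: poly_mapping_sum_induct)
    case (single n d)
    then show ?case by (simp add: mult_single sec_single teich_mult[symmetric])
  next
    case (add a b)
    then show ?case
      unfolding distrib_left
      by (rule cg_trans[OF sec_add cg_trans[OF cg_add]])
        (use cg_sym[OF cg_mult[OF cg_refl sec_add]] in \<open>simp add: distrib_left\<close>)
  qed simp
next
  case (add a b')
  then show ?case
    unfolding distrib_right
    by (rule cg_trans[OF sec_add cg_trans[OF cg_add]])
      (use cg_sym[OF cg_mult[OF sec_add cg_refl]] in \<open>simp add: distrib_right\<close>)
qed simp

lemma cg_F: "cg x y \<Longrightarrow> cg (wfrob x) (wfrob y)"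
  by (metis F_hom(3) F_hom(6) F_hom(8) dvdE dvd_triv_left)

text \<open>Both sides are additive modulo \<open>p\<close>, and on the lift of a single term
  \<open>F\<close> is the \<open>p\<close>-th power.\<close>

lemma sec_frob: "cg (wfrob (sec a)) (sec (a ^ p))"
proof (induction a rule: poly_mapping_sum_induct)
  case zero
  then show ?case by (simp add: F_hom power_0_left)
next
  case (single m c)
  then show ?case by (simp add: single_power sec_single F_teich teich_power[symmetric])
next
  case (add a b)
  have "cg (wfrob (sec (a + b))) (wfrob (sec a) + wfrob (sec b))"
    using cg_F[OF sec_add] by (simp add: F_hom)
  moreover have "cg (wfrob (sec a) + wfrob (sec b)) (sec (a ^ p) + sec (b ^ p))"
    by (intro cg_add add)
  moreover have "cg (sec (a ^ p) + sec (b ^ p)) (sec ((a + b) ^ p))"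
    using cg_sym[OF sec_add, of "a ^ p" "b ^ p"] frob_add[of a b 1] by simp
  ultimately show ?case using cg_trans by blast
qed

section \<open>Homomorphisms from Witt vectors modulo \<open>p\<close>\<close>

text \<open>\<open>uq p (E [g\<^sub>1, \<dots>, g\<^sub>n] w)\<close> is the homomorphism \<open>F\<^sub>* W\<^sub>n S / p \<rightarrow> S\<close> with coordinates \<open>g\<^sub>i\<close> with respect
  to the expansion of \<open>w\<close> as the sum of \<open>ver ^ i (sec a\<^sub>i)\<close>; well-definedness modulo \<open>p\<close> means
  \<open>u (g\<^sub>i) = 0\<close> for \<open>i \<ge> 2\<close>.\<close>

fun E :: "('v::finite, 'k) mpoly list \<Rightarrow> ('v, 'k) mpoly witt \<Rightarrow> ('v, 'k) mpoly" where
  "E [] w = 0"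
| "E (g # gs) w = g * wnth w 0 + uq p (E gs (red w))"

definition ok :: "('v::finite, 'k) mpoly list \<Rightarrow> bool"
  where "ok gs \<longleftrightarrow> (\<forall>g\<in>set gs. uq p g = 0)"

lemma ok_simps [simp]: "ok []" "ok (g # gs) \<longleftrightarrow> uq p g = 0 \<and> ok gs"
  by (simp_all add: ok_def)

lemma ok_tl: "ok gs \<Longrightarrow> ok (tl gs)"
  by (cases gs) auto

lemma ok_drop: "ok gs \<Longrightarrow> ok (drop j gs)"
  by (meson in_set_dropD ok_def)

lemma ok_hdz: "ok gs \<Longrightarrow> uq p (hdz gs) = 0"
  by (cases gs) auto

lemma cgE:
  assumes "cg x y"
  obtains z where "x = y + of_nat p * z"
  using assms by (metis add.commute diff_add_cancel dvdE)

text \<open>The defect of additivity of \<open>sec\<close> is \<open>p z = V (F z)\<close>; taking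
  off the outer \<open>V\<close> leaves a Frobenius image. For \<open>ok\<close> coordinates such
  images vanish under \<open>E\<close> followed by \<open>uq p\<close>.\<close>

lemma red_add: "\<exists>z. red (x + y) = red x + red y + wfrob (z :: ('v::finite, 'k) mpoly witt)"
proof -
  let ?a = "wnth x 0" and ?b = "wnth y 0"
  obtain z where z: "sec ?a + sec ?b = sec (?a + ?b) + of_nat p * z"
    using cg_sym[OF sec_add] by (rule cgE)
  have "x + y = (sec ?a + sec ?b) + ver (red x + red y)"
    by (subst sec_red[of x], subst sec_red[of y]) (simp add: ver_add)
  also have "\<dots> = sec (wnth (x + y) 0) + ver (red x + red y + wfrob z)"
    unfolding z p_VF by (simp add: ver_add)
  finally show ?thesis by (blast intro: redI)
qed

lemma red_F: "\<exists>z. red (wfrob x) = wfrob (z :: ('v::finite, 'k) mpoly witt)"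
proof -
  obtain z where z: "wfrob (sec (wnth x 0)) = sec (wnth x 0 ^ p) + of_nat p * z"
    using sec_frob by (rule cgE)
  have "wfrob x = wfrob (sec (wnth x 0)) + wfrob (ver (red x))"
    by (subst sec_red[of x]) (simp add: F_hom)
  also have "\<dots> = sec (wnth (wfrob x) 0) + ver (wfrob (z + red x))"
    unfolding z FV p_VF by (simp add: ver_add F_hom)
  finally show ?thesis by (blast intro: redI)
qed

text \<open>The claims are proved together: additivity fails by Frobenius images, see
  \<open>red_add\<close>, and these are killed by the second claim one level down. The second claim
  itself descends through \<open>red_F\<close> and uses \<open>uq p g = 0\<close> at the
  head.\<close>

lemma E_add_F:
  assumes "ok gs"
  shows "(\<forall>x y. E gs (x + y) = E gs x + E gs y) \<and> (\<forall>x. uq p (E gs (wfrob x)) = 0)"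
  using assms
proof (induction gs)
  case (Cons g gs)
  then have add: "E gs (x + y) = E gs x + E gs y" and F: "uq p (E gs (wfrob x)) = 0" for x y
    by auto
  have "E (g # gs) (x + y) = E (g # gs) x + E (g # gs) y" for x y
  proof -
    obtain z where "red (x + y) = red x + red y + wfrob z" using red_add by blast
    then show ?thesis by (simp add: add uq_p_add F distrib_left)
  qed
  moreover have "uq p (E (g # gs) (wfrob x)) = 0" for x
  proof -
    obtain z where "red (wfrob x) = wfrob z" using red_F by blast
    then have "uq p (E (g # gs) (wfrob x)) = uq p (wnth x 0 ^ p * g)"
      by (simp add: F mult.commute)
    then show ?thesis using Cons.prems by (simp add: uq_p_frob_mult)
  qed
  ultimately show ?case by blast
qed simp

lemma uq_E_F: "ok gs \<Longrightarrow> uq p (E gs (wfrob x)) = 0"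
  using E_add_F by blast

text \<open>The head coordinate enters without a \<open>u\<close> in front, so the condition
  concerns the tail. This freedom is what allows \<open>u\<close> of the head to be a unit.\<close>

lemma E_add:
  assumes "ok (tl gs)"
  shows "E gs (x + y) = E gs x + E gs y"
proof (cases gs)
  case (Cons g hs)
  then have "ok hs" using assms by simp
  obtain z where "red (x + y) = red x + red y + wfrob z" using red_add by blast
  then show ?thesis
    using E_add_F[OF \<open>ok hs\<close>] by (simp add: Cons uq_p_add distrib_left)
qed simp

lemma E_0 [simp]: "E gs 0 = 0"
  by (induction gs) auto

lemma E_minus: "ok (tl gs) \<Longrightarrow> E gs (- x) = - E gs x"
  using E_add[of gs x "- x"] by (simp add: eq_neg_iff_add_eq_0 add.commute)

lemma E_diff: "ok (tl gs) \<Longrightarrow> E gs (x - y) = E gs x - E gs y"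
  using E_add[of gs x "- y"] by (simp add: E_minus)

lemma E_sum: "ok (tl gs) \<Longrightarrow> E gs (\<Sum>i\<in>A. g i) = (\<Sum>i\<in>A. E gs (g i))"
  by (induction A rule: infinite_finite_induct) (auto simp: E_add)

lemma E_ver: "E gs (ver x) = uq p (E (tl gs) x)"
  by (cases gs) auto

lemma uq_pow_0: "uq (p ^ 0) a = (a :: ('v::finite, 'k) mpoly)"
proof (rule poly_mapping_eqI)
  fix m
  show "Poly_Mapping.lookup (uq (p ^ 0) a) m = Poly_Mapping.lookup a m"
    using rt_power[of 0 "Poly_Mapping.lookup a m"] by (simp only: lookup_uq) simp
qed

lemma E_ver_pow: "E gs ((ver ^^ j) x) = uq (p ^ j) (E (drop j gs) x)"
proof (induction j arbitrary: gs)
  case 0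
  show ?case by (simp only: uq_pow_0 drop_0 funpow_0)
next
  case (Suc j)
  have "E gs ((ver ^^ Suc j) x) = uq p (uq (p ^ j) (E (drop j (tl gs)) x))"
    by (simp add: E_ver Suc)
  then show ?case by (simp add: uq_p_uq drop_Suc)
qed

lemma E_p: "ok (tl gs) \<Longrightarrow> E gs (of_nat p * x) = 0"
  unfolding p_VF E_ver by (rule uq_E_F)

lemma E_cg: "ok (tl gs) \<Longrightarrow> cg x y \<Longrightarrow> E gs x = E gs y"
  by (elim cgE) (simp add: E_add E_p)

lemma E_sec: "E gs (sec b) = hdz gs * b"
  by (cases gs) auto

text \<open>Moving \<open>sec b\<close> past one \<open>V\<close> turns it into
  \<open>F (sec b)\<close>, which is congruent to \<open>sec (b^p)\<close>; the \<open>u\<close>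
  that belongs to this \<open>V\<close> takes the \<open>p\<close>-th power off again.\<close>

lemma E_sec_mult:
  assumes "ok (tl gs)"
  shows "E gs (sec b * w) = b * E gs w"
  using assms
proof (induction gs arbitrary: b w)
  case (Cons g gs)
  then have ok: "ok gs" and ok': "ok (tl gs)" by (simp_all add: ok_tl)
  obtain z where z: "sec b * sec (wnth w 0) = sec (b * wnth w 0) + of_nat p * z"
    using cg_sym[OF sec_mult] by (rule cgE)
  have "sec b * w = sec b * sec (wnth w 0) + ver (red w) * sec b"
    by (subst sec_red[of w]) (simp add: distrib_left mult.commute)
  also have "\<dots> = sec (wnth (sec b * w) 0) + ver (wfrob z + wfrob (sec b) * red w)"
    unfolding z p_VF ver_proj by (simp add: ver_add mult.commute)
  finally have "red (sec b * w) = wfrob z + wfrob (sec b) * red w"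
    by (rule redI)
  then have "uq p (E gs (red (sec b * w))) = uq p (E gs (wfrob (sec b) * red w))"
    using ok ok' by (simp add: E_add uq_p_add uq_E_F)
  also have "E gs (wfrob (sec b) * red w) = E gs (sec (b ^ p) * red w)"
    using ok' by (intro E_cg cg_mult sec_frob cg_refl)
  also have "\<dots> = b ^ p * E gs (red w)"
    by (rule Cons.IH[OF ok'])
  finally show ?case by (simp add: uq_p_frob_mult distrib_left mult_ac)
qed simp

text \<open>Decompose \<open>c\<close> as \<open>sec\<close> of its zeroth component plus
  \<open>V (red c)\<close>. Frobenius makes the second part a multiple of \<open>p\<close>, so the
  action through \<open>F\<close> depends on the zeroth component alone.\<close>

lemma E_F_mult:
  assumes "ok (tl gs)"
  shows "E gs (wfrob c * w) = wnth c 0 ^ p * E gs w"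
proof -
  have "wfrob c = wfrob (sec (wnth c 0)) + of_nat p * red c"
    by (subst sec_red[of c]) (simp add: F_hom FV)
  then have "cg (wfrob c) (wfrob (sec (wnth c 0)))" by simp
  then have "cg (wfrob c) (sec (wnth c 0 ^ p))"
    using sec_frob cg_trans by blast
  then have "E gs (wfrob c * w) = E gs (sec (wnth c 0 ^ p) * w)"
    using assms by (intro E_cg cg_mult cg_refl)
  then show ?thesis by (simp add: E_sec_mult[OF assms])
qed

end

section \<open>The multinomial formula\<close>

definition comps :: "'a set \<Rightarrow> nat \<Rightarrow> ('a \<Rightarrow> nat) set"
  where "comps A n = {\<alpha> \<in> A \<rightarrow>\<^sub>E {0..n}. sum \<alpha> A = n}"

lemma finite_comps: "finite A \<Longrightarrow> finite (comps A n)"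
  by (simp add: comps_def finite_PiE)

lemma prod_fact_dvd_fact_sum:
  "finite A \<Longrightarrow> (\<Prod>t\<in>A. fact (\<alpha> t)) dvd (fact (\<Sum>t\<in>A. \<alpha> t) :: nat)"
proof (induction A rule: finite_induct)
  case (insert a A)
  have "fact (\<alpha> a) * (\<Prod>t\<in>A. fact (\<alpha> t)) dvd fact (\<alpha> a) * (fact (\<Sum>t\<in>A. \<alpha> t) :: nat)"
    using insert.IH by (rule mult_dvd_mono[OF dvd_refl])
  also have "\<dots> dvd fact (\<alpha> a + (\<Sum>t\<in>A. \<alpha> t))"
    by (rule fact_fact_dvd_fact)
  finally show ?case using insert.hyps by simp
qed simp

lemma comps_insert:
  assumes "finite A" "a \<notin> A"
  shows "bij_betw (\<lambda>(k, \<beta>). \<beta>(a := k)) (SIGMA k:{..n}. comps A (n - k)) (comps (insert a A) n)"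
proof (rule bij_betwI[where g = "\<lambda>\<alpha>. (\<alpha> a, \<alpha>(a := undefined))"])
  show "(\<lambda>(k, \<beta>). \<beta>(a := k)) \<in> (SIGMA k:{..n}. comps A (n - k)) \<rightarrow> comps (insert a A) n"
  proof
    fix x assume "x \<in> (SIGMA k:{..n}. comps A (n - k))"
    then obtain k \<beta> where x: "x = (k, \<beta>)" and k: "k \<in> {..n}" and \<beta>: "\<beta> \<in> comps A (n - k)"
      by auto
    have "sum (\<beta>(a := k)) A = sum \<beta> A"
      using assms(2) by (intro sum.cong) auto
    then have "\<beta>(a := k) \<in> comps (insert a A) n"
      using k \<beta> assms by (fastforce simp: comps_def PiE_def Pi_def extensional_def)
    then show "(case x of (k, \<beta>) \<Rightarrow> \<beta>(a := k)) \<in> comps (insert a A) n"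
      by (simp add: x)
  qed
  show "(\<lambda>\<alpha>. (\<alpha> a, \<alpha>(a := undefined))) \<in> comps (insert a A) n \<rightarrow> (SIGMA k:{..n}. comps A (n - k))"
  proof
    fix \<alpha> assume \<alpha>: "\<alpha> \<in> comps (insert a A) n"
    have s: "sum (\<alpha>(a := undefined)) A = sum \<alpha> A"
      using assms(2) by (intro sum.cong) auto
    have n: "\<alpha> a + sum \<alpha> A = n"
      using \<alpha> assms by (simp add: comps_def)
    have "\<alpha> t \<le> sum \<alpha> A" if "t \<in> A" for t
      using assms(1) that by (simp add: member_le_sum)
    then show "(\<alpha> a, \<alpha>(a := undefined)) \<in> (SIGMA k:{..n}. comps A (n - k))"
      using \<alpha> n s assms(2) by (auto simp: comps_def PiE_def Pi_def extensional_def)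
  qed
  show "(\<lambda>\<alpha>. (\<alpha> a, \<alpha>(a := undefined))) ((\<lambda>(k, \<beta>). \<beta>(a := k)) x) = x"
    if "x \<in> (SIGMA k:{..n}. comps A (n - k))" for x
    using that assms(2) by (auto simp: comps_def PiE_def extensional_def fun_eq_iff)
qed auto

lemma multinomial:
  fixes x :: "'a \<Rightarrow> 'b::comm_ring_1"
  assumes "finite A"
  shows "(\<Sum>t\<in>A. x t) ^ n =
    (\<Sum>\<alpha>\<in>comps A n. of_nat (fact n div (\<Prod>t\<in>A. fact (\<alpha> t))) * (\<Prod>t\<in>A. x t ^ \<alpha> t))"
  using assms
proof (induction A arbitrary: n rule: finite_induct)
  case empty
  have "comps {} n = (if n = 0 then {\<lambda>_. undefined} else ({} :: ('a \<Rightarrow> nat) set))"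
    by (auto simp: comps_def)
  then show ?case by (simp add: power_0_left)
next
  case (insert a A)
  let ?T = "\<lambda>A n \<alpha>. of_nat (fact n div (\<Prod>t\<in>A. fact (\<alpha> t))) * (\<Prod>t\<in>A. x t ^ \<alpha> t)"
  have tm: "of_nat (n choose k) * x a ^ k * ?T A (n - k) \<beta> = ?T (insert a A) n (\<beta>(a := k))"
    if k: "k \<le> n" and \<beta>: "\<beta> \<in> comps A (n - k)" for k \<beta>
  proof -
    let ?P = "\<Prod>t\<in>A. fact (\<beta> t) :: nat"
    have pr: "(\<Prod>t\<in>A. fact ((\<beta>(a := k)) t)) = ?P" "(\<Prod>t\<in>A. x t ^ (\<beta>(a := k)) t) = (\<Prod>t\<in>A. x t ^ \<beta> t)"
      using insert.hyps by (auto intro!: prod.cong)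
    have "?P dvd fact (n - k)"
      using prod_fact_dvd_fact_sum[OF insert.hyps(1), of \<beta>] \<beta> by (simp add: comps_def)
    then obtain c where c: "fact (n - k) = ?P * c" by (auto simp: dvd_def)
    have pos: "?P > 0" by (simp add: prod_pos)
    have "fact n = fact k * ?P * (c * (n choose k))"
      using binomial_fact_lemma[OF k] c by (simp add: mult_ac)
    then have "fact n div (fact k * ?P) = c * (n choose k)"
      using pos by simp
    moreover have "fact (n - k) div ?P = c" using c pos by simp
    ultimately show ?thesis
      using insert.hyps by (simp add: pr mult_ac fun_upd_same del: fun_upd_apply)
  qed
  have "(\<Sum>t\<in>insert a A. x t) ^ n = (x a + (\<Sum>t\<in>A. x t)) ^ n"
    using insert.hyps by simp
  also have "\<dots> = (\<Sum>k\<le>n. of_nat (n choose k) * x a ^ k * (\<Sum>t\<in>A. x t) ^ (n - k))"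
    by (rule binomial_ring)
  also have "\<dots> = (\<Sum>k\<le>n. \<Sum>\<beta>\<in>comps A (n - k). ?T (insert a A) n (\<beta>(a := k)))"
    unfolding insert.IH sum_distrib_left by (intro sum.cong refl tm) auto
  also have "\<dots> = (\<Sum>(k, \<beta>)\<in>(SIGMA k:{..n}. comps A (n - k)). ?T (insert a A) n (\<beta>(a := k)))"
    by (intro sum.Sigma) (auto simp: finite_comps insert.hyps)
  also have "\<dots> = (\<Sum>\<alpha>\<in>comps (insert a A) n. ?T (insert a A) n \<alpha>)"
    by (subst sum.reindex_bij_betw[OF comps_insert[OF insert.hyps], symmetric]) (simp add: case_prod_unfold)
  finally show ?case .
qed

text \<open>Exponent vectors containing the entry \<open>p\<close> give the pure powers. In all
  others the entries are below \<open>p\<close>, so \<open>p\<close> divides \<open>p!\<close> but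
  not the denominator of the multinomial coefficient; taking out this \<open>p\<close> leaves the
  coefficients of \<open>Delta1\<close>.\<close>

lemma multinomial_prime:
  fixes x :: "'a \<Rightarrow> 'b::comm_ring_1"
  assumes p: "prime p" and A: "finite A"
  shows "(\<Sum>t\<in>A. x t) ^ p = (\<Sum>t\<in>A. x t ^ p) + of_nat p *
    (\<Sum>\<alpha> | \<alpha> \<in> A \<rightarrow>\<^sub>E {0..p - 1} \<and> (\<Sum>t\<in>A. \<alpha> t) = p.
      of_nat ((fact p div (\<Prod>t\<in>A. fact (\<alpha> t))) div p) * (\<Prod>t\<in>A. x t ^ \<alpha> t))"
proof -
  have p0: "p > 0" using p prime_gt_0_nat by blast
  let ?T = "\<lambda>\<alpha>. of_nat (fact p div (\<Prod>t\<in>A. fact (\<alpha> t))) * (\<Prod>t\<in>A. x t ^ \<alpha> t)"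
  define S1 where "S1 = {\<alpha>. \<alpha> \<in> A \<rightarrow>\<^sub>E {0..p - 1} \<and> (\<Sum>t\<in>A. \<alpha> t) = p}"
  \<comment> \<open>\<open>e s\<close> is the exponent vector of the pure power
    \<open>x s ^ p\<close>; exactly these vectors lie outside the index set of
    \<open>Delta1\<close>.\<close>
  define e where "e s = (\<lambda>t\<in>A. if t = s then p else 0)" for s
  have "comps A p = S1 \<union> e ` A"
  proof
    show "S1 \<union> e ` A \<subseteq> comps A p"
      using A p0 by (fastforce simp: S1_def comps_def e_def PiE_def Pi_def extensional_def)
    show "comps A p \<subseteq> S1 \<union> e ` A"
    proof
      fix \<alpha> assume \<alpha>: "\<alpha> \<in> comps A p"
      show "\<alpha> \<in> S1 \<union> e ` A"
      proof (cases "\<exists>s\<in>A. \<alpha> s = p")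
        case True
        then obtain s where s: "s \<in> A" "\<alpha> s = p" by blast
        have "\<alpha> s + sum \<alpha> (A - {s}) = p"
          using \<alpha> sum.remove[OF A s(1), of \<alpha>] by (simp add: comps_def)
        then have "\<forall>t\<in>A - {s}. \<alpha> t = 0" using s A by simp
        then have "\<alpha> = e s"
          using s \<alpha> by (auto simp: e_def comps_def PiE_def extensional_def fun_eq_iff)
        then show ?thesis using s by blast
      next
        case False
        then have "\<alpha> t \<le> p - 1" if "t \<in> A" for t
          using \<alpha> that by (force simp: comps_def PiE_def Pi_def)
        then show ?thesis using \<alpha> by (auto simp: S1_def comps_def PiE_def Pi_def)
      qed
    qed
  qed
  moreover have "S1 \<inter> e ` A = {}"
    using p0 by (force simp: S1_def e_def PiE_def Pi_def)
  moreover have fin: "finite S1"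
    using A finite_PiE[of A "\<lambda>_. {0..p - 1}"] unfolding S1_def by (auto intro: finite_subset[rotated])
  moreover have "sum ?T (comps A p) = (\<Sum>t\<in>A. x t) ^ p"
    by (rule multinomial[OF A, symmetric])
  ultimately have "(\<Sum>t\<in>A. x t) ^ p = sum ?T S1 + sum ?T (e ` A)"
    using A by (simp add: sum.union_disjoint)
  moreover have "sum ?T (e ` A) = (\<Sum>t\<in>A. x t ^ p)"
  proof -
    have "inj_on e A"
      using p0 by (force simp: inj_on_def e_def fun_eq_iff)
    moreover have "?T (e s) = x s ^ p" if "s \<in> A" for s
    proof -
      have "(\<Prod>t\<in>A. fact (e s t)) = (\<Prod>t\<in>A. if t = s then fact p else 1 :: nat)"
        "(\<Prod>t\<in>A. x t ^ e s t) = (\<Prod>t\<in>A. if t = s then x t ^ p else 1)"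
        by (auto simp: e_def intro!: prod.cong)
      then show ?thesis using A that by simp
    qed
    ultimately show ?thesis by (simp add: sum.reindex)
  qed
  moreover have "sum ?T S1 = of_nat p * (\<Sum>\<alpha>\<in>S1. of_nat ((fact p div (\<Prod>t\<in>A. fact (\<alpha> t))) div p) * (\<Prod>t\<in>A. x t ^ \<alpha> t))"
    unfolding sum_distrib_left
  proof (intro sum.cong refl)
    fix \<alpha> assume \<alpha>: "\<alpha> \<in> S1"
    let ?P = "\<Prod>t\<in>A. fact (\<alpha> t) :: nat"
    have "?P dvd fact p"
      using prod_fact_dvd_fact_sum[OF A, of \<alpha>] \<alpha> by (simp add: S1_def)
    then obtain c where c: "fact p = ?P * c" by (auto simp: dvd_def)
    have "\<not> p dvd fact (\<alpha> t)" if "t \<in> A" for t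
    proof -
      have "\<alpha> t < p" using \<alpha> that p0 by (force simp: S1_def PiE_def Pi_def)
      then show ?thesis by (simp add: prime_dvd_fact_iff[OF p])
    qed
    then have "\<not> p dvd ?P"
      by (auto simp: prime_dvd_prod_iff[OF A p])
    moreover have "p dvd fact p" by (simp add: prime_dvd_fact_iff[OF p])
    ultimately have "p dvd c" using c by (simp add: prime_dvd_mult_iff[OF p])
    then obtain d where d: "c = p * d" by (auto simp: dvd_def)
    have "?P > 0" by (simp add: prod_pos)
    then have "fact p div ?P = p * d" using c d by simp
    then show "?T \<alpha> = of_nat p * (of_nat ((fact p div ?P) div p) * (\<Prod>t\<in>A. x t ^ \<alpha> t))"
      using p0 by (simp add: mult.assoc)
  qed
  ultimately show ?thesis by (simp add: S1_def add.commute)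
qed

section \<open>The Witt vector lifting \<open>Delta1\<close>\<close>

text \<open>The sum defining \<open>Delta1\<close> with Teichmueller elements in place of terms, so
  that it can be compared with \<open>p\<close>-th powers in \<open>W(S)\<close>, where
  \<open>p\<close> is not zero.\<close>

definition Delta_lift :: "nat \<Rightarrow> ('v, 'k::comm_ring_1) mpoly \<Rightarrow> ('v, 'k) mpoly witt"
  where "Delta_lift p a =
    (\<Sum>\<alpha> | \<alpha> \<in> Poly_Mapping.keys a \<rightarrow>\<^sub>E {0..p - 1} \<and> (\<Sum>t\<in>Poly_Mapping.keys a. \<alpha> t) = p.
       of_nat ((fact p div (\<Prod>t\<in>Poly_Mapping.keys a. fact (\<alpha> t))) div p) *
       (\<Prod>t\<in>Poly_Mapping.keys a. teich (Poly_Mapping.single t (Poly_Mapping.lookup a t)) ^ \<alpha> t))"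

lemma wnth_Delta_lift: "wnth (Delta_lift p a) 0 = Delta1 p a"
  by (simp add: Delta_lift_def Delta1_def wnth_0_hom)

lemma power_add_expand:
  fixes y e :: "'a::comm_ring_1"
  obtains h where "(y + e) ^ n = y ^ n + of_nat n * y ^ (n - 1) * e + e ^ 2 * h"
proof -
  have "\<exists>h. (y + e) ^ n = y ^ n + of_nat n * y ^ (n - 1) * e + e ^ 2 * h"
  proof (induction n)
    case 0
    then show ?case by (intro exI[of _ 0]) simp
  next
    case (Suc n)
    then obtain h where h: "(y + e) ^ n = y ^ n + of_nat n * y ^ (n - 1) * e + e ^ 2 * h" by blast
    have "of_nat n * y ^ (n - 1) * y = of_nat n * y ^ n"
      by (cases n) (simp_all add: mult_ac)
    then have "(y + e) ^ Suc n = y ^ Suc n + of_nat (Suc n) * y ^ n * e + e ^ 2 * (of_nat n * y ^ (n - 1) + h * (y + e))"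
      unfolding power_Suc2 h by (simp add: algebra_simps power2_eq_square)
    then show ?case by (metis diff_Suc_1)
  qed
  then show thesis using that by blast
qed

section \<open>The Leibniz rule for \<open>Delta1\<close> and a formula for
  \<open>theta\<close>\<close>

context perfect_char
begin

lemma sec_of_nat_mult: "cg (sec (of_nat n * a)) (of_nat n * sec a)"
proof (induction n)
  case (Suc n)
  have "cg (sec (a + of_nat n * a)) (sec a + of_nat n * sec a)"
    by (rule cg_trans[OF sec_add cg_add[OF cg_refl Suc]])
  then show ?case by (simp add: distrib_right)
qed simp

lemma sec_monomials:
  assumes "finite A"
  shows "sec (\<Prod>t\<in>A. Poly_Mapping.single t (c t) ^ \<alpha> t) = (\<Prod>t\<in>A. teich (Poly_Mapping.single t (c t)) ^ \<alpha> t)"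
proof -
  have "\<exists>m d. (\<Prod>t\<in>A. Poly_Mapping.single t (c t) ^ \<alpha> t) = Poly_Mapping.single m d"
    using assms
  proof (induction A rule: finite_induct)
    case empty
    then show ?case by (metis prod.empty single_one)
  next
    case (insert a A)
    then obtain m d where "(\<Prod>t\<in>A. Poly_Mapping.single t (c t) ^ \<alpha> t) = Poly_Mapping.single m d"
      by blast
    then show ?case
      using insert.hyps by (auto simp: single_power mult_single)
  qed
  then have "sec (\<Prod>t\<in>A. Poly_Mapping.single t (c t) ^ \<alpha> t) = teich (\<Prod>t\<in>A. Poly_Mapping.single t (c t) ^ \<alpha> t)"
    by (metis sec_single)
  moreover have "teich (\<Prod>t\<in>A. g t) = (\<Prod>t\<in>A. teich (g t))" for g :: "_ \<Rightarrow> ('a, 'b) mpoly"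
    by (induction A rule: infinite_finite_induct) (auto simp: teich_mult)
  ultimately show ?thesis by (simp add: teich_power)
qed

lemma Delta_lift_cg: "cg (Delta_lift p a) (sec (Delta1 p a))"
  unfolding Delta_lift_def Delta1_def
  by (rule cg_sym, rule cg_trans[OF sec_sum], rule cg_sum)
    (use sec_of_nat_mult in \<open>simp add: sec_monomials[symmetric]\<close>)

text \<open>The multinomial formula for the sum \<open>sec a\<close>, whose pure powers add up to
  \<open>F (sec a)\<close>. Thus \<open>- Delta_lift p a\<close> is the \<open>p\<close>-derivation
  belonging to \<open>F\<close>, evaluated at \<open>sec a\<close>.\<close>

lemma sec_power_p:
  "sec a ^ p = wfrob (sec a) + of_nat p * Delta_lift p (a :: ('v, 'k) mpoly)"
proof -
  have "(\<Sum>t\<in>Poly_Mapping.keys a. teich (Poly_Mapping.single t (Poly_Mapping.lookup a t)) ^ p) = wfrob (sec a)"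
    by (simp add: sec_def F_hom F_teich)
  then show ?thesis
    using multinomial_prime[OF prime finite_keys[of a], of "\<lambda>t. teich (Poly_Mapping.single t (Poly_Mapping.lookup a t))"]
    by (simp only: sec_def Delta_lift_def)
qed

text \<open>A Leibniz rule up to \<open>p\<close>-th powers: insert
  \<open>sec (a b) = sec a sec b + p z\<close> into \<open>sec_power_p\<close>, cancel
  \<open>p\<close> and take zeroth components. The error comes from \<open>F z\<close>, so it is a
  \<open>p\<close>-th power, which can be pulled out of \<open>u\<close>.\<close>

lemma Delta1_mult:
  fixes a b :: "('v::finite, 'k) mpoly"
  obtains r where "Delta1 p (a * b) = a ^ p * Delta1 p b + b ^ p * Delta1 p a + r ^ p"
proof -
  let ?s = "sec a" and ?t = "sec b"
  obtain z where z: "sec (a * b) = ?s * ?t + of_nat p * z"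
    using sec_mult by (rule cgE)
  obtain h where h: "(?s * ?t + of_nat p * z) ^ p =
      (?s * ?t) ^ p + of_nat p * (?s * ?t) ^ (p - 1) * (of_nat p * z) + (of_nat p * z) ^ 2 * h"
    by (rule power_add_expand)
  have "of_nat p * Delta_lift p (a * b) = sec (a * b) ^ p - wfrob (sec (a * b))"
    by (simp add: sec_power_p)
  also have "\<dots> = (?s * ?t) ^ p + of_nat p * (?s * ?t) ^ (p - 1) * (of_nat p * z) + (of_nat p * z) ^ 2 * h
      - (wfrob ?s * wfrob ?t + of_nat p * wfrob z)"
    unfolding z h by (simp add: F_hom)
  also have "\<dots> = of_nat p * (wfrob ?s * Delta_lift p b + wfrob ?t * Delta_lift p a - wfrob z
      + of_nat p * (Delta_lift p a * Delta_lift p b + (?s * ?t) ^ (p - 1) * z + z ^ 2 * h))"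
    by (simp add: power_mult_distrib sec_power_p algebra_simps power2_eq_square)
  finally have "Delta_lift p (a * b) = wfrob ?s * Delta_lift p b + wfrob ?t * Delta_lift p a - wfrob z
      + of_nat p * (Delta_lift p a * Delta_lift p b + (?s * ?t) ^ (p - 1) * z + z ^ 2 * h)" (is "_ = ?r")
    by (rule p_mult_cancel)
  then have "wnth (Delta_lift p (a * b)) 0 = wnth ?r 0" by simp
  moreover have "of_nat p = (0 :: ('v, 'k) mpoly)"
    using of_nat_CHAR[where ?'a = "('v, 'k) mpoly"] by (simp add: char_mpoly)
  ultimately have "Delta1 p (a * b) = a ^ p * Delta1 p b + b ^ p * Delta1 p a - wnth z 0 ^ p"
    by (simp add: wnth_Delta_lift wnth_0_hom)
  also have "- (wnth z 0 ^ p) = (- wnth z 0) ^ p"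
    using frob_minus[of "wnth z 0" 1] by simp
  ultimately show thesis
    using that[of "- wnth z 0"] by simp
qed

lemma Delta1_power:
  fixes f :: "('v::finite, 'k) mpoly"
  shows "\<exists>r. Delta1 p (f ^ Suc n) = of_nat (Suc n) * f ^ (p * n) * Delta1 p f + r ^ p"
proof (induction n)
  case 0
  show ?case by (intro exI[of _ 0]) (simp add: power_0_left)
next
  case (Suc n)
  then obtain r where r: "Delta1 p (f ^ Suc n) = of_nat (Suc n) * f ^ (p * n) * Delta1 p f + r ^ p" by blast
  obtain t where t: "Delta1 p (f * f ^ Suc n) = f ^ p * Delta1 p (f ^ Suc n) + (f ^ Suc n) ^ p * Delta1 p f + t ^ p"
    by (rule Delta1_mult)
  have "(f ^ Suc n) ^ p = f ^ (p * Suc n)" "f ^ p * f ^ (p * n) = f ^ (p * Suc n)"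
    by (simp_all only: power_mult[symmetric] mult.commute[of p] power_add[symmetric] mult_Suc)
  then have "Delta1 p (f ^ Suc (Suc n)) = of_nat (Suc (Suc n)) * f ^ (p * Suc n) * Delta1 p f + ((f * r) ^ p + t ^ p)"
    using t unfolding r by (simp add: power_mult_distrib algebra_simps del: power_Suc mult_Suc_right flip: power_Suc)
  then show ?case
    using frob_add[of "f * r" t 1] by (intro exI[of _ "f * r + t"]) simp
qed

text \<open>By \<open>Delta1_power\<close>, \<open>Delta1\<close> of \<open>f^(p-1)\<close> is
  \<open>(p - 1) f^(p(p-2)) Delta1 f\<close> plus a \<open>p\<close>-th power. Here
  \<open>p - 1\<close> is \<open>-1\<close>, the power of \<open>f\<close> leaves \<open>u\<close>
  as \<open>f^(p-2)\<close>, and the \<open>p\<close>-th power contributes a multiple of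
  \<open>u a = 0\<close>.\<close>

lemma theta_eq:
  assumes "uq p a = 0"
  shows "theta p f a = - (f ^ (p - 2) * uq p (a * Delta1 p (f :: ('v::finite, 'k) mpoly)))"
proof -
  \<comment> \<open>Brings the exponent \<open>p - 1\<close> into the successor form of
    \<open>Delta1_power\<close>; \<open>p = 2\<close> gives \<open>n = 0\<close>.\<close>
  define n where "n = p - 2"
  have n: "p - 1 = Suc n"
    using p_gt_1 by (simp add: n_def)
  obtain r where r: "Delta1 p (f ^ (p - 1)) = of_nat (p - 1) * f ^ (p * n) * Delta1 p f + r ^ p"
    using Delta1_power[of f n] unfolding n by blast
  have "of_nat (p - 1) + 1 = (of_nat p :: ('v, 'k) mpoly)"
    using of_nat_Suc[of "p - 1", where ?'a = "('v, 'k) mpoly"] by (simp add: add.commute)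
  also have "of_nat p = (0 :: ('v, 'k) mpoly)"
    using of_nat_CHAR[where ?'a = "('v, 'k) mpoly"] by (simp add: char_mpoly)
  finally have m: "of_nat (p - 1) = (- 1 :: ('v, 'k) mpoly)"
    by (simp add: eq_neg_iff_add_eq_0)
  have "Delta1 p (f ^ (p - 1)) * a = (f ^ n) ^ p * (- (a * Delta1 p f)) + r ^ p * a"
    unfolding r m by (simp add: algebra_simps power_mult[symmetric])
  then have "theta p f a = uq p ((f ^ n) ^ p * (- (a * Delta1 p f)) + r ^ p * a)"
    by (simp only: theta_def dual_u_eq)
  then show ?thesis
    using assms by (simp add: uq_p_add uq_p_diff uq_p_frob_mult n_def)
qed

end

context perfect_char
begin

section \<open>The expansion of a Teichmueller element\<close>

lemma p_ver: "of_nat p * ver y = ver (of_nat p * (y :: ('v, 'k) mpoly witt))"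
  by (simp only: p_VF[of "ver y"] FV)

text \<open>Split \<open>w\<close> into a Teichmueller element, on which \<open>F\<close> is the
  \<open>p\<close>-th power, and \<open>V x\<close>, which satisfies
  \<open>(V x)^2 = p V (x^2)\<close> and lies in the kernel of \<open>F\<close> modulo
  \<open>p\<close>.\<close>

lemma cg_frob_power: "cg (w ^ p) (wfrob (w :: ('v::finite, 'k) mpoly witt))"
proof -
  let ?t = "teich (wnth w 0)" and ?x = "shift w"
  have w: "w = ?t + ver ?x" by (rule witt_decomp)
  have "cg (w ^ p) (?t ^ p + ver ?x ^ p)"
    by (subst w) (rule dvd_freshman[OF prime])
  moreover have "ver ?x ^ p = of_nat p * (ver (of_nat p ^ (p - 2) * ?x ^ p))"
  proof -
    have pow: "ver ?x ^ Suc n = of_nat p ^ n * ver (?x ^ Suc n)" for n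
    proof (induction n)
      case (Suc n)
      have "ver ?x ^ Suc (Suc n) = of_nat p ^ n * (ver (?x ^ Suc n) * ver ?x)"
        using Suc by (simp add: mult_ac)
      also have "ver (?x ^ Suc n) * ver ?x = ver (of_nat p * ?x ^ Suc (Suc n))"
        by (simp add: ver_proj FV mult_ac)
      also have "\<dots> = of_nat p * ver (?x ^ Suc (Suc n))"
        by (simp only: p_ver)
      finally show ?case by (simp add: mult_ac)
    qed simp
    have pv: "of_nat p ^ n * ver y = ver (of_nat p ^ n * y)" for n and y :: "('v, 'k) mpoly witt"
      by (induction n) (simp_all only: power.simps mult.assoc p_ver mult_1)
    have "p = Suc (p - 1)" "p - 1 = Suc (p - 2)" using p_gt_1 by simp_all
    then show ?thesis
      using pow[of "p - 1"] pv[of "p - 2"] by (metis mult.assoc power_Suc)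
  qed
  then have "cg (ver ?x ^ p) 0" by simp
  ultimately have "cg (w ^ p) (?t ^ p + 0)"
    using cg_trans cg_add[OF cg_refl] by blast
  moreover have "cg (wfrob w) (?t ^ p + 0)"
    by (subst w) (simp add: F_hom F_teich FV)
  ultimately show ?thesis using cg_sym cg_trans by blast
qed

text \<open>For odd \<open>p\<close> the terms beyond the linear one are divisible by
  \<open>p^(m+2)\<close>. For \<open>p = 2\<close> and \<open>m = 1\<close> the term
  \<open>p^(2m) D^2\<close> misses this by one factor, but \<open>D^2\<close> is congruent to
  \<open>F D\<close>; this is the origin of the Frobenius image in the statement.\<close>

lemma power_p_perturb:
  fixes y D :: "('v::finite, 'k) mpoly witt"
  assumes m: "m \<ge> 1"
  shows "\<exists>z w. (y + of_nat p ^ m * D) ^ p = y ^ p + of_nat p ^ Suc m * (D * y ^ (p - 1) + wfrob z + of_nat p * w)"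
proof (cases "p = 2")
  case True
  have sq: "(y + of_nat p ^ m * D) ^ p = y ^ p + of_nat p ^ Suc m * (D * y ^ (p - 1)) + of_nat p ^ (m + m) * D ^ 2"
    unfolding True by (simp add: power2_eq_square algebra_simps power_add)
  obtain w where w: "D ^ 2 = wfrob D + of_nat p * w"
    using cg_frob_power[of D] unfolding True by (rule cgE[unfolded True])
  have "of_nat p ^ (m + m) = (of_nat p ^ Suc m * of_nat p ^ (m - 1) :: ('v, 'k) mpoly witt)"
    unfolding power_add[symmetric] using m by simp
  then have "of_nat p ^ (m + m) * D ^ 2 = of_nat p ^ Suc m * (wfrob (of_nat p ^ (m - 1) * D) + of_nat p * (of_nat p ^ (m - 1) * w))"
    unfolding w by (simp add: F_hom algebra_simps)
  then have "(y + of_nat p ^ m * D) ^ p = y ^ p + of_nat p ^ Suc m *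
      (D * y ^ (p - 1) + wfrob (of_nat p ^ (m - 1) * D) + of_nat p * (of_nat p ^ (m - 1) * w))"
    unfolding sq by (simp add: distrib_left add.assoc)
  then show ?thesis by blast
next
  case False
  then have p3: "p \<ge> 3" using p_gt_1 by simp
  let ?e = "of_nat p ^ m * D"
  have "of_nat p ^ Suc (Suc m) dvd of_nat (p choose k) * ?e ^ k * y ^ (p - k)" if k: "2 \<le> k" "k \<le> p" for k
  proof -
    have "of_nat p ^ Suc (Suc m) dvd of_nat (p choose k) * (of_nat p ^ (m * k) :: ('v, 'k) mpoly witt)"
    proof (cases "k = p")
      case True
      have "Suc (Suc m) \<le> m * 3" using m by simp
      also have "\<dots> \<le> m * k" using p3 True by simp
      finally have "of_nat p ^ Suc (Suc m) dvd (of_nat p ^ (m * k) :: ('v, 'k) mpoly witt)"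
        by (rule le_imp_power_dvd)
      then show ?thesis by (rule dvd_mult)
    next
      case False
      then have "p dvd p choose k"
        using k by (intro dvd_choose_prime[OF _ _ _ prime]) auto
      then obtain c where c: "p choose k = p * c" by (auto simp: dvd_def)
      have "Suc m \<le> m * 2" using m by simp
      also have "\<dots> \<le> m * k" using k by simp
      finally have "of_nat p ^ Suc m dvd (of_nat p ^ (m * k) :: ('v, 'k) mpoly witt)"
        by (rule le_imp_power_dvd)
      then have "of_nat p * of_nat p ^ Suc m dvd of_nat p * (of_nat c * (of_nat p ^ (m * k) :: ('v, 'k) mpoly witt))"
        by (intro mult_dvd_mono dvd_refl dvd_mult)
      then show ?thesis by (simp add: c mult_ac)
    qed
    then have "of_nat p ^ Suc (Suc m) dvd of_nat (p choose k) * of_nat p ^ (m * k) * (D ^ k * y ^ (p - k))"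
      by (rule dvd_mult2)
    then show ?thesis
      by (simp add: power_mult_distrib power_mult[symmetric] mult_ac)
  qed
  then have "of_nat p ^ Suc (Suc m) dvd (\<Sum>k\<in>{2..p}. of_nat (p choose k) * ?e ^ k * y ^ (p - k))"
    by (intro dvd_sum) auto
  then obtain w where w: "(\<Sum>k\<in>{2..p}. of_nat (p choose k) * ?e ^ k * y ^ (p - k)) = of_nat p ^ Suc (Suc m) * w"
    by (auto simp: dvd_def)
  have "(y + ?e) ^ p = (?e + y) ^ p" by (simp add: add.commute)
  also have "\<dots> = (\<Sum>k\<le>p. of_nat (p choose k) * ?e ^ k * y ^ (p - k))"
    by (rule binomial_ring)
  also have "{..p} = insert 0 (insert 1 {2..p})" using p_gt_1 by auto
  finally have "(y + ?e) ^ p = y ^ p + of_nat p * ?e * y ^ (p - 1) + of_nat p ^ Suc (Suc m) * w"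
    by (simp add: w del: power_Suc)
  also have "\<dots> = y ^ p + of_nat p ^ Suc m * (D * y ^ (p - 1) + wfrob 0 + of_nat p * w)"
    by (simp add: F_hom algebra_simps)
  finally show ?thesis by blast
qed

text \<open>The elements \<open>D j\<close> with \<open>teich a = sec a + \<Sum>j. ver ^ (j+1) (D j)\<close>; only their class modulo \<open>p\<close>
  and the image of Frobenius matters.\<close>

lemma ghost_differences:
  fixes a :: "('v::finite, 'k) mpoly"
  defines "s \<equiv> sec a"
  shows "\<exists>D. \<forall>r. s ^ (p ^ Suc r) = wfrob s ^ (p ^ r) + of_nat p ^ Suc r * D r \<and>
    (\<exists>z w. D r = Delta_lift p a * wfrob (s ^ (p ^ r - 1)) + wfrob z + of_nat p * w)"
proof -
  let ?d = "Delta_lift p a" and ?B = "wfrob s"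
  have "\<exists>D. s ^ (p ^ Suc r) = ?B ^ (p ^ r) + of_nat p ^ Suc r * D \<and>
    (\<exists>z w. D = ?d * wfrob (s ^ (p ^ r - 1)) + wfrob z + of_nat p * w)" for r
  proof (induction r)
    case 0
    have "s ^ p = ?B + of_nat p * ?d"
      unfolding s_def by (rule sec_power_p)
    then show ?case
      by (intro exI[of _ ?d] conjI exI[of _ 0]) (simp_all add: F_hom)
  next
    case (Suc r)
    then obtain D z w where D: "s ^ (p ^ Suc r) = ?B ^ (p ^ r) + of_nat p ^ Suc r * D"
      and Dz: "D = ?d * wfrob (s ^ (p ^ r - 1)) + wfrob z + of_nat p * w"
      by blast
    obtain z' w' where p: "(?B ^ (p ^ r) + of_nat p ^ Suc r * D) ^ p = (?B ^ (p ^ r)) ^ p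
        + of_nat p ^ Suc (Suc r) * (D * (?B ^ (p ^ r)) ^ (p - 1) + wfrob z' + of_nat p * w')"
      using power_p_perturb[of "Suc r" "?B ^ (p ^ r)" D] by auto
    let ?D = "D * (?B ^ (p ^ r)) ^ (p - 1) + wfrob z' + of_nat p * w'"
    have pw: "x ^ (p ^ Suc n) = (x ^ (p ^ n)) ^ p" for n and x :: "('v, 'k) mpoly witt"
      by (simp add: power_mult[symmetric] mult.commute)
    have "s ^ (p ^ Suc (Suc r)) = ?B ^ (p ^ Suc r) + of_nat p ^ Suc (Suc r) * ?D"
      unfolding pw[of s "Suc r"] D p pw[of ?B] ..
    moreover have "?D = ?d * wfrob (s ^ (p ^ Suc r - 1))
        + wfrob (z * (s ^ (p ^ r)) ^ (p - 1) + z') + of_nat p * (w * (?B ^ (p ^ r)) ^ (p - 1) + w')"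
    proof -
      have "x - 1 + x * (y - 1) = y * x - 1" if "x > 0" "y > 0" for x y :: nat
        using that by (cases x; cases y) auto
      from this[OF q_pos[of r] p_pos] have "p ^ r - 1 + p ^ r * (p - 1) = p ^ Suc r - 1"
        by (simp only: power_Suc)
      then have "s ^ (p ^ Suc r - 1) = s ^ (p ^ r - 1) * (s ^ (p ^ r)) ^ (p - 1)"
        by (simp only: power_mult[symmetric] power_add[symmetric])
      then show ?thesis
        unfolding Dz by (simp only: F_hom) (simp add: algebra_simps)
    qed
    ultimately show ?case by blast
  qed
  then show ?thesis by (intro choice allI)
qed

lemma F_power: "(wfrob ^^ m) (teich a) = teich (a :: ('v, 'k) mpoly) ^ (p ^ m)"
  by (induction m) (simp_all add: F_hom F_teich power_mult[symmetric])

lemma F_pow_hom: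
  "(wfrob ^^ m) (x + y) = (wfrob ^^ m) x + (wfrob ^^ m) (y :: ('v, 'k) mpoly witt)"
  "(wfrob ^^ m) (x - y) = (wfrob ^^ m) x - (wfrob ^^ m) (y :: ('v, 'k) mpoly witt)"
  by (induction m) (simp_all add: F_hom)

lemma F_pow_inject: "(wfrob ^^ m) x = (wfrob ^^ m) y \<Longrightarrow> x = (y :: ('v::finite, 'k) mpoly witt)"
  by (induction m) (auto dest: F_inject)

lemma FV_pow: "(wfrob ^^ m) ((ver ^^ m) x) = of_nat p ^ m * (x :: ('v, 'k) mpoly witt)"
proof (induction m arbitrary: x)
  case (Suc m)
  have "(wfrob ^^ Suc m) ((ver ^^ Suc m) x) = (wfrob ^^ m) (wfrob (ver ((ver ^^ m) x)))"
    by (simp add: funpow_swap1)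
  also have "\<dots> = (wfrob ^^ m) ((ver ^^ m) (of_nat p * x))"
  proof -
    have "of_nat p * (ver ^^ m) x = (ver ^^ m) (of_nat p * x)"
      by (induction m) (simp_all add: p_ver)
    then show ?thesis by (simp add: FV)
  qed
  finally show ?case
    using Suc[of "of_nat p * x"] by (simp add: mult_ac)
qed simp

text \<open>For \<open>m = 0\<close> the difference lies in the image of \<open>V\<close>, which is
  an ideal. Each \<open>p\<close>-th power then gains a factor \<open>p\<close>: the linear term
  carries it, and in the rest \<open>(V z)^2 = p V (z^2)\<close> supplies it.\<close>

lemma teich_power_cong:
  fixes a :: "('v::finite, 'k) mpoly"
  shows "\<exists>z. teich a ^ (p ^ m) = sec a ^ (p ^ m) + of_nat p ^ m * ver z"
proof (induction m)
  case 0
  have "teich a = sec (wnth (teich a) 0) + ver (red (teich a))" by (rule sec_red)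
  then show ?case by (intro exI[of _ "red (teich a)"]) simp
next
  case (Suc m)
  then obtain z where z: "teich a ^ (p ^ m) = sec a ^ (p ^ m) + of_nat p ^ m * ver z" by blast
  let ?y = "sec a ^ (p ^ m)" and ?e = "of_nat p ^ m * ver z"
  obtain h where h: "(?y + ?e) ^ p = ?y ^ p + of_nat p * ?y ^ (p - 1) * ?e + ?e ^ 2 * h"
    by (rule power_add_expand)
  have sq: "?e ^ 2 * h = of_nat p ^ Suc m * (ver (z ^ 2) * (of_nat p ^ m * h))"
  proof -
    have "ver z ^ 2 = of_nat p * ver (z ^ 2)"
      by (simp only: power2_eq_square ver_proj FV p_ver mult_ac)
    moreover have "?e ^ 2 * h = ver z ^ 2 * (of_nat p ^ m * (of_nat p ^ m * h))"
      by (simp add: power2_eq_square mult_ac)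
    ultimately show ?thesis by (simp add: mult_ac)
  qed
  have "teich a ^ (p ^ Suc m) = (?y + ?e) ^ p"
    by (simp only: z[symmetric] power_mult[symmetric] power_Suc2)
  also have "\<dots> = ?y ^ p + of_nat p ^ Suc m * (ver z * ?y ^ (p - 1) + ver (z ^ 2) * (of_nat p ^ m * h))"
    unfolding h sq by (simp add: algebra_simps)
  also have "\<dots> = sec a ^ (p ^ Suc m) + of_nat p ^ Suc m *
      ver (z * wfrob (?y ^ (p - 1)) + z ^ 2 * wfrob (of_nat p ^ m * h))"
    unfolding ver_proj by (simp add: ver_add power_mult[symmetric] mult.commute)
  finally show ?case by blast
qed

text \<open>It suffices to compare after the injective \<open>F^m\<close>. There the
  \<open>V^(j+1)\<close> become powers of \<open>p\<close>, and by the recursion \<open>D\<close>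
  the partial sum collapses to \<open>sec a ^ (p^m)\<close>, which \<open>teich_power_cong\<close>
  compares with the power of the Teichmueller element.\<close>

lemma teich_expansion:
  fixes a :: "('v::finite, 'k) mpoly"
  assumes D: "\<And>r. sec a ^ (p ^ Suc r) = wfrob (sec a) ^ (p ^ r) + of_nat p ^ Suc r * D r"
  shows "\<exists>z. teich a = sec a + (\<Sum>j<m. (ver ^^ Suc j) (D j)) + (ver ^^ Suc m) z"
proof -
  let ?T = "\<lambda>m. sec a + (\<Sum>j<m. (ver ^^ Suc j) (D j))"
  have T: "(wfrob ^^ m) (?T m) = sec a ^ (p ^ m)" for m
  proof (induction m)
    case (Suc m)
    have "(wfrob ^^ Suc m) (?T (Suc m)) = wfrob ((wfrob ^^ m) (?T m)) + (wfrob ^^ Suc m) ((ver ^^ Suc m) (D m))"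
      by (simp only: sum.lessThan_Suc add.assoc[symmetric] F_pow_hom(1)) (simp add: F_hom(2))
    also have "\<dots> = wfrob (sec a) ^ (p ^ m) + of_nat p ^ Suc m * D m"
      unfolding Suc FV_pow F_hom ..
    finally show ?case unfolding D .
  qed simp
  obtain z where z: "teich a ^ (p ^ m) = sec a ^ (p ^ m) + of_nat p ^ m * ver z"
    using teich_power_cong by blast
  have "(wfrob ^^ m) (teich a) = (wfrob ^^ m) (?T m + (ver ^^ m) (ver z))"
    unfolding F_power z F_pow_hom(1)[of m "?T m"] T FV_pow ..
  then have "teich a = ?T m + (ver ^^ m) (ver z)" by (rule F_pow_inject)
  also have "(ver ^^ m) (ver z) = (ver ^^ Suc m) z" by (simp add: funpow_swap1)
  finally show ?thesis by blast
qed

section \<open>Divisibility conditions on the coordinates\<close>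

lemma uq_p_dvd: "a ^ (p ^ Suc i) dvd b \<Longrightarrow> a ^ (p ^ i) dvd uq p (b :: ('v::finite, 'k) mpoly)"
proof -
  assume "a ^ (p ^ Suc i) dvd b"
  then obtain c where c: "b = a ^ (p ^ Suc i) * c" by (auto simp: dvd_def)
  have "a ^ (p ^ Suc i) = (a ^ (p ^ i)) ^ p"
    by (simp add: power_mult[symmetric] mult.commute)
  then show ?thesis by (simp add: c uq_p_frob_mult)
qed

text \<open>The summand \<open>V^(j+1) (D j)\<close> is seen by the coordinates after the first
  \<open>j + 1\<close>, followed by \<open>u^(j+1)\<close>. Multiples of \<open>p\<close> and
  Frobenius images in \<open>D j\<close> vanish; in the remaining product the Frobenius factor
  leaves the innermost \<open>u\<close> as \<open>f^(p^j - 1)\<close> and stays under the other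
  \<open>j\<close>.\<close>

lemma E_teich:
  fixes f :: "('v::finite, 'k) mpoly"
  assumes "ok (tl gs)"
  shows "E gs (teich f) = hdz gs * f +
    (\<Sum>j<length gs. uq (p ^ j) (f ^ (p ^ j - 1) * uq p (hdz (drop (Suc j) gs) * Delta1 p f)))"
proof -
  obtain D where D: "\<And>r. sec f ^ (p ^ Suc r) = wfrob (sec f) ^ (p ^ r) + of_nat p ^ Suc r * D r"
    and Dz: "\<And>r. \<exists>z w. D r = Delta_lift p f * wfrob (sec f ^ (p ^ r - 1)) + wfrob z + of_nat p * w"
    using ghost_differences[of f] by auto
  obtain z where z: "teich f = sec f + (\<Sum>j<length gs. (ver ^^ Suc j) (D j)) + (ver ^^ Suc (length gs)) z"
    using teich_expansion[OF D] by blast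
  \<comment> \<open>All coordinates have been dropped here, so the remainder of the expansion
    evaluates to 0.\<close>
  have last: "E gs ((ver ^^ Suc (length gs)) z) = 0"
    unfolding E_ver_pow by (simp del: power_Suc)
  have "E gs ((ver ^^ Suc j) (D j)) = uq (p ^ j) (f ^ (p ^ j - 1) * uq p (hdz (drop (Suc j) gs) * Delta1 p f))" for j
  proof -
    let ?g = "drop (Suc j) gs"
    have ok: "ok ?g" using assms ok_drop[of "tl gs" j] by (simp add: drop_Suc)
    then have ok': "ok (tl ?g)" by (rule ok_tl)
    obtain z w where Dj: "D j = Delta_lift p f * wfrob (sec f ^ (p ^ j - 1)) + wfrob z + of_nat p * w"
      using Dz by blast
    have "uq p (E ?g (D j)) = uq p (E ?g (wfrob (sec f ^ (p ^ j - 1)) * Delta_lift p f))"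
      unfolding Dj mult.commute[of "Delta_lift p f"]
      by (simp add: E_add[OF ok'] E_p[OF ok'] uq_p_add uq_E_F[OF ok])
    also have "\<dots> = uq p ((f ^ (p ^ j - 1)) ^ p * (hdz ?g * Delta1 p f))"
      by (simp only: E_F_mult[OF ok'] E_cg[OF ok' Delta_lift_cg] E_sec wnth_0_hom wnth_sec_0)
    finally have "uq p (E ?g (D j)) = f ^ (p ^ j - 1) * uq p (hdz ?g * Delta1 p f)"
      by (simp only: uq_p_frob_mult)
    moreover have "uq (p ^ Suc j) x = uq (p ^ j) (uq p x)" for x :: "('v, 'k) mpoly"
      by (simp add: uq_uq_p mult.commute)
    ultimately show ?thesis unfolding E_ver_pow by simp
  qed
  then show ?thesis
    unfolding z using last by (simp only: E_add[OF assms] E_sum[OF assms] E_sec) simp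
qed

text \<open>The exponent grows by a factor \<open>p\<close> with each coordinate because every
  \<open>V\<close> is answered by a \<open>u\<close>, which turns divisibility by
  \<open>f^(p^(i+1))\<close> into divisibility by \<open>f^(p^i)\<close>. Starting at
  \<open>i = 1\<close> leaves a single \<open>f\<close> after the outermost
  \<open>u\<close>.\<close>

fun teich_cond :: "('v::finite, 'k) mpoly \<Rightarrow> nat \<Rightarrow> ('v, 'k) mpoly list \<Rightarrow> bool" where
  "teich_cond f i [] \<longleftrightarrow> True"
| "teich_cond f i (g # gs) \<longleftrightarrow> f ^ (p ^ i) dvd E (g # gs) (teich f) \<and> teich_cond f (Suc i) gs"

text \<open>The same conditions with the expansion \<open>E_teich\<close> cut off after its first
  correction term.\<close>

fun step_cond :: "('v::finite, 'k) mpoly \<Rightarrow> nat \<Rightarrow> ('v, 'k) mpoly list \<Rightarrow> bool" where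
  "step_cond f i [] \<longleftrightarrow> True"
| "step_cond f i (g # gs) \<longleftrightarrow> f ^ (p ^ i) dvd f * g + uq p (hdz gs * Delta1 p f) \<and> step_cond f (Suc i) gs"

lemma step_cond_nth:
  assumes "step_cond f i gs"
  shows "f ^ (p ^ (i + j)) dvd f * hdz (drop j gs) + uq p (hdz (drop (Suc j) gs) * Delta1 p f)"
  using assms
proof (induction j arbitrary: i gs)
  case 0
  then show ?case by (cases gs) (auto simp: drop_Suc)
next
  case (Suc j)
  then show ?case
    by (cases gs) (use Suc.IH[of "Suc i" "tl gs"] in \<open>auto simp: drop_Suc\<close>)
qed

text \<open>The later corrections in \<open>E_teich\<close> are divisible anyway: for consecutive
  coordinates \<open>h\<close>, \<open>h'\<close> of the tail, its conditions replace
  \<open>u (h' Delta1 f)\<close> by \<open>- f h\<close> up to a high power of \<open>f\<close>.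
  Multiplied by \<open>f^(p^j - 1)\<close> this is \<open>- f^(p^j) h\<close>, and its
  \<open>j\<close>-fold trace is 0 because \<open>u h = 0\<close> and
  \<open>j \<ge> 1\<close>.\<close>

lemma teich_cond_iff_step_cond:
  assumes "i \<ge> 1" "ok (tl gs)"
  shows "teich_cond f i gs \<longleftrightarrow> step_cond f i gs"
  using assms
proof (induction gs arbitrary: i)
  case (Cons g gs)
  then have ok: "ok gs" by simp
  have IH: "teich_cond f (Suc i) gs \<longleftrightarrow> step_cond f (Suc i) gs"
    by (rule Cons.IH) (use ok ok_tl in auto)
  have "f ^ (p ^ i) dvd E (g # gs) (teich f) \<longleftrightarrow> f ^ (p ^ i) dvd f * g + uq p (hdz gs * Delta1 p f)"
    if sc: "step_cond f (Suc i) gs"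
  proof -
    let ?t = "\<lambda>j. uq (p ^ j) (f ^ (p ^ j - 1) * uq p (hdz (drop (Suc j) (g # gs)) * Delta1 p f))"
    have t: "f ^ (p ^ i) dvd ?t (Suc j)" for j
    proof -
      let ?h = "hdz (drop j gs)" and ?j = "Suc j"
      have "f ^ (p ^ (Suc i + j)) dvd f * ?h + uq p (hdz (drop (Suc j) gs) * Delta1 p f)"
        by (rule step_cond_nth[OF sc])
      then obtain c where "f * ?h + uq p (hdz (drop (Suc j) gs) * Delta1 p f) = f ^ (p ^ (Suc i + j)) * c"
        by (auto simp: dvd_def)
      then have c: "uq p (hdz (drop (Suc j) gs) * Delta1 p f) = f ^ (p ^ (Suc i + j)) * c - f * ?h"
        by (simp add: eq_diff_eq add.commute)
      have e1: "f ^ (p ^ ?j - 1) * f = f ^ (p ^ ?j)"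
        using q_pos[of ?j] by (metis Suc_diff_1 power_Suc2)
      have e2: "f ^ (p ^ (Suc i + j)) = (f ^ (p ^ i)) ^ (p ^ ?j)"
        by (simp add: power_mult[symmetric] power_add[symmetric] del: power_Suc)
      have "?t ?j = uq (p ^ ?j) (f ^ (p ^ ?j - 1) * (f ^ (p ^ (Suc i + j)) * c - f * ?h))"
        by (simp only: drop_Suc_Cons c)
      also have "f ^ (p ^ ?j - 1) * (f ^ (p ^ (Suc i + j)) * c - f * ?h) =
          (f ^ (p ^ i)) ^ (p ^ ?j) * (f ^ (p ^ ?j - 1) * c) - f ^ (p ^ ?j) * ?h"
        unfolding e2 by (simp only: right_diff_distrib mult.assoc[symmetric] e1) (simp only: mult_ac)
      also have "uq (p ^ ?j) \<dots> = f ^ (p ^ i) * uq (p ^ ?j) (f ^ (p ^ ?j - 1) * c) - f * uq (p ^ ?j) ?h"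
        by (simp only: uq_diff uq_frob_mult)
      also have "uq (p ^ ?j) ?h = uq (p ^ j) (uq p ?h)"
        by (simp add: uq_uq_p mult.commute)
      also have "\<dots> = 0"
        using ok_hdz[OF ok_drop[OF ok]] by simp
      finally show ?thesis by simp
    qed
    have len: "length (g # gs) = Suc (length gs)" by simp
    have "E (g # gs) (teich f) = g * f + (\<Sum>j<length (g # gs). ?t j)"
      using E_teich[of "g # gs" f] ok by simp
    also have "(\<Sum>j<length (g # gs). ?t j) = ?t 0 + (\<Sum>j<length gs. ?t (Suc j))"
      unfolding len by (rule sum.lessThan_Suc_shift)
    also have "?t 0 = uq p (hdz gs * Delta1 p f)"
      using uq_pow_0[of "uq p (hdz gs * Delta1 p f)"] by simp
    finally have eq: "E (g # gs) (teich f) = (f * g + uq p (hdz gs * Delta1 p f)) + (\<Sum>j<length gs. ?t (Suc j))"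
      by (simp add: mult.commute add.assoc)
    have "f ^ (p ^ i) dvd (\<Sum>j<length gs. ?t (Suc j))"
      by (intro dvd_sum t)
    then show ?thesis
      unfolding eq by (rule dvd_add_left_iff)
  qed
  then show ?case using IH by auto
qed simp

text \<open>Write \<open>w = [f][b] + V (shift w)\<close> and \<open>[b] = sec b + V y\<close>.
  Linearity over \<open>sec b\<close> reduces the main part to the value at \<open>[f]\<close>. The
  other parts are \<open>V\<close> of vectors with components divisible by \<open>f\<close>, covered
  by induction with exponent \<open>p^(i+1)\<close> and one application of \<open>u\<close>.\<close>

lemma teich_cond_imp_dvd_E:
  fixes f :: "('v::finite, 'k) mpoly"
  assumes "ok (tl gs)" "teich_cond f i gs" "\<And>j. f dvd wnth w j"
  shows "f ^ (p ^ i) dvd E gs w"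
  using assms
proof (induction gs arbitrary: i w)
  case (Cons g gs)
  then have ok: "ok (tl (g # gs))" and ok': "ok (tl gs)" by (auto simp: ok_tl)
  have IH: "f ^ (p ^ i) dvd E (g # gs) (ver x)" if "\<And>j. f dvd wnth x j" for x
  proof -
    have "f ^ (p ^ Suc i) dvd E gs x"
      by (rule Cons.IH) (use ok' Cons.prems(2) that in auto)
    then show ?thesis by (simp add: E_ver uq_p_dvd)
  qed
  obtain b where b: "wnth w 0 = f * b" using Cons.prems(3)[of 0] by (auto simp: dvd_def)
  let ?\<beta> = "red (teich b)"
  have "teich b = sec b + ver ?\<beta>" using sec_red[of "teich b"] by simp
  then have "teich f * teich b = teich f * (sec b + ver ?\<beta>)" by (rule arg_cong)
  also have "\<dots> = sec b * teich f + ver ?\<beta> * teich f"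
    by (simp add: algebra_simps)
  also have "ver ?\<beta> * teich f = ver (teich (f ^ p) * ?\<beta>)"
    by (simp only: ver_proj F_teich teich_power) (simp only: mult.commute)
  finally have "w = sec b * teich f + ver (teich (f ^ p) * ?\<beta>) + ver (shift w)"
    using witt_decomp[of w] by (simp add: b teich_mult)
  then have "E (g # gs) w = b * E (g # gs) (teich f) + E (g # gs) (ver (teich (f ^ p) * ?\<beta>)) + E (g # gs) (ver (shift w))"
    by (metis E_add[OF ok] E_sec_mult[OF ok])
  moreover have "f dvd (f ^ p) ^ (p ^ j) * c" for j c
    by (simp add: power_mult[symmetric] dvd_power flip: power_Suc)
  then have "f ^ (p ^ i) dvd E (g # gs) (ver (teich (f ^ p) * ?\<beta>))"
    by (intro IH) simp
  moreover have "f ^ (p ^ i) dvd E (g # gs) (ver (shift w))"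
    by (intro IH) (use Cons.prems(3) in simp)
  moreover have "f ^ (p ^ i) dvd b * E (g # gs) (teich f)"
    using Cons.prems(2) by (intro dvd_mult) simp
  ultimately show ?case by (simp only: dvd_add)
qed simp

end

section \<open>Ideals of the polynomial ring\<close>

lemma poly_ring_simps [simp]:
  "carrier poly_ring = UNIV" "a \<otimes>\<^bsub>poly_ring\<^esub> b = a * b" "a \<oplus>\<^bsub>poly_ring\<^esub> b = a + b"
  "\<one>\<^bsub>poly_ring\<^esub> = 1" "\<zero>\<^bsub>poly_ring\<^esub> = 0"
  by (simp_all add: poly_ring_def)

lemma cring_poly_ring: "cring (poly_ring :: ('v, 'k::comm_ring_1) mpoly ring)"
proof (rule cringI)
  show "abelian_group (poly_ring :: ('v, 'k) mpoly ring)"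
    by (rule abelian_groupI) (auto simp: ac_simps intro: exI[of _ "- _"] left_minus)
  show "comm_monoid (poly_ring :: ('v, 'k) mpoly ring)"
    by (rule comm_monoidI) (auto simp: ac_simps)
qed (auto simp: distrib_right)

interpretation poly_ring: cring "poly_ring :: ('v, 'k::comm_ring_1) mpoly ring"
  by (rule cring_poly_ring)

lemma poly_ring_a_inv [simp]: "\<ominus>\<^bsub>poly_ring\<^esub> a = - a"
  using poly_ring.minus_equality[of "- a" a] by simp

lemma ideal_poly_ring: "ideal J poly_ring \<longleftrightarrow> is_ideal (J :: ('v, 'k::comm_ring_1) mpoly set)"
proof
  assume "ideal J poly_ring"
  then interpret J: ideal J "poly_ring :: ('v, 'k) mpoly ring" .
  show "is_ideal J"
    using J.zero_closed J.a_closed J.I_l_closed by (auto simp: is_ideal_def)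
next
  assume J: "is_ideal J"
  show "ideal J poly_ring"
  proof (rule idealI)
    show "ring (poly_ring :: ('v, 'k) mpoly ring)" by (rule poly_ring.ring_axioms)
    show "subgroup J (add_monoid poly_ring)"
      by (rule poly_ring.add.subgroupI)
        (use is_idealD[OF J] in \<open>auto simp: a_inv_def[symmetric]\<close>)
  qed (use is_idealD[OF J] in auto)
qed

lemma cgenideal_poly_ring: "PIdl\<^bsub>poly_ring\<^esub> a = {c * a | c. True}"
  by (auto simp: cgenideal_def)

lemma set_add_poly_ring: "A <+>\<^bsub>poly_ring\<^esub> B = {a + b | a b. a \<in> A \<and> b \<in> B}"
  by (auto simp: set_add_defs)

lemma genideal_poly_ring: "Idl\<^bsub>poly_ring\<^esub> A = \<Inter> {J. is_ideal J \<and> A \<subseteq> J}"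
  by (simp add: genideal_def ideal_poly_ring)

lemma is_ideal_genideal: "is_ideal (Idl\<^bsub>poly_ring\<^esub> A)"
  unfolding genideal_poly_ring is_ideal_def by blast

lemma lookup_times_0: "Poly_Mapping.lookup (a * b) 0 = Poly_Mapping.lookup a 0 * Poly_Mapping.lookup b 0"
  for a b :: "('v, 'k::comm_ring_1) mpoly"
proof (induction a rule: poly_mapping_sum_induct)
  case (single m c)
  have z: "m + n = 0 \<longleftrightarrow> m = 0 \<and> n = 0" for m n :: "'v \<Rightarrow>\<^sub>0 nat"
    by (auto simp: poly_mapping_eq_iff lookup_add fun_eq_iff)
  show ?case
    by (induction b rule: poly_mapping_sum_induct)
      (auto simp: mult_single lookup_single when_def z lookup_add distrib_left)
qed (simp_all add: lookup_add distrib_right)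

lemma irrelevant_ideal_eq: "irrelevant_ideal = {a :: ('v, 'k::comm_ring_1) mpoly. Poly_Mapping.lookup a 0 = 0}"
proof
  have "is_ideal {a :: ('v, 'k) mpoly. Poly_Mapping.lookup a 0 = 0}"
    by (simp add: is_ideal_def lookup_add lookup_times_0)
  moreover have "range mvar \<subseteq> {a :: ('v, 'k) mpoly. Poly_Mapping.lookup a 0 = 0}"
    by (auto simp: mvar_def lookup_single when_def poly_mapping_eq_iff fun_eq_iff)
  ultimately show "irrelevant_ideal \<subseteq> {a :: ('v, 'k) mpoly. Poly_Mapping.lookup a 0 = 0}"
    unfolding irrelevant_ideal_def genideal_poly_ring by blast
  show "{a :: ('v, 'k) mpoly. Poly_Mapping.lookup a 0 = 0} \<subseteq> irrelevant_ideal"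
    unfolding irrelevant_ideal_def genideal_poly_ring
  proof clarify
    fix a :: "('v, 'k) mpoly" and J :: "('v, 'k) mpoly set"
    assume a: "Poly_Mapping.lookup a 0 = 0" and J: "is_ideal J" "range mvar \<subseteq> J"
    have "Poly_Mapping.single m c \<in> J" if nz: "m \<noteq> 0" for m c
    proof -
      obtain v where v: "Poly_Mapping.lookup m v \<noteq> 0"
        using nz by (auto simp: poly_mapping_eq_iff fun_eq_iff)
      define n where "n = m - Poly_Mapping.single v 1"
      have "m = n + Poly_Mapping.single v 1"
        using v by (intro poly_mapping_eqI) (auto simp: n_def lookup_add lookup_minus lookup_single when_def)
      then have "Poly_Mapping.single m c = Poly_Mapping.single n c * mvar v"
        by (simp add: mvar_def mult_single)
      moreover have "mvar v \<in> J" using J(2) by blast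
      ultimately show ?thesis
        using is_idealD(3)[OF J(1)] by simp
    qed
    moreover have "m \<noteq> 0" if "m \<in> Poly_Mapping.keys a" for m
      using a that by (auto simp: in_keys_iff)
    ultimately show "a \<in> J"
      by (subst poly_mapping_expand[of a]) (intro is_ideal_sum[OF J(1)], blast)
  qed
qed

lemma is_ideal_irrelevant: "is_ideal irrelevant_ideal"
  unfolding irrelevant_ideal_def by (rule is_ideal_genideal)

lemma irrelevant_mult_iff:
  "a * b \<in> irrelevant_ideal \<longleftrightarrow> a \<in> irrelevant_ideal \<or> b \<in> (irrelevant_ideal :: ('v, 'k::field) mpoly set)"
  by (simp add: irrelevant_ideal_eq lookup_times_0)

lemma one_not_irrelevant: "1 \<notin> (irrelevant_ideal :: ('v, 'k::field) mpoly set)"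
  by (simp add: irrelevant_ideal_eq)

context perfect_char
begin

text \<open>Membership is tested on coordinates in the monomial basis. The elements all of whose
  multiples have trace in the maximal ideal form an ideal containing the required
  \<open>p\<close>-th powers; conversely, \<open>uq_expand\<close> rebuilds an element from
  \<open>p\<close>-th powers of its coordinates.\<close>

lemma frob_power_irrelevant:
  fixes a :: "('v::finite, 'k) mpoly"
  shows "a \<in> frob_power p irrelevant_ideal \<longleftrightarrow>
    (\<forall>e\<in>box p. uq p (xpow (\<lambda>v. p - 1 - e v) * a) \<in> irrelevant_ideal)"
proof
  let ?J = "{a :: ('v, 'k) mpoly. \<forall>b. uq p (b * a) \<in> irrelevant_ideal}"
  have "is_ideal ?J"
    unfolding is_ideal_def
  proof (intro conjI ballI allI)
    show "0 \<in> ?J" using is_idealD(1)[OF is_ideal_irrelevant] by simp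
    show "x + y \<in> ?J" if "x \<in> ?J" "y \<in> ?J" for x y
      using that is_idealD(2)[OF is_ideal_irrelevant] by (auto simp: distrib_left uq_p_add)
    show "c * x \<in> ?J" if "x \<in> ?J" for x c
      using that by (auto simp: mult.assoc[symmetric])
  qed
  moreover have "(\<lambda>a. a ^ p) ` irrelevant_ideal \<subseteq> ?J"
    using is_idealD(6)[OF is_ideal_irrelevant] by (auto simp: mult.commute[of _ "_ ^ p"] uq_p_frob_mult)
  moreover assume "a \<in> frob_power p irrelevant_ideal"
  ultimately have "a \<in> ?J"
    unfolding frob_power_def genideal_poly_ring by blast
  then show "\<forall>e\<in>box p. uq p (xpow (\<lambda>v. p - 1 - e v) * a) \<in> irrelevant_ideal" by simp
next
  assume *: "\<forall>e\<in>box p. uq p (xpow (\<lambda>v. p - 1 - e v) * a) \<in> irrelevant_ideal"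
  have id: "is_ideal (frob_power p (irrelevant_ideal :: ('v, 'k) mpoly set))"
    unfolding frob_power_def by (rule is_ideal_genideal)
  have "b ^ p \<in> frob_power p irrelevant_ideal" if "b \<in> irrelevant_ideal" for b :: "('v, 'k) mpoly"
    using that unfolding frob_power_def genideal_poly_ring by blast
  then have "uq p (xpow (\<lambda>v. p - 1 - e v) * a) ^ p * xpow e \<in> frob_power p irrelevant_ideal" if "e \<in> box p" for e
    using * that is_idealD(6)[OF id] by blast
  then have "(\<Sum>e\<in>box p. uq p (xpow (\<lambda>v. p - 1 - e v) * a) ^ p * xpow e) \<in> frob_power p irrelevant_ideal"
    by (intro is_ideal_sum[OF id])
  then show "a \<in> frob_power p irrelevant_ideal"
    using uq_p_expand[of a] by simp
qed

text \<open>The coordinates of an element are traces of its multiples, and these stay in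
  \<open>J\<close>.\<close>

lemma not_subset_frob_power:
  fixes J :: "('v::finite, 'k) mpoly set"
  assumes "is_ideal J"
  shows "\<not> J \<subseteq> frob_power p irrelevant_ideal \<longleftrightarrow> (\<exists>g\<in>J. uq p g \<notin> irrelevant_ideal)"
proof
  assume "\<not> J \<subseteq> frob_power p irrelevant_ideal"
  then obtain a e where "a \<in> J" "uq p (xpow (\<lambda>v. p - 1 - e v) * a) \<notin> irrelevant_ideal"
    using frob_power_irrelevant by blast
  then show "\<exists>g\<in>J. uq p g \<notin> irrelevant_ideal"
    using is_idealD(3)[OF assms] by blast
next
  assume "\<exists>g\<in>J. uq p g \<notin> irrelevant_ideal"
  then obtain g where g: "g \<in> J" "uq p g \<notin> irrelevant_ideal" by blast
  have box: "(\<lambda>_ :: 'v. p - 1) \<in> box p"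
    using p_gt_1 by (simp add: box_def)
  have "g \<notin> frob_power p irrelevant_ideal"
  proof
    assume "g \<in> frob_power p irrelevant_ideal"
    then have "uq p (xpow (\<lambda>v. p - 1 - (\<lambda>_ :: 'v. p - 1) v) * g) \<in> irrelevant_ideal"
      unfolding frob_power_irrelevant using box by (rule bspec)
    then show False using g(2) by simp
  qed
  then show "\<not> J \<subseteq> frob_power p irrelevant_ideal" using g by blast
qed

section \<open>The ideals \<open>I\<^sub>n\<close>\<close>

lemma theta_add: "theta p f (a + b) = theta p f a + theta p (f :: ('v::finite, 'k) mpoly) b"
  by (simp add: theta_def dual_u_eq distrib_left uq_p_add)

lemma theta_frob_mult: "theta p f (c ^ p * a) = c * theta p (f :: ('v::finite, 'k) mpoly) a"
proof -
  have "Delta1 p (f ^ (p - 1)) * (c ^ p * a) = c ^ p * (Delta1 p (f ^ (p - 1)) * a)"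
    by (simp only: mult_ac)
  then show ?thesis
    unfolding theta_def dual_u_eq by (simp only: uq_p_frob_mult)
qed

lemma theta_step_eq: "theta_step p f J = {theta p f a + c * f ^ (p - 1) | a c. a \<in> J \<and> uq p a = 0}"
  for f :: "('v::finite, 'k) mpoly"
  unfolding theta_step_def set_add_poly_ring cgenideal_poly_ring dual_u_eq by blast

lemma is_ideal_theta_step:
  fixes f :: "('v::finite, 'k) mpoly"
  assumes J: "is_ideal J"
  shows "is_ideal (theta_step p f J)"
  unfolding is_ideal_def
proof (intro conjI ballI allI)
  have "theta p f 0 + 0 * f ^ (p - 1) = 0"
    using theta_add[of f 0 0] by simp
  then show "0 \<in> theta_step p f J"
    unfolding theta_step_eq using is_idealD(1)[OF J] uq_p_0 by (metis (mono_tags, lifting) mem_Collect_eq)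
next
  fix x y assume "x \<in> theta_step p f J" "y \<in> theta_step p f J"
  then obtain a b c d where x: "x = theta p f a + c * f ^ (p - 1)" "a \<in> J" "uq p a = 0"
    and y: "y = theta p f b + d * f ^ (p - 1)" "b \<in> J" "uq p b = 0"
    unfolding theta_step_eq by blast
  have "x + y = theta p f (a + b) + (c + d) * f ^ (p - 1)"
    by (simp add: x y theta_add algebra_simps)
  moreover have "a + b \<in> J" "uq p (a + b) = 0"
    using x y is_idealD(2)[OF J] by (simp_all add: uq_p_add)
  ultimately show "x + y \<in> theta_step p f J"
    unfolding theta_step_eq by blast
next
  fix x y assume "x \<in> theta_step p f J"
  then obtain a c where x: "x = theta p f a + c * f ^ (p - 1)" "a \<in> J" "uq p a = 0"
    unfolding theta_step_eq by blast
  have "y * x = theta p f (y ^ p * a) + (y * c) * f ^ (p - 1)"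
    by (simp add: x theta_frob_mult distrib_left mult.assoc)
  moreover have "y ^ p * a \<in> J" "uq p (y ^ p * a) = 0"
    using x is_idealD(3)[OF J] by (simp_all add: uq_p_frob_mult)
  ultimately show "y * x \<in> theta_step p f J"
    unfolding theta_step_eq by blast
qed

lemma theta_step_mono: "I \<subseteq> J \<Longrightarrow> theta_step p f I \<subseteq> theta_step p (f :: ('v::finite, 'k) mpoly) J"
  unfolding theta_step_eq by blast

lemma I_seq_1: "I_seq p f (Suc 0) = {c * f ^ (p - 1) | c. True}"
  by (simp add: cgenideal_poly_ring)

lemma is_ideal_I_seq: "is_ideal (I_seq p (f :: ('v::finite, 'k) mpoly) (Suc n))"
proof (induction n)
  case 0
  show ?case
    unfolding I_seq_1 is_ideal_def
  proof (intro conjI ballI allI)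
    show "0 \<in> {c * f ^ (p - 1) | c. True}" by (rule CollectI, rule exI[of _ 0]) simp
  next
    fix x y assume "x \<in> {c * f ^ (p - 1) | c. True}" "y \<in> {c * f ^ (p - 1) | c. True}"
    then show "x + y \<in> {c * f ^ (p - 1) | c. True}" by (auto simp: distrib_right[symmetric])
  next
    fix x y assume "x \<in> {c * f ^ (p - 1) | c. True}"
    then show "y * x \<in> {c * f ^ (p - 1) | c. True}" by (auto simp: mult.assoc[symmetric])
  qed
qed (simp add: is_ideal_theta_step)

lemma I_seq_1_subset_theta_step:
  fixes f :: "('v::finite, 'k) mpoly"
  assumes "is_ideal J"
  shows "I_seq p f (Suc 0) \<subseteq> theta_step p f J"
proof -
  have "theta p f 0 = 0" using theta_add[of f 0 0] by simp
  then have "c * f ^ (p - 1) = theta p f 0 + c * f ^ (p - 1) \<and> 0 \<in> J \<and> uq p (0 :: ('v, 'k) mpoly) = 0" for c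
    using is_idealD(1)[OF assms] by simp
  then show ?thesis
    unfolding I_seq_1 theta_step_eq by blast
qed

lemma I_seq_mono: "I_seq p f (Suc n) \<subseteq> I_seq p (f :: ('v::finite, 'k) mpoly) (Suc (Suc n))"
proof (induction n)
  case 0
  show ?case
    using I_seq_1_subset_theta_step[OF is_ideal_I_seq[of f 0], of f] by simp
next
  case (Suc n)
  show ?case
    unfolding I_seq.simps(3)[of p f "Suc n"] I_seq.simps(3)[of p f n]
    using theta_step_mono[OF Suc] by simp
qed

text \<open>By Noetherianity the chain stops growing at some stage; this stage is the greatest
  member of the family, and a further step does not change it.\<close>

lemma I_infty_eq:
  fixes f :: "('v::finite, 'k) mpoly"
  obtains N where "I_infty p f = I_seq p f (Suc N)" "\<And>n. I_seq p f (Suc n) \<subseteq> I_infty p f"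
    "theta_step p f (I_infty p f) = I_infty p f"
proof -
  obtain N where N: "\<forall>n\<ge>N. I_seq p f (Suc n) = I_seq p f (Suc N)"
    using mpoly_ideal_chain_stabilizes[of "\<lambda>n. I_seq p f (Suc n)"] is_ideal_I_seq I_seq_mono by blast
  have le: "I_seq p f (Suc n) \<subseteq> I_seq p f (Suc N)" for n
  proof (cases "n \<le> N")
    case True
    then show ?thesis
      using lift_Suc_mono_le[of "\<lambda>n. I_seq p f (Suc n)", OF I_seq_mono] by blast
  next
    case False
    then have "n \<ge> N" by simp
    then show ?thesis using N by blast
  qed
  have "I_infty p f = I_seq p f (Suc N)"
    unfolding I_infty_def
  proof (rule Greatest_equality)
    show "I_seq p f (Suc N) \<in> {I_seq p f n | n. 1 \<le> n}" by auto
    fix J assume "J \<in> {I_seq p f n | n. 1 \<le> n}"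
    then obtain n where "J = I_seq p f n" "1 \<le> n" by blast
    then show "J \<subseteq> I_seq p f (Suc N)"
      using le[of "n - 1"] by simp
  qed
  moreover have "theta_step p f (I_seq p f (Suc N)) = I_seq p f (Suc N)"
    using N[rule_format, of "Suc N"] by simp
  ultimately show thesis using that le by simp
qed

lemma I_infty_minimal:
  fixes f :: "('v::finite, 'k) mpoly"
  assumes J: "is_ideal J" "theta_step p f J \<subseteq> J"
  shows "I_infty p f \<subseteq> J"
proof -
  have "I_seq p f (Suc n) \<subseteq> J" for n
  proof (induction n)
    case 0
    show ?case using I_seq_1_subset_theta_step[OF J(1)] J(2) by blast
  next
    case (Suc n)
    show ?case using theta_step_mono[OF Suc] J(2) by simp blast
  qed
  then show ?thesis by (metis I_infty_eq)
qed

lemma power_split: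
  assumes "i \<ge> 1"
  shows "(x :: 'a::comm_monoid_mult) ^ (p ^ i - p) * x ^ p = x ^ (p ^ i)"
    and "x ^ (p ^ Suc i - p) = (x ^ (p ^ i - 1)) ^ p"
    and "x ^ (p - 1) * x = x ^ p"
proof -
  have "p \<le> p ^ i" using assms p_gt_1 by (simp add: self_le_power)
  then show "x ^ (p ^ i - p) * x ^ p = x ^ (p ^ i)"
    by (simp flip: power_add)
  have "p ^ Suc i - p = (p ^ i - 1) * p"
    by (simp add: diff_mult_distrib2 mult.commute[of _ p])
  then show "x ^ (p ^ Suc i - p) = (x ^ (p ^ i - 1)) ^ p"
    by (simp only: power_mult)
  show "x ^ (p - 1) * x = x ^ p"
    by (metis p_pos power_minus_mult)
qed

text \<open>The origin of the exponents \<open>p^i - p\<close>: the factor of the next coordinate is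
  the \<open>p\<close>-th power of \<open>f^(p^i - 1)\<close>, which equals
  \<open>f * f^(p^i - p) * f^(p - 2)\<close>. So \<open>u\<close> releases one factor
  \<open>f\<close>, the scaling of the \<open>i\<close>-th coordinate, and the
  \<open>f^(p - 2)\<close> that occurs in \<open>theta_eq\<close>.\<close>

lemma step_relation:
  fixes f g :: "('v::finite, 'k) mpoly"
  assumes i: "i \<ge> 1" and u: "uq p g = 0"
  shows "uq p ((f ^ (p ^ Suc i - p) * g) * Delta1 p f) = - (f * (f ^ (p ^ i - p) * theta p f g))"
proof -
  have p2: "f * f ^ (p - 2) = f ^ (p - 1)"
    using p_gt_1 by (metis Suc_1 Suc_diff_Suc diff_Suc_1 power_Suc One_nat_def)
  have pw: "f ^ (p ^ i - p) * f ^ (p - 1) = f ^ (p ^ i - 1)"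
  proof -
    have "p \<le> p ^ i" using i p_gt_1 by (simp add: self_le_power)
    then show ?thesis using p_gt_1 by (simp flip: power_add)
  qed
  have "uq p ((f ^ (p ^ Suc i - p) * g) * Delta1 p f) = f ^ (p ^ i - 1) * uq p (g * Delta1 p f)"
    unfolding power_split(2)[OF i] mult.assoc by (rule uq_p_frob_mult)
  also have "\<dots> = f ^ (p ^ i - p) * (f * f ^ (p - 2)) * uq p (g * Delta1 p f)"
    unfolding p2 pw ..
  also have "\<dots> = - (f * (f ^ (p ^ i - p) * theta p f g))"
    unfolding theta_eq[OF u] by (simp add: mult_ac)
  finally show ?thesis .
qed

text \<open>Unfolding the recursion of \<open>I_seq\<close>, the \<open>theta\<close> part of
  \<open>g\<close> cancels against the trace of the next coordinate, and the multiple of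
  \<open>f^(p-1)\<close> becomes a multiple of \<open>f^(p^i)\<close>. For \<open>i = 1\<close> the
  scaling factor is \<open>f^0\<close>, so \<open>g\<close> itself is the head coordinate.\<close>

lemma I_seq_imp_step_cond:
  fixes f :: "('v::finite, 'k) mpoly"
  assumes "g \<in> I_seq p f (Suc n)" "i \<ge> 1"
  shows "\<exists>gs. length gs = n \<and> ok gs \<and> step_cond f i (f ^ (p ^ i - p) * g # gs)"
  using assms
proof (induction n arbitrary: g i)
  case 0
  then obtain c where g: "g = c * f ^ (p - 1)" unfolding I_seq_1 by blast
  have "f * (f ^ (p ^ i - p) * g) = f ^ (p ^ i) * c"
    unfolding g power_split(1)[OF 0(2), symmetric] power_split(3)[OF 0(2), symmetric] by (simp add: mult_ac)
  then show ?case by simp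
next
  case (Suc n)
  then obtain h c where g: "g = theta p f h + c * f ^ (p - 1)" and h: "h \<in> I_seq p f (Suc n)" "uq p h = 0"
    unfolding I_seq.simps(3) theta_step_eq by blast
  obtain gs where gs: "length gs = n" "ok gs" "step_cond f (Suc i) (f ^ (p ^ Suc i - p) * h # gs)"
    using Suc.IH[OF h(1), of "Suc i"] by auto
  have "f * (f ^ (p ^ i - p) * g) + uq p ((f ^ (p ^ Suc i - p) * h) * Delta1 p f) = f ^ (p ^ i) * c"
    unfolding step_relation[OF Suc.prems(2) h(2)] g
      power_split(1)[OF Suc.prems(2), symmetric] power_split(3)[OF Suc.prems(2), symmetric]
    by (simp add: algebra_simps)
  moreover have "uq p (f ^ (p ^ Suc i - p) * h) = 0"
    unfolding power_split(2)[OF Suc.prems(2)] by (simp add: uq_p_frob_mult h)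
  ultimately show ?case
    using gs by (intro exI[of _ "f ^ (p ^ Suc i - p) * h # gs"]) simp
qed

text \<open>The last coordinate is a multiple of \<open>f^(p^i - 1)\<close>, and the claim
  propagates from there to the head. Since \<open>S\<close> is a domain, powers of \<open>f\<close>
  cancel; in particular \<open>u h = 0\<close> gives \<open>u h' = 0\<close> for the quotient
  \<open>h'\<close>.\<close>

lemma step_cond_imp_I_seq:
  fixes f :: "('v::finite, 'k) mpoly"
  assumes "step_cond f i (g # gs)" "ok gs" "i \<ge> 1" "f \<noteq> 0"
  shows "\<exists>g'\<in>I_seq p f (Suc (length gs)). g = f ^ (p ^ i - p) * g'"
  using assms
proof (induction gs arbitrary: i g)
  case Nil
  then obtain c where "f * g = f ^ (p ^ i) * c" by (auto simp: dvd_def)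
  also have "\<dots> = f * (f ^ (p ^ i - p) * (c * f ^ (p - 1)))"
    unfolding power_split(1)[OF Nil(3), symmetric] power_split(3)[OF Nil(3), symmetric] by (simp add: mult_ac)
  finally have "g = f ^ (p ^ i - p) * (c * f ^ (p - 1))"
    using mpoly_mult_left_cancel Nil(4) by blast
  moreover have "c * f ^ (p - 1) \<in> I_seq p f (Suc (length []))"
    unfolding list.size(3) I_seq_1 by blast
  ultimately show ?case by blast
next
  case (Cons h gs)
  obtain h' where h': "h' \<in> I_seq p f (Suc (length gs))" "h = f ^ (p ^ Suc i - p) * h'"
    using Cons.IH[of "Suc i" h] Cons.prems by auto
  have "f ^ (p ^ i - 1) * uq p h' = uq p h"
    unfolding h'(2) power_split(2)[OF Cons.prems(3)] by (simp add: uq_p_frob_mult)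
  also have "\<dots> = 0" using Cons.prems by simp
  finally have u: "uq p h' = 0"
    using Cons.prems(4) mpoly_power_eq_0[of f "p ^ i - 1"] mpoly_mult_eq_0 by blast
  obtain c where "f * g + uq p (h * Delta1 p f) = f ^ (p ^ i) * c"
    using Cons.prems(1) by (auto simp: dvd_def)
  then have "f * g = f * (f ^ (p ^ i - p) * (theta p f h' + c * f ^ (p - 1)))"
    unfolding h'(2) step_relation[OF Cons.prems(3) u]
      power_split(1)[OF Cons.prems(3), symmetric] power_split(3)[OF Cons.prems(3), symmetric]
    by (simp add: algebra_simps)
  then have "g = f ^ (p ^ i - p) * (theta p f h' + c * f ^ (p - 1))"
    using mpoly_mult_left_cancel Cons.prems(4) by blast
  moreover have "theta p f h' + c * f ^ (p - 1) \<in> I_seq p f (Suc (length (h # gs)))"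
    using h'(1) u unfolding length_Cons I_seq.simps(3) theta_step_eq by blast
  ultimately show ?case by blast
qed

theorem I_seq_iff_teich_cond:
  fixes f :: "('v::finite, 'k) mpoly"
  assumes "f \<noteq> 0"
  shows "g \<in> I_seq p f (Suc n) \<longleftrightarrow> (\<exists>gs. length gs = n \<and> ok gs \<and> teich_cond f 1 (g # gs))"
proof -
  have "step_cond f 1 (g # gs) \<longleftrightarrow> teich_cond f 1 (g # gs)" if "ok gs" for gs
    using teich_cond_iff_step_cond[of 1 "g # gs" f] that by simp
  moreover have "g \<in> I_seq p f (Suc (length gs))" if "ok gs" "step_cond f 1 (g # gs)" for gs
    using step_cond_imp_I_seq[OF that(2,1) _ assms] by simp
  moreover have "\<exists>gs. length gs = n \<and> ok gs \<and> step_cond f 1 (g # gs)" if "g \<in> I_seq p f (Suc n)"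
    using I_seq_imp_step_cond[OF that, of 1] by simp
  ultimately show ?thesis by blast
qed

end

section \<open>Integral polynomials in rings with carrier\<close>

definition mon_eval :: "('a, 'x) ring_scheme \<Rightarrow> ('v \<Rightarrow> 'a) \<Rightarrow> ('v \<Rightarrow>\<^sub>0 nat) \<Rightarrow> 'a"
  where "mon_eval A z m = (\<Otimes>\<^bsub>A\<^esub>v\<in>Poly_Mapping.keys m. z v [^]\<^bsub>A\<^esub> Poly_Mapping.lookup m v)"

definition poly_vars :: "('v, 'k::zero) mpoly \<Rightarrow> 'v set"
  where "poly_vars P = (\<Union>m\<in>Poly_Mapping.keys P. Poly_Mapping.keys m)"

lemma int_poly_eval_alt:
  "int_poly_eval A z P = (\<Oplus>\<^bsub>A\<^esub>m\<in>Poly_Mapping.keys P. [Poly_Mapping.lookup P m] \<cdot>\<^bsub>A\<^esub> mon_eval A z m)"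
  by (simp add: int_poly_eval_def mon_eval_def)

context ring_hom_cring
begin

lemma hom_finsum_carrier:
  "g \<in> F \<rightarrow> carrier R \<Longrightarrow> h (finsum R g F) = finsum S (\<lambda>x. h (g x)) F"
proof (induction F rule: infinite_finite_induct)
  case (insert x F)
  then have "(\<lambda>x. h (g x)) \<in> F \<rightarrow> carrier S" by auto
  then show ?case using insert by (simp add: Pi_def)
qed simp_all

lemma hom_finprod_carrier:
  "g \<in> F \<rightarrow> carrier R \<Longrightarrow> h (finprod R g F) = finprod S (\<lambda>x. h (g x)) F"
proof (induction F rule: infinite_finite_induct)
  case (insert x F)
  then have "(\<lambda>x. h (g x)) \<in> F \<rightarrow> carrier S" by auto
  then show ?case using insert by (simp add: Pi_def)
qed simp_all

lemma hom_nat_pow_carrier: "x \<in> carrier R \<Longrightarrow> h (x [^]\<^bsub>R\<^esub> (n::nat)) = h x [^]\<^bsub>S\<^esub> n"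
  by (induction n) simp_all

lemma hom_add_pow_nat: "x \<in> carrier R \<Longrightarrow> h ([(n::nat)] \<cdot>\<^bsub>R\<^esub> x) = [n] \<cdot>\<^bsub>S\<^esub> h x"
proof (induction n)
  case 0
  then show ?case by (simp add: add_pow_def nat_pow_def)
next
  case (Suc n)
  then show ?case
    by (simp add: R.add.nat_pow_Suc S.add.nat_pow_Suc R.add.nat_pow_closed)
qed

lemma hom_add_pow_int: "x \<in> carrier R \<Longrightarrow> h ([(k::int)] \<cdot>\<^bsub>R\<^esub> x) = [k] \<cdot>\<^bsub>S\<^esub> h x"
  by (cases "k \<ge> 0") (simp_all add: add_pow_int_ge add_pow_int_lt hom_add_pow_nat)

lemma hom_mon_eval:
  assumes "\<And>v. v \<in> Poly_Mapping.keys m \<Longrightarrow> z v \<in> carrier R"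
  shows "h (mon_eval R z m) = mon_eval S (\<lambda>v. h (z v)) m"
proof -
  have "h (mon_eval R z m) = (\<Otimes>\<^bsub>S\<^esub>v\<in>Poly_Mapping.keys m. h (z v [^]\<^bsub>R\<^esub> Poly_Mapping.lookup m v))"
    unfolding mon_eval_def by (intro hom_finprod_carrier) (use assms in auto)
  also have "\<dots> = mon_eval S (\<lambda>v. h (z v)) m"
    unfolding mon_eval_def by (intro S.finprod_cong') (use assms hom_nat_pow_carrier in auto)
  finally show ?thesis .
qed

lemma mon_eval_closed_R:
  "(\<And>v. v \<in> Poly_Mapping.keys m \<Longrightarrow> z v \<in> carrier R) \<Longrightarrow> mon_eval R z m \<in> carrier R"
  unfolding mon_eval_def by (intro R.finprod_closed) auto

lemma hom_int_poly_eval: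
  assumes "\<And>v. v \<in> poly_vars P \<Longrightarrow> z v \<in> carrier R"
  shows "h (int_poly_eval R z P) = int_poly_eval S (\<lambda>v. h (z v)) P"
proof -
  have z: "z v \<in> carrier R" if "m \<in> Poly_Mapping.keys P" "v \<in> Poly_Mapping.keys m" for m v
    using assms that by (auto simp: poly_vars_def)
  have c: "mon_eval R z m \<in> carrier R" if "m \<in> Poly_Mapping.keys P" for m
    using z[OF that] by (rule mon_eval_closed_R)
  have hm: "h (mon_eval R z m) = mon_eval S (\<lambda>v. h (z v)) m" if "m \<in> Poly_Mapping.keys P" for m
    using z[OF that] by (rule hom_mon_eval)
  have "h (int_poly_eval R z P) = (\<Oplus>\<^bsub>S\<^esub>m\<in>Poly_Mapping.keys P. h ([Poly_Mapping.lookup P m] \<cdot>\<^bsub>R\<^esub> mon_eval R z m))"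
    unfolding int_poly_eval_alt by (intro hom_finsum_carrier) (use c R.add.int_pow_closed in auto)
  also have "\<dots> = int_poly_eval S (\<lambda>v. h (z v)) P"
    unfolding int_poly_eval_alt
  proof (intro S.finsum_cong' refl)
    show "(\<lambda>m. [Poly_Mapping.lookup P m] \<cdot>\<^bsub>S\<^esub> mon_eval S (\<lambda>v. h (z v)) m) \<in> Poly_Mapping.keys P \<rightarrow> carrier S"
      by (intro funcsetI S.add.int_pow_closed) (simp add: hm[symmetric] c)
    show "h ([Poly_Mapping.lookup P m] \<cdot>\<^bsub>R\<^esub> mon_eval R z m) = [Poly_Mapping.lookup P m] \<cdot>\<^bsub>S\<^esub> mon_eval S (\<lambda>v. h (z v)) m"
      if "m \<in> Poly_Mapping.keys P" for m
      using c[OF that] hm[OF that] by (simp add: hom_add_pow_int)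
  qed
  finally show ?thesis .
qed

end

context cring
begin

lemma mon_eval_closed:
  "(\<And>v. v \<in> Poly_Mapping.keys m \<Longrightarrow> z v \<in> carrier R) \<Longrightarrow> mon_eval R z m \<in> carrier R"
  unfolding mon_eval_def by (intro finprod_closed) auto

lemma int_poly_eval_closed:
  assumes "\<And>v. v \<in> poly_vars P \<Longrightarrow> z v \<in> carrier R"
  shows "int_poly_eval R z P \<in> carrier R"
  unfolding int_poly_eval_alt
  by (intro finsum_closed funcsetI add.int_pow_closed mon_eval_closed) (use assms in \<open>auto simp: poly_vars_def\<close>)

lemma int_poly_eval_cong:
  assumes eq: "\<And>v. v \<in> poly_vars P \<Longrightarrow> z v = z' v" and c: "\<And>v. v \<in> poly_vars P \<Longrightarrow> z' v \<in> carrier R"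
  shows "int_poly_eval R z P = int_poly_eval R z' P"
  unfolding int_poly_eval_alt
proof (intro finsum_cong' refl)
  show "(\<lambda>m. [Poly_Mapping.lookup P m] \<cdot> mon_eval R z' m) \<in> Poly_Mapping.keys P \<rightarrow> carrier R"
    by (intro funcsetI add.int_pow_closed mon_eval_closed) (use c in \<open>auto simp: poly_vars_def\<close>)
  fix m assume m: "m \<in> Poly_Mapping.keys P"
  have "mon_eval R z m = mon_eval R z' m"
    unfolding mon_eval_def
  proof (intro finprod_cong' refl)
    show "(\<lambda>v. z' v [^] Poly_Mapping.lookup m v) \<in> Poly_Mapping.keys m \<rightarrow> carrier R"
      by (intro funcsetI nat_pow_closed c) (use m in \<open>auto simp: poly_vars_def\<close>)
    fix v assume "v \<in> Poly_Mapping.keys m"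
    then have "v \<in> poly_vars P" using m by (auto simp: poly_vars_def)
    then show "z v [^] Poly_Mapping.lookup m v = z' v [^] Poly_Mapping.lookup m v"
      by (simp add: eq)
  qed
  then show "[Poly_Mapping.lookup P m] \<cdot> mon_eval R z m = [Poly_Mapping.lookup P m] \<cdot> mon_eval R z' m"
    by simp
qed

lemma finprod_nat_pow:
  assumes "c \<in> carrier R" "finite F"
  shows "(\<Otimes>v\<in>F. c [^] (g v :: nat)) = c [^] (\<Sum>v\<in>F. g v)"
  using assms(2) by (induction F rule: finite_induct) (use assms(1) in \<open>auto simp: nat_pow_mult\<close>)

lemma mon_eval_scale:
  assumes c: "c \<in> carrier R" and z: "\<And>v. v \<in> Poly_Mapping.keys m \<Longrightarrow> z v \<in> carrier R"
  shows "mon_eval R (\<lambda>v. c [^] (wt v :: nat) \<otimes> z v) m =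
    c [^] (\<Sum>v\<in>Poly_Mapping.keys m. wt v * Poly_Mapping.lookup m v) \<otimes> mon_eval R z m"
proof -
  let ?k = "Poly_Mapping.lookup m"
  have "mon_eval R (\<lambda>v. c [^] wt v \<otimes> z v) m =
      (\<Otimes>v\<in>Poly_Mapping.keys m. c [^] (wt v * ?k v) \<otimes> z v [^] ?k v)"
    unfolding mon_eval_def
    by (intro finprod_cong') (use c z in \<open>auto simp: nat_pow_distrib nat_pow_pow\<close>)
  also have "\<dots> = (\<Otimes>v\<in>Poly_Mapping.keys m. c [^] (wt v * ?k v)) \<otimes> mon_eval R z m"
    unfolding mon_eval_def by (intro finprod_multf) (use c z in auto)
  finally show ?thesis by (simp add: finprod_nat_pow c)
qed

lemma int_poly_eval_scale:
  assumes c: "c \<in> carrier R" and z: "\<And>v. v \<in> poly_vars P \<Longrightarrow> z v \<in> carrier R"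
    and w: "\<And>m. m \<in> Poly_Mapping.keys P \<Longrightarrow> (\<Sum>v\<in>Poly_Mapping.keys m. wt v * Poly_Mapping.lookup m v) = w"
  shows "int_poly_eval R (\<lambda>v. c [^] (wt v :: nat) \<otimes> z v) P = c [^] w \<otimes> int_poly_eval R z P"
proof -
  have z': "z v \<in> carrier R" if "m \<in> Poly_Mapping.keys P" "v \<in> Poly_Mapping.keys m" for m v
    using z that by (auto simp: poly_vars_def)
  have cl: "mon_eval R z m \<in> carrier R" if "m \<in> Poly_Mapping.keys P" for m
    using z'[OF that] by (rule mon_eval_closed)
  have "int_poly_eval R (\<lambda>v. c [^] wt v \<otimes> z v) P =
      (\<Oplus>m\<in>Poly_Mapping.keys P. c [^] w \<otimes> [Poly_Mapping.lookup P m] \<cdot> mon_eval R z m)"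
    unfolding int_poly_eval_alt
    by (intro finsum_cong') (use c cl z' w in \<open>auto simp: mon_eval_scale add_pow_rdistr_int intro!: add.int_pow_closed\<close>)
  also have "\<dots> = c [^] w \<otimes> int_poly_eval R z P"
    unfolding int_poly_eval_alt
    by (intro finsum_rdistr[symmetric]) (use c cl in \<open>auto intro!: add.int_pow_closed\<close>)
  finally show ?thesis .
qed

end

section \<open>Evaluation in the polynomial ring as a ring with carrier\<close>

lemma poly_ring_nat_pow [simp]: "a [^]\<^bsub>poly_ring\<^esub> (n::nat) = a ^ n"
  by (induction n) (simp_all add: mult.commute)

lemma poly_ring_finsum: "finsum poly_ring g F = sum g F"
  by (induction F rule: infinite_finite_induct) simp_all

lemma poly_ring_finprod: "finprod poly_ring g F = prod g F"
  by (induction F rule: infinite_finite_induct) simp_all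

lemma poly_ring_add_pow: "[(k::int)] \<cdot>\<^bsub>poly_ring\<^esub> a = of_int k * a"
proof -
  have n: "[(n::nat)] \<cdot>\<^bsub>poly_ring\<^esub> a = of_nat n * a" for n
  proof (induction n)
    case 0
    then show ?case by (simp add: add_pow_def nat_pow_def)
  next
    case (Suc n)
    then show ?case by (simp add: poly_ring.add.nat_pow_Suc distrib_right add.commute)
  qed
  show ?thesis
    by (cases "k \<ge> 0") (simp_all add: add_pow_int_ge add_pow_int_lt n)
qed

lemma int_poly_eval_poly_ring: "int_poly_eval poly_ring z P = ev z P"
  by (simp add: int_poly_eval_def ev_def mon_def poly_ring_finsum poly_ring_finprod poly_ring_add_pow)

section \<open>The Witt polynomials are isobaric\<close>

text \<open>The variables of index \<open>j\<close> have weight \<open>p^j\<close>. The bound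
  \<open>N\<close> makes the polynomials meaningful on vectors of finite length; homogeneity makes
  them compatible with scaling by Teichmueller elements.\<close>

definition isobaric :: "nat \<Rightarrow> nat \<Rightarrow> nat \<Rightarrow> (nat + nat, int) mpoly set"
  where "isobaric p N w = {P. \<forall>m\<in>Poly_Mapping.keys P.
    (\<forall>v\<in>Poly_Mapping.keys m. case_sum id id v \<le> N) \<and>
    (\<Sum>v\<in>Poly_Mapping.keys m. p ^ case_sum id id v * Poly_Mapping.lookup m v) = w}"

lemma weight_add:
  fixes m n :: "'v \<Rightarrow>\<^sub>0 nat"
  shows "(\<Sum>v\<in>Poly_Mapping.keys (m + n). wt v * Poly_Mapping.lookup (m + n) v) =
    (\<Sum>v\<in>Poly_Mapping.keys m. wt v * Poly_Mapping.lookup m v) +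
    (\<Sum>v\<in>Poly_Mapping.keys n. wt v * Poly_Mapping.lookup n v :: nat)"
proof -
  let ?K = "Poly_Mapping.keys m \<union> Poly_Mapping.keys n"
  have s: "(\<Sum>v\<in>Poly_Mapping.keys k. wt v * Poly_Mapping.lookup k v) = (\<Sum>v\<in>?K. wt v * Poly_Mapping.lookup k v)"
    if "Poly_Mapping.keys k \<subseteq> ?K" for k
    using that by (intro sum.mono_neutral_left) (auto simp: in_keys_iff)
  show ?thesis
    unfolding s[OF keys_add] s[of m, OF Un_upper1] s[of n, OF Un_upper2]
    by (simp add: lookup_add distrib_left sum.distrib)
qed

lemma isobaric_0: "0 \<in> isobaric p N w"
  by (simp add: isobaric_def)

lemma isobaric_1: "1 \<in> isobaric p N 0"
  by (simp add: isobaric_def)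

lemma isobaric_add: "P \<in> isobaric p N w \<Longrightarrow> Q \<in> isobaric p N w \<Longrightarrow> P + Q \<in> isobaric p N w"
  using keys_add[of P Q] unfolding isobaric_def by blast

lemma isobaric_diff: "P \<in> isobaric p N w \<Longrightarrow> Q \<in> isobaric p N w \<Longrightarrow> P - Q \<in> isobaric p N w"
  using keys_diff[of P Q] unfolding isobaric_def by blast

lemma isobaric_sum: "(\<And>i. i \<in> A \<Longrightarrow> g i \<in> isobaric p N w) \<Longrightarrow> sum g A \<in> isobaric p N w"
  by (induction A rule: infinite_finite_induct) (auto simp: isobaric_0 isobaric_add)

lemma isobaric_mult:
  assumes "P \<in> isobaric p N w" "Q \<in> isobaric p N w'"
  shows "P * Q \<in> isobaric p N (w + w')"
  unfolding isobaric_def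
proof (intro CollectI ballI)
  fix k assume "k \<in> Poly_Mapping.keys (P * Q)"
  then obtain m n where k: "k = m + n" and m: "m \<in> Poly_Mapping.keys P" and n: "n \<in> Poly_Mapping.keys Q"
    using keys_mult[of P Q] by blast
  have "\<forall>v\<in>Poly_Mapping.keys k. case_sum id id v \<le> N"
    using m n keys_add[of m n] assms unfolding isobaric_def k by blast
  moreover have "(\<Sum>v\<in>Poly_Mapping.keys k. p ^ case_sum id id v * Poly_Mapping.lookup k v) = w + w'"
    using m n assms unfolding k weight_add isobaric_def by auto
  ultimately show "(\<forall>v\<in>Poly_Mapping.keys k. case_sum id id v \<le> N) \<and>
      (\<Sum>v\<in>Poly_Mapping.keys k. p ^ case_sum id id v * Poly_Mapping.lookup k v) = w + w'" ..
qed

lemma isobaric_power: "P \<in> isobaric p N w \<Longrightarrow> P ^ n \<in> isobaric p N (n * w)"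
  by (induction n) (auto simp: isobaric_1 isobaric_mult)

lemma keys_of_nat_mult: "n > 0 \<Longrightarrow> Poly_Mapping.keys (of_nat n * P) = Poly_Mapping.keys (P :: ('v, int) mpoly)"
proof -
  assume n: "n > 0"
  have "Poly_Mapping.lookup (of_nat n * P) m = int n * Poly_Mapping.lookup P m" for m
    using lookup_single_times[of 0 "int n" P m] by (simp add: single_of_nat)
  then show ?thesis using n by (auto simp: in_keys_iff)
qed

lemma isobaric_of_nat_power: "p > 0 \<Longrightarrow> of_nat p ^ i * P \<in> isobaric p N w \<longleftrightarrow> P \<in> isobaric p N w"
  using keys_of_nat_mult[of "p ^ i" P] by (simp add: isobaric_def)

lemma isobaric_mvar: "case_sum id id v \<le> N \<Longrightarrow> mvar v \<in> isobaric p N (p ^ case_sum id id v)"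
  by (simp add: isobaric_def mvar_def)

lemma isobaric_ghost_var:
  assumes "n \<le> N" "\<And>i. case_sum id id (g i) = i" "p > 0"
  shows "witt_poly p n (\<lambda>i. mvar (g i)) \<in> isobaric p N (p ^ n)"
  unfolding witt_poly_def
proof (intro isobaric_sum)
  fix i assume "i \<in> {..n}"
  then have "mvar (g i) ^ (p ^ (n - i)) \<in> isobaric p N (p ^ (n - i) * p ^ i)"
    using assms(1) assms(2)[of i] isobaric_mvar[of "g i" N p] by (intro isobaric_power) simp
  moreover have "p ^ (n - i) * p ^ i = p ^ n"
    using \<open>i \<in> {..n}\<close> by (simp flip: power_add)
  ultimately show "of_nat p ^ i * mvar (g i) ^ (p ^ (n - i)) \<in> isobaric p N (p ^ n)"
    using assms(3) by (simp add: isobaric_of_nat_power)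
qed

text \<open>Weights pass from ghost components to components by solving for \<open>X n\<close>: the
  powers of earlier components have the right weight, and dividing by \<open>p^n\<close> does not
  change the set of monomials. The constant \<open>c\<close> is 1 for sums and 2 for
  products.\<close>

lemma isobaric_solve:
  assumes p: "p > 0" and G: "\<And>n. n \<le> N \<Longrightarrow> witt_poly p n X \<in> isobaric p N (c * p ^ n)"
  shows "n \<le> N \<Longrightarrow> X n \<in> isobaric p N (c * p ^ n)"
proof (induction n rule: less_induct)
  case (less n)
  have "of_nat p ^ i * X i ^ (p ^ (n - i)) \<in> isobaric p N (c * p ^ n)" if "i < n" for i
  proof -
    have "X i ^ (p ^ (n - i)) \<in> isobaric p N (p ^ (n - i) * (c * p ^ i))"
      using less that by (intro isobaric_power) simp
    moreover have "p ^ (n - i) * (c * p ^ i) = c * p ^ n"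
      using that by (simp add: mult.left_commute flip: power_add)
    ultimately show ?thesis by (simp add: isobaric_of_nat_power p)
  qed
  then have "witt_poly p n X - (\<Sum>i<n. of_nat p ^ i * X i ^ (p ^ (n - i))) \<in> isobaric p N (c * p ^ n)"
    using less.prems by (intro isobaric_diff G isobaric_sum) auto
  then have "of_nat p ^ n * X n \<in> isobaric p N (c * p ^ n)"
    by (simp add: witt_poly_split)
  then show ?case by (simp add: isobaric_of_nat_power p)
qed

lemma isobaric_witt_polys:
  assumes "prime p"
  shows "witt_add_poly p n \<in> isobaric p n (p ^ n)" "witt_mult_poly p n \<in> isobaric p n (2 * p ^ n)"
proof -
  have p: "p > 0" using assms prime_gt_0_nat by blast
  have "witt_add_poly p n \<in> isobaric p n (1 * p ^ n)"
    by (rule isobaric_solve[OF p]) (auto simp: witt_poly_add_poly[OF assms] p intro!: isobaric_add isobaric_ghost_var)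
  then show "witt_add_poly p n \<in> isobaric p n (p ^ n)" by simp
  have "witt_poly p i (witt_mult_poly p) \<in> isobaric p n (2 * p ^ i)" if "i \<le> n" for i
    unfolding witt_poly_mult_poly[OF assms] mult_2
    by (intro isobaric_mult isobaric_ghost_var) (use that p in auto)
  then show "witt_mult_poly p n \<in> isobaric p n (2 * p ^ n)"
    by (rule isobaric_solve[OF p]) auto
qed

lemma isobaric_vars: "P \<in> isobaric p N w \<Longrightarrow> v \<in> poly_vars P \<Longrightarrow> case_sum id id v \<le> N"
  unfolding isobaric_def poly_vars_def by blast

section \<open>Rings of fractions of \<open>S / f\<close>\<close>

context perfect_char
begin

text \<open>\<open>red Z\<close> differs from \<open>shift Z\<close> by a vector that depends on the
  zeroth component only, so each step of the recursion consumes one component.\<close>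

lemma E_local:
  assumes "ok (tl gs)" "\<And>i. i < length gs \<Longrightarrow> wnth X i = wnth Y i"
  shows "E gs X = E gs Y"
  using assms
proof (induction gs arbitrary: X Y)
  case (Cons g gs)
  then have ok: "ok gs" "ok (tl gs)" by (auto simp: ok_tl)
  have red: "red Z = red (teich (wnth Z 0)) + shift Z" for Z :: "('a, 'k) mpoly witt"
  proof -
    have "Z = teich (wnth Z 0) + ver (shift Z)" by (rule witt_decomp)
    also have "teich (wnth Z 0) = sec (wnth Z 0) + ver (red (teich (wnth Z 0)))"
      using sec_red[of "teich (wnth Z 0)"] by simp
    finally have "Z = sec (wnth Z 0) + ver (red (teich (wnth Z 0)) + shift Z)"
      by (simp add: ver_add add.assoc)
    then show ?thesis by (rule redI)
  qed
  have "E gs (shift X) = E gs (shift Y)"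
    by (rule Cons.IH) (use ok Cons.prems(2)[of "Suc _"] in auto)
  moreover have "wnth X 0 = wnth Y 0"
    using Cons.prems(2)[of 0] by simp
  ultimately show ?case
    by (simp add: red[of X] red[of Y] E_add[OF ok(2)])
qed simp

lemma ev_dvd_cong:
  assumes "\<And>v. (f :: 'r::comm_ring_1) dvd z v - z' v"
  shows "f dvd ev z P - ev z' P"
proof -
  have pw: "f dvd a ^ n - b ^ n" if "f dvd a - b" for a b :: 'r and n
    using that by (metis dvd_trans dvd_triv_left power_diff_sumr2)
  have pr: "f dvd (\<Prod>v\<in>K. z v ^ g v) - (\<Prod>v\<in>K. z' v ^ g v)" for K and g :: "_ \<Rightarrow> nat"
  proof (induction K rule: infinite_finite_induct)
    case (insert v K)
    have "(\<Prod>v\<in>insert v K. z v ^ g v) - (\<Prod>v\<in>insert v K. z' v ^ g v) =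
        (z v ^ g v - z' v ^ g v) * (\<Prod>v\<in>K. z v ^ g v) + z' v ^ g v * ((\<Prod>v\<in>K. z v ^ g v) - (\<Prod>v\<in>K. z' v ^ g v))"
      using insert.hyps by (simp add: algebra_simps)
    then show ?case
      by (simp only:) (intro dvd_add dvd_mult dvd_mult2 insert.IH pw assms)
  qed simp_all
  have "ev z P - ev z' P = (\<Sum>m\<in>Poly_Mapping.keys P. of_int (Poly_Mapping.lookup P m) * (mon z m - mon z' m))"
    by (simp add: ev_def sum_subtractf right_diff_distrib)
  then show ?thesis
    using pr by (simp add: mon_def dvd_sum)
qed

lemma witt_diff_dvd:
  fixes X Y :: "('v, 'k) mpoly witt"
  assumes "\<And>i. f dvd wnth X i - wnth Y i"
  shows "f dvd wnth (X - Y) i"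
proof -
  have "f dvd wnth (X + (- Y)) i - wnth (Y + (- Y)) i"
    unfolding plus_witt_def by (simp add: wadd_def) (rule ev_dvd_cong, use assms in \<open>auto split: sum.split\<close>)
  then show ?thesis by simp
qed

text \<open>Setting the components beyond the length to 0 does not affect \<open>E\<close> and makes
  all components of the difference divisible by \<open>f\<close>. The outer \<open>u\<close> turns
  the resulting \<open>f^p\<close> into \<open>f\<close>.\<close>

lemma E_dvd_cong:
  fixes f :: "('v::finite, 'k) mpoly"
  assumes ok: "ok (tl gs)" and tc: "teich_cond f 1 gs"
    and eq: "\<And>i. i < length gs \<Longrightarrow> f dvd wnth X i - wnth Y i"
  shows "f dvd uq p (E gs X) - uq p (E gs Y)"
proof -
  let ?t = "\<lambda>X. Witt (\<lambda>i. if i < length gs then wnth X i else 0)"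
  have l: "E gs (?t Z) = E gs Z" for Z
    by (rule E_local[OF ok]) simp
  have "f ^ (p ^ 1) dvd E gs (?t X - ?t Y)"
    by (rule teich_cond_imp_dvd_E[OF ok tc witt_diff_dvd]) (use eq in auto)
  then have "f ^ (p ^ Suc 0) dvd E gs X - E gs Y"
    by (simp add: E_diff[OF ok] l)
  then have "f ^ (p ^ 0) dvd uq p (E gs X - E gs Y)"
    by (rule uq_p_dvd)
  then show ?thesis by (simp add: uq_p_diff)
qed

end

section \<open>Rings of fractions and representatives of their Witt vectors\<close>

text \<open>\<open>A\<close> is the localization of \<open>S / f\<close> at the image of \<open>L\<close>, up to isomorphism.\<close>

locale hypersurface_fractions = perfect_char p K + A: cring A
  for p :: nat and K :: "'k::field itself" and A :: "'a ring" +
  fixes f :: "('v::finite, 'k) mpoly" and h :: "('v, 'k) mpoly \<Rightarrow> 'a" and L :: "('v, 'k) mpoly set"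
  assumes h_hom: "h \<in> ring_hom poly_ring A"
    and L_1: "1 \<in> L" and L_mult: "a \<in> L \<Longrightarrow> b \<in> L \<Longrightarrow> a * b \<in> L"
    and h_unit: "b \<in> L \<Longrightarrow> h b \<in> Units A"
    and h_frac: "x \<in> carrier A \<Longrightarrow> \<exists>a. \<exists>b\<in>L. x \<otimes>\<^bsub>A\<^esub> h b = h a"
    and h_f: "h f = \<zero>\<^bsub>A\<^esub>"
    and h_ker: "h a = \<zero>\<^bsub>A\<^esub> \<Longrightarrow> \<exists>t\<in>L. f dvd t * a"
begin

sublocale h: ring_hom_cring poly_ring A h
  by (intro ring_hom_cringI ring_hom_ringI2 cring_poly_ring A.cring_axioms h_hom
      cring.axioms(1)[OF cring_poly_ring] A.ring_axioms)

lemma h_closed [simp]: "h a \<in> carrier A"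
  using h.hom_closed[of a] by simp

lemma h_simps:
  "h (a * b) = h a \<otimes>\<^bsub>A\<^esub> h b" "h (a + b) = h a \<oplus>\<^bsub>A\<^esub> h b" "h 1 = \<one>\<^bsub>A\<^esub>" "h 0 = \<zero>\<^bsub>A\<^esub>"
  "h (a ^ n) = h a [^]\<^bsub>A\<^esub> n" "h (- a) = \<ominus>\<^bsub>A\<^esub> h a" "h (a - b) = h a \<ominus>\<^bsub>A\<^esub> h b"
proof -
  show "h (a * b) = h a \<otimes>\<^bsub>A\<^esub> h b" "h (a + b) = h a \<oplus>\<^bsub>A\<^esub> h b" "h 1 = \<one>\<^bsub>A\<^esub>" "h 0 = \<zero>\<^bsub>A\<^esub>" for a b
    using h.hom_mult[of a b] h.hom_add[of a b] h.hom_one h.hom_zero by simp_all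
  note add = this(2)
  show "h (a ^ n) = h a [^]\<^bsub>A\<^esub> n"
    using h.hom_nat_pow_carrier[of a n] by simp
  show neg: "h (- a) = \<ominus>\<^bsub>A\<^esub> h a" for a
    using h.hom_a_inv[of a] by simp
  show "h (a - b) = h a \<ominus>\<^bsub>A\<^esub> h b"
    using add[of a "- b"] by (simp add: neg a_minus_def)
qed

lemma h_ev: "h (ev z P) = int_poly_eval A (\<lambda>v. h (z v)) P"
  using h.hom_int_poly_eval[of P z] by (simp add: int_poly_eval_poly_ring)

lemma L_power: "a \<in> L \<Longrightarrow> a ^ n \<in> L"
  by (induction n) (auto simp: L_1 L_mult)

lemma L_prod: "(\<And>i. i \<in> I \<Longrightarrow> b i \<in> L) \<Longrightarrow> prod b I \<in> L"
  by (induction I rule: infinite_finite_induct) (auto simp: L_1 L_mult)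

lemma h_dvd: "f dvd a \<Longrightarrow> h a = \<zero>\<^bsub>A\<^esub>"
  by (auto simp: dvd_def h_simps h_f)

lemma h_eq_iff_diff: "h a = h b \<longleftrightarrow> h (a - b) = \<zero>\<^bsub>A\<^esub>"
proof
  assume "h a = h b"
  then show "h (a - b) = \<zero>\<^bsub>A\<^esub>" by (simp add: h_simps a_minus_def A.r_neg)
next
  assume "h (a - b) = \<zero>\<^bsub>A\<^esub>"
  then show "h a = h b" using h_simps(2)[of "a - b" b] by simp
qed

lemma unit_cancel:
  assumes "b \<in> L" "x \<in> carrier A" "y \<in> carrier A" "x \<otimes>\<^bsub>A\<^esub> h b = y \<otimes>\<^bsub>A\<^esub> h b"
  shows "x = y"
  using assms h_unit by (metis A.Units_l_cancel A.m_comm h_closed)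

lemma unit_div:
  assumes "b \<in> L" "y \<in> carrier A"
  obtains x where "x \<in> carrier A" "x \<otimes>\<^bsub>A\<^esub> h b = y"
proof
  show "y \<otimes>\<^bsub>A\<^esub> inv\<^bsub>A\<^esub> (h b) \<in> carrier A"
    using assms h_unit by simp
  show "y \<otimes>\<^bsub>A\<^esub> inv\<^bsub>A\<^esub> (h b) \<otimes>\<^bsub>A\<^esub> h b = y"
    using assms h_unit by (simp add: A.m_assoc)
qed

lemma ker_finite:
  assumes "finite I" "\<And>i. i \<in> I \<Longrightarrow> h (a i) = \<zero>\<^bsub>A\<^esub>"
  obtains t where "t \<in> L" "\<And>i. i \<in> I \<Longrightarrow> f dvd t * a i"
proof -
  obtain s where s: "\<And>i. i \<in> I \<Longrightarrow> s i \<in> L" "\<And>i. i \<in> I \<Longrightarrow> f dvd s i * a i"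
    using h_ker[OF assms(2)] by metis
  have "f dvd prod s I * a i" if "i \<in> I" for i
    unfolding prod.remove[OF assms(1) that] using s(2)[OF that] by (metis dvd_mult2 mult.commute mult.left_commute)
  then show thesis using that[of "prod s I"] L_prod s(1) by blast
qed

lemma common_denominator:
  assumes "finite I" "\<And>i. i \<in> I \<Longrightarrow> x i \<in> carrier A"
  obtains b a where "b \<in> L" "\<And>i. i \<in> I \<Longrightarrow> x i \<otimes>\<^bsub>A\<^esub> h b = h (a i)"
proof -
  obtain c d where d: "\<And>i. i \<in> I \<Longrightarrow> d i \<in> L" and c: "\<And>i. i \<in> I \<Longrightarrow> x i \<otimes>\<^bsub>A\<^esub> h (d i) = h (c i)"
    using h_frac[OF assms(2)] by metis
  have "x i \<otimes>\<^bsub>A\<^esub> h (prod d I) = h (c i * prod d (I - {i}))" if "i \<in> I" for i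
    unfolding prod.remove[OF assms(1) that] h_simps c[OF that, symmetric]
    using assms(2)[OF that] by (simp add: A.m_assoc)
  then show thesis
    using that[of "prod d I" "\<lambda>i. c i * prod d (I - {i})"] L_prod d by blast
qed

text \<open>\<open>X\<close> represents the Witt vector \<open>x\<close> scaled by the Teichmueller element of \<open>b ^ e\<close>.\<close>

definition rep :: "nat \<Rightarrow> nat \<Rightarrow> (nat \<Rightarrow> 'a) \<Rightarrow> ('v, 'k) mpoly \<Rightarrow> ('v, 'k) mpoly witt \<Rightarrow> bool"
  where "rep n e x b X \<longleftrightarrow> b \<in> L \<and> (\<forall>i<n. h (wnth X i) = h (b ^ (e * p ^ i)) \<otimes>\<^bsub>A\<^esub> x i)"

lemma repD: "rep n e x b X \<Longrightarrow> i < n \<Longrightarrow> h (wnth X i) = h (b ^ (e * p ^ i)) \<otimes>\<^bsub>A\<^esub> x i"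
  by (simp add: rep_def)

lemma rep_L: "rep n e x b X \<Longrightarrow> b \<in> L"
  by (simp add: rep_def)

text \<open>The factor \<open>b^(e p^i - 1)\<close> completes the denominator \<open>b\<close> of
  \<open>x i\<close> to the power \<open>b^(e p^i)\<close> prescribed by the Teichmueller
  scaling.\<close>

lemma rep_from_fractions:
  assumes "b \<in> L" "e > 0" "\<And>i. i < n \<Longrightarrow> x i \<in> carrier A" "\<And>i. i < n \<Longrightarrow> x i \<otimes>\<^bsub>A\<^esub> h b = h (a i)"
  shows "rep n e x b (Witt (\<lambda>i. b ^ (e * p ^ i - 1) * a i))"
  unfolding rep_def
proof (intro conjI allI impI)
  fix i assume i: "i < n"
  have "b ^ (e * p ^ i) = b ^ (e * p ^ i - 1) * b"
    using assms(2) by (metis nat_0_less_mult_iff power_minus_mult q_pos)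
  then show "h (wnth (Witt (\<lambda>i. b ^ (e * p ^ i - 1) * a i)) i) = h (b ^ (e * p ^ i)) \<otimes>\<^bsub>A\<^esub> x i"
    using assms(3)[OF i] assms(4)[OF i, symmetric] by (simp only: Witt_inverse UNIV_I) (simp add: h_simps A.m_ac)
qed fact

lemma rep_exists:
  assumes "e > 0" "\<And>i. i < n \<Longrightarrow> x i \<in> carrier A"
  obtains b X where "rep n e x b X"
proof -
  obtain b a where "b \<in> L" "\<And>i. i \<in> {..<n} \<Longrightarrow> x i \<otimes>\<^bsub>A\<^esub> h b = h (a i)"
    using common_denominator[of "{..<n}" x] assms(2) by auto
  then show thesis
    using rep_from_fractions[of b e n x a] assms that by auto
qed

lemma rep_scale:
  assumes "rep n e x b X" "c \<in> L" "\<And>i. i < n \<Longrightarrow> x i \<in> carrier A"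
  shows "rep n e x (c * b) (teich (c ^ e) * X)"
  unfolding rep_def
proof (intro conjI allI impI)
  show "c * b \<in> L" using assms L_mult by (auto simp: rep_def)
  fix i assume i: "i < n"
  show "h (wnth (teich (c ^ e) * X) i) = h ((c * b) ^ (e * p ^ i)) \<otimes>\<^bsub>A\<^esub> x i"
    using assms(3)[OF i] by (simp add: h_simps(1) repD[OF assms(1) i] power_mult_distrib power_mult[symmetric] A.m_assoc)
qed

text \<open>Scaling by the Teichmueller element of \<open>b^e\<close> multiplies a variable of index
  \<open>j\<close> by \<open>b^(e p^j)\<close>, hence an isobaric polynomial of weight
  \<open>w\<close> by \<open>b^(e w)\<close>.\<close>

lemma rep_mult_aux:
  assumes "\<And>v. v \<in> poly_vars P \<Longrightarrow> y v \<in> carrier A"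
    and P: "P \<in> isobaric p N w"
    and z: "\<And>v. v \<in> poly_vars P \<Longrightarrow> h (z v) = h (b ^ (e * p ^ case_sum id id v)) \<otimes>\<^bsub>A\<^esub> y v"
  shows "h (ev z P) = h (b ^ (e * w)) \<otimes>\<^bsub>A\<^esub> int_poly_eval A y P"
proof -
  let ?c = "h (b ^ e)"
  have pw: "h (b ^ (e * n)) = ?c [^]\<^bsub>A\<^esub> n" for n
    by (simp only: power_mult h_simps(5))
  have "h (ev z P) = int_poly_eval A (\<lambda>v. ?c [^]\<^bsub>A\<^esub> (p ^ case_sum id id v) \<otimes>\<^bsub>A\<^esub> y v) P"
    unfolding h_ev by (rule A.int_poly_eval_cong) (use z assms(1) pw in auto)
  also have "\<dots> = ?c [^]\<^bsub>A\<^esub> w \<otimes>\<^bsub>A\<^esub> int_poly_eval A y P"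
    by (rule A.int_poly_eval_scale) (use assms(1) P in \<open>auto simp: isobaric_def\<close>)
  finally show ?thesis by (simp only: pw)
qed

abbreviation W :: "nat \<Rightarrow> (nat \<Rightarrow> 'a) ring" where "W n \<equiv> witt_ring p n A"

lemma W_closed: "x \<in> carrier (W n) \<Longrightarrow> i < n \<Longrightarrow> x i \<in> carrier A"
  by (auto simp: witt_ring_def)

lemma W_add_nth: "i < n \<Longrightarrow> (x \<oplus>\<^bsub>W n\<^esub> y) i = int_poly_eval A (case_sum x y) (witt_add_poly p i)"
  by (simp add: witt_ring_def)

lemma W_mult_nth: "i < n \<Longrightarrow> (x \<otimes>\<^bsub>W n\<^esub> y) i = int_poly_eval A (case_sum x y) (witt_mult_poly p i)"
  by (simp add: witt_ring_def)

lemma vars_bound: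
  "v \<in> poly_vars (witt_add_poly p i) \<Longrightarrow> case_sum id id v \<le> i"
  "v \<in> poly_vars (witt_mult_poly p i) \<Longrightarrow> case_sum id id v \<le> i"
  using isobaric_vars isobaric_witt_polys[OF prime] by blast+

lemma rep_add:
  assumes x: "x \<in> carrier (W n)" and y: "y \<in> carrier (W n)" and X: "rep n e x b X" and Y: "rep n e y b Y"
  shows "rep n e (x \<oplus>\<^bsub>W n\<^esub> y) b (X + Y)"
  unfolding rep_def
proof (intro conjI allI impI)
  fix i assume i: "i < n"
  have "wnth (X + Y) i = ev (case_sum (wnth X) (wnth Y)) (witt_add_poly p i)"
    by (simp add: plus_witt_def wadd_def)
  moreover have "h \<dots> = h (b ^ (e * p ^ i)) \<otimes>\<^bsub>A\<^esub> int_poly_eval A (case_sum x y) (witt_add_poly p i)"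
  proof (rule rep_mult_aux[OF _ isobaric_witt_polys(1)[OF prime]])
    fix v assume "v \<in> poly_vars (witt_add_poly p i)"
    then have "case_sum id id v < n" using vars_bound(1) i by fastforce
    then show "case_sum x y v \<in> carrier A"
      "h (case_sum (wnth X) (wnth Y) v) = h (b ^ (e * p ^ case_sum id id v)) \<otimes>\<^bsub>A\<^esub> case_sum x y v"
      using W_closed[OF x] W_closed[OF y] repD[OF X] repD[OF Y] by (auto split: sum.splits)
  qed
  ultimately show "h (wnth (X + Y) i) = h (b ^ (e * p ^ i)) \<otimes>\<^bsub>A\<^esub> (x \<oplus>\<^bsub>W n\<^esub> y) i"
    by (simp add: W_add_nth i)
qed (use X in \<open>auto simp: rep_def\<close>)

lemma rep_mult:
  assumes x: "x \<in> carrier (W n)" and y: "y \<in> carrier (W n)" and X: "rep n e x b X" and Y: "rep n e y b Y"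
  shows "rep n e (x \<otimes>\<^bsub>W n\<^esub> y) (b ^ 2) (X * Y)"
  unfolding rep_def
proof (intro conjI allI impI)
  fix i assume i: "i < n"
  have "wnth (X * Y) i = ev (case_sum (wnth X) (wnth Y)) (witt_mult_poly p i)"
    by (simp add: times_witt_def wmul_def)
  moreover have "h \<dots> = h (b ^ (e * (2 * p ^ i))) \<otimes>\<^bsub>A\<^esub> int_poly_eval A (case_sum x y) (witt_mult_poly p i)"
  proof (rule rep_mult_aux[OF _ isobaric_witt_polys(2)[OF prime]])
    fix v assume "v \<in> poly_vars (witt_mult_poly p i)"
    then have "case_sum id id v < n" using vars_bound(2) i by fastforce
    then show "case_sum x y v \<in> carrier A"
      "h (case_sum (wnth X) (wnth Y) v) = h (b ^ (e * p ^ case_sum id id v)) \<otimes>\<^bsub>A\<^esub> case_sum x y v"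
      using W_closed[OF x] W_closed[OF y] repD[OF X] repD[OF Y] by (auto split: sum.splits)
  qed
  moreover have "b ^ (e * (2 * p ^ i)) = (b ^ 2) ^ (e * p ^ i)"
    by (simp add: power_mult[symmetric] mult_ac)
  ultimately show "h (wnth (X * Y) i) = h ((b ^ 2) ^ (e * p ^ i)) \<otimes>\<^bsub>A\<^esub> (x \<otimes>\<^bsub>W n\<^esub> y) i"
    by (simp add: W_mult_nth i)
qed (use X L_power in \<open>auto simp: rep_def\<close>)

text \<open>Frobenius turns scaling by \<open>[b]\<close> into scaling by \<open>[b^p]\<close>:
  scalars are represented with exponent 1, arguments of the splitting with exponent
  \<open>p\<close>.\<close>

lemma rep_frob:
  assumes x: "x \<in> carrier (W n)" and X: "rep n 1 x b X"
  shows "rep n p (witt_frob p n A x) b (wfrob X)"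
  unfolding rep_def
proof (intro conjI allI impI)
  fix i assume i: "i < n"
  have "h (wnth (wfrob X) i) = (h (b ^ (p ^ i)) \<otimes>\<^bsub>A\<^esub> x i) [^]\<^bsub>A\<^esub> p"
    using repD[OF X i] by (simp add: h_simps(5))
  also have "\<dots> = h (b ^ (p ^ i)) [^]\<^bsub>A\<^esub> p \<otimes>\<^bsub>A\<^esub> x i [^]\<^bsub>A\<^esub> p"
    using W_closed[OF x i] by (simp add: A.nat_pow_distrib)
  also have "h (b ^ (p ^ i)) [^]\<^bsub>A\<^esub> p = h (b ^ (p * p ^ i))"
    by (simp only: h_simps(5)[symmetric] power_mult[symmetric] mult.commute)
  finally show "h (wnth (wfrob X) i) = h (b ^ (p * p ^ i)) \<otimes>\<^bsub>A\<^esub> witt_frob p n A x i"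
    using i by (simp add: witt_frob_def witt_map_def)
qed (use X in \<open>auto simp: rep_def\<close>)

lemma frob_closed: "x \<in> carrier (W n) \<Longrightarrow> witt_frob p n A x \<in> carrier (W n)"
  by (auto simp: witt_frob_def witt_map_def witt_ring_def)

end

section \<open>From coordinates to splittings\<close>

context hypersurface_fractions
begin

text \<open>With exponent \<open>p\<close> the scaling factor is \<open>[b^p] = F [b]\<close>, which
  leaves \<open>uq p (E gs X)\<close> as \<open>b\<close>. Dividing by \<open>u\<close> of the head
  coordinate, the value at 1, normalizes the homomorphism to a splitting.\<close>

definition frac_split :: "('v, 'k) mpoly list \<Rightarrow> (nat \<Rightarrow> 'a) \<Rightarrow> 'a"
  where "frac_split gs x = (SOME y. y \<in> carrier A \<and> (\<exists>b X. rep (length gs) p x b X \<and>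
    y \<otimes>\<^bsub>A\<^esub> h (b * uq p (hd gs)) = h (uq p (E gs X))))"

lemma uq_E_teich_mult: "ok (tl gs) \<Longrightarrow> uq p (E gs (teich (c ^ p) * X)) = c * uq p (E gs X)"
  using E_F_mult[of gs "teich c" X] by (simp add: F_teich teich_power uq_p_frob_mult)

text \<open>Scale both representatives to the denominator \<open>b b'\<close>. Their components then
  agree in \<open>A\<close>, hence modulo \<open>f\<close> after multiplication by some
  \<open>t\<close> in \<open>L\<close>; scaling by \<open>[t^p]\<close> achieves this in all
  components at once, and \<open>t\<close> cancels as a unit of \<open>A\<close>.\<close>

lemma rep_unique:
  assumes ok: "ok (tl gs)" and tc: "teich_cond f 1 gs" and x: "x \<in> carrier (W (length gs))"
    and X: "rep (length gs) p x b X" and X': "rep (length gs) p x b' X'"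
  shows "h (b' * uq p (E gs X)) = h (b * uq p (E gs X'))"
proof -
  let ?n = "length gs" and ?Y = "teich (b' ^ p) * X" and ?Y' = "teich (b ^ p) * X'"
  have Y: "rep ?n p x (b' * b) ?Y" and Y': "rep ?n p x (b * b') ?Y'"
    by (intro rep_scale X X' rep_L[OF X] rep_L[OF X'] W_closed[OF x]; assumption)+
  have z: "h (wnth ?Y i - wnth ?Y' i) = \<zero>\<^bsub>A\<^esub>" if "i \<in> {..<?n}" for i
    using repD[OF Y, of i] repD[OF Y', of i] that
    by (subst h_eq_iff_diff[symmetric]) (simp add: mult.commute[of b b'])
  have "\<exists>t\<in>L. \<forall>i<?n. f dvd t * (wnth ?Y i - wnth ?Y' i)"
    by (rule ker_finite[OF finite_lessThan[of ?n] z]) auto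
  then obtain t where t: "t \<in> L" "\<And>i. i < ?n \<Longrightarrow> f dvd t * (wnth ?Y i - wnth ?Y' i)"
    by blast
  have "f dvd uq p (E gs (teich (t ^ p) * ?Y)) - uq p (E gs (teich (t ^ p) * ?Y'))"
  proof (rule E_dvd_cong[OF ok tc])
    fix i assume "i < ?n"
    then have "f dvd t * (wnth ?Y i - wnth ?Y' i)" using t by simp
    also have "\<dots> dvd (t ^ p) ^ (p ^ i) * (wnth ?Y i - wnth ?Y' i)"
      by (intro mult_dvd_mono dvd_refl) (simp add: power_mult[symmetric] dvd_power)
    finally show "f dvd wnth (teich (t ^ p) * ?Y) i - wnth (teich (t ^ p) * ?Y') i"
      by (simp only: wnth_simps(10) witt_prime_mpoly right_diff_distrib)
  qed
  then have "f dvd (b' * uq p (E gs X)) * t - (b * uq p (E gs X')) * t"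
    by (simp only: uq_E_teich_mult[OF ok]) (simp only: mult_ac)
  then have "h ((b' * uq p (E gs X)) * t) = h ((b * uq p (E gs X')) * t)"
    unfolding h_eq_iff_diff by (rule h_dvd)
  then show ?thesis
    unfolding h_simps(1)[of _ t] by (rule unit_cancel[OF t(1) h_closed h_closed])
qed

context
  fixes gs :: "('v, 'k) mpoly list"
  assumes ok: "ok (tl gs)" and tc: "teich_cond f 1 gs" and ne: "gs \<noteq> []" and unit: "uq p (hd gs) \<in> L"
begin

lemma frac_split_spec:
  assumes x: "x \<in> carrier (W (length gs))"
  shows "frac_split gs x \<in> carrier A"
    and "rep (length gs) p x b X \<Longrightarrow> frac_split gs x \<otimes>\<^bsub>A\<^esub> h (b * uq p (hd gs)) = h (uq p (E gs X))"
proof -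
  obtain b' X' where X': "rep (length gs) p x b' X'"
    using rep_exists[of p "length gs" x] W_closed[OF x] by auto
  have "b' * uq p (hd gs) \<in> L" using X' unit by (auto simp: rep_def L_mult)
  then obtain y where "y \<in> carrier A" "y \<otimes>\<^bsub>A\<^esub> h (b' * uq p (hd gs)) = h (uq p (E gs X'))"
    using unit_div h_closed by metis
  then have "\<exists>y. y \<in> carrier A \<and> (\<exists>b X. rep (length gs) p x b X \<and>
    y \<otimes>\<^bsub>A\<^esub> h (b * uq p (hd gs)) = h (uq p (E gs X)))"
    using X' by blast
  then have s: "frac_split gs x \<in> carrier A \<and> (\<exists>b X. rep (length gs) p x b X \<and>
    frac_split gs x \<otimes>\<^bsub>A\<^esub> h (b * uq p (hd gs)) = h (uq p (E gs X)))"
    unfolding frac_split_def by (rule someI_ex)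
  then show c: "frac_split gs x \<in> carrier A" by blast
  obtain d Y where Y: "rep (length gs) p x d Y" "frac_split gs x \<otimes>\<^bsub>A\<^esub> h (d * uq p (hd gs)) = h (uq p (E gs Y))"
    using s by blast
  assume X: "rep (length gs) p x b X"
  have "frac_split gs x \<otimes>\<^bsub>A\<^esub> h (b * uq p (hd gs)) \<otimes>\<^bsub>A\<^esub> h d =
      frac_split gs x \<otimes>\<^bsub>A\<^esub> h (d * uq p (hd gs)) \<otimes>\<^bsub>A\<^esub> h b"
    using c by (simp add: h_simps A.m_ac)
  also have "\<dots> = h (b * uq p (E gs Y))"
    using Y(2) by (simp add: h_simps(1) A.m_comm)
  also have "\<dots> = h (uq p (E gs X)) \<otimes>\<^bsub>A\<^esub> h d"
    using rep_unique[OF ok tc x X Y(1)] by (simp add: h_simps(1) A.m_comm)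
  finally show "frac_split gs x \<otimes>\<^bsub>A\<^esub> h (b * uq p (hd gs)) = h (uq p (E gs X))"
    by (rule unit_cancel[OF rep_L[OF Y(1)], rotated 2]) (use c in auto)
qed

lemma frac_split_eqI:
  assumes "x \<in> carrier (W (length gs))" "rep (length gs) p x b X" "y \<in> carrier A"
    "y \<otimes>\<^bsub>A\<^esub> h (b * uq p (hd gs)) = h (uq p (E gs X))"
  shows "frac_split gs x = y"
proof (rule unit_cancel[OF L_mult[OF rep_L[OF assms(2)] unit] frac_split_spec(1)[OF assms(1)] assms(3)])
  show "frac_split gs x \<otimes>\<^bsub>A\<^esub> h (b * uq p (hd gs)) = y \<otimes>\<^bsub>A\<^esub> h (b * uq p (hd gs))"
    unfolding frac_split_spec(2)[OF assms(1,2)] assms(4) ..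
qed

lemma W_closed_ops:
  assumes "x \<in> carrier (W n)" "y \<in> carrier (W n)"
  shows "x \<oplus>\<^bsub>W n\<^esub> y \<in> carrier (W n)" "x \<otimes>\<^bsub>W n\<^esub> y \<in> carrier (W n)"
proof -
  have *: "case_sum x y v \<in> carrier A" if "case_sum id id v < n" for v
    using that W_closed[OF assms(1)] W_closed[OF assms(2)] by (cases v) auto
  have "int_poly_eval A (case_sum x y) (witt_add_poly p i) \<in> carrier A"
    "int_poly_eval A (case_sum x y) (witt_mult_poly p i) \<in> carrier A" if "i < n" for i
    using that vars_bound[of _ i] * by (fastforce intro!: A.int_poly_eval_closed)+
  then show "x \<oplus>\<^bsub>W n\<^esub> y \<in> carrier (W n)" "x \<otimes>\<^bsub>W n\<^esub> y \<in> carrier (W n)"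
    by (auto simp: witt_ring_def)
qed

lemma rep_common:
  assumes x: "x \<in> carrier (W n)" and y: "y \<in> carrier (W n)" and "e > 0" "e' > 0"
  obtains b X Y where "rep n e x b X" "rep n e' y b Y"
proof -
  \<comment> \<open>Joining the vectors into one family of \<open>2n\<close> fractions gives them a
    single denominator.\<close>
  let ?z = "\<lambda>i. if i < n then x i else y (i - n)"
  have z: "?z i \<in> carrier A" if "i \<in> {..<n + n}" for i
    using W_closed[OF x, of i] W_closed[OF y, of "i - n"] that by auto
  have "\<exists>b\<in>L. \<exists>a. \<forall>i<n + n. ?z i \<otimes>\<^bsub>A\<^esub> h b = h (a i)"
  proof (rule common_denominator[OF finite_lessThan[of "n + n"] z])
    fix b a assume "b \<in> L" "\<And>i. i \<in> {..<n + n} \<Longrightarrow> ?z i \<otimes>\<^bsub>A\<^esub> h b = h (a i)"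
    then show ?thesis by (intro bexI[of _ b] exI[of _ a]) simp_all
  qed
  then obtain b a where b: "b \<in> L" "\<And>i. i < n + n \<Longrightarrow> ?z i \<otimes>\<^bsub>A\<^esub> h b = h (a i)"
    by blast
  have bx: "x i \<otimes>\<^bsub>A\<^esub> h b = h (a i)" and b_y: "y i \<otimes>\<^bsub>A\<^esub> h b = h (a (n + i))" if "i < n" for i
    using b(2)[of i] b(2)[of "n + i"] that by simp_all
  have "rep n e x b (Witt (\<lambda>i. b ^ (e * p ^ i - 1) * a i))"
    by (rule rep_from_fractions[OF b(1) \<open>e > 0\<close>]) (use W_closed[OF x] bx in auto)
  moreover have "rep n e' y b (Witt (\<lambda>i. b ^ (e' * p ^ i - 1) * a (n + i)))"
    by (rule rep_from_fractions[OF b(1) \<open>e' > 0\<close>]) (use W_closed[OF y] b_y in auto)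
  ultimately show thesis using that by blast
qed

lemma frac_split_add:
  assumes x: "x \<in> carrier (W (length gs))" and y: "y \<in> carrier (W (length gs))"
  shows "frac_split gs (x \<oplus>\<^bsub>W (length gs)\<^esub> y) = frac_split gs x \<oplus>\<^bsub>A\<^esub> frac_split gs y"
proof -
  obtain b X Y where X: "rep (length gs) p x b X" and Y: "rep (length gs) p y b Y"
    using rep_common[OF x y p_pos p_pos] .
  show ?thesis
  proof (rule frac_split_eqI[OF W_closed_ops(1)[OF x y] rep_add[OF x y X Y]])
    show "frac_split gs x \<oplus>\<^bsub>A\<^esub> frac_split gs y \<in> carrier A"
      using frac_split_spec(1)[OF x] frac_split_spec(1)[OF y] by simp
    have "(frac_split gs x \<oplus>\<^bsub>A\<^esub> frac_split gs y) \<otimes>\<^bsub>A\<^esub> h (b * uq p (hd gs)) = h (uq p (E gs X)) \<oplus>\<^bsub>A\<^esub> h (uq p (E gs Y))"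
      using frac_split_spec[OF x] frac_split_spec[OF y] X Y by (simp add: A.l_distr)
    then show "(frac_split gs x \<oplus>\<^bsub>A\<^esub> frac_split gs y) \<otimes>\<^bsub>A\<^esub> h (b * uq p (hd gs)) = h (uq p (E gs (X + Y)))"
      by (simp add: E_add[OF ok] uq_p_add h_simps)
  qed
qed

text \<open>The scalar is represented with exponent 1, so that its Frobenius has exponent
  \<open>p\<close> like the argument. The product has denominator \<open>b^2\<close>, one factor of
  which is the denominator of \<open>c 0\<close>.\<close>

lemma frac_split_smult:
  assumes c: "c \<in> carrier (W (length gs))" and x: "x \<in> carrier (W (length gs))"
  shows "frac_split gs (witt_frob p (length gs) A c \<otimes>\<^bsub>W (length gs)\<^esub> x) = c 0 \<otimes>\<^bsub>A\<^esub> frac_split gs x"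
proof -
  obtain b C X where C: "rep (length gs) 1 c b C" and X: "rep (length gs) p x b X"
    using rep_common[OF c x _ p_pos, of 1] by auto
  have c0: "c 0 \<in> carrier A" "h (wnth C 0) = c 0 \<otimes>\<^bsub>A\<^esub> h b"
    using W_closed[OF c, of 0] repD[OF C, of 0] ne by (simp_all add: A.m_comm)
  have s: "frac_split gs x \<in> carrier A" "frac_split gs x \<otimes>\<^bsub>A\<^esub> h (b * uq p (hd gs)) = h (uq p (E gs X))"
    using frac_split_spec[OF x] X by simp_all
  have m: "rep (length gs) p (witt_frob p (length gs) A c \<otimes>\<^bsub>W (length gs)\<^esub> x) (b ^ 2) (wfrob C * X)"
    by (rule rep_mult[OF frob_closed[OF c] x rep_frob[OF c C] X])
  show ?thesis
  proof (rule frac_split_eqI[OF W_closed_ops(2)[OF frob_closed[OF c] x] m])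
    show "c 0 \<otimes>\<^bsub>A\<^esub> frac_split gs x \<in> carrier A" using c0 s by simp
    have "c 0 \<otimes>\<^bsub>A\<^esub> frac_split gs x \<otimes>\<^bsub>A\<^esub> h (b ^ 2 * uq p (hd gs)) =
        (c 0 \<otimes>\<^bsub>A\<^esub> h b) \<otimes>\<^bsub>A\<^esub> (frac_split gs x \<otimes>\<^bsub>A\<^esub> h (b * uq p (hd gs)))"
      using c0(1) s(1) by (simp add: power2_eq_square h_simps(1) A.m_ac)
    also have "\<dots> = h (wnth C 0 * uq p (E gs X))"
      unfolding s(2) c0(2)[symmetric] by (rule h_simps(1)[symmetric])
    finally show "c 0 \<otimes>\<^bsub>A\<^esub> frac_split gs x \<otimes>\<^bsub>A\<^esub> h (b ^ 2 * uq p (hd gs)) = h (uq p (E gs (wfrob C * X)))"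
      by (simp add: E_F_mult[OF ok] uq_p_frob_mult)
  qed
qed

lemma frac_split_frob:
  assumes c: "c \<in> carrier (W (length gs))"
  shows "frac_split gs (witt_frob p (length gs) A c) = c 0"
proof -
  obtain b C where C: "rep (length gs) 1 c b C"
    using rep_exists[of 1 "length gs" c] W_closed[OF c] by auto
  have c0: "c 0 \<in> carrier A" "h (wnth C 0) = c 0 \<otimes>\<^bsub>A\<^esub> h b"
    using W_closed[OF c, of 0] repD[OF C, of 0] ne by (simp_all add: A.m_comm)
  obtain g gs' where gs: "gs = g # gs'" using ne by (cases gs) auto
  have "E gs 1 = hd gs" using E_sec[of gs 1] by (simp add: gs)
  then have "uq p (E gs (wfrob C)) = wnth C 0 * uq p (hd gs)"
    using E_F_mult[OF ok, of C 1] by (simp add: uq_p_frob_mult)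
  then show ?thesis
    using c0 by (intro frac_split_eqI[OF frob_closed[OF c] rep_frob[OF c C]])
      (simp_all add: h_simps(1) A.m_assoc)
qed

end

end

section \<open>From splittings to coordinates\<close>

lemma wnth_ver_pow: "wnth ((ver ^^ m) w) j = (if j < m then 0 else wnth w (j - m))"
proof (induction m arbitrary: j)
  case (Suc m)
  then show ?case by (cases j) simp_all
qed simp

context perfect_char
begin

lemma uq_xpow_dual:
  assumes "d \<in> box (p ^ i)" "e \<in> box (p ^ i)"
  shows "uq (p ^ i) (xpow (\<lambda>v. p ^ i - 1 - d v) * xpow e) = (if d = e then 1 else (0 :: ('v::finite, 'k) mpoly))"
proof -
  have iff: "(q - 1 - a + b) mod q = q - 1 \<longleftrightarrow> a = b" if "a < q" "b < q" for q a b :: nat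
  proof (cases "b \<le> a")
    case True
    then have "q - 1 - a + b < q" using that by simp
    then show ?thesis using True that by auto
  next
    case False
    then have "q - 1 - a + b = q + (b - a - 1)" using that by simp
    then have "(q - 1 - a + b) mod q = (q + (b - a - 1)) mod q" by (rule arg_cong)
    also have "\<dots> = b - a - 1" using that by simp
    finally show ?thesis using False that by auto
  qed
  have "(p ^ i - 1 - d v + e v) mod p ^ i = p ^ i - 1 \<longleftrightarrow> d v = e v" for v
    by (rule iff) (use assms in \<open>auto simp: box_def\<close>)
  then have all: "(\<forall>v. (p ^ i - 1 - d v + e v) mod p ^ i = p ^ i - 1) \<longleftrightarrow> d = e"
    by (simp only: fun_eq_iff)
  have "(p ^ i - 1 - d v + d v) div p ^ i = 0" for v
  proof (rule div_less)
    have "d v < p ^ i" using assms(1) by (simp add: box_def)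
    then show "p ^ i - 1 - d v + d v < p ^ i" by linarith
  qed
  then show ?thesis
    unfolding xpow_mult uq_xpow all by auto
qed

lemma ver_pow_hom:
  "(ver ^^ i) (x + y) = (ver ^^ i) x + (ver ^^ i) (y :: ('v::finite, 'k) mpoly witt)"
  "(ver ^^ i) (of_nat p * x) = of_nat p * (ver ^^ i) x"
  "(ver ^^ i) ((wfrob ^^ i) z * x) = z * (ver ^^ i) x"
proof -
  show "(ver ^^ i) (x + y) = (ver ^^ i) x + (ver ^^ i) y"
    by (induction i) (simp_all add: ver_add)
  show "(ver ^^ i) (of_nat p * x) = of_nat p * (ver ^^ i) x"
    by (induction i) (simp_all add: p_ver)
  show "(ver ^^ i) ((wfrob ^^ i) z * x) = z * (ver ^^ i) x"
  proof (induction i arbitrary: z)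
    case (Suc i)
    have "(ver ^^ Suc i) ((wfrob ^^ Suc i) z * x) = ver ((ver ^^ i) ((wfrob ^^ i) (wfrob z) * x))"
      by (simp add: funpow_swap1)
    also have "\<dots> = ver ((ver ^^ i) x * wfrob z)"
      unfolding Suc by (simp add: mult.commute)
    also have "\<dots> = ver ((ver ^^ i) x) * z" by (rule ver_proj[symmetric])
    finally show ?case unfolding mult.commute[of z] by simp
  qed simp
qed

lemma ver_pow_sum: "(ver ^^ i) (\<Sum>x\<in>I. g x) = (\<Sum>x\<in>I. (ver ^^ i) (g x :: ('v::finite, 'k) mpoly witt))"
proof -
  have "(ver ^^ i) 0 = (0 :: ('v, 'k) mpoly witt)"
    using ver_pow_hom(1)[of i 0 0] by simp
  then show ?thesis
    by (induction I rule: infinite_finite_induct) (simp_all add: ver_pow_hom(1))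
qed

lemma sec_frob_pow: "cg ((wfrob ^^ m) (sec b)) (sec ((b :: ('v::finite, 'k) mpoly) ^ (p ^ m)))"
proof (induction m)
  case (Suc m)
  have "cg ((wfrob ^^ Suc m) (sec b)) (wfrob (sec (b ^ (p ^ m))))"
    using cg_F[OF Suc] by simp
  moreover have "(b ^ (p ^ m)) ^ p = b ^ (p ^ Suc m)"
    by (simp only: power_mult[symmetric] power_Suc2)
  ultimately show ?case
    using cg_trans sec_frob by metis
qed simp

text \<open>Multiplies the whole homomorphism by \<open>s^(p^k)\<close>: below each \<open>V\<close>
  the exponent grows by a factor \<open>p\<close>, which the matching \<open>u\<close>
  undoes.\<close>

fun scale_coords :: "('v::finite, 'k) mpoly \<Rightarrow> nat \<Rightarrow> ('v, 'k) mpoly list \<Rightarrow> ('v, 'k) mpoly list" where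
  "scale_coords s k [] = []"
| "scale_coords s k (g # gs) = s ^ (p ^ k) * g # scale_coords s (Suc k) gs"

lemma uq_p_scale: "uq p (s ^ (p ^ Suc k) * a) = s ^ (p ^ k) * uq p (a :: ('v::finite, 'k) mpoly)"
  by (simp only: power_Suc2 power_mult uq_p_frob_mult)

lemma E_scale_coords: "E (scale_coords s k gs) w = s ^ (p ^ k) * E gs w"
proof (induction gs arbitrary: k w)
  case (Cons g gs)
  have "uq p (E (scale_coords s (Suc k) gs) (red w)) = s ^ (p ^ k) * uq p (E gs (red w))"
    unfolding Cons by (rule uq_p_scale)
  then show ?case by (simp add: distrib_left mult.assoc)
qed simp

lemma ok_scale_coords: "ok gs \<Longrightarrow> ok (scale_coords s (Suc k) gs)"
  by (induction gs arbitrary: k) (auto simp: uq_p_scale simp del: power_Suc)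

lemma length_scale_coords [simp]: "length (scale_coords s k gs) = length gs"
  by (induction gs arbitrary: k) auto

lemma teich_cond_scale_coords:
  assumes "\<And>j. j < length gs \<Longrightarrow> f ^ (p ^ (i + j)) dvd s ^ (p ^ (i + j)) * E (drop j gs) (teich f)"
  shows "teich_cond f i (scale_coords s i gs)"
  using assms
proof (induction gs arbitrary: i)
  case (Cons g gs)
  have "teich_cond f (Suc i) (scale_coords s (Suc i) gs)"
    by (rule Cons.IH) (use Cons.prems[of "Suc _"] in auto)
  moreover have "f ^ (p ^ i) dvd E (scale_coords s i (g # gs)) (teich f)"
    unfolding E_scale_coords using Cons.prems[of 0] by simp
  ultimately show ?case by simp
qed simp

end

context hypersurface_fractions
begin

text \<open>Apply the hypothesis to the finitely many monomials that compute the coordinates of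
  \<open>Y\<close>. One \<open>s\<close> makes all coordinates divisible by \<open>f\<close>, and
  reassembling \<open>s^q Y\<close> from their \<open>q\<close>-th powers, \<open>q = p ^ i\<close>,
  gives divisibility by \<open>f^q\<close>.\<close>

lemma uq_ker:
  assumes "\<And>b. h (uq (p ^ i) (b * Y)) = \<zero>\<^bsub>A\<^esub>"
  obtains s where "s \<in> L" "f ^ (p ^ i) dvd s ^ (p ^ i) * Y"
proof -
  let ?a = "\<lambda>e. uq (p ^ i) (xpow (\<lambda>v. p ^ i - 1 - e v) * Y)"
  have "\<exists>s\<in>L. \<forall>e\<in>box (p ^ i). f dvd s * ?a e"
    by (rule ker_finite[of "box (p ^ i)" ?a]) (use assms in auto)
  then obtain s where s: "s \<in> L" "\<And>e. e \<in> box (p ^ i) \<Longrightarrow> f dvd s * ?a e" by blast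
  have "s ^ (p ^ i) * Y = (\<Sum>e\<in>box (p ^ i). (s * ?a e) ^ (p ^ i) * xpow e)"
    by (subst uq_expand[of Y i]) (simp only: sum_distrib_left power_mult_distrib mult.assoc)
  moreover have "f ^ (p ^ i) dvd \<dots>"
    by (intro dvd_sum dvd_mult2 dvd_power_same s(2))
  ultimately show thesis using that s(1) by simp
qed

section \<open>Splittings pulled back to Witt vectors of the polynomial ring\<close>

context
  fixes n :: nat and \<Phi> :: "('v, 'k) mpoly witt \<Rightarrow> 'a"
  assumes \<Phi>_closed: "\<Phi> X \<in> carrier A"
    and \<Phi>_add: "\<Phi> (X + Y) = \<Phi> X \<oplus>\<^bsub>A\<^esub> \<Phi> Y"
    and \<Phi>_mult: "\<Phi> (wfrob C * X) = h (wnth C 0) \<otimes>\<^bsub>A\<^esub> \<Phi> X"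
    and \<Phi>_cong: "(\<And>i. i < n \<Longrightarrow> h (wnth X i) = h (wnth Y i)) \<Longrightarrow> \<Phi> X = \<Phi> Y"
    and \<Phi>_1: "\<Phi> 1 = \<one>\<^bsub>A\<^esub>"
    and n: "n \<ge> 1" and L: "L \<inter> irrelevant_ideal = {}" and f: "f \<in> irrelevant_ideal" "f \<noteq> 0"
begin

lemma \<Phi>_0: "\<Phi> 0 = \<zero>\<^bsub>A\<^esub>"
  using \<Phi>_mult[of 0 0] \<Phi>_closed by (simp add: F_hom h_simps)

text \<open>\<open>p X = F (V X)\<close> acts on 1 through the zeroth component of
  \<open>V X\<close>, which is 0.\<close>

lemma \<Phi>_p: "\<Phi> (of_nat p * X) = \<zero>\<^bsub>A\<^esub>"
  using \<Phi>_mult[of "ver X" 1] \<Phi>_closed by (simp add: FV h_simps)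

lemma \<Phi>_cg: "cg X Y \<Longrightarrow> \<Phi> ((ver ^^ i) X) = \<Phi> ((ver ^^ i) Y)"
  by (elim cgE) (simp add: ver_pow_hom(1) ver_pow_hom(2) \<Phi>_add \<Phi>_p \<Phi>_closed)

lemma \<Phi>_ver_sec_mult:
  "\<Phi> ((ver ^^ i) (sec (b ^ (p ^ Suc i) * a))) = h b \<otimes>\<^bsub>A\<^esub> \<Phi> ((ver ^^ i) (sec a))"
proof -
  have "cg (sec (b ^ (p ^ Suc i) * a)) ((wfrob ^^ Suc i) (sec b) * sec a)"
    using cg_trans[OF sec_mult cg_mult[OF cg_sym[OF sec_frob_pow] cg_refl]] .
  then have "\<Phi> ((ver ^^ i) (sec (b ^ (p ^ Suc i) * a))) = \<Phi> ((ver ^^ i) ((wfrob ^^ i) (wfrob (sec b)) * sec a))"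
    by (subst \<Phi>_cg) (simp_all add: funpow_swap1)
  also have "\<dots> = h b \<otimes>\<^bsub>A\<^esub> \<Phi> ((ver ^^ i) (sec a))"
    unfolding ver_pow_hom(3) \<Phi>_mult by simp
  finally show ?thesis .
qed

lemma \<Phi>_sum: "finite I \<Longrightarrow> \<Phi> (\<Sum>x\<in>I. g x) = (\<Oplus>\<^bsub>A\<^esub>x\<in>I. \<Phi> (g x))"
  by (induction I rule: finite_induct) (auto simp: \<Phi>_0 \<Phi>_add \<Phi>_closed)

lemma h_sum: "finite I \<Longrightarrow> h (\<Sum>x\<in>I. g x) = (\<Oplus>\<^bsub>A\<^esub>x\<in>I. h (g x))"
  by (induction I rule: finite_induct) (auto simp: h_simps)

text \<open>Duality: by \<open>\<Phi>_ver_sec_mult\<close> the map \<open>a\<close> to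
  \<open>\<Phi> (V^i (sec a))\<close> is linear over \<open>p^(i+1)\<close>-th powers, so it is
  determined by its values on the basis monomials, from which \<open>G i\<close> is built through
  the dual basis. The element \<open>t\<close> is a common denominator of these finitely many
  values.\<close>

lemma coordinates_exist:
  obtains t G where "t \<in> L"
    "\<And>i a. i < n \<Longrightarrow> h (uq (p ^ Suc i) (G i * a)) = h t \<otimes>\<^bsub>A\<^esub> \<Phi> ((ver ^^ i) (sec a))"
    "\<And>i. 1 \<le> i \<Longrightarrow> uq p (G i) = 0"
proof -
  let ?y = "\<lambda>i e. \<Phi> ((ver ^^ i) (sec (xpow e)))"
  let ?I = "SIGMA i:{..<n}. (box (p ^ Suc i) :: ('v \<Rightarrow> nat) set)"
  have "\<exists>t\<in>L. \<exists>a. \<forall>(i, e)\<in>?I. ?y i e \<otimes>\<^bsub>A\<^esub> h t = h (a i e)"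
  proof (rule common_denominator[of ?I "\<lambda>(i, e). ?y i e"])
    fix t a assume "t \<in> L" "\<And>j. j \<in> ?I \<Longrightarrow> (case j of (i, e) \<Rightarrow> ?y i e) \<otimes>\<^bsub>A\<^esub> h t = h (a j)"
    then show ?thesis by (intro bexI[of _ t] exI[of _ "\<lambda>i e. a (i, e)"]) auto
  qed (auto simp: \<Phi>_closed)
  then obtain t a where t: "t \<in> L" and a: "\<And>i e. i < n \<Longrightarrow> e \<in> box (p ^ Suc i) \<Longrightarrow> ?y i e \<otimes>\<^bsub>A\<^esub> h t = h (a i e)"
    by blast
  \<comment> \<open>A value that vanishes in \<open>A\<close> is represented by 0 itself; an
    arbitrary representative would give \<open>u (G i) = 0\<close> only in \<open>A\<close> and not
    in \<open>S\<close>.\<close>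
  define c where "c i e = (if ?y i e = \<zero>\<^bsub>A\<^esub> then 0 else a i e)" for i e
  have c: "h (c i e) = h t \<otimes>\<^bsub>A\<^esub> ?y i e" if "i < n" "e \<in> box (p ^ Suc i)" for i e
  proof (cases "?y i e = \<zero>\<^bsub>A\<^esub>")
    case True
    then show ?thesis by (simp add: c_def h_simps)
  next
    case False
    then show ?thesis using a[OF that] \<Phi>_closed by (simp add: c_def A.m_comm)
  qed
  define G where "G i = (\<Sum>e\<in>box (p ^ Suc i). c i e ^ (p ^ Suc i) * xpow (\<lambda>v. p ^ Suc i - 1 - e v))" for i
  have G_dual: "uq (p ^ Suc i) (G i * xpow e) = c i e" if e: "e \<in> box (p ^ Suc i)" for i e
  proof -
    have "uq (p ^ Suc i) (G i * xpow e) =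
      (\<Sum>d\<in>box (p ^ Suc i). c i d * uq (p ^ Suc i) (xpow (\<lambda>v. p ^ Suc i - 1 - d v) * xpow e))"
      by (simp only: G_def sum_distrib_right mult.assoc uq_sum uq_frob_mult)
    also have "\<dots> = (\<Sum>d\<in>box (p ^ Suc i). if d = e then c i d else 0)"
      by (intro sum.cong refl, subst uq_xpow_dual[OF _ e]) auto
    finally show ?thesis using e by simp
  qed
  have "h (uq (p ^ Suc i) (G i * a)) = h t \<otimes>\<^bsub>A\<^esub> \<Phi> ((ver ^^ i) (sec a))" if i: "i < n" for i a
  proof -
    let ?b = "\<lambda>e. uq (p ^ Suc i) (xpow (\<lambda>v. p ^ Suc i - 1 - e v) * a)"
    have ex: "a = (\<Sum>e\<in>box (p ^ Suc i). ?b e ^ (p ^ Suc i) * xpow e)"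
      by (rule uq_expand)
    have "h (uq (p ^ Suc i) (G i * a)) = h (\<Sum>e\<in>box (p ^ Suc i). ?b e * c i e)"
    proof -
      have "G i * (?b e ^ (p ^ Suc i) * xpow e) = ?b e ^ (p ^ Suc i) * (G i * xpow e)" for e
        by (simp only: mult_ac)
      then have "uq (p ^ Suc i) (G i * (\<Sum>e\<in>box (p ^ Suc i). ?b e ^ (p ^ Suc i) * xpow e)) = (\<Sum>e\<in>box (p ^ Suc i). ?b e * c i e)"
        by (simp only: sum_distrib_left uq_sum uq_frob_mult) (intro sum.cong refl, simp only: G_dual)
      then show ?thesis using ex by simp
    qed
    also have "\<dots> = (\<Oplus>\<^bsub>A\<^esub>e\<in>box (p ^ Suc i). h t \<otimes>\<^bsub>A\<^esub> \<Phi> ((ver ^^ i) (sec (?b e ^ (p ^ Suc i) * xpow e))))"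
      unfolding h_sum[OF finite_box]
      by (intro A.finsum_cong') (auto simp: \<Phi>_closed \<Phi>_ver_sec_mult h_simps(1) c[OF i] A.m_lcomm simp del: power_Suc)
    also have "\<dots> = h t \<otimes>\<^bsub>A\<^esub> (\<Oplus>\<^bsub>A\<^esub>e\<in>box (p ^ Suc i). \<Phi> ((ver ^^ i) (sec (?b e ^ (p ^ Suc i) * xpow e))))"
      by (intro A.finsum_rdistr[symmetric]) (auto simp: \<Phi>_closed)
    also have "(\<Oplus>\<^bsub>A\<^esub>e\<in>box (p ^ Suc i). \<Phi> ((ver ^^ i) (sec (?b e ^ (p ^ Suc i) * xpow e)))) =
        \<Phi> (\<Sum>e\<in>box (p ^ Suc i). (ver ^^ i) (sec (?b e ^ (p ^ Suc i) * xpow e)))"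
      by (rule \<Phi>_sum[symmetric]) simp
    also have "(\<Sum>e\<in>box (p ^ Suc i). (ver ^^ i) (sec (?b e ^ (p ^ Suc i) * xpow e))) =
        (ver ^^ i) (\<Sum>e\<in>box (p ^ Suc i). sec (?b e ^ (p ^ Suc i) * xpow e))"
      by (rule ver_pow_sum[symmetric])
    also have "\<Phi> \<dots> = \<Phi> ((ver ^^ i) (sec a))"
      by (subst (2) ex) (rule \<Phi>_cg[OF cg_sym[OF sec_sum]])
    finally show ?thesis .
  qed
  moreover have "uq p (G i) = 0" if i: "1 \<le> i" for i
  proof -
    obtain j where j: "i = Suc j" using i by (cases i) auto
    have "c i e ^ (p ^ i) * uq p (xpow (\<lambda>v. p ^ Suc i - 1 - e v)) = 0" if e: "e \<in> box (p ^ Suc i)" for e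
    proof (cases "\<forall>v. (p ^ Suc i - 1 - e v) mod p = p - 1")
      case False
      then have "uq p (xpow (\<lambda>v. p ^ Suc i - 1 - e v)) = (0 :: ('v, 'k) mpoly)"
        by (rule trans[OF uq_xpow[of 1, unfolded power_one_right] if_not_P])
      then show ?thesis by (simp only: mult_zero_right)
    next
      case True
      \<comment> \<open>The complementary monomial survives \<open>u\<close> only if
        \<open>p\<close> divides \<open>e\<close>. In that case \<open>sec (xpow e)\<close> is a
        Frobenius image and, as \<open>i \<ge> 1\<close>, \<open>V^i\<close> makes it a multiple of
        \<open>p\<close>; so its value under \<open>\<Phi>\<close>, and with it
        \<open>c i e\<close>, is 0.\<close>
      have "p dvd e v" for v
      proof -
        have "e v < p ^ Suc i" using e by (simp add: box_def del: power_Suc)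
        then have "p ^ Suc i - 1 - e v + Suc (e v) = p * p ^ i" by simp
        then have "((p ^ Suc i - 1 - e v) mod p + Suc (e v)) mod p = 0"
          by (metis mod_add_left_eq mod_mult_self1_is_0)
        then have "(p - 1 + Suc (e v)) mod p = 0" using True by simp
        moreover have "p - 1 + Suc (e v) = e v + p" using p_pos by simp
        ultimately show ?thesis by (simp add: mod_eq_0_iff_dvd)
      qed
      then have xe: "xpow e = (xpow (\<lambda>v. e v div p) :: ('v, 'k) mpoly) ^ p"
        by (simp add: single_expo_power)
      have "sec (xpow e) = wfrob (teich (xpow (\<lambda>v. e v div p) :: ('v, 'k) mpoly))"
        unfolding F_teich teich_power[symmetric] xe[symmetric] by (rule sec_single)
      then have "(ver ^^ i) (sec (xpow e)) = of_nat p * (ver ^^ j) (teich (xpow (\<lambda>v. e v div p) :: ('v, 'k) mpoly))"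
        by (simp add: j funpow_swap1 p_VF[symmetric] ver_pow_hom(2))
      then have "c i e = 0" by (simp add: c_def \<Phi>_p)
      then show ?thesis using q_pos[of i] by (simp add: power_0_left)
    qed
    moreover have "uq p (c i e ^ (p ^ Suc i) * y) = c i e ^ (p ^ i) * uq p y" for e y
      by (rule uq_p_scale)
    ultimately show ?thesis
      unfolding G_def uq_p_sum by (intro sum.neutral) simp
  qed
  ultimately show thesis using that t by blast
qed

text \<open>The coordinates reproduce \<open>\<Phi>\<close> up to the factor \<open>t\<close>. As
  \<open>\<Phi>\<close> sees components only modulo \<open>f\<close>, all multiples of
  \<open>[f]\<close> go to 0 in \<open>A\<close>; by \<open>uq_ker\<close> this becomes divisibility
  by powers of \<open>f\<close> in \<open>S\<close> once the coordinates are scaled. The value at 1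
  shows that \<open>u\<close> of the first coordinate is congruent to \<open>t\<close> modulo the
  maximal ideal.\<close>

theorem splitting_imp_I_seq: "\<exists>g\<in>I_seq p f n. uq p g \<notin> irrelevant_ideal"
proof -
  obtain t G where t: "t \<in> L"
    and G: "\<And>i a. i < n \<Longrightarrow> h (uq (p ^ Suc i) (G i * a)) = h t \<otimes>\<^bsub>A\<^esub> \<Phi> ((ver ^^ i) (sec a))"
    and G0: "\<And>i. 1 \<le> i \<Longrightarrow> uq p (G i) = 0"
    using coordinates_exist by blast
  define gs where "gs = map G [0..<n]"
  have len: "length gs = n" by (simp add: gs_def)
  have drop: "drop i gs = G i # drop (Suc i) gs" if "i < n" for i
    using Cons_nth_drop_Suc[of i gs] that by (simp add: gs_def)
  have okd: "ok (drop (Suc i) gs)" for i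
    using G0 by (auto simp: ok_def gs_def drop_map)
  have ok: "ok (tl gs)" using okd[of 0] by (simp add: drop_Suc)
  have ok': "ok (tl (drop i gs))" for i
    using okd[of i] by (simp add: tl_drop drop_Suc)
  \<comment> \<open>Descending induction: for \<open>i = n\<close> the vector \<open>V^n w\<close>
    agrees with 0 in its first \<open>n\<close> components, and no coordinates are left.\<close>
  have EG: "h (uq (p ^ Suc i) (E (drop i gs) w)) = h t \<otimes>\<^bsub>A\<^esub> \<Phi> ((ver ^^ i) w)" if "i \<le> n" for i w
    using that
  proof (induction i arbitrary: w rule: inc_induct)
    case base
    have "\<Phi> ((ver ^^ n) w) = \<Phi> 0"
      by (rule \<Phi>_cong) (simp add: wnth_ver_pow)
    then show ?case by (simp add: len \<Phi>_0 h_simps del: power_Suc)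
  next
    case (step i)
    have "(ver ^^ i) w = (ver ^^ i) (sec (wnth w 0)) + (ver ^^ Suc i) (red w)"
      by (subst sec_red[of w]) (simp add: ver_pow_hom(1) funpow_swap1)
    then have \<Phi>: "\<Phi> ((ver ^^ i) w) = \<Phi> ((ver ^^ i) (sec (wnth w 0))) \<oplus>\<^bsub>A\<^esub> \<Phi> ((ver ^^ Suc i) (red w))"
      by (simp only: \<Phi>_add)
    have "uq (p ^ Suc i) (E (drop i gs) w) = uq (p ^ Suc i) (G i * wnth w 0) + uq (p ^ Suc (Suc i)) (E (drop (Suc i) gs) (red w))"
      unfolding drop[OF step(2)] E.simps uq_add uq_uq_p by (simp add: add.commute)
    then show ?case
      unfolding \<Phi> using G[OF step(2)] step.IH \<Phi>_closed by (simp add: h_simps(2) A.r_distr del: power_Suc funpow.simps)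
  qed
  have "\<exists>s\<in>L. f ^ (p ^ Suc i) dvd s ^ (p ^ Suc i) * E (drop i gs) (teich f)" if i: "i < n" for i
  proof -
    have "h (uq (p ^ Suc i) (b * E (drop i gs) (teich f))) = \<zero>\<^bsub>A\<^esub>" for b
    proof -
      have "\<Phi> ((ver ^^ i) (sec b * teich f)) = \<Phi> 0"
      proof (rule \<Phi>_cong)
        fix j
        have "f dvd f ^ (p ^ (j - i)) * wnth (sec b) (j - i)"
          by (intro dvd_mult2 dvd_power) simp
        then have "h (wnth (teich f * sec b) (j - i)) = \<zero>\<^bsub>A\<^esub>"
          by (intro h_dvd) simp
        then show "h (wnth ((ver ^^ i) (sec b * teich f)) j) = h (wnth 0 j)"
          by (simp only: wnth_ver_pow mult.commute[of "sec b"]) (simp add: h_simps)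
      qed
      then show ?thesis
        using EG[of i "sec b * teich f"] i by (simp add: E_sec_mult[OF ok'] \<Phi>_0 del: power_Suc)
    qed
    then show ?thesis using uq_ker by metis
  qed
  then obtain s where s: "\<And>i. i < n \<Longrightarrow> s i \<in> L"
    "\<And>i. i < n \<Longrightarrow> f ^ (p ^ Suc i) dvd s i ^ (p ^ Suc i) * E (drop i gs) (teich f)"
    by metis
  \<comment> \<open>One factor for all conditions; \<open>scale_coords\<close> raises it to the
    power that each of them requires.\<close>
  define r where "r = (\<Prod>i<n. s i)"
  have rL: "r \<in> L" unfolding r_def by (rule L_prod) (use s in auto)
  define gs' where "gs' = scale_coords r 1 gs"
  have "teich_cond f 1 gs'"
    unfolding gs'_def
  proof (rule teich_cond_scale_coords)
    fix j assume "j < length gs"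
    then have j: "j < n" by (simp add: len)
    have "s j dvd r" unfolding r_def using j by (intro dvd_prodI) auto
    then have "s j ^ (p ^ Suc j) * E (drop j gs) (teich f) dvd r ^ (p ^ Suc j) * E (drop j gs) (teich f)"
      by (intro mult_dvd_mono dvd_power_same dvd_refl)
    then show "f ^ (p ^ (1 + j)) dvd r ^ (p ^ (1 + j)) * E (drop j gs) (teich f)"
      unfolding plus_1_eq_Suc by (rule dvd_trans[OF s(2)[OF j]])
  qed
  moreover obtain hs where hs: "gs = G 0 # hs" using drop[of 0] n by auto
  ultimately have "teich_cond f 1 ((r ^ p * G 0) # scale_coords r (Suc 1) hs)"
    by (simp add: gs'_def)
  moreover have "ok (scale_coords r (Suc 1) hs)"
    by (rule ok_scale_coords) (use ok hs in simp)
  moreover have "length (scale_coords r (Suc 1) hs) = n - 1"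
    using len hs by simp
  ultimately have "r ^ p * G 0 \<in> I_seq p f (Suc (n - 1))"
    using I_seq_iff_teich_cond[OF f(2)] by blast
  then have mem: "r ^ p * G 0 \<in> I_seq p f n" using n by simp
  have "E gs 1 = G 0" using E_sec[of gs 1] by (simp add: hs)
  then have "h (uq p (G 0)) = h t"
    using EG[of 0 1] n by (simp add: \<Phi>_1)
  then obtain b where b: "b \<in> L" "f dvd b * (uq p (G 0) - t)"
    using h_eq_iff_diff h_ker by blast
  have "b * (uq p (G 0) - t) \<in> irrelevant_ideal"
    using b(2) f(1) is_idealD(6)[OF is_ideal_irrelevant] by (auto simp: dvd_def)
  then have d: "uq p (G 0) - t \<in> irrelevant_ideal"
    using b(1) L by (auto simp: irrelevant_mult_iff)
  have "uq p (G 0) \<notin> irrelevant_ideal"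
  proof
    assume "uq p (G 0) \<in> irrelevant_ideal"
    then have "uq p (G 0) - (uq p (G 0) - t) \<in> irrelevant_ideal"
      using d by (rule is_idealD(5)[OF is_ideal_irrelevant])
    then show False using t L by auto
  qed
  then have "uq p (r ^ p * G 0) \<notin> irrelevant_ideal"
    using rL L by (auto simp: uq_p_frob_mult irrelevant_mult_iff)
  then show ?thesis using mem by blast
qed

end

end

section \<open>Localization\<close>

locale localized = cring B for B (structure) +
  fixes M :: "'a set"
  assumes M_sub: "M \<subseteq> carrier B" and M_1: "\<one> \<in> M" and M_mult: "s \<in> M \<Longrightarrow> t \<in> M \<Longrightarrow> s \<otimes> t \<in> M"
begin

abbreviation frac :: "'a \<Rightarrow> 'a \<Rightarrow> ('a \<times> 'a) set"
  where "frac a s \<equiv> loc_frac B M a s"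

abbreviation Loc :: "('a \<times> 'a) set ring"
  where "Loc \<equiv> localization B M"

lemma M_closed [simp]: "s \<in> M \<Longrightarrow> s \<in> carrier B"
  using M_sub by blast

lemma mem_frac: "(b, t) \<in> frac a s \<longleftrightarrow> b \<in> carrier B \<and> t \<in> M \<and> (\<exists>v\<in>M. v \<otimes> (a \<otimes> t) = v \<otimes> (b \<otimes> s))"
  by (simp add: loc_frac_def)

lemma mem_frac_self: "a \<in> carrier B \<Longrightarrow> s \<in> M \<Longrightarrow> (a, s) \<in> frac a s"
  using M_1 by (auto simp: mem_frac)

lemma rel_trans:
  assumes "a \<in> carrier B" "b \<in> carrier B" "c \<in> carrier B" "s \<in> M" "t \<in> M" "u \<in> M" "v \<in> M" "w \<in> M"
    and 1: "v \<otimes> (a \<otimes> t) = v \<otimes> (b \<otimes> s)" and 2: "w \<otimes> (b \<otimes> u) = w \<otimes> (c \<otimes> t)"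
  shows "(v \<otimes> w \<otimes> t) \<otimes> (a \<otimes> u) = (v \<otimes> w \<otimes> t) \<otimes> (c \<otimes> s)"
proof -
  have "(v \<otimes> w \<otimes> t) \<otimes> (a \<otimes> u) = (v \<otimes> (a \<otimes> t)) \<otimes> (w \<otimes> u)"
    using assms(1-8) by (simp add: m_ac)
  also have "\<dots> = (w \<otimes> (b \<otimes> u)) \<otimes> (v \<otimes> s)"
    unfolding 1 using assms(1-8) by (simp add: m_ac)
  also have "\<dots> = (v \<otimes> w \<otimes> t) \<otimes> (c \<otimes> s)"
    unfolding 2 using assms(1-8) by (simp add: m_ac)
  finally show ?thesis .
qed

lemma frac_subset:
  assumes "a \<in> carrier B" "b \<in> carrier B" "s \<in> M" "t \<in> M" and eq: "\<exists>v\<in>M. v \<otimes> (a \<otimes> t) = v \<otimes> (b \<otimes> s)"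
  shows "frac a s \<subseteq> frac b t"
proof
  fix x assume "x \<in> frac a s"
  then obtain c u w where x: "x = (c, u)" "c \<in> carrier B" "u \<in> M" "w \<in> M" "w \<otimes> (a \<otimes> u) = w \<otimes> (c \<otimes> s)"
    by (cases x) (auto simp: mem_frac)
  obtain v where v: "v \<in> M" "v \<otimes> (b \<otimes> s) = v \<otimes> (a \<otimes> t)" using eq by metis
  have "(v \<otimes> w \<otimes> s) \<otimes> (b \<otimes> u) = (v \<otimes> w \<otimes> s) \<otimes> (c \<otimes> t)"
    using assms x v by (intro rel_trans[of b a c t s u v w]) auto
  moreover have "v \<otimes> w \<otimes> s \<in> M" using v x assms by (intro M_mult)
  ultimately show "x \<in> frac b t" using x by (auto simp: mem_frac)
qed

lemma frac_eq_iff: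
  assumes "a \<in> carrier B" "b \<in> carrier B" "s \<in> M" "t \<in> M"
  shows "frac a s = frac b t \<longleftrightarrow> (\<exists>v\<in>M. v \<otimes> (a \<otimes> t) = v \<otimes> (b \<otimes> s))"
proof
  assume "frac a s = frac b t"
  then have "(b, t) \<in> frac a s" using mem_frac_self[OF assms(2,4)] by simp
  then show "\<exists>v\<in>M. v \<otimes> (a \<otimes> t) = v \<otimes> (b \<otimes> s)" by (simp add: mem_frac)
next
  assume *: "\<exists>v\<in>M. v \<otimes> (a \<otimes> t) = v \<otimes> (b \<otimes> s)"
  then have "\<exists>v\<in>M. v \<otimes> (b \<otimes> s) = v \<otimes> (a \<otimes> t)" by metis
  then show "frac a s = frac b t"
    using frac_subset[OF assms *] frac_subset[of b a t s] assms by blast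
qed

lemma frac_eqI:
  assumes "a \<in> carrier B" "b \<in> carrier B" "s \<in> M" "t \<in> M" "a \<otimes> t = b \<otimes> s"
  shows "frac a s = frac b t"
  using assms M_1 by (subst frac_eq_iff) auto

lemma frac_scale: "a \<in> carrier B \<Longrightarrow> s \<in> M \<Longrightarrow> u \<in> M \<Longrightarrow> frac (a \<otimes> u) (s \<otimes> u) = frac a s"
  by (rule frac_eqI) (auto simp: M_mult m_ac)

lemma carrier_Loc: "carrier Loc = {frac a s | a s. a \<in> carrier B \<and> s \<in> M}"
  by (simp add: localization_def)

lemma frac_closed [simp]: "a \<in> carrier B \<Longrightarrow> s \<in> M \<Longrightarrow> frac a s \<in> carrier Loc"
  by (auto simp: carrier_Loc)

lemma LocE:
  assumes "x \<in> carrier Loc"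
  obtains a s where "a \<in> carrier B" "s \<in> M" "x = frac a s"
  using assms by (auto simp: carrier_Loc)

lemma frac_mem_eq: "a \<in> carrier B \<Longrightarrow> s \<in> M \<Longrightarrow> (a', s') \<in> frac a s \<Longrightarrow> frac a' s' = frac a s \<and> a' \<in> carrier B \<and> s' \<in> M"
  using frac_eq_iff[of a a' s s'] by (auto simp: mem_frac)

text \<open>The operations of \<open>localization\<close> are unions over all representatives; once
  the result is independent of the choice, all members of the union are the same class.\<close>

lemma Loc_union:
  assumes ab: "a \<in> carrier B" "s \<in> M" "b \<in> carrier B" "t \<in> M"
    and F: "\<And>a' s' b' t'. a' \<in> carrier B \<Longrightarrow> s' \<in> M \<Longrightarrow> b' \<in> carrier B \<Longrightarrow> t' \<in> M \<Longrightarrow>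
      frac a' s' = frac a s \<Longrightarrow> frac b' t' = frac b t \<Longrightarrow> F a' s' b' t' = F a s b t"
  shows "(\<Union>(a, s)\<in>frac a s. \<Union>(b, t)\<in>frac b t. F a s b t) = F a s b t"
proof (intro equalityI subsetI)
  fix z assume "z \<in> (\<Union>(a, s)\<in>frac a s. \<Union>(b, t)\<in>frac b t. F a s b t)"
  then obtain a' s' b' t' where *: "(a', s') \<in> frac a s" "(b', t') \<in> frac b t" "z \<in> F a' s' b' t'"
    by blast
  then have "F a' s' b' t' = F a s b t"
    using frac_mem_eq[OF ab(1,2) *(1)] frac_mem_eq[OF ab(3,4) *(2)] by (intro F) simp_all
  then show "z \<in> F a s b t" using *(3) by simp
next
  fix z assume "z \<in> F a s b t"
  then show "z \<in> (\<Union>(a, s)\<in>frac a s. \<Union>(b, t)\<in>frac b t. F a s b t)"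
    using mem_frac_self[OF ab(1,2)] mem_frac_self[OF ab(3,4)] by blast
qed

lemma frac_mult:
  assumes ab: "a \<in> carrier B" "s \<in> M" "b \<in> carrier B" "t \<in> M"
  shows "frac a s \<otimes>\<^bsub>Loc\<^esub> frac b t = frac (a \<otimes> b) (s \<otimes> t)"
proof -
  have "(\<Union>(a, s)\<in>frac a s. \<Union>(b, t)\<in>frac b t. frac (a \<otimes> b) (s \<otimes> t)) = frac (a \<otimes> b) (s \<otimes> t)"
  proof (rule Loc_union[OF ab])
    fix a' s' b' t' assume c: "a' \<in> carrier B" "s' \<in> M" "b' \<in> carrier B" "t' \<in> M"
      and eq: "frac a' s' = frac a s" "frac b' t' = frac b t"
    obtain v w where v: "v \<in> M" "v \<otimes> (a' \<otimes> s) = v \<otimes> (a \<otimes> s')" and w: "w \<in> M" "w \<otimes> (b' \<otimes> t) = w \<otimes> (b \<otimes> t')"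
      using eq ab c by (auto simp: frac_eq_iff)
    have "(v \<otimes> w) \<otimes> ((a' \<otimes> b') \<otimes> (s \<otimes> t)) = (v \<otimes> (a' \<otimes> s)) \<otimes> (w \<otimes> (b' \<otimes> t))"
      using ab c v(1) w(1) by (simp add: m_ac)
    also have "\<dots> = (v \<otimes> w) \<otimes> ((a \<otimes> b) \<otimes> (s' \<otimes> t'))"
      unfolding v(2) w(2) using ab c v(1) w(1) by (simp add: m_ac)
    finally show "frac (a' \<otimes> b') (s' \<otimes> t') = frac (a \<otimes> b) (s \<otimes> t)"
      using ab c v(1) w(1) M_mult by (subst frac_eq_iff) auto
  qed
  then show ?thesis by (simp add: localization_def)
qed

lemma frac_add:
  assumes ab: "a \<in> carrier B" "s \<in> M" "b \<in> carrier B" "t \<in> M"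
  shows "frac a s \<oplus>\<^bsub>Loc\<^esub> frac b t = frac (a \<otimes> t \<oplus> b \<otimes> s) (s \<otimes> t)"
proof -
  have "(\<Union>(a, s)\<in>frac a s. \<Union>(b, t)\<in>frac b t. frac (a \<otimes> t \<oplus> b \<otimes> s) (s \<otimes> t)) = frac (a \<otimes> t \<oplus> b \<otimes> s) (s \<otimes> t)"
  proof (rule Loc_union[OF ab])
    fix a' s' b' t' assume c: "a' \<in> carrier B" "s' \<in> M" "b' \<in> carrier B" "t' \<in> M"
      and eq: "frac a' s' = frac a s" "frac b' t' = frac b t"
    obtain v w where v: "v \<in> M" "v \<otimes> (a' \<otimes> s) = v \<otimes> (a \<otimes> s')" and w: "w \<in> M" "w \<otimes> (b' \<otimes> t) = w \<otimes> (b \<otimes> t')"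
      using eq ab c by (auto simp: frac_eq_iff)
    have "(v \<otimes> w) \<otimes> ((a' \<otimes> t' \<oplus> b' \<otimes> s') \<otimes> (s \<otimes> t)) =
        (v \<otimes> (a' \<otimes> s)) \<otimes> (w \<otimes> t \<otimes> t') \<oplus> (w \<otimes> (b' \<otimes> t)) \<otimes> (v \<otimes> s \<otimes> s')"
      using ab c v(1) w(1) by (simp add: l_distr r_distr m_ac)
    also have "\<dots> = (v \<otimes> w) \<otimes> ((a \<otimes> t \<oplus> b \<otimes> s) \<otimes> (s' \<otimes> t'))"
      unfolding v(2) w(2) using ab c v(1) w(1) by (simp add: l_distr r_distr m_ac)
    finally show "frac (a' \<otimes> t' \<oplus> b' \<otimes> s') (s' \<otimes> t') = frac (a \<otimes> t \<oplus> b \<otimes> s) (s \<otimes> t)"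
      using ab c v(1) w(1) M_mult by (subst frac_eq_iff) auto
  qed
  then show ?thesis by (simp add: localization_def)
qed

lemma one_Loc: "\<one>\<^bsub>Loc\<^esub> = frac \<one> \<one>" and zero_Loc: "\<zero>\<^bsub>Loc\<^esub> = frac \<zero> \<one>"
  by (simp_all add: localization_def)

lemma frac_zero: "s \<in> M \<Longrightarrow> frac \<zero> s = \<zero>\<^bsub>Loc\<^esub>"
  unfolding zero_Loc using M_1 by (intro frac_eqI) auto

lemma cring_Loc: "cring Loc"
proof (rule cringI)
  show "abelian_group Loc"
  proof (rule abelian_groupI)
    fix x y assume "x \<in> carrier Loc" "y \<in> carrier Loc"
    then obtain a s b t where *: "a \<in> carrier B" "s \<in> M" "x = frac a s" "b \<in> carrier B" "t \<in> M" "y = frac b t"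
      by (metis LocE)
    show "x \<oplus>\<^bsub>Loc\<^esub> y \<in> carrier Loc" using * by (simp add: frac_add M_mult)
    show "x \<oplus>\<^bsub>Loc\<^esub> y = y \<oplus>\<^bsub>Loc\<^esub> x"
      using * by (simp add: frac_add m_comm[of s t] a_comm)
    show "\<zero>\<^bsub>Loc\<^esub> \<oplus>\<^bsub>Loc\<^esub> x = x"
      using * M_1 unfolding zero_Loc by (simp add: frac_add)
    show "\<exists>y\<in>carrier Loc. y \<oplus>\<^bsub>Loc\<^esub> x = \<zero>\<^bsub>Loc\<^esub>"
      using * M_mult by (intro bexI[of _ "frac (\<ominus> a) s"]) (simp_all add: frac_add l_minus l_neg frac_zero)
    fix z assume "z \<in> carrier Loc"
    then obtain c u where z: "c \<in> carrier B" "u \<in> M" "z = frac c u" by (rule LocE)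
    show "x \<oplus>\<^bsub>Loc\<^esub> y \<oplus>\<^bsub>Loc\<^esub> z = x \<oplus>\<^bsub>Loc\<^esub> (y \<oplus>\<^bsub>Loc\<^esub> z)"
      using * z by (simp add: frac_add M_mult l_distr r_distr m_ac a_assoc)
  qed (simp add: zero_Loc M_1)
  show "comm_monoid Loc"
  proof (rule comm_monoidI)
    fix x y assume "x \<in> carrier Loc" "y \<in> carrier Loc"
    then obtain a s b t where *: "a \<in> carrier B" "s \<in> M" "x = frac a s" "b \<in> carrier B" "t \<in> M" "y = frac b t"
      by (metis LocE)
    show "x \<otimes>\<^bsub>Loc\<^esub> y \<in> carrier Loc" using * by (simp add: frac_mult M_mult)
    show "x \<otimes>\<^bsub>Loc\<^esub> y = y \<otimes>\<^bsub>Loc\<^esub> x" using * by (simp add: frac_mult m_comm)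
    show "\<one>\<^bsub>Loc\<^esub> \<otimes>\<^bsub>Loc\<^esub> x = x" using * M_1 by (simp add: one_Loc frac_mult)
    fix z assume "z \<in> carrier Loc"
    then obtain c u where z: "c \<in> carrier B" "u \<in> M" "z = frac c u" by (rule LocE)
    show "x \<otimes>\<^bsub>Loc\<^esub> y \<otimes>\<^bsub>Loc\<^esub> z = x \<otimes>\<^bsub>Loc\<^esub> (y \<otimes>\<^bsub>Loc\<^esub> z)"
      using * z by (simp add: frac_mult M_mult m_assoc)
  qed (simp add: one_Loc M_1)
next
  fix x y z assume "x \<in> carrier Loc" "y \<in> carrier Loc" "z \<in> carrier Loc"
  then obtain a s b t c u where *: "a \<in> carrier B" "s \<in> M" "x = frac a s" "b \<in> carrier B" "t \<in> M" "y = frac b t"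
    and z: "c \<in> carrier B" "u \<in> M" "z = frac c u"
    by (metis LocE)
  have "x \<otimes>\<^bsub>Loc\<^esub> z \<oplus>\<^bsub>Loc\<^esub> y \<otimes>\<^bsub>Loc\<^esub> z =
      frac (((a \<otimes> t \<oplus> b \<otimes> s) \<otimes> c) \<otimes> u) ((s \<otimes> t \<otimes> u) \<otimes> u)"
    using * z by (simp add: frac_add frac_mult M_mult l_distr r_distr m_ac)
  also have "\<dots> = frac ((a \<otimes> t \<oplus> b \<otimes> s) \<otimes> c) (s \<otimes> t \<otimes> u)"
    using * z by (intro frac_scale) (auto simp: M_mult)
  also have "\<dots> = (x \<oplus>\<^bsub>Loc\<^esub> y) \<otimes>\<^bsub>Loc\<^esub> z"
    using * z by (simp add: frac_add frac_mult M_mult)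
  finally show "(x \<oplus>\<^bsub>Loc\<^esub> y) \<otimes>\<^bsub>Loc\<^esub> z = x \<otimes>\<^bsub>Loc\<^esub> z \<oplus>\<^bsub>Loc\<^esub> y \<otimes>\<^bsub>Loc\<^esub> z" by simp
qed

sublocale Loc: cring Loc
  by (rule cring_Loc)

abbreviation \<iota> :: "'a \<Rightarrow> ('a \<times> 'a) set" where "\<iota> a \<equiv> frac a \<one>"

lemma \<iota>_hom: "\<iota> \<in> ring_hom B Loc"
  by (rule ring_hom_memI) (simp_all add: M_1 frac_mult frac_add one_Loc)

lemma \<iota>_closed [simp]: "a \<in> carrier B \<Longrightarrow> \<iota> a \<in> carrier Loc"
  by (simp add: M_1)

lemma frac_times_\<iota>: "a \<in> carrier B \<Longrightarrow> s \<in> M \<Longrightarrow> b \<in> carrier B \<Longrightarrow> frac a s \<otimes>\<^bsub>Loc\<^esub> \<iota> b = frac (a \<otimes> b) s"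
  by (simp add: frac_mult M_1)

lemma frac_cancel: "a \<in> carrier B \<Longrightarrow> s \<in> M \<Longrightarrow> frac (a \<otimes> s) s = \<iota> a"
  using M_1 by (intro frac_eqI) auto

lemma \<iota>_unit: "s \<in> M \<Longrightarrow> \<iota> s \<in> Units Loc"
proof -
  assume s: "s \<in> M"
  have "frac \<one> s \<otimes>\<^bsub>Loc\<^esub> \<iota> s = \<one>\<^bsub>Loc\<^esub>"
    using s frac_cancel[of \<one> s] by (simp add: frac_times_\<iota> one_Loc)
  then show ?thesis
    using s Loc.m_comm[of "frac \<one> s" "\<iota> s"] unfolding Units_def by (intro CollectI conjI bexI[of _ "frac \<one> s"]) simp_all
qed

lemma eq_fracI:
  assumes "y \<in> carrier Loc" "a \<in> carrier B" "s \<in> M" "y \<otimes>\<^bsub>Loc\<^esub> \<iota> s = \<iota> a"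
  shows "y = frac a s"
proof -
  have "frac a s \<otimes>\<^bsub>Loc\<^esub> \<iota> s = \<iota> a"
    using assms by (simp add: frac_times_\<iota> frac_cancel)
  then have "\<iota> s \<otimes>\<^bsub>Loc\<^esub> y = \<iota> s \<otimes>\<^bsub>Loc\<^esub> frac a s"
    using assms by (simp add: Loc.m_comm)
  then show ?thesis
    using assms \<iota>_unit[of s] by (simp add: Loc.Units_l_cancel)
qed

lemma \<iota>_eq_0:
  assumes "a \<in> carrier B" "\<iota> a = \<zero>\<^bsub>Loc\<^esub>"
  shows "\<exists>v\<in>M. v \<otimes> a = \<zero>"
  using assms M_1 by (auto simp: zero_Loc frac_eq_iff)

end

lemma localized_prime:
  fixes B (structure)
  assumes "primeideal P B"
  shows "localized B (carrier B - P)"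
proof -
  interpret P: primeideal P B by fact
  have "\<one> \<notin> P" using P.I_notcarr P.one_imp_carrier by blast
  moreover have "s \<otimes> t \<notin> P" if "s \<in> carrier B - P" "t \<in> carrier B - P" for s t
    using P.I_prime[of s t] that by blast
  ultimately show ?thesis
    by (intro localized.intro P.cring_axioms localized_axioms.intro) auto
qed

section \<open>The local ring of the hypersurface\<close>

lemma localized_poly_ring: "localized poly_ring (UNIV - (irrelevant_ideal :: ('v, 'k::field) mpoly set))"
  by (intro localized.intro cring_poly_ring localized_axioms.intro)
    (auto simp: irrelevant_mult_iff one_not_irrelevant)

context perfect_char
begin

definition to_hypersurface :: "('v::finite, 'k) mpoly \<Rightarrow> ('v, 'k) mpoly \<Rightarrow> (('v, 'k) mpoly \<times> ('v, 'k) mpoly) set set"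
  where "to_hypersurface f a = PIdl\<^bsub>local_poly_ring\<^esub> (loc_frac poly_ring (UNIV - irrelevant_ideal) f 1)
    +>\<^bsub>local_poly_ring\<^esub> loc_frac poly_ring (UNIV - irrelevant_ideal) a 1"

text \<open>The kernel condition: if \<open>a / 1\<close> equals \<open>(c / s) f\<close> in the
  local ring, clearing denominators gives \<open>v s a = v c f\<close> in \<open>S\<close>, with
  \<open>v s\<close> outside the maximal ideal.\<close>

lemma hypersurface_fractions_hypersurface_ring:
  fixes f :: "('v::finite, 'k) mpoly"
  shows "hypersurface_fractions p (hypersurface_ring f) f (to_hypersurface f) (UNIV - irrelevant_ideal)"
proof -
  interpret R: localized "poly_ring :: ('v, 'k) mpoly ring" "UNIV - irrelevant_ideal"
    by (rule localized_poly_ring)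
  have loc: "local_poly_ring = R.Loc" by (simp add: local_poly_ring_def)
  let ?\<iota> = "\<lambda>a. R.frac a 1"
  have \<iota>: "?\<iota> \<in> ring_hom poly_ring R.Loc" using R.\<iota>_hom by simp
  have \<iota>c: "?\<iota> a \<in> carrier R.Loc" for a using R.\<iota>_closed[of a] by simp
  let ?I = "PIdl\<^bsub>R.Loc\<^esub> (?\<iota> f)"
  interpret I: ideal ?I R.Loc
    by (rule R.Loc.cgenideal_ideal[OF \<iota>c])
  have B: "hypersurface_ring f = R.Loc Quot ?I"
    by (simp add: hypersurface_ring_def loc)
  have h: "to_hypersurface f = (\<lambda>a. ?I +>\<^bsub>R.Loc\<^esub> ?\<iota> a)"
    by (simp add: to_hypersurface_def[abs_def] loc)
  interpret B: cring "R.Loc Quot ?I"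
    by (rule I.quotient_is_cring[OF R.cring_Loc])
  have pr: "(+>\<^bsub>R.Loc\<^esub>) ?I \<in> ring_hom R.Loc (R.Loc Quot ?I)"
    by (rule I.rcos_ring_hom)
  have hom: "to_hypersurface f \<in> ring_hom poly_ring (R.Loc Quot ?I)"
    using ring_hom_trans[OF \<iota> pr] by (simp add: h comp_def)
  have frac: "(?I +>\<^bsub>R.Loc\<^esub> R.frac a s) \<otimes>\<^bsub>R.Loc Quot ?I\<^esub> to_hypersurface f s = to_hypersurface f a"
    if "s \<in> UNIV - irrelevant_ideal" for a s
    unfolding h using that R.frac_times_\<iota>[of a s s] R.frac_cancel[of a s]
    by (subst ring_hom_mult[OF pr, symmetric]) (simp_all add: \<iota>c)
  have hc: "to_hypersurface f a \<in> carrier (R.Loc Quot ?I)" for a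
    using ring_hom_closed[OF hom, of a] by simp
  have prc: "x \<in> carrier R.Loc \<Longrightarrow> ?I +>\<^bsub>R.Loc\<^esub> x \<in> carrier (R.Loc Quot ?I)" for x
    by (rule ring_hom_closed[OF pr])
  show ?thesis
    unfolding B
  proof (intro hypersurface_fractions.intro perfect_char_axioms B.cring_axioms hypersurface_fractions_axioms.intro hom)
    show "1 \<in> UNIV - (irrelevant_ideal :: ('v, 'k) mpoly set)" by (simp add: one_not_irrelevant)
    show "a * b \<in> UNIV - irrelevant_ideal" if "a \<in> UNIV - irrelevant_ideal" "b \<in> UNIV - irrelevant_ideal"
      for a b :: "('v, 'k) mpoly"
      using that by (simp add: irrelevant_mult_iff)
    show "to_hypersurface f b \<in> Units (R.Loc Quot ?I)" if b: "b \<in> UNIV - irrelevant_ideal" for b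
    proof -
      have "(?I +>\<^bsub>R.Loc\<^esub> R.frac 1 b) \<otimes>\<^bsub>R.Loc Quot ?I\<^esub> to_hypersurface f b = \<one>\<^bsub>R.Loc Quot ?I\<^esub>"
        using frac[OF b, of 1] ring_hom_one[OF hom] by simp
      moreover have "?I +>\<^bsub>R.Loc\<^esub> R.frac 1 b \<in> carrier (R.Loc Quot ?I)"
        using b by (intro prc R.frac_closed) auto
      ultimately show ?thesis
        using B.m_comm hc unfolding Units_def by (intro CollectI conjI bexI[of _ "?I +>\<^bsub>R.Loc\<^esub> R.frac 1 b"]) auto
    qed
    show "\<exists>a. \<exists>b\<in>UNIV - irrelevant_ideal. x \<otimes>\<^bsub>R.Loc Quot ?I\<^esub> to_hypersurface f b = to_hypersurface f a"
      if xc: "x \<in> carrier (R.Loc Quot ?I)" for x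
    proof -
      obtain r where r: "r \<in> carrier R.Loc" "x = ?I +>\<^bsub>R.Loc\<^esub> r"
        using xc by (auto simp: FactRing_def A_RCOSETS_def')
      obtain a s where "a \<in> carrier poly_ring" "s \<in> UNIV - irrelevant_ideal" "r = R.frac a s"
        using r(1) by (rule R.LocE)
      then show ?thesis using frac[of s a] r(2) by blast
    qed
    show "to_hypersurface f f = \<zero>\<^bsub>R.Loc Quot ?I\<^esub>"
      using I.a_rcos_const[OF R.Loc.cgenideal_self[OF \<iota>c]] by (simp add: h FactRing_def)
    show "\<exists>t\<in>UNIV - irrelevant_ideal. f dvd t * a" if "to_hypersurface f a = \<zero>\<^bsub>R.Loc Quot ?I\<^esub>" for a
    proof -
      have "?I +>\<^bsub>R.Loc\<^esub> ?\<iota> a = ?I" using that by (simp add: h FactRing_def)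
      then have "?\<iota> a \<in> ?I" using I.rcos_const_imp_mem[OF \<iota>c] by blast
      then obtain y where y: "y \<in> carrier R.Loc" "?\<iota> a = y \<otimes>\<^bsub>R.Loc\<^esub> ?\<iota> f"
        unfolding cgenideal_def by blast
      obtain c s where "c \<in> carrier poly_ring" and cs: "s \<in> UNIV - irrelevant_ideal" "y = R.frac c s"
        using y(1) by (rule R.LocE)
      have "?\<iota> a = R.frac (c * f) s"
        using y(2) cs R.frac_times_\<iota>[of c s f] by simp
      then obtain v where v: "v \<in> UNIV - irrelevant_ideal" "v * (a * s) = v * (c * f)"
        using R.frac_eq_iff[of a "c * f" 1 s] cs one_not_irrelevant[where ?'v = 'v and ?'k = 'k] by auto
      have "(v * s) * a = f * (v * c)"
        using v(2) by (simp add: mult_ac)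
      then show ?thesis
        using v(1) cs(1) by (intro bexI[of _ "v * s"]) (auto simp: irrelevant_mult_iff)
    qed
  qed
qed

end

context hypersurface_fractions
begin

lemma unit_notin_prime:
  assumes "primeideal P A" "b \<in> L"
  shows "h b \<notin> P"
proof
  interpret P: primeideal P A by fact
  assume "h b \<in> P"
  then have "h b \<otimes>\<^bsub>A\<^esub> inv\<^bsub>A\<^esub> (h b) \<in> P"
    using h_unit[OF assms(2)] by (intro P.I_r_closed) auto
  then show False
    using h_unit[OF assms(2)] P.I_notcarr P.one_imp_carrier by simp
qed

lemma notin_prime_mult:
  assumes "primeideal P A" "x \<in> carrier A" "y \<in> carrier A" "x \<notin> P" "y \<notin> P"
  shows "x \<otimes>\<^bsub>A\<^esub> y \<notin> P"
  using primeideal.I_prime[OF assms(1-3)] assms(4,5) by blast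

text \<open>The quotient of \<open>a / b\<close> by \<open>c / d\<close> is
  \<open>(a d) / (b c)\<close>. The form with cleared denominators serves both the stalks as rings
  of fractions and the local description of sections.\<close>

lemma fraction_of_fractions:
  assumes P: "primeideal P A"
    and a: "\<beta> \<in> carrier A" "\<beta> \<otimes>\<^bsub>A\<^esub> h b = h a" "b \<in> L"
    and c: "\<gamma> \<in> carrier A - P" "\<gamma> \<otimes>\<^bsub>A\<^esub> h d = h c" "d \<in> L"
  shows "loc_frac A (carrier A - P) \<beta> \<gamma> \<otimes>\<^bsub>localization A (carrier A - P)\<^esub> loc_frac A (carrier A - P) (h (b * c)) \<one>\<^bsub>A\<^esub>
      = loc_frac A (carrier A - P) (h (a * d)) \<one>\<^bsub>A\<^esub>"
    and "h (b * c) \<notin> P"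
proof -
  interpret Loc: localized A "carrier A - P" by (rule localized_prime[OF P])
  have \<gamma>: "\<gamma> \<in> carrier A" using c by simp
  have "\<beta> \<otimes>\<^bsub>A\<^esub> h (b * c) = h (a * d) \<otimes>\<^bsub>A\<^esub> \<gamma>"
    unfolding h_simps(1) a(2)[symmetric] c(2)[symmetric] using a(1) \<gamma> by (simp add: A.m_ac)
  then show "loc_frac A (carrier A - P) \<beta> \<gamma> \<otimes>\<^bsub>localization A (carrier A - P)\<^esub> loc_frac A (carrier A - P) (h (b * c)) \<one>\<^bsub>A\<^esub>
      = loc_frac A (carrier A - P) (h (a * d)) \<one>\<^bsub>A\<^esub>"
    using Loc.frac_times_\<iota>[OF a(1) c(1) h_closed] Loc.frac_cancel[OF h_closed c(1)] by simp
  have "h c \<notin> P"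
    unfolding c(2)[symmetric] using c unit_notin_prime[OF P c(3)] by (intro notin_prime_mult[OF P]) auto
  then show "h (b * c) \<notin> P"
    unfolding h_simps(1) using unit_notin_prime[OF P a(3)] by (intro notin_prime_mult[OF P]) auto
qed

text \<open>Localizing once more at a prime \<open>P\<close> enlarges the denominators to all
  elements not mapped into \<open>P\<close>, so that everything proved for \<open>A\<close> holds
  for each stalk.\<close>

lemma hypersurface_fractions_stalk:
  assumes P: "primeideal P A"
  shows "hypersurface_fractions p (localization A (carrier A - P)) f
    (\<lambda>a. loc_frac A (carrier A - P) (h a) \<one>\<^bsub>A\<^esub>) {t. h t \<notin> P}"
proof -
  interpret Loc: localized A "carrier A - P" by (rule localized_prime[OF P])
  interpret P: primeideal P A by fact
  show ?thesis
  proof (intro hypersurface_fractions.intro perfect_char_axioms Loc.cring_Loc hypersurface_fractions_axioms.intro)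
    show "(\<lambda>a. Loc.\<iota> (h a)) \<in> ring_hom poly_ring Loc.Loc"
      using ring_hom_trans[OF h_hom Loc.\<iota>_hom] by (simp add: comp_def)
    show "1 \<in> {t. h t \<notin> P}"
      using unit_notin_prime[OF P L_1] by simp
    show "a * b \<in> {t. h t \<notin> P}" if "a \<in> {t. h t \<notin> P}" "b \<in> {t. h t \<notin> P}" for a b
      using notin_prime_mult[OF P, of "h a" "h b"] that by (simp add: h_simps(1))
    show "Loc.\<iota> (h b) \<in> Units Loc.Loc" if "b \<in> {t. h t \<notin> P}" for b
      using that by (intro Loc.\<iota>_unit) simp
    show "\<exists>a. \<exists>b\<in>{t. h t \<notin> P}. x \<otimes>\<^bsub>Loc.Loc\<^esub> Loc.\<iota> (h b) = Loc.\<iota> (h a)" if xc: "x \<in> carrier Loc.Loc" for x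
    proof -
      obtain \<beta> \<gamma> where x: "\<beta> \<in> carrier A" "\<gamma> \<in> carrier A - P" "x = Loc.frac \<beta> \<gamma>"
        using xc by (rule Loc.LocE)
      obtain a b where a: "b \<in> L" "\<beta> \<otimes>\<^bsub>A\<^esub> h b = h a" using h_frac[OF x(1)] by blast
      obtain c d where c: "d \<in> L" "\<gamma> \<otimes>\<^bsub>A\<^esub> h d = h c" using h_frac[of \<gamma>] x(2) by blast
      show ?thesis
        using fraction_of_fractions[OF P x(1) a(2,1) x(2) c(2,1)] x(3) by blast
    qed
    show "Loc.\<iota> (h f) = \<zero>\<^bsub>Loc.Loc\<^esub>"
      by (simp add: h_f Loc.zero_Loc)
    show "\<exists>t\<in>{t. h t \<notin> P}. f dvd t * a" if 0: "Loc.\<iota> (h a) = \<zero>\<^bsub>Loc.Loc\<^esub>" for a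
    proof -
      obtain v where v: "v \<in> carrier A - P" "v \<otimes>\<^bsub>A\<^esub> h a = \<zero>\<^bsub>A\<^esub>"
        using Loc.\<iota>_eq_0[OF h_closed 0] by blast
      obtain c d where c: "d \<in> L" "v \<otimes>\<^bsub>A\<^esub> h d = h c" using h_frac[of v] v(1) by blast
      have "h (c * a) = h d \<otimes>\<^bsub>A\<^esub> (v \<otimes>\<^bsub>A\<^esub> h a)"
        unfolding h_simps(1) c(2)[symmetric] using v(1) by (simp add: A.m_ac)
      then have "h (c * a) = \<zero>\<^bsub>A\<^esub>" by (simp add: v(2))
      then obtain t where t: "t \<in> L" "f dvd t * (c * a)" using h_ker by blast
      have "h c \<notin> P"
        unfolding c(2)[symmetric] using v unit_notin_prime[OF P c(1)] by (intro notin_prime_mult[OF P]) auto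
      then have "h (t * c) \<notin> P"
        unfolding h_simps(1) using unit_notin_prime[OF P t(1)] by (intro notin_prime_mult[OF P]) auto
      then show ?thesis using t(2) by (intro bexI[of _ "t * c"]) (simp_all add: mult.assoc)
    qed
  qed
qed

end

section \<open>Functoriality of truncated Witt vectors\<close>

lemma witt_ring_simps:
  "i < n \<Longrightarrow> (x \<oplus>\<^bsub>witt_ring p n A\<^esub> y) i = int_poly_eval A (case_sum x y) (witt_add_poly p i)"
  "i < n \<Longrightarrow> (x \<otimes>\<^bsub>witt_ring p n A\<^esub> y) i = int_poly_eval A (case_sum x y) (witt_mult_poly p i)"
  "\<not> i < n \<Longrightarrow> (x \<oplus>\<^bsub>witt_ring p n A\<^esub> y) i = undefined"
  "\<not> i < n \<Longrightarrow> (x \<otimes>\<^bsub>witt_ring p n A\<^esub> y) i = undefined"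
  by (simp_all add: witt_ring_def)

lemma carrier_witt_ring: "carrier (witt_ring p n A) = {..<n} \<rightarrow>\<^sub>E carrier A"
  by (simp add: witt_ring_def)

text \<open>The Witt polynomials of index \<open>i\<close> involve only variables of index at most
  \<open>i\<close>, so entries below the length suffice. The relation \<open>Q\<close> covers
  membership in a carrier and equality under a map at once.\<close>

lemma case_sum_bounded:
  fixes x y :: "nat \<Rightarrow> 'a"
  assumes "prime p" "i < n" "v \<in> poly_vars (witt_add_poly p i) \<or> v \<in> poly_vars (witt_mult_poly p i)"
    and "\<And>j. j < n \<Longrightarrow> Q (x j) (x' j)" "\<And>j. j < n \<Longrightarrow> Q (y j) (y' j)"
  shows "Q (case_sum x y v) (case_sum x' y' v)"
proof -
  have "case_sum id id v \<le> i"
    using assms(3) isobaric_vars isobaric_witt_polys[OF assms(1)] by blast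
  then show ?thesis using assms(2,4,5) by (cases v) auto
qed

context ring_hom_cring
begin

lemma witt_map_closed: "x \<in> carrier (witt_ring p n R) \<Longrightarrow> witt_map n h x \<in> carrier (witt_ring p n S)"
  by (auto simp: carrier_witt_ring witt_map_def)

lemma witt_map_hom:
  assumes p: "prime p" and x: "x \<in> carrier (witt_ring p n R)" and y: "y \<in> carrier (witt_ring p n R)"
  shows "witt_map n h (x \<oplus>\<^bsub>witt_ring p n R\<^esub> y) = witt_map n h x \<oplus>\<^bsub>witt_ring p n S\<^esub> witt_map n h y"
    and "witt_map n h (x \<otimes>\<^bsub>witt_ring p n R\<^esub> y) = witt_map n h x \<otimes>\<^bsub>witt_ring p n S\<^esub> witt_map n h y"
proof -
  have c: "case_sum x y v \<in> carrier R \<and> h (case_sum x y v) = case_sum (witt_map n h x) (witt_map n h y) v"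
    if "i < n" "v \<in> poly_vars (witt_add_poly p i) \<or> v \<in> poly_vars (witt_mult_poly p i)" for i v
    by (rule case_sum_bounded[OF p that, where Q = "\<lambda>a b. a \<in> carrier R \<and> h a = b"])
      (use x y in \<open>simp_all add: carrier_witt_ring witt_map_def PiE_iff\<close>)
  have ev: "h (int_poly_eval R (case_sum x y) P) = int_poly_eval S (case_sum (witt_map n h x) (witt_map n h y)) P"
    if "i < n" "P = witt_add_poly p i \<or> P = witt_mult_poly p i" for i P
  proof -
    have v: "case_sum x y v \<in> carrier R" and hv: "h (case_sum x y v) = case_sum (witt_map n h x) (witt_map n h y) v"
      if "v \<in> poly_vars P" for v
      using c[OF \<open>i < n\<close>, of v] \<open>P = _ \<or> _\<close> that by blast+
    have "h (int_poly_eval R (case_sum x y) P) = int_poly_eval S (\<lambda>v. h (case_sum x y v)) P"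
      by (rule hom_int_poly_eval[OF v])
    also have "\<dots> = int_poly_eval S (case_sum (witt_map n h x) (witt_map n h y)) P"
      using hv hom_closed[OF v] by (intro S.int_poly_eval_cong) simp_all
    finally show ?thesis .
  qed
  show "witt_map n h (x \<oplus>\<^bsub>witt_ring p n R\<^esub> y) = witt_map n h x \<oplus>\<^bsub>witt_ring p n S\<^esub> witt_map n h y"
  proof
    fix i show "witt_map n h (x \<oplus>\<^bsub>witt_ring p n R\<^esub> y) i = (witt_map n h x \<oplus>\<^bsub>witt_ring p n S\<^esub> witt_map n h y) i"
      by (cases "i < n") (simp_all add: witt_ring_simps ev, simp_all add: witt_map_def witt_ring_simps ev[unfolded witt_map_def])
  qed
  show "witt_map n h (x \<otimes>\<^bsub>witt_ring p n R\<^esub> y) = witt_map n h x \<otimes>\<^bsub>witt_ring p n S\<^esub> witt_map n h y"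
  proof
    fix i show "witt_map n h (x \<otimes>\<^bsub>witt_ring p n R\<^esub> y) i = (witt_map n h x \<otimes>\<^bsub>witt_ring p n S\<^esub> witt_map n h y) i"
      by (cases "i < n") (simp_all add: witt_ring_simps ev, simp_all add: witt_map_def witt_ring_simps ev[unfolded witt_map_def])
  qed
qed

lemma witt_map_frob:
  assumes "x \<in> carrier (witt_ring p n R)"
  shows "witt_map n h (witt_frob p n R x) = witt_frob p n S (witt_map n h x)"
  unfolding witt_frob_def witt_map_def
proof (rule restrict_ext)
  fix i assume "i \<in> {..<n}"
  then show "h ((\<lambda>i\<in>{..<n}. x i [^]\<^bsub>R\<^esub> p) i) = (\<lambda>i\<in>{..<n}. h (x i)) i [^]\<^bsub>S\<^esub> p"
    using assms hom_nat_pow_carrier[of "x i" p] by (simp add: carrier_witt_ring PiE_iff)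
qed

end

lemma (in cring) witt_frob_closed: "x \<in> carrier (witt_ring p n R) \<Longrightarrow> witt_frob p n R x \<in> carrier (witt_ring p n R)"
  by (auto simp: witt_frob_def witt_map_def carrier_witt_ring)

section \<open>Sections over open sets of the spectrum\<close>

context cring
begin

abbreviation stalk :: "'a set \<Rightarrow> ('a \<times> 'a) set ring"
  where "stalk P \<equiv> localization R (carrier R - P)"

lemma zariski_prime: "U \<in> zariski_opens R \<Longrightarrow> P \<in> U \<Longrightarrow> primeideal P R"
  by (auto simp: zariski_opens_def prime_spectrum_def)

lemma prime_spectrum_open: "prime_spectrum R \<in> zariski_opens R"
proof -
  have "\<one> \<notin> P" if "primeideal P R" for P
  proof -
    interpret P: primeideal P R by fact
    show ?thesis using P.I_notcarr P.one_imp_carrier by blast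
  qed
  then have "prime_spectrum R = {P \<in> prime_spectrum R. \<not> {\<one>} \<subseteq> P}"
    by (auto simp: prime_spectrum_def)
  then show ?thesis unfolding zariski_opens_def by blast
qed

lemma zariski_Int:
  assumes "U \<in> zariski_opens R" "V \<in> zariski_opens R"
  shows "U \<inter> V \<in> zariski_opens R"
proof -
  obtain D E where D: "D \<subseteq> carrier R" "U = {P \<in> prime_spectrum R. \<not> D \<subseteq> P}"
    and E: "E \<subseteq> carrier R" "V = {P \<in> prime_spectrum R. \<not> E \<subseteq> P}"
    using assms unfolding zariski_opens_def by blast
  let ?F = "{x \<otimes> y | x y. x \<in> D \<and> y \<in> E}"
  have "\<not> ?F \<subseteq> P \<longleftrightarrow> \<not> D \<subseteq> P \<and> \<not> E \<subseteq> P" if "P \<in> prime_spectrum R" for P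
  proof -
    interpret P: primeideal P R using that by (simp add: prime_spectrum_def)
    have "x \<otimes> y \<in> P \<longleftrightarrow> x \<in> P \<or> y \<in> P" if "x \<in> carrier R" "y \<in> carrier R" for x y
      using P.I_prime[of x y] P.I_l_closed[of y x] P.I_r_closed[of x y] that by blast
    then show ?thesis using D(1) E(1) by blast
  qed
  then have "U \<inter> V = {P \<in> prime_spectrum R. \<not> ?F \<subseteq> P}"
    unfolding D(2) E(2) by blast
  moreover have "?F \<subseteq> carrier R" using D(1) E(1) by auto
  ultimately show ?thesis unfolding zariski_opens_def by blast
qed

definition locally_frac :: "'a set set \<Rightarrow> 'a set \<Rightarrow> ('a set \<Rightarrow> ('a \<times> 'a) set) \<Rightarrow> bool"
  where "locally_frac U P s \<longleftrightarrow> (\<exists>V\<in>zariski_opens R. P \<in> V \<and> V \<subseteq> U \<and>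
    (\<exists>a\<in>carrier R. \<exists>b\<in>carrier R. \<forall>Q\<in>V. b \<notin> Q \<and> s Q = loc_frac R (carrier R - Q) a b))"

lemma carrier_spec_sections:
  "carrier (spec_sections R U) = {s \<in> (\<Pi>\<^sub>E P\<in>U. carrier (stalk P)). \<forall>P\<in>U. locally_frac U P s}"
  by (simp add: spec_sections_def locally_frac_def)

lemma spec_sections_ops:
  "s \<otimes>\<^bsub>spec_sections R U\<^esub> t = (\<lambda>P\<in>U. s P \<otimes>\<^bsub>stalk P\<^esub> t P)"
  "s \<oplus>\<^bsub>spec_sections R U\<^esub> t = (\<lambda>P\<in>U. s P \<oplus>\<^bsub>stalk P\<^esub> t P)"
  "\<one>\<^bsub>spec_sections R U\<^esub> = (\<lambda>P\<in>U. \<one>\<^bsub>stalk P\<^esub>)"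
  "\<zero>\<^bsub>spec_sections R U\<^esub> = (\<lambda>P\<in>U. \<zero>\<^bsub>stalk P\<^esub>)"
  by (simp_all add: spec_sections_def)

lemma cring_stalk: "primeideal P R \<Longrightarrow> cring (stalk P)"
  using localized.cring_Loc[OF localized_prime] .

lemma section_val: "s \<in> carrier (spec_sections R U) \<Longrightarrow> P \<in> U \<Longrightarrow> s P \<in> carrier (stalk P)"
  by (auto simp: carrier_spec_sections)

lemma section_ext: "s \<in> carrier (spec_sections R U) \<Longrightarrow> s \<in> extensional U"
  by (auto simp: carrier_spec_sections PiE_def)

lemma section_eqI:
  assumes "s \<in> extensional U" "t \<in> extensional U" "\<And>P. P \<in> U \<Longrightarrow> s P = t P"
  shows "s = t"
  using assms by (rule extensionalityI)

lemma section_fracE: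
  assumes "s \<in> carrier (spec_sections R U)" "P \<in> U"
  obtains V a b where "V \<in> zariski_opens R" "P \<in> V" "V \<subseteq> U" "a \<in> carrier R" "b \<in> carrier R"
    "\<forall>Q\<in>V. b \<notin> Q \<and> s Q = loc_frac R (carrier R - Q) a b"
proof -
  have "locally_frac U P s" using assms by (simp add: carrier_spec_sections)
  then show thesis unfolding locally_frac_def using that by blast
qed

lemma sectionI:
  assumes "s \<in> extensional U" "\<And>P. P \<in> U \<Longrightarrow> s P \<in> carrier (stalk P)" "\<And>P. P \<in> U \<Longrightarrow> locally_frac U P s"
  shows "s \<in> carrier (spec_sections R U)"
  using assms by (auto simp: carrier_spec_sections PiE_def)

text \<open>One argument for all operations: on the intersection of two neighbourhoods both sections
  are single fractions, and \<open>num\<close> supplies the numerator of the result over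
  \<open>b \<otimes> d\<close>.\<close>

lemma section_combine:
  assumes U: "U \<in> zariski_opens R" and s: "s \<in> carrier (spec_sections R U)" and t: "t \<in> carrier (spec_sections R U)"
    and num: "\<And>a b c d. a \<in> carrier R \<Longrightarrow> b \<in> carrier R \<Longrightarrow> c \<in> carrier R \<Longrightarrow> d \<in> carrier R \<Longrightarrow> num a b c d \<in> carrier R"
    and op: "\<And>Q a b c d. primeideal Q R \<Longrightarrow> a \<in> carrier R \<Longrightarrow> b \<in> carrier R - Q \<Longrightarrow> c \<in> carrier R \<Longrightarrow>
      d \<in> carrier R - Q \<Longrightarrow> F Q (loc_frac R (carrier R - Q) a b) (loc_frac R (carrier R - Q) c d) =
        loc_frac R (carrier R - Q) (num a b c d) (b \<otimes> d)"
  shows "(\<lambda>P\<in>U. F P (s P) (t P)) \<in> carrier (spec_sections R U)"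
proof -
  have *: "\<exists>V\<in>zariski_opens R. P \<in> V \<and> V \<subseteq> U \<and> (\<exists>a\<in>carrier R. \<exists>b\<in>carrier R.
      \<forall>Q\<in>V. b \<notin> Q \<and> F Q (s Q) (t Q) = loc_frac R (carrier R - Q) a b)" if P: "P \<in> U" for P
  proof -
    obtain V a b where V: "V \<in> zariski_opens R" "P \<in> V" "V \<subseteq> U" "a \<in> carrier R" "b \<in> carrier R"
      "\<forall>Q\<in>V. b \<notin> Q \<and> s Q = loc_frac R (carrier R - Q) a b"
      by (rule section_fracE[OF s P])
    obtain W c d where W: "W \<in> zariski_opens R" "P \<in> W" "W \<subseteq> U" "c \<in> carrier R" "d \<in> carrier R"
      "\<forall>Q\<in>W. d \<notin> Q \<and> t Q = loc_frac R (carrier R - Q) c d"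
      by (rule section_fracE[OF t P])
    have VW: "b \<otimes> d \<notin> Q \<and> F Q (s Q) (t Q) = loc_frac R (carrier R - Q) (num a b c d) (b \<otimes> d)" if "Q \<in> V \<inter> W" for Q
    proof -
      have Q: "primeideal Q R" using that zariski_prime[OF V(1)] by blast
      interpret Q: localized R "carrier R - Q" by (rule localized_prime[OF Q])
      have bd: "b \<in> carrier R - Q" "d \<in> carrier R - Q" using that V W by auto
      show ?thesis
        using Q.M_mult[OF bd] op[OF Q V(4) bd(1) W(4) bd(2)] V(6) W(6) that by auto
    qed
    show ?thesis
    proof (rule bexI[OF _ zariski_Int[OF V(1) W(1)]], intro conjI)
      show "P \<in> V \<inter> W" using V(2) W(2) by blast
      show "V \<inter> W \<subseteq> U" using V(3) by blast
      show "\<exists>a\<in>carrier R. \<exists>b\<in>carrier R. \<forall>Q\<in>V \<inter> W. b \<notin> Q \<and> F Q (s Q) (t Q) = loc_frac R (carrier R - Q) a b"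
      proof (rule bexI[of _ "num a b c d"], rule bexI[of _ "b \<otimes> d"], rule ballI)
        show "num a b c d \<in> carrier R" by (rule num[OF V(4,5) W(4,5)])
        show "b \<otimes> d \<in> carrier R" by (rule m_closed[OF V(5) W(5)])
      qed (rule VW)
    qed
  qed
  show ?thesis
  proof (rule sectionI)
    fix P assume P: "P \<in> U"
    interpret P: localized R "carrier R - P" by (rule localized_prime[OF zariski_prime[OF U P]])
    obtain V a b where V: "V \<in> zariski_opens R" "P \<in> V" "V \<subseteq> U" "a \<in> carrier R" "b \<in> carrier R"
      "\<forall>Q\<in>V. b \<notin> Q \<and> F Q (s Q) (t Q) = loc_frac R (carrier R - Q) a b"
      using *[OF P] by blast
    show "locally_frac U P (\<lambda>P\<in>U. F P (s P) (t P))"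
      unfolding locally_frac_def
    proof (rule bexI[OF _ V(1)], intro conjI, rule V(2), rule V(3), rule bexI[OF _ V(4)], rule bexI[OF _ V(5)], rule ballI)
      fix Q assume "Q \<in> V"
      then show "b \<notin> Q \<and> (\<lambda>P\<in>U. F P (s P) (t P)) Q = loc_frac R (carrier R - Q) a b"
        using V(3,6) by auto
    qed
    show "(\<lambda>P\<in>U. F P (s P) (t P)) P \<in> carrier (stalk P)"
      using P V(2,4,5,6) by simp
  qed simp
qed

lemma const_section:
  assumes U: "U \<in> zariski_opens R" and a: "a \<in> carrier R"
  shows "(\<lambda>P\<in>U. loc_frac R (carrier R - P) a \<one>) \<in> carrier (spec_sections R U)"
proof (rule sectionI)
  fix P assume P: "P \<in> U"
  interpret P: localized R "carrier R - P" by (rule localized_prime[OF zariski_prime[OF U P]])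
  show "(\<lambda>P\<in>U. loc_frac R (carrier R - P) a \<one>) P \<in> carrier (stalk P)" using P a by simp
  have "\<one> \<notin> Q" if "Q \<in> U" for Q
    using localized.M_1[OF localized_prime[OF zariski_prime[OF U that]]] by simp
  then show "locally_frac U P (\<lambda>P\<in>U. loc_frac R (carrier R - P) a \<one>)"
    unfolding locally_frac_def using U P a by (intro bexI[of _ U] conjI bexI[of _ a] bexI[of _ \<one>]) auto
qed simp

lemma section_closed:
  assumes U: "U \<in> zariski_opens R" and s: "s \<in> carrier (spec_sections R U)" and t: "t \<in> carrier (spec_sections R U)"
  shows "s \<oplus>\<^bsub>spec_sections R U\<^esub> t \<in> carrier (spec_sections R U)" "s \<otimes>\<^bsub>spec_sections R U\<^esub> t \<in> carrier (spec_sections R U)"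
  unfolding spec_sections_ops
  by (rule section_combine[OF U s t, where num = "\<lambda>a b c d. a \<otimes> d \<oplus> c \<otimes> b"],
      simp, simp add: localized.frac_add[OF localized_prime],
      rule section_combine[OF U s t, where num = "\<lambda>a b c d. a \<otimes> c"],
      simp, simp add: localized.frac_mult[OF localized_prime])

lemma cring_spec_sections:
  assumes U: "U \<in> zariski_opens R"
  shows "cring (spec_sections R U)"
proof -
  let ?G = "spec_sections R U"
  have st: "cring (stalk P)" if "P \<in> U" for P
    by (rule cring_stalk[OF zariski_prime[OF U that]])
  have one: "\<one>\<^bsub>?G\<^esub> \<in> carrier ?G" and zero: "\<zero>\<^bsub>?G\<^esub> \<in> carrier ?G"
    using const_section[OF U one_closed] const_section[OF U zero_closed]
    by (simp_all add: spec_sections_ops localization_def)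
  show ?thesis
  proof (rule cringI)
    show "abelian_group ?G"
    proof (rule abelian_groupI)
      fix x y z assume x: "x \<in> carrier ?G" and y: "y \<in> carrier ?G" and z: "z \<in> carrier ?G"
      show "x \<oplus>\<^bsub>?G\<^esub> y \<oplus>\<^bsub>?G\<^esub> z = x \<oplus>\<^bsub>?G\<^esub> (y \<oplus>\<^bsub>?G\<^esub> z)"
        unfolding spec_sections_ops
        using section_val[OF x] section_val[OF y] section_val[OF z] abelian_monoid.a_assoc[OF abelian_group.axioms(1)[OF ring.is_abelian_group[OF cring.axioms(1)[OF st]]]]
        by (intro restrict_ext) simp
    next
      fix x y assume x: "x \<in> carrier ?G" and y: "y \<in> carrier ?G"
      show "x \<oplus>\<^bsub>?G\<^esub> y \<in> carrier ?G" by (rule section_closed(1)[OF U x y])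
      show "x \<oplus>\<^bsub>?G\<^esub> y = y \<oplus>\<^bsub>?G\<^esub> x"
        unfolding spec_sections_ops
        using section_val[OF x] section_val[OF y] abelian_monoid.a_comm[OF abelian_group.axioms(1)[OF ring.is_abelian_group[OF cring.axioms(1)[OF st]]]]
        by (intro restrict_ext) simp
    next
      fix x assume x: "x \<in> carrier ?G"
      show "\<zero>\<^bsub>?G\<^esub> \<oplus>\<^bsub>?G\<^esub> x = x"
      proof (rule section_eqI[OF _ section_ext[OF x]])
        fix P assume P: "P \<in> U"
        interpret P: cring "stalk P" by (rule st[OF P])
        show "(\<zero>\<^bsub>?G\<^esub> \<oplus>\<^bsub>?G\<^esub> x) P = x P" using section_val[OF x P] P by (simp add: spec_sections_ops)
      qed (simp add: spec_sections_ops)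
      let ?y = "(\<lambda>P\<in>U. \<ominus>\<^bsub>stalk P\<^esub> x P)"
      have y: "?y \<in> carrier ?G"
      \<comment> \<open>Negation is cast as an operation on \<open>x\<close> and \<open>x\<close>
        that ignores its second argument, whence the extra factor \<open>d\<close> in numerator and
        denominator.\<close>
      proof (rule section_combine[OF U x x, where F = "\<lambda>P s t. \<ominus>\<^bsub>stalk P\<^esub> s" and num = "\<lambda>a b c d. \<ominus> a \<otimes> d"])
        fix Q a b c d
        assume Q: "primeideal Q R" and a: "a \<in> carrier R" and b: "b \<in> carrier R - Q" and c: "c \<in> carrier R" and d: "d \<in> carrier R - Q"
        interpret Q: localized R "carrier R - Q" by (rule localized_prime[OF Q])
        have "Q.frac (\<ominus> a) b \<oplus>\<^bsub>stalk Q\<^esub> Q.frac a b = \<zero>\<^bsub>stalk Q\<^esub>"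
          using a b Q.M_mult[OF b b] by (simp add: Q.frac_add l_minus l_neg Q.frac_zero del: DiffE)
        then have "\<ominus>\<^bsub>stalk Q\<^esub> Q.frac a b = Q.frac (\<ominus> a) b"
          using a b by (intro Q.Loc.minus_equality) auto
        then show "\<ominus>\<^bsub>stalk Q\<^esub> Q.frac a b = Q.frac (\<ominus> a \<otimes> d) (b \<otimes> d)"
          using Q.frac_scale[of "\<ominus> a" b d] a b d by simp
      qed simp
      have "?y \<oplus>\<^bsub>?G\<^esub> x = \<zero>\<^bsub>?G\<^esub>"
        unfolding spec_sections_ops
      proof (rule restrict_ext)
        fix P assume P: "P \<in> U"
        interpret P: cring "stalk P" by (rule st[OF P])
        show "?y P \<oplus>\<^bsub>stalk P\<^esub> x P = \<zero>\<^bsub>stalk P\<^esub>" using section_val[OF x P] P by (simp add: P.l_neg)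
      qed
      then show "\<exists>y\<in>carrier ?G. y \<oplus>\<^bsub>?G\<^esub> x = \<zero>\<^bsub>?G\<^esub>" using y by blast
    qed (rule zero)
    show "comm_monoid ?G"
    proof (rule comm_monoidI)
      fix x y z assume x: "x \<in> carrier ?G" and y: "y \<in> carrier ?G" and z: "z \<in> carrier ?G"
      show "x \<otimes>\<^bsub>?G\<^esub> y \<otimes>\<^bsub>?G\<^esub> z = x \<otimes>\<^bsub>?G\<^esub> (y \<otimes>\<^bsub>?G\<^esub> z)"
        unfolding spec_sections_ops
      proof (rule restrict_ext)
        fix P assume P: "P \<in> U"
        interpret P: cring "stalk P" by (rule st[OF P])
        show "(\<lambda>P\<in>U. x P \<otimes>\<^bsub>stalk P\<^esub> y P) P \<otimes>\<^bsub>stalk P\<^esub> z P = x P \<otimes>\<^bsub>stalk P\<^esub> (\<lambda>P\<in>U. y P \<otimes>\<^bsub>stalk P\<^esub> z P) P"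
          using section_val[OF x P] section_val[OF y P] section_val[OF z P] P by (simp add: P.m_assoc)
      qed
    next
      fix x y assume x: "x \<in> carrier ?G" and y: "y \<in> carrier ?G"
      show "x \<otimes>\<^bsub>?G\<^esub> y \<in> carrier ?G" by (rule section_closed(2)[OF U x y])
      show "x \<otimes>\<^bsub>?G\<^esub> y = y \<otimes>\<^bsub>?G\<^esub> x"
        unfolding spec_sections_ops
      proof (rule restrict_ext)
        fix P assume P: "P \<in> U"
        interpret P: cring "stalk P" by (rule st[OF P])
        show "x P \<otimes>\<^bsub>stalk P\<^esub> y P = y P \<otimes>\<^bsub>stalk P\<^esub> x P"
          using section_val[OF x P] section_val[OF y P] by (rule P.m_comm)
      qed
    next
      fix x assume x: "x \<in> carrier ?G"
      show "\<one>\<^bsub>?G\<^esub> \<otimes>\<^bsub>?G\<^esub> x = x"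
      proof (rule section_eqI[OF _ section_ext[OF x]])
        fix P assume P: "P \<in> U"
        interpret P: cring "stalk P" by (rule st[OF P])
        show "(\<one>\<^bsub>?G\<^esub> \<otimes>\<^bsub>?G\<^esub> x) P = x P" using section_val[OF x P] P by (simp add: spec_sections_ops)
      qed (simp add: spec_sections_ops)
    qed (rule one)
  next
    fix x y z assume x: "x \<in> carrier ?G" and y: "y \<in> carrier ?G" and z: "z \<in> carrier ?G"
    show "(x \<oplus>\<^bsub>?G\<^esub> y) \<otimes>\<^bsub>?G\<^esub> z = x \<otimes>\<^bsub>?G\<^esub> z \<oplus>\<^bsub>?G\<^esub> y \<otimes>\<^bsub>?G\<^esub> z"
      unfolding spec_sections_ops
    proof (rule restrict_ext)
      fix P assume P: "P \<in> U"
      interpret P: cring "stalk P" by (rule st[OF P])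
      show "(\<lambda>P\<in>U. x P \<oplus>\<^bsub>stalk P\<^esub> y P) P \<otimes>\<^bsub>stalk P\<^esub> z P =
          (\<lambda>P\<in>U. x P \<otimes>\<^bsub>stalk P\<^esub> z P) P \<oplus>\<^bsub>stalk P\<^esub> (\<lambda>P\<in>U. y P \<otimes>\<^bsub>stalk P\<^esub> z P) P"
        using section_val[OF x P] section_val[OF y P] section_val[OF z P] P by (simp add: P.l_distr)
    qed
  qed
qed

lemma eval_hom:
  assumes "U \<in> zariski_opens R" "P \<in> U"
  shows "ring_hom_cring (spec_sections R U) (stalk P) (\<lambda>s. s P)"
  using assms cring_spec_sections[OF assms(1)] cring_stalk[OF zariski_prime[OF assms]] section_val[OF _ assms(2)]
  by (intro ring_hom_cringI ring_hom_ringI2 ring_hom_memI) (auto simp: spec_sections_ops intro: cring.axioms(1))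

end

section \<open>Quasi-F-splittings of the spectrum\<close>

lemma restr_scalars_simps:
  "carrier (restr_scalars g B) = carrier B" "x \<oplus>\<^bsub>restr_scalars g B\<^esub> y = x \<oplus>\<^bsub>B\<^esub> y"
  "a \<odot>\<^bsub>restr_scalars g B\<^esub> x = g a \<otimes>\<^bsub>B\<^esub> x"
  by (simp_all add: restr_scalars_def)

context cring
begin

text \<open>Intersecting one neighbourhood for each component makes all components of a truncated
  Witt vector single fractions at the same time.\<close>

lemma sections_common_open:
  fixes n :: nat
  assumes U: "U \<in> zariski_opens R" and s: "\<forall>i<n. s i \<in> carrier (spec_sections R U)" and P: "P \<in> U"
  shows "\<exists>V\<in>zariski_opens R. P \<in> V \<and> V \<subseteq> U \<and> (\<exists>a b. \<forall>i<n. a i \<in> carrier R \<and> b i \<in> carrier R \<and>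
    (\<forall>Q\<in>V. b i \<notin> Q \<and> s i Q = loc_frac R (carrier R - Q) (a i) (b i)))"
  using s
proof (induction n)
  case 0
  then show ?case using U P by blast
next
  case (Suc n)
  then obtain V a b where V: "V \<in> zariski_opens R" "P \<in> V" "V \<subseteq> U"
    and ab: "\<forall>i<n. a i \<in> carrier R \<and> b i \<in> carrier R \<and>
      (\<forall>Q\<in>V. b i \<notin> Q \<and> s i Q = loc_frac R (carrier R - Q) (a i) (b i))"
    by (metis less_SucI)
  obtain W c d where W: "W \<in> zariski_opens R" "P \<in> W" "W \<subseteq> U" "c \<in> carrier R" "d \<in> carrier R"
    "\<forall>Q\<in>W. d \<notin> Q \<and> s n Q = loc_frac R (carrier R - Q) c d"
    by (rule section_fracE[OF Suc.prems[rule_format, OF lessI] P])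
  have "\<forall>i<Suc n. (a(n := c)) i \<in> carrier R \<and> (b(n := d)) i \<in> carrier R \<and>
      (\<forall>Q\<in>V \<inter> W. (b(n := d)) i \<notin> Q \<and> s i Q = loc_frac R (carrier R - Q) ((a(n := c)) i) ((b(n := d)) i))"
  proof (intro allI impI)
    fix i assume "i < Suc n"
    then consider "i = n" | "i < n" "i \<noteq> n" by linarith
    then show "(a(n := c)) i \<in> carrier R \<and> (b(n := d)) i \<in> carrier R \<and>
      (\<forall>Q\<in>V \<inter> W. (b(n := d)) i \<notin> Q \<and> s i Q = loc_frac R (carrier R - Q) ((a(n := c)) i) ((b(n := d)) i))"
      by cases (use ab W in simp_all)
  qed
  moreover have "V \<inter> W \<in> zariski_opens R" "P \<in> V \<inter> W" "V \<inter> W \<subseteq> U"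
    using zariski_Int V W by blast+
  ultimately show ?case by meson
qed

end

lemma Spec_simps [simp]: "opens (Spec B) = zariski_opens B" "sect (Spec B) = spec_sections B"
  "res (Spec B) = (\<lambda>U V s. restrict s V)"
  by (simp_all add: Spec_def)

context hypersurface_fractions
begin

definition stalk_split :: "('v, 'k) mpoly list \<Rightarrow> 'a set \<Rightarrow> (nat \<Rightarrow> ('a \<times> 'a) set) \<Rightarrow> ('a \<times> 'a) set"
  where "stalk_split gs P = hypersurface_fractions.frac_split p (A.stalk P)
    (\<lambda>a. loc_frac A (carrier A - P) (h a) \<one>\<^bsub>A\<^esub>) {t. h t \<notin> P} gs"

text \<open>Near \<open>P\<close> the components of \<open>w\<close> are fixed fractions, so a
  single representative \<open>X\<close> with denominator \<open>B\<close> serves all points of the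
  neighbourhood. The value at each of them is then the same fraction, \<open>u (E gs X)\<close> over
  \<open>B\<close> times \<open>u\<close> of the head coordinate.\<close>

lemma stalk_split_section:
  assumes U: "U \<in> zariski_opens A" and w: "w \<in> carrier (witt_ring p (length gs) (spec_sections A U))"
    and gs: "ok (tl gs)" "teich_cond f 1 gs" "gs \<noteq> []" "uq p (hd gs) \<in> L"
  shows "(\<lambda>P\<in>U. stalk_split gs P (witt_map (length gs) (\<lambda>s. s P) w)) \<in> carrier (spec_sections A U)"
proof (rule A.sectionI)
  let ?n = "length gs" and ?u = "uq p (hd gs)"
  have wi: "\<forall>i<?n. w i \<in> carrier (spec_sections A U)"
    using w by (auto simp: carrier_witt_ring)
  have wP: "witt_map ?n (\<lambda>s. s P) w \<in> carrier (witt_ring p ?n (A.stalk P))" if "P \<in> U" for P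
    by (rule ring_hom_cring.witt_map_closed[OF A.eval_hom[OF U that] w])
  fix P assume P: "P \<in> U"
  obtain V a b where V: "V \<in> zariski_opens A" "P \<in> V" "V \<subseteq> U"
    and ab: "\<forall>i<?n. a i \<in> carrier A \<and> b i \<in> carrier A \<and>
      (\<forall>Q\<in>V. b i \<notin> Q \<and> w i Q = loc_frac A (carrier A - Q) (a i) (b i))"
    using A.sections_common_open[OF U wi P] by (elim bexE conjE exE) (rule that)
  have "\<forall>i. \<exists>x r. i < ?n \<longrightarrow> r \<in> L \<and> a i \<otimes>\<^bsub>A\<^esub> h r = h x"
    using h_frac ab by meson
  then obtain x r where xr: "\<And>i. i < ?n \<Longrightarrow> r i \<in> L \<and> a i \<otimes>\<^bsub>A\<^esub> h (r i) = h (x i)" by metis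
  have "\<forall>i. \<exists>c d. i < ?n \<longrightarrow> d \<in> L \<and> b i \<otimes>\<^bsub>A\<^esub> h d = h c"
    using h_frac ab by meson
  then obtain c d where cd: "\<And>i. i < ?n \<Longrightarrow> d i \<in> L \<and> b i \<otimes>\<^bsub>A\<^esub> h (d i) = h (c i)" by metis
  \<comment> \<open>A component is a quotient of \<open>a i\<close> by \<open>b i\<close>, which are
    themselves fractions with denominators \<open>r i\<close> and \<open>d i\<close>. Over
    \<open>S\<close> it is \<open>(x i d i) / (r i c i)\<close>, and \<open>B\<close> is the common
    denominator.\<close>
  define B where "B = (\<Prod>i<?n. r i * c i)"
  define y where "y i = (x i * d i) * (\<Prod>j\<in>{..<?n} - {i}. r j * c j)" for i
  define X where "X = Witt (\<lambda>i. B ^ (p * p ^ i - 1) * y i)"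
  have main: "h (B * ?u) \<notin> Q \<and>
      stalk_split gs Q (witt_map ?n (\<lambda>s. s Q) w) = loc_frac A (carrier A - Q) (h (uq p (E gs X))) (h (B * ?u))"
    if Q: "Q \<in> V" for Q
  proof -
    have pQ: "primeideal Q A" by (rule A.zariski_prime[OF V(1) Q])
    have QU: "Q \<in> U" using Q V(3) by blast
    interpret Loc: localized A "carrier A - Q" by (rule localized_prime[OF pQ])
    interpret S: hypersurface_fractions p K "A.stalk Q" f "\<lambda>a. loc_frac A (carrier A - Q) (h a) \<one>\<^bsub>A\<^esub>" "{t. h t \<notin> Q}"
      by (rule hypersurface_fractions_stalk[OF pQ])
    have split: "stalk_split gs Q = S.frac_split gs" by (simp add: stalk_split_def)
    have uQ: "?u \<in> {t. h t \<notin> Q}" using unit_notin_prime[OF pQ gs(4)] by simp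
    have fr: "w i Q \<otimes>\<^bsub>A.stalk Q\<^esub> Loc.\<iota> (h (r i * c i)) = Loc.\<iota> (h (x i * d i))"
      and rc: "r i * c i \<in> {t. h t \<notin> Q}" if i: "i < ?n" for i
    proof -
      have a: "a i \<in> carrier A" "b i \<in> carrier A - Q" "w i Q = Loc.frac (a i) (b i)"
        using ab i Q by auto
      show "w i Q \<otimes>\<^bsub>A.stalk Q\<^esub> Loc.\<iota> (h (r i * c i)) = Loc.\<iota> (h (x i * d i))" "r i * c i \<in> {t. h t \<notin> Q}"
        using fraction_of_fractions[OF pQ a(1) _ _ a(2), of "r i" "x i" "d i" "c i"] xr[OF i] cd[OF i] a(3) by auto
    qed
    have BQ: "B \<in> {t. h t \<notin> Q}"
      unfolding B_def by (rule S.L_prod) (use rc in auto)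
    have wQ: "w i Q \<in> carrier (A.stalk Q)" if "i < ?n" for i
      by (rule A.section_val[OF wi[rule_format, OF that] QU])
    have "w i Q \<otimes>\<^bsub>A.stalk Q\<^esub> Loc.\<iota> (h B) = Loc.\<iota> (h (y i))" if i: "i < ?n" for i
    proof -
      have B: "B = (r i * c i) * (\<Prod>j\<in>{..<?n} - {i}. r j * c j)"
        unfolding B_def using i by (intro prod.remove) auto
      show ?thesis
        unfolding B y_def S.h_simps(1)[of "r i * c i"] S.h_simps(1)[of "x i * d i"] fr[OF i, symmetric]
        using wQ[OF i] by (simp add: Loc.Loc.m_assoc)
    qed
    then have "S.rep ?n p (witt_map ?n (\<lambda>s. s Q) w) B X"
      unfolding X_def using wQ by (intro S.rep_from_fractions[OF BQ p_pos]) (simp_all add: witt_map_def)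
    then have s: "S.frac_split gs (witt_map ?n (\<lambda>s. s Q) w) \<otimes>\<^bsub>A.stalk Q\<^esub> Loc.\<iota> (h (B * ?u)) = Loc.\<iota> (h (uq p (E gs X)))"
      by (rule S.frac_split_spec(2)[OF gs(1,2,3) uQ wP[OF QU]])
    have Bu: "h (B * ?u) \<notin> Q" using S.L_mult[OF BQ uQ] by simp
    moreover have "S.frac_split gs (witt_map ?n (\<lambda>s. s Q) w) = Loc.frac (h (uq p (E gs X))) (h (B * ?u))"
      by (rule Loc.eq_fracI[OF S.frac_split_spec(1)[OF gs(1,2,3) uQ wP[OF QU]] h_closed _ s]) (simp add: Bu)
    ultimately show ?thesis by (simp add: split)
  qed
  interpret LocP: localized A "carrier A - P" by (rule localized_prime[OF A.zariski_prime[OF U P]])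
  show "(\<lambda>P\<in>U. stalk_split gs P (witt_map ?n (\<lambda>s. s P) w)) P \<in> carrier (A.stalk P)"
    using main[OF V(2)] P by simp
  show "A.locally_frac U P (\<lambda>P\<in>U. stalk_split gs P (witt_map ?n (\<lambda>s. s P) w))"
    unfolding A.locally_frac_def
  proof (rule bexI[OF _ V(1)], intro conjI, rule V(2), rule V(3), rule bexI[OF _ h_closed], rule bexI[OF _ h_closed], rule ballI)
    fix Q assume Q: "Q \<in> V"
    then show "h (B * ?u) \<notin> Q \<and> (\<lambda>P\<in>U. stalk_split gs P (witt_map ?n (\<lambda>s. s P) w)) Q =
        loc_frac A (carrier A - Q) (h (uq p (E gs X))) (h (B * ?u))"
      using main[OF Q] V(3) by auto
  qed
qed simp

theorem coordinates_imp_split: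
  assumes gs: "ok (tl gs)" "teich_cond f 1 gs" "gs \<noteq> []" "uq p (hd gs) \<in> L"
  shows "n_quasi_F_split p (length gs) (Spec A)"
proof -
  let ?n = "length gs"
  define \<phi> where "\<phi> U w = (\<lambda>P\<in>U. stalk_split gs P (witt_map ?n (\<lambda>s. s P) w))" for U w
  have stalk: "stalk_split gs P (x \<oplus>\<^bsub>witt_ring p ?n (A.stalk P)\<^esub> y) = stalk_split gs P x \<oplus>\<^bsub>A.stalk P\<^esub> stalk_split gs P y"
    "stalk_split gs P (witt_frob p ?n (A.stalk P) x \<otimes>\<^bsub>witt_ring p ?n (A.stalk P)\<^esub> y) = x 0 \<otimes>\<^bsub>A.stalk P\<^esub> stalk_split gs P y"
    "stalk_split gs P (witt_frob p ?n (A.stalk P) x) = x 0"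
    if P: "primeideal P A" and x: "x \<in> carrier (witt_ring p ?n (A.stalk P))" and y: "y \<in> carrier (witt_ring p ?n (A.stalk P))"
    for P x y
  proof -
    interpret S: hypersurface_fractions p K "A.stalk P" f "\<lambda>a. loc_frac A (carrier A - P) (h a) \<one>\<^bsub>A\<^esub>" "{t. h t \<notin> P}"
      by (rule hypersurface_fractions_stalk[OF P])
    have u: "uq p (hd gs) \<in> {t. h t \<notin> P}" using unit_notin_prime[OF P gs(4)] by simp
    show "stalk_split gs P (x \<oplus>\<^bsub>witt_ring p ?n (A.stalk P)\<^esub> y) = stalk_split gs P x \<oplus>\<^bsub>A.stalk P\<^esub> stalk_split gs P y"
      unfolding stalk_split_def by (rule S.frac_split_add[OF gs(1,2,3) u x y])
    show "stalk_split gs P (witt_frob p ?n (A.stalk P) x \<otimes>\<^bsub>witt_ring p ?n (A.stalk P)\<^esub> y) = x 0 \<otimes>\<^bsub>A.stalk P\<^esub> stalk_split gs P y"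
      unfolding stalk_split_def by (rule S.frac_split_smult[OF gs(1,2,3) u x y])
    show "stalk_split gs P (witt_frob p ?n (A.stalk P) x) = x 0"
      unfolding stalk_split_def by (rule S.frac_split_frob[OF gs(1,2,3) u x])
  qed
  have "\<phi> U \<in> mod_hom (witt_ring p ?n (spec_sections A U))
      (restr_scalars (witt_frob p ?n (spec_sections A U)) (witt_ring p ?n (spec_sections A U)))
      (restr_scalars witt_restr (spec_sections A U))"
    and "\<forall>w\<in>carrier (witt_ring p ?n (spec_sections A U)). \<phi> U (witt_frob p ?n (spec_sections A U) w) = witt_restr w"
    if U: "U \<in> zariski_opens A" for U
  proof -
    let ?G = "spec_sections A U" and ?W = "witt_ring p ?n (spec_sections A U)"
    interpret G: cring ?G by (rule A.cring_spec_sections[OF U])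
    have hom: "ring_hom_cring ?G (A.stalk P) (\<lambda>s. s P)" if "P \<in> U" for P
      by (rule A.eval_hom[OF U that])
    have P: "primeideal P A" if "P \<in> U" for P by (rule A.zariski_prime[OF U that])
    note cl = ring_hom_cring.witt_map_closed[OF hom]
    have w0: "w 0 \<in> carrier ?G" if "w \<in> carrier ?W" for w
      using that gs(3) by (auto simp: carrier_witt_ring)
    have m0: "witt_map ?n g w 0 = g (w 0)" for g :: "_ \<Rightarrow> ('a \<times> 'a) set" and w :: "nat \<Rightarrow> _"
      using gs(3) by (simp add: witt_map_def)
    have add: "\<phi> U (x \<oplus>\<^bsub>?W\<^esub> y) = \<phi> U x \<oplus>\<^bsub>?G\<^esub> \<phi> U y" if x: "x \<in> carrier ?W" and y: "y \<in> carrier ?W" for x y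
      unfolding \<phi>_def A.spec_sections_ops
    proof (rule restrict_ext)
      fix Q assume Q: "Q \<in> U"
      show "stalk_split gs Q (witt_map ?n (\<lambda>s. s Q) (x \<oplus>\<^bsub>?W\<^esub> y)) =
        (\<lambda>P\<in>U. stalk_split gs P (witt_map ?n (\<lambda>s. s P) x)) Q \<oplus>\<^bsub>A.stalk Q\<^esub> (\<lambda>P\<in>U. stalk_split gs P (witt_map ?n (\<lambda>s. s P) y)) Q"
        using ring_hom_cring.witt_map_hom(1)[OF hom[OF Q] prime x y] stalk(1)[OF P[OF Q] cl[OF Q x] cl[OF Q y]] Q by simp
    qed
    have smult: "\<phi> U (witt_frob p ?n ?G x \<otimes>\<^bsub>?W\<^esub> y) = x 0 \<otimes>\<^bsub>?G\<^esub> \<phi> U y" if x: "x \<in> carrier ?W" and y: "y \<in> carrier ?W" for x y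
      unfolding \<phi>_def A.spec_sections_ops
    proof (rule restrict_ext)
      fix Q assume Q: "Q \<in> U"
      show "stalk_split gs Q (witt_map ?n (\<lambda>s. s Q) (witt_frob p ?n ?G x \<otimes>\<^bsub>?W\<^esub> y)) =
        x 0 Q \<otimes>\<^bsub>A.stalk Q\<^esub> (\<lambda>P\<in>U. stalk_split gs P (witt_map ?n (\<lambda>s. s P) y)) Q"
        using ring_hom_cring.witt_map_hom(2)[OF hom[OF Q] prime G.witt_frob_closed[OF x] y]
          ring_hom_cring.witt_map_frob[OF hom[OF Q] x] stalk(2)[OF P[OF Q] cl[OF Q x] cl[OF Q y]] Q by (simp add: m0)
    qed
    have frob: "\<phi> U (witt_frob p ?n ?G x) = x 0" if x: "x \<in> carrier ?W" for x
    proof (rule A.section_eqI[OF _ A.section_ext[OF w0[OF x]]])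
      fix Q assume Q: "Q \<in> U"
      show "\<phi> U (witt_frob p ?n ?G x) Q = x 0 Q"
        using ring_hom_cring.witt_map_frob[OF hom[OF Q] x] stalk(3)[OF P[OF Q] cl[OF Q x] cl[OF Q x]] Q by (simp add: \<phi>_def m0)
    qed (simp add: \<phi>_def)
    have closed: "\<phi> U x \<in> carrier ?G" if "x \<in> carrier ?W" for x
      unfolding \<phi>_def by (rule stalk_split_section[OF U that gs])
    show "\<phi> U \<in> mod_hom ?W (restr_scalars (witt_frob p ?n ?G) ?W) (restr_scalars witt_restr ?G)"
      unfolding mod_hom_def restr_scalars_simps witt_restr_def using add smult closed by simp
    show "\<forall>w\<in>carrier ?W. \<phi> U (witt_frob p ?n ?G w) = witt_restr w"
      unfolding witt_restr_def using frob by blast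
  qed
  \<comment> \<open>The value at \<open>P\<close> is computed from the values at \<open>P\<close>
    alone, so restriction to a smaller open set changes nothing.\<close>
  moreover have "restrict (\<phi> U w) V = \<phi> V (witt_map ?n (\<lambda>s. restrict s V) w)" if "V \<subseteq> U" for U V w
  proof
    fix P
    have "witt_map ?n (\<lambda>s. s P) (witt_map ?n (\<lambda>s. restrict s V) w) = witt_map ?n (\<lambda>s. s P) w" if "P \<in> V"
      unfolding witt_map_def by (rule restrict_ext) (use that in simp)
    then show "restrict (\<phi> U w) V P = \<phi> V (witt_map ?n (\<lambda>s. restrict s V) w) P"
      using that by (auto simp: \<phi>_def)
  qed
  ultimately show ?thesis
    unfolding n_quasi_F_split_def Spec_simps by (intro exI[of _ \<phi>]) blast
qed

section \<open>The maximal ideal of the local ring\<close>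

definition closed_point :: "'a set"
  where "closed_point = {x \<in> carrier A. \<exists>a\<in>irrelevant_ideal. \<exists>b\<in>L. x \<otimes>\<^bsub>A\<^esub> h b = h a}"

context
  assumes L: "L = UNIV - irrelevant_ideal" and f: "f \<in> irrelevant_ideal"
begin

text \<open>Two representations \<open>a / b\<close> and \<open>c / d\<close> of \<open>x\<close>
  give \<open>t (a d - c b)\<close> in \<open>(f)\<close> for some \<open>t\<close> in
  \<open>L\<close>. Since \<open>f\<close> lies in the irrelevant prime ideal and \<open>b\<close>,
  \<open>d\<close>, \<open>t\<close> do not, \<open>a\<close> lies in it if and only if
  \<open>c\<close> does.\<close>

lemma mem_closed_point_iff:
  assumes x: "x \<in> carrier A" and b: "b \<in> L" "x \<otimes>\<^bsub>A\<^esub> h b = h a"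
  shows "x \<in> closed_point \<longleftrightarrow> a \<in> irrelevant_ideal"
proof
  assume "x \<in> closed_point"
  then obtain c d where c: "c \<in> irrelevant_ideal" "d \<in> L" "x \<otimes>\<^bsub>A\<^esub> h d = h c"
    unfolding closed_point_def by blast
  have "h (a * d) = h (c * b)"
    unfolding h_simps(1) b(2)[symmetric] c(3)[symmetric] using x by (simp add: A.m_ac)
  then obtain t where t: "t \<in> L" "f dvd t * (a * d - c * b)"
    using h_eq_iff_diff h_ker by blast
  have "t * (a * d - c * b) \<in> irrelevant_ideal"
    using t(2) f is_idealD(6)[OF is_ideal_irrelevant] by (auto simp: dvd_def)
  then have "a * d - c * b \<in> irrelevant_ideal"
    using t(1) L by (auto simp: irrelevant_mult_iff)
  moreover have "c * b \<in> irrelevant_ideal"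
    using c(1) by (simp add: irrelevant_mult_iff)
  ultimately have "(a * d - c * b) + c * b \<in> irrelevant_ideal"
    by (rule is_idealD(2)[OF is_ideal_irrelevant])
  then show "a \<in> irrelevant_ideal"
    using c(2) L by (auto simp: irrelevant_mult_iff)
qed (use assms in \<open>auto simp: closed_point_def\<close>)

lemma fracE:
  assumes "x \<in> carrier A"
  obtains a b where "b \<in> L" "x \<otimes>\<^bsub>A\<^esub> h b = h a"
  using h_frac[OF assms] by blast

lemma frac_mult_rep:
  assumes "x \<in> carrier A" "y \<in> carrier A" "x \<otimes>\<^bsub>A\<^esub> h b = h a" "y \<otimes>\<^bsub>A\<^esub> h d = h c"
  shows "(x \<otimes>\<^bsub>A\<^esub> y) \<otimes>\<^bsub>A\<^esub> h (b * d) = h (a * c)"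
  unfolding h_simps(1) assms(3,4)[symmetric] using assms(1,2) by (simp add: A.m_ac)

lemma closed_point_mult:
  assumes "x \<in> carrier A" "y \<in> carrier A"
  shows "x \<otimes>\<^bsub>A\<^esub> y \<in> closed_point \<longleftrightarrow> x \<in> closed_point \<or> y \<in> closed_point"
proof -
  obtain a b where b: "b \<in> L" "x \<otimes>\<^bsub>A\<^esub> h b = h a" using assms(1) by (rule fracE)
  obtain c d where d: "d \<in> L" "y \<otimes>\<^bsub>A\<^esub> h d = h c" using assms(2) by (rule fracE)
  show ?thesis
    using mem_closed_point_iff[OF assms(1) b] mem_closed_point_iff[OF assms(2) d]
      mem_closed_point_iff[OF A.m_closed[OF assms] L_mult[OF b(1) d(1)] frac_mult_rep[OF assms b(2) d(2)]]
    by (simp add: irrelevant_mult_iff)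
qed

lemma closed_point_prime: "primeideal closed_point A"
proof (rule primeidealI)
  show "ideal closed_point A"
  proof (rule idealI)
    show "subgroup closed_point (add_monoid A)"
    proof (rule A.add.subgroupI)
      show "closed_point \<subseteq> carrier A" by (auto simp: closed_point_def)
      have "\<zero>\<^bsub>A\<^esub> \<in> closed_point"
        using mem_closed_point_iff[OF A.zero_closed L_1, of 0] is_idealD(1)[OF is_ideal_irrelevant] by (simp add: h_simps)
      then show "closed_point \<noteq> {}" by blast
      show "\<ominus>\<^bsub>A\<^esub> x \<in> closed_point" if x: "x \<in> closed_point" for x
      proof -
        obtain a b where ab: "x \<in> carrier A" "a \<in> irrelevant_ideal" "b \<in> L" "x \<otimes>\<^bsub>A\<^esub> h b = h a"
          using x unfolding closed_point_def by blast
        have "\<ominus>\<^bsub>A\<^esub> x \<otimes>\<^bsub>A\<^esub> h b = h (- a)"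
          using ab by (simp add: A.l_minus h_simps(6))
        then show ?thesis
          using mem_closed_point_iff[of "\<ominus>\<^bsub>A\<^esub> x" b "- a"] ab is_idealD(4)[OF is_ideal_irrelevant] by simp
      qed
      show "x \<oplus>\<^bsub>A\<^esub> y \<in> closed_point" if xy: "x \<in> closed_point" "y \<in> closed_point" for x y
      proof -
        obtain a b c d where ab: "x \<in> carrier A" "a \<in> irrelevant_ideal" "b \<in> L" "x \<otimes>\<^bsub>A\<^esub> h b = h a"
          and cd: "y \<in> carrier A" "c \<in> irrelevant_ideal" "d \<in> L" "y \<otimes>\<^bsub>A\<^esub> h d = h c"
          using xy unfolding closed_point_def by blast
        have "(x \<oplus>\<^bsub>A\<^esub> y) \<otimes>\<^bsub>A\<^esub> h (b * d) = h (a * d + c * b)"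
          unfolding h_simps(1,2) ab(4)[symmetric] cd(4)[symmetric] using ab(1) cd(1)
          by (simp add: A.r_distr A.m_ac)
        moreover have "a * d + c * b \<in> irrelevant_ideal"
          using ab(2) cd(2) is_idealD(2,6)[OF is_ideal_irrelevant] by blast
        ultimately show ?thesis
          using mem_closed_point_iff[OF A.a_closed[OF ab(1) cd(1)] L_mult[OF ab(3) cd(3)]] by blast
      qed
    qed
    show "y \<otimes>\<^bsub>A\<^esub> x \<in> closed_point" "x \<otimes>\<^bsub>A\<^esub> y \<in> closed_point"
      if "x \<in> closed_point" "y \<in> carrier A" for x y
      using that closed_point_mult[of y x] closed_point_mult[of x y] by (auto simp: closed_point_def)
  qed (rule A.ring_axioms)
  have "\<one>\<^bsub>A\<^esub> \<notin> closed_point"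
    using mem_closed_point_iff[OF A.one_closed L_1, of 1] one_not_irrelevant by (simp add: h_simps)
  then show "carrier A \<noteq> closed_point" by auto
  show "x \<in> closed_point \<or> y \<in> closed_point"
    if "x \<in> carrier A" "y \<in> carrier A" "x \<otimes>\<^bsub>A\<^esub> y \<in> closed_point" for x y
    using that closed_point_mult by blast
qed (rule A.cring_axioms)

lemma h_mem_closed_point: "h a \<in> closed_point \<longleftrightarrow> a \<in> irrelevant_ideal"
  using mem_closed_point_iff[OF h_closed L_1, of a a] by (simp add: h_simps(3))

text \<open>Pull the homomorphism on global sections back along the map from \<open>S\<close> to
  global sections and evaluate at the closed point. This gives a map from \<open>W(S)\<close> to the
  stalk there that meets the requirements of \<open>splitting_imp_I_seq\<close>.\<close>

theorem split_imp_coordinates: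
  assumes split: "n_quasi_F_split p n (Spec A)" and n: "n \<ge> 1" and f0: "f \<noteq> 0"
  shows "\<exists>g\<in>I_seq p f n. uq p g \<notin> irrelevant_ideal"
proof -
  let ?X = "prime_spectrum A" and ?G = "spec_sections A (prime_spectrum A)"
  have X: "?X \<in> zariski_opens A" by (rule A.prime_spectrum_open)
  have P0: "closed_point \<in> ?X" using closed_point_prime by (simp add: prime_spectrum_def)
  interpret G: cring ?G by (rule A.cring_spec_sections[OF X])
  interpret ev0: ring_hom_cring ?G "A.stalk closed_point" "\<lambda>s. s closed_point"
    by (rule A.eval_hom[OF X P0])
  let ?g = "\<lambda>a. \<lambda>P\<in>?X. loc_frac A (carrier A - P) (h a) \<one>\<^bsub>A\<^esub>"
  have g_ops: "?g (a * b) = ?g a \<otimes>\<^bsub>?G\<^esub> ?g b" "?g (a + b) = ?g a \<oplus>\<^bsub>?G\<^esub> ?g b" "?g 1 = \<one>\<^bsub>?G\<^esub>" for a b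
    unfolding A.spec_sections_ops
    by (intro restrict_ext, simp add: h_simps prime_spectrum_def
        ring_hom_mult[OF localized.\<iota>_hom[OF localized_prime]] ring_hom_add[OF localized.\<iota>_hom[OF localized_prime]]
        ring_hom_one[OF localized.\<iota>_hom[OF localized_prime]])+
  have g_closed: "?g a \<in> carrier ?G" for a by (rule A.const_section[OF X h_closed])
  interpret g: ring_hom_cring poly_ring ?G ?g
    by (intro ring_hom_cringI ring_hom_ringI2 ring_hom_memI cring_poly_ring G.cring_axioms G.ring_axioms
        cring.axioms(1)[OF cring_poly_ring]) (simp_all only: poly_ring_simps g_closed g_ops)
  interpret S: hypersurface_fractions p K "A.stalk closed_point" f
      "\<lambda>a. loc_frac A (carrier A - closed_point) (h a) \<one>\<^bsub>A\<^esub>" "{t. h t \<notin> closed_point}"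
    by (rule hypersurface_fractions_stalk[OF closed_point_prime])
  let ?h0 = "\<lambda>a. loc_frac A (carrier A - closed_point) (h a) \<one>\<^bsub>A\<^esub>"
  let ?W = "witt_ring p n ?G"
  define tr where "tr Y = (\<lambda>i\<in>{..<n}. wnth Y i)" for Y :: "('v, 'k) mpoly witt"
  have tr_closed: "tr Y \<in> carrier (witt_ring p n poly_ring)" for Y
    by (auto simp: tr_def carrier_witt_ring)
  have tr_ops: "tr (Y + Z) = tr Y \<oplus>\<^bsub>witt_ring p n poly_ring\<^esub> tr Z" "tr (Y * Z) = tr Y \<otimes>\<^bsub>witt_ring p n poly_ring\<^esub> tr Z" for Y Z
  proof -
    have eq: "ev (case_sum (wnth Y) (wnth Z)) Q = int_poly_eval poly_ring (case_sum (tr Y) (tr Z)) Q"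
      if i: "i < n" and Q: "Q = witt_add_poly p i \<or> Q = witt_mult_poly p i" for i Q
      unfolding int_poly_eval_poly_ring[symmetric]
    proof (rule cring.int_poly_eval_cong[OF cring_poly_ring])
      fix v assume "v \<in> poly_vars Q"
      then have "v \<in> poly_vars (witt_add_poly p i) \<or> v \<in> poly_vars (witt_mult_poly p i)" using Q by blast
      then show "case_sum (wnth Y) (wnth Z) v = case_sum (tr Y) (tr Z) v"
        by (rule case_sum_bounded[OF prime i]) (simp_all add: tr_def)
    qed simp
    show "tr (Y + Z) = tr Y \<oplus>\<^bsub>witt_ring p n poly_ring\<^esub> tr Z"
    proof
      fix i show "tr (Y + Z) i = (tr Y \<oplus>\<^bsub>witt_ring p n poly_ring\<^esub> tr Z) i"
        using eq[of i "witt_add_poly p i"] unfolding plus_witt_def wadd_def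
        by (cases "i < n") (simp_all add: witt_ring_simps tr_def[of "Witt _"])
    qed
    show "tr (Y * Z) = tr Y \<otimes>\<^bsub>witt_ring p n poly_ring\<^esub> tr Z"
    proof
      fix i show "tr (Y * Z) i = (tr Y \<otimes>\<^bsub>witt_ring p n poly_ring\<^esub> tr Z) i"
        using eq[of i "witt_mult_poly p i"] unfolding times_witt_def wmul_def
        by (cases "i < n") (simp_all add: witt_ring_simps tr_def[of "Witt _"])
    qed
  qed
  have tr_frob: "tr (wfrob C) = witt_frob p n poly_ring (tr C)" for C
    by (auto simp: tr_def witt_frob_def witt_map_def)
  define T where "T Y = witt_map n ?g (tr Y)" for Y
  have T_closed: "T Y \<in> carrier ?W" for Y
    unfolding T_def by (rule g.witt_map_closed[OF tr_closed])
  have T_add: "T (Y + Z) = T Y \<oplus>\<^bsub>?W\<^esub> T Z" for Y Z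
    unfolding T_def tr_ops by (rule g.witt_map_hom(1)[OF prime tr_closed tr_closed])
  have T_mult: "T (wfrob C * Z) = witt_frob p n ?G (T C) \<otimes>\<^bsub>?W\<^esub> T Z" for C Z
    unfolding T_def tr_ops g.witt_map_frob[OF tr_closed, symmetric] tr_frob[symmetric]
    by (rule g.witt_map_hom(2)[OF prime tr_closed tr_closed])
  have T_0: "T Y 0 = ?g (wnth Y 0)" for Y
    using n by (simp add: T_def tr_def witt_map_def)
  obtain \<phi> where \<phi>: "\<phi> ?X \<in> mod_hom ?W (restr_scalars (witt_frob p n ?G) ?W) (restr_scalars witt_restr ?G)"
    and \<phi>_frob: "\<forall>w\<in>carrier ?W. \<phi> ?X (witt_frob p n ?G w) = witt_restr w"
    using split unfolding n_quasi_F_split_def Spec_simps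
    by (elim exE conjE) (rule that; erule bspec[OF _ X])
  have \<phi>_closed: "\<phi> ?X w \<in> carrier ?G" if "w \<in> carrier ?W" for w
    using \<phi> that unfolding mod_hom_def restr_scalars_simps by blast
  have \<phi>_add: "\<phi> ?X (x \<oplus>\<^bsub>?W\<^esub> y) = \<phi> ?X x \<oplus>\<^bsub>?G\<^esub> \<phi> ?X y" if "x \<in> carrier ?W" "y \<in> carrier ?W" for x y
    using \<phi> that unfolding mod_hom_def restr_scalars_simps by blast
  have \<phi>_mult: "\<phi> ?X (witt_frob p n ?G x \<otimes>\<^bsub>?W\<^esub> y) = x 0 \<otimes>\<^bsub>?G\<^esub> \<phi> ?X y" if "x \<in> carrier ?W" "y \<in> carrier ?W" for x y
    using \<phi> that unfolding mod_hom_def restr_scalars_simps witt_restr_def by blast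
  define \<Phi> where "\<Phi> Y = \<phi> ?X (T Y) closed_point" for Y
  show ?thesis
  proof (rule S.splitting_imp_I_seq[of \<Phi> n])
    show "\<Phi> Y \<in> carrier (A.stalk closed_point)" for Y
      unfolding \<Phi>_def by (rule A.section_val[OF \<phi>_closed[OF T_closed] P0])
    show "\<Phi> (Y + Z) = \<Phi> Y \<oplus>\<^bsub>A.stalk closed_point\<^esub> \<Phi> Z" for Y Z
      unfolding \<Phi>_def T_add \<phi>_add[OF T_closed T_closed] using P0 by (simp add: A.spec_sections_ops)
    show "\<Phi> (wfrob C * Y) = ?h0 (wnth C 0) \<otimes>\<^bsub>A.stalk closed_point\<^esub> \<Phi> Y" for C Y
      unfolding \<Phi>_def T_mult \<phi>_mult[OF T_closed T_closed] T_0 using P0 by (simp add: A.spec_sections_ops)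
    show "\<Phi> Y = \<Phi> Z" if eq: "\<And>i. i < n \<Longrightarrow> ?h0 (wnth Y i) = ?h0 (wnth Z i)" for Y Z
    proof -
      \<comment> \<open>The denominators of the stalk at the closed point already belong to
        \<open>L\<close>, so equality in this stalk implies equality in \<open>A\<close> and hence
        equality of global sections.\<close>
      have "h (wnth Y i) = h (wnth Z i)" if i: "i < n" for i
      proof -
        obtain t where t: "h t \<notin> closed_point" "f dvd t * (wnth Y i - wnth Z i)"
          using S.h_ker[OF iffD1[OF S.h_eq_iff_diff eq[OF i]]] by (elim bexE CollectE) (rule that)
        then have "t \<in> L" using h_mem_closed_point L by simp
        have "h ((wnth Y i - wnth Z i) * t) = \<zero>\<^bsub>A\<^esub>"
          using h_dvd[OF t(2)] by (simp add: mult.commute)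
        then have "h (wnth Y i - wnth Z i) \<otimes>\<^bsub>A\<^esub> h t = \<zero>\<^bsub>A\<^esub> \<otimes>\<^bsub>A\<^esub> h t"
          by (simp add: h_simps(1))
        then have "h (wnth Y i - wnth Z i) = \<zero>\<^bsub>A\<^esub>"
          by (rule unit_cancel[OF \<open>t \<in> L\<close> h_closed A.zero_closed])
        then show ?thesis by (simp add: h_eq_iff_diff)
      qed
      then have "T Y = T Z"
        unfolding T_def tr_def witt_map_def by (intro restrict_ext) simp
      then show ?thesis by (simp add: \<Phi>_def)
    qed
    show "\<Phi> 1 = \<one>\<^bsub>A.stalk closed_point\<^esub>"
    proof -
      \<comment> \<open>Writing 1 as \<open>F 1\<close> brings it into the form to which the
        splitting identity applies.\<close>
      have "wfrob 1 = (1 :: ('v, 'k) mpoly witt)" by (rule F_hom(1))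
      then have "T 1 = witt_frob p n ?G (T 1)"
        unfolding T_def g.witt_map_frob[OF tr_closed, symmetric] tr_frob[symmetric] by simp
      then have "\<Phi> 1 = T 1 0 closed_point"
        using bspec[OF \<phi>_frob T_closed[of 1]] by (simp add: \<Phi>_def witt_restr_def)
      then show ?thesis using P0 S.h_simps(3) by (simp add: T_0)
    qed
    show "1 \<le> n" by (rule n)
    show "{t. h t \<notin> closed_point} \<inter> irrelevant_ideal = {}"
      using h_mem_closed_point by blast
  qed (rule f, rule f0)
qed

end

end

theorem corollary2:
  fixes p :: nat and f :: "('v::finite, 'k::field) mpoly"
  assumes "prime p" and "CHAR('k) = p"
    and perfect: "surj (\<lambda>c::'k. c ^ p)"
    and "f \<in> irrelevant_ideal" and "f \<noteq> 0"
  shows "(ring_quasi_F_split p (hypersurface_ring f) \<longleftrightarrow>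
            \<not> I_infty p f \<subseteq> frob_power p irrelevant_ideal) \<and>
         (I_infty p f \<in> {J. ideal J poly_ring \<and> theta_step p f J \<subseteq> J} \<and>
          (\<forall>J\<in>{J. ideal J poly_ring \<and> theta_step p f J \<subseteq> J}. I_infty p f \<subseteq> J))"
proof -
  interpret perfect_char p "TYPE('k)"
    using assms by unfold_locales
  interpret hypersurface_fractions p "TYPE('k)" "hypersurface_ring f" f "to_hypersurface f" "UNIV - irrelevant_ideal"
    by (rule hypersurface_fractions_hypersurface_ring)
  obtain N where N: "I_infty p f = I_seq p f (Suc N)" and le: "\<forall>n. I_seq p f (Suc n) \<subseteq> I_infty p f"
    and fix_step: "theta_step p f (I_infty p f) = I_infty p f"
    by (metis I_infty_eq)
  have id: "is_ideal (I_infty p f)" unfolding N by (rule is_ideal_I_seq)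
  have "ring_quasi_F_split p (hypersurface_ring f) \<longleftrightarrow> (\<exists>g\<in>I_infty p f. uq p g \<notin> irrelevant_ideal)"
  proof
    assume "ring_quasi_F_split p (hypersurface_ring f)"
    then obtain n where n: "n \<ge> 1" "n_quasi_F_split p n (Spec (hypersurface_ring f))"
      by (auto simp: ring_quasi_F_split_def quasi_F_split_def)
    then obtain g where "g \<in> I_seq p f n" "uq p g \<notin> irrelevant_ideal"
      using split_imp_coordinates[OF refl assms(4) n(2,1) assms(5)] by blast
    then show "\<exists>g\<in>I_infty p f. uq p g \<notin> irrelevant_ideal"
      using le[rule_format, of "n - 1"] n(1) by auto
  next
    assume "\<exists>g\<in>I_infty p f. uq p g \<notin> irrelevant_ideal"
    then obtain g where g: "g \<in> I_seq p f (Suc N)" "uq p g \<notin> irrelevant_ideal" unfolding N by blast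
    then obtain gs where gs: "length gs = N" "ok gs" "teich_cond f 1 (g # gs)"
      using I_seq_iff_teich_cond[OF assms(5)] by blast
    \<comment> \<open>Membership in the ideal of index \<open>N + 1\<close> amounts to a head and
      \<open>N\<close> further coordinates, hence to a splitting of length
      \<open>N + 1\<close>.\<close>
    have "n_quasi_F_split p (length (g # gs)) (Spec (hypersurface_ring f))"
      using gs g by (intro coordinates_imp_split) simp_all
    then show "ring_quasi_F_split p (hypersurface_ring f)"
      unfolding ring_quasi_F_split_def quasi_F_split_def by (intro exI[of _ "length (g # gs)"]) simp
  qed
  then show ?thesis
    using not_subset_frob_power[OF id] id fix_step I_infty_minimal by (auto simp: ideal_poly_ring)
qed

end
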